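(* Let $m\ge 1$ be an integer and let $(\rho_x)_{x\in\mathbb{Z}}\subset[0,1]$ satisfy $\rho_0=1$, $\rho_x=0$ for $x>0$, $\rho_i=\rho_{i-m}$ for every $i\le -1$, and $\rho_{-1},\dots,\rho_{-m}$ not all $0$. Let $\bar\rho=\frac1m\sum_{j=1}^m\rho_{-j}$. For $L=L(t)>0$, let $\nu_L$ be the Bernoulli product measure on $\{0,1\}^{\mathbb{Z}}$ with $\nu_L(\eta(k)=1)=\rho_k$ if $-L\le k\le 0$ and $\nu_L(\eta(k)=1)=0$ otherwise. Suppose $L\to\infty$ as $t\to\infty$. Let $X_t=\max\{x\in\mathbb{Z}:\eta_t(x)=1\}$ be the position at time $t$ of the right-most particle of the symmetric exclusion process $(\eta_t)$ with jump probabilities $(p_i)$ (for each $t$, the process is started from $\nu_{L(t)}$). (a) If $L\sqrt{\frac{\log t}{t}}\to c\in(0,\infty]$, and $a_t=\log\left(\frac{t}{\sqrt{2\pi}\log t}\right)$, $b_t=\sqrt{\frac{t}{\log t}}$, then for all $x\in\mathbb{R}$ $$\lim_{t\to\infty}\mathbb{P}_{\nu_L}\left(\frac{X_t}{\sigma b_t}-a_t\le x\right)=\exp\left(-\sigma\bar\rho\,(1-e^{-c/\sigma})e^{-x}\right)$$ (with $e^{-\infty}=0$). (b) If $L\sqrt{\frac{\log t}{t}}\to 0$, and $a_t=a_t^{(L)}=\log\left(\frac{L^2}{\sqrt{2\pi\log L^2}}\right)$, $b_t=b_t^{(L)}=\sqrt{\frac{t}{\log L^2}}$, then for all $x\in\mathbb{R}$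 $$\lim_{t\to\infty}\mathbb{P}_{\nu_L}\left(\frac{X_t}{\sigma b_t}-a_t\le x\right)=\exp\left(-\bar\rho\, e^{-x}\right).$$
   Context: Standing assumptions: $(p_i)_{i\in\mathbb{Z}}$ are probabilities ($p_i\ge 0$, $\sum_i p_i=1$) that are symmetric ($p_i=p_{-i}$), such that the translation-invariant random walk on $\mathbb{Z}$ with jump probabilities $p(x,x+i)=p_i$ is irreducible, and such that $\sum_i e^{\theta i}p_i<\infty$ for some $\theta>0$. Set $\sigma^2=\sum_i i^2p_i$, $\sigma>0$. The symmetric exclusion process $(\eta_t)_{t\ge0}$ is the Markov process on $\{0,1\}^{\mathbb{Z}}$ with generator $\mathcal{L}f(\eta)=\sum_{x,y\in\mathbb{Z}}p_{y-x}\,\eta(x)(1-\eta(y))[f(\eta^{x,y})-f(\eta)]$ for functions $f$ depending on finitely many coordinates, where $\eta^{x,y}$ is $\eta$ with the values at $x$ and $y$ exchanged. $\mathbb{P}_\nu$ is the probability measure under which $\eta_0$ has law $\nu$. *)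

theory Defs
  imports "HOL-Probability.Probability"
begin

section \<open>The underlying random walk\<close>

text \<open>The walk on the integers started at \<open>x\<close>, with jump probabilities
  \<open>p(x, x + i) = pmf p i\<close>; \<open>walk p n x\<close> is the law of its position after \<open>n\<close> steps.\<close>

primrec walk :: "int pmf \<Rightarrow> nat \<Rightarrow> int \<Rightarrow> int pmf" where
  "walk p 0 x = return_pmf x"
| "walk p (Suc n) x = bind_pmf (walk p n x) (\<lambda>y. map_pmf (\<lambda>i. y + i) p)"

definition irreducible_walk :: "int pmf \<Rightarrow> bool" where
  "irreducible_walk p \<longleftrightarrow> (\<forall>x y. \<exists>n. pmf (walk p n x) y > 0)"


section \<open>Configurations\<close>

text \<open>A configuration is a map \<open>\<eta>\<close> from the integers to \<^typ>\<open>bool\<close>; \<open>\<eta> x\<close> means that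
  site \<open>x\<close> is occupied. Continuity of functions on configurations refers to the product
  topology that \<^typ>\<open>int \<Rightarrow> bool\<close> carries as a type (\<^typ>\<open>bool\<close> being discrete); the
  product sigma-algebra below is its Borel sigma-algebra.\<close>

type_synonym config = "int \<Rightarrow> bool"

definition configs :: "config measure" where
  "configs = PiM UNIV (\<lambda>_. count_space UNIV)"

definition exchange :: "int \<Rightarrow> int \<Rightarrow> config \<Rightarrow> config" where
  "exchange x y \<eta> = \<eta>(x := \<eta> y, y := \<eta> x)"

definition cylinder :: "(config \<Rightarrow> real) \<Rightarrow> bool" where
  "cylinder f \<longleftrightarrow> (\<exists>A. finite A \<and> (\<forall>\<eta> \<xi>. (\<forall>x\<in>A. \<eta> x = \<xi> x) \<longrightarrow> f \<eta> = f \<xi>))"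

text \<open>Only used for cylinder functions \<open>f\<close>: the bracket then vanishes unless \<open>x\<close> or \<open>y\<close>
  lies in a fixed finite set, so that the double series converges absolutely.\<close>

definition exclusion_generator :: "int pmf \<Rightarrow> (config \<Rightarrow> real) \<Rightarrow> config \<Rightarrow> real" where
  "exclusion_generator p f \<eta> =
     (\<Sum>\<^sub>\<infinity>(x, y)\<in>UNIV. pmf p (y - x) * of_bool (\<eta> x) * (1 - of_bool (\<eta> y))
        * (f (exchange x y \<eta>) - f \<eta>))"

definition bernoulli_product :: "(int \<Rightarrow> real) \<Rightarrow> config measure" where
  "bernoulli_product q = PiM UNIV (\<lambda>k. measure_pmf (bernoulli_pmf (q k)))"

text \<open>The maximum of the occupied sites. It is unspecified when there is none, that is for
  the empty configuration and for those that are unbounded to the right.\<close>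

definition rightmost :: "config \<Rightarrow> int" where
  "rightmost \<eta> = (GREATEST x. \<eta> x)"


section \<open>Feller processes on the space of configurations\<close>

text \<open>A transition function \<open>K\<close> assigns to a time \<open>t\<close> and a starting configuration the law
  at time \<open>t\<close>; only times \<open>t \<ge> 0\<close> matter.\<close>

type_synonym transition_function = "real \<Rightarrow> config \<Rightarrow> config measure"

definition semigroup_of :: "transition_function \<Rightarrow> real \<Rightarrow> (config \<Rightarrow> real) \<Rightarrow> config \<Rightarrow> real" where
  "semigroup_of K t f \<eta> = (\<integral>\<xi>. f \<xi> \<partial>K t \<eta>)"

definition feller :: "transition_function \<Rightarrow> bool" where
  "feller K \<longleftrightarrow>
     (\<forall>t\<ge>0. K t \<in> measurable configs (prob_algebra configs)) \<and>
     (\<forall>\<eta>. K 0 \<eta> = return configs \<eta>) \<and>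
     (\<forall>s\<ge>0. \<forall>t\<ge>0. \<forall>\<eta>. K (s + t) \<eta> = K s \<eta> \<bind> K t) \<and>
     (\<forall>f. continuous_on UNIV f \<longrightarrow>
        (\<forall>t\<ge>0. continuous_on UNIV (semigroup_of K t f)) \<and>
        uniform_limit UNIV (\<lambda>t. semigroup_of K t f) f (at_right 0))"

text \<open>\<open>f\<close> lies in the domain of the infinitesimal generator of the semigroup on the
  continuous functions (with the supremum norm), and the generator maps it to \<open>g\<close>.\<close>

definition generator_maps ::
    "transition_function \<Rightarrow> (config \<Rightarrow> real) \<Rightarrow> (config \<Rightarrow> real) \<Rightarrow> bool" where
  "generator_maps K f g \<longleftrightarrow>
     continuous_on UNIV f \<and> continuous_on UNIV g \<and>
     uniform_limit UNIV (\<lambda>t \<eta>. (semigroup_of K t f \<eta> - f \<eta>) / t) g (at_right 0)"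

definition natural_filtration :: "'w measure \<Rightarrow> (real \<Rightarrow> 'w \<Rightarrow> config) \<Rightarrow> real \<Rightarrow> 'w measure" where
  "natural_filtration M \<eta> s =
     sigma (space M) (\<Union>u\<in>{0..s}. {\<eta> u -` A \<inter> space M | A. A \<in> sets configs})"

definition markov_process ::
    "'w measure \<Rightarrow> (real \<Rightarrow> 'w \<Rightarrow> config) \<Rightarrow> transition_function \<Rightarrow> bool" where
  "markov_process M \<eta> K \<longleftrightarrow>
     prob_space M \<and>
     (\<forall>t\<ge>0. \<eta> t \<in> measurable M configs) \<and>
     (\<forall>s\<ge>0. \<forall>t\<ge>0. \<forall>A\<in>sets configs. AE \<omega> in M.
        real_cond_exp M (natural_filtration M \<eta> s) (\<lambda>\<omega>. indicator A (\<eta> (s + t) \<omega>)) \<omega>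
          = measure (K t (\<eta> s \<omega>)) A)"

text \<open>In the product topology, right-continuity and existence of left limits amount to the
  same properties of each occupation variable, which takes values in a discrete space.\<close>

definition cadlag :: "(real \<Rightarrow> config) \<Rightarrow> bool" where
  "cadlag \<eta> \<longleftrightarrow>
     (\<forall>x. (\<forall>t\<ge>0. \<forall>\<^sub>F s in at_right t. \<eta> s x = \<eta> t x) \<and>
          (\<forall>t>0. \<exists>b. \<forall>\<^sub>F s in at_left t. \<eta> s x = b))"

text \<open>The generator of the process extends the operator above, which is defined on cylinder
  functions. Cylinder functions form a core, so this determines \<open>K\<close> uniquely.\<close>

definition exclusion_process ::
    "int pmf \<Rightarrow> 'w measure \<Rightarrow> (real \<Rightarrow> 'w \<Rightarrow> config) \<Rightarrow> bool" where
  "exclusion_process p M \<eta> \<longleftrightarrow>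
     (\<exists>K. feller K \<and>
          (\<forall>f. cylinder f \<longrightarrow> generator_maps K f (exclusion_generator p f)) \<and>
          markov_process M \<eta> K) \<and>
     (AE \<omega> in M. cadlag (\<lambda>t. \<eta> t \<omega>))"

end

(* By symmetry of p the vacancy probabilities q_t(A) = P(no particle in A at time t), for finite A,
   solve the linear equation of the stirring process on finite sets. The products
   prod_{x in A} (1 - rho_t(x)), with rho_t the solution of the heat equation for the jump rates p,
   solve it up to a nonnegative source, so a minimum principle gives q_t(A) <= prod, and the gap is
   at most the sum of the gaps d_t(x, z) of the pairs in A. With g_r = sum_{a in A} heat_r(. - a) and
   the exponential weights w_r(x) = exp(alpha (x - Y) + 3 psi(alpha) r), the functional
     sum_{x /= z} d_s(x, z) g_{t-s}(x) g_{t-s}(z) + 2 sum_x g_{t-s}(x) w_{t-s}(x) rho_s(x)^2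
   does not increase in s; comparing s = 0 and s = t bounds the sum of the pair gaps in A, for A to
   the right of Y, by E times the mean number lambda of particles right of Y, where
   E = exp(3 psi(alpha) t - alpha Y) tends to 0 for the choice alpha = Y / (6 sigma^2 t). Hence
   P(X_t <= Y) - exp(-lambda) -> 0, and lambda is computed by exponential tilting with parameter
   Y / (sigma^2 t) and a local limit theorem for the tilted walk. *)
theory Submission
  imports Defs "HOL-Real_Asymp.Real_Asymp"
begin

text \<open>The obstacle is the lower bound for the vacancy probability. The limit concerns
  infinitely many sites to the right of Y, so the error must be small against the mean number of
  particles there and must not depend on the size of A. The gap of a pair is minus the covariance of
  its two occupation variables. It is fed by the squared differences of \<rho>, and these are
  exactly what the heat flow dissipates from the sum of \<rho>^2. The second term of the functional
  therefore loses at least what the source adds to the first. The weight w makes this quantitative: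
  g \<le> w by the exponential Chebyshev inequality, so w can replace one factor g in the source,
  while w is at most E at the initial sites, all of which are \<le> 0. Averaging against w is not
  free. Completing a square leaves 3 - e - 2 / e, where e is the ratio of w at the two sites; its
  mean is -3 psi, and the rate 3 psi in w pays for it. Two tilts occur because the tasks differ:
  \<lambda> needs sharp constants, so its tilt puts the mean of the walk at Y, whereas E only has to
  vanish.\<close>

abbreviation site_swap :: "'a \<Rightarrow> 'a \<Rightarrow> 'a \<Rightarrow> 'a" where
  "site_swap \<equiv> Transposition.transpose"

definition avg :: "int pmf \<Rightarrow> (int \<Rightarrow> real) \<Rightarrow> int \<Rightarrow> real" where
  "avg p f x = measure_pmf.expectation p (\<lambda>i. f (x + i))"

text \<open>Generator of the stirring process on finite sets, applied to \<open>Q\<close>. In the difference an exchange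
  between two sites of \<open>A\<close> does nothing, so summing over \<open>x \<in> A\<close> counts every effective exchange once.\<close>

definition stirring :: "int pmf \<Rightarrow> (int set \<Rightarrow> real) \<Rightarrow> int set \<Rightarrow> real" where
  "stirring p Q A = (\<Sum>x\<in>A. measure_pmf.expectation p (\<lambda>i. Q (site_swap x (x + i) ` A) - Q A))"

definition vacancy :: "int set \<Rightarrow> config \<Rightarrow> real" where
  "vacancy A \<eta> = of_bool (\<forall>x\<in>A. \<not> \<eta> x)"

section \<open>Expectations over a jump law, as integrals and as series\<close>

lemma pmf_integrable_bounded:
  fixes f :: "'a \<Rightarrow> real"
  assumes "\<And>i. \<bar>f i\<bar> \<le> B"
  shows "integrable (measure_pmf p) f"
  by (rule measure_pmf.integrable_const_bound[of _ B]) (use assms in auto)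

lemma pmf_has_sum:
  fixes f :: "'a \<Rightarrow> real"
  assumes "integrable (measure_pmf p) f"
  shows "((\<lambda>i. pmf p i * f i) has_sum measure_pmf.expectation p f) UNIV"
proof -
  have "integrable (density (count_space UNIV) (pmf p)) f"
    using assms by (simp add: measure_pmf_eq_density)
  then have i: "integrable (count_space UNIV) (\<lambda>i. pmf p i * f i)"
    by (subst (asm) integrable_density) (auto simp: mult.commute)
  then have s: "Infinite_Set_Sum.abs_summable_on (\<lambda>i. pmf p i * f i) UNIV"
    by (simp add: Infinite_Set_Sum.abs_summable_on_def)
  have "measure_pmf.expectation p f = (\<integral>i. pmf p i * f i \<partial>count_space UNIV)"
    by (subst measure_pmf_eq_density, subst integral_density) auto
  also have "\<dots> = infsetsum (\<lambda>i. pmf p i * f i) UNIV" by (simp add: infsetsum_def)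
  also have "\<dots> = infsum (\<lambda>i. pmf p i * f i) UNIV" by (rule infsetsum_infsum[OF s])
  finally have "measure_pmf.expectation p f = infsum (\<lambda>i. pmf p i * f i) UNIV" .
  moreover have "(\<lambda>i. pmf p i * f i) summable_on UNIV"
    using s abs_summable_equivalent abs_summable_summable by blast
  ultimately show ?thesis by simp
qed

lemma pmf_abs_le:
  fixes f :: "'a \<Rightarrow> real"
  assumes "\<And>i. \<bar>f i\<bar> \<le> B"
  shows "\<bar>measure_pmf.expectation p f\<bar> \<le> B"
proof -
  have "\<bar>measure_pmf.expectation p f\<bar> \<le> measure_pmf.expectation p (\<lambda>i. \<bar>f i\<bar>)" by (rule integral_abs_bound)
  also have "\<dots> \<le> measure_pmf.expectation p (\<lambda>i. B)"
    by (rule integral_mono) (use assms in \<open>auto intro: pmf_integrable_bounded[where B=B]\<close>)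
  finally show ?thesis by simp
qed

lemma site_swap_image: "x \<in> A \<Longrightarrow> y \<notin> A \<Longrightarrow> site_swap x y ` A = insert y (A - {x})"
  by (auto simp: Transposition.transpose_def image_iff split: if_splits)

lemma card_site_swap [simp]: "card (site_swap x y ` A) = card A"
  by (rule card_image) simp

section \<open>Evolution of the vacancy probabilities\<close>

definition marginal :: "config measure \<Rightarrow> transition_function \<Rightarrow> real \<Rightarrow> config measure" where
  "marginal \<nu> K t = \<nu> \<bind> K t"

lemma space_configs [simp]: "space configs = UNIV"
  by (simp add: configs_def space_PiM)

lemma kernel_prob:
  assumes "feller K" "t \<ge> 0"
  shows "K t \<in> measurable configs (prob_algebra configs)"
  using assms by (auto simp: feller_def)

lemma kernel_subprob:
  assumes "feller K" "t \<ge> 0"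
  shows "K t \<in> measurable configs (subprob_algebra configs)"
  using kernel_prob[OF assms] by (rule measurable_prob_algebraD)

lemma kernel_space:
  assumes "feller K" "t \<ge> 0"
  shows "prob_space (K t \<eta>)" "sets (K t \<eta>) = sets configs"
  using measurable_space[OF kernel_prob[OF assms], of \<eta>] by (auto simp: space_prob_algebra)

lemma marginal_space:
  assumes "feller K" "\<nu> \<in> space (prob_algebra configs)" "t \<ge> 0"
  shows "prob_space (marginal \<nu> K t)" "sets (marginal \<nu> K t) = sets configs"
  unfolding marginal_def
  using prob_space_bind'[OF assms(2) kernel_prob[OF assms(1,3)]]
        sets_bind'[OF assms(2) kernel_prob[OF assms(1,3)]] by auto

lemma marginal_0:
  assumes "feller K" "\<nu> \<in> space (prob_algebra configs)"
  shows "marginal \<nu> K 0 = \<nu>"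
proof -
  have "K 0 = return configs" using assms by (auto simp: feller_def)
  moreover have "sets \<nu> = sets configs" using assms(2) by (auto simp: space_prob_algebra)
  ultimately show ?thesis by (simp add: marginal_def bind_return''[of \<nu> configs])
qed

lemma marginal_add:
  assumes "feller K" "\<nu> \<in> space (prob_algebra configs)" "s \<ge> 0" "t \<ge> 0"
  shows "marginal \<nu> K (s + t) = marginal (marginal \<nu> K s) K t"
proof -
  have "sets \<nu> = sets configs" using assms(2) by (auto simp: space_prob_algebra)
  then have "K s \<in> measurable \<nu> (subprob_algebra configs)"
    using kernel_subprob[OF assms(1,3)] by (simp cong: measurable_cong_sets)
  from bind_assoc[OF this kernel_subprob[OF assms(1,4)]]
  show ?thesis using assms by (simp add: marginal_def feller_def cong: bind_cong)
qed

lemma semigroup_measurable: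
  assumes "feller K" "t \<ge> 0" "f \<in> borel_measurable configs"
  shows "semigroup_of K t f \<in> borel_measurable configs"
  unfolding semigroup_of_def
  by (rule measurable_compose[OF kernel_subprob[OF assms(1,2)] integral_measurable_subprob_algebra[OF assms(3)]])

lemma integrable_bounded:
  fixes f :: "config \<Rightarrow> real"
  assumes "prob_space \<mu>" "sets \<mu> = sets configs" "f \<in> borel_measurable configs" "\<And>\<xi>. \<bar>f \<xi>\<bar> \<le> B"
  shows "integrable \<mu> f"
proof -
  interpret prob_space \<mu> by fact
  show ?thesis using assms
    by (intro integrable_const_bound[of _ B]) (auto simp: cong: measurable_cong_sets)
qed

lemma integral_abs_bound_prob:
  fixes f :: "config \<Rightarrow> real"
  assumes "prob_space \<mu>" "sets \<mu> = sets configs" "f \<in> borel_measurable configs" "\<And>\<xi>. \<bar>f \<xi>\<bar> \<le> B"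
  shows "\<bar>\<integral>\<xi>. f \<xi> \<partial>\<mu>\<bar> \<le> B"
proof -
  interpret prob_space \<mu> by fact
  have "\<bar>\<integral>\<xi>. f \<xi> \<partial>\<mu>\<bar> \<le> (\<integral>\<xi>. \<bar>f \<xi>\<bar> \<partial>\<mu>)" by (rule integral_abs_bound)
  also have "\<dots> \<le> (\<integral>\<xi>. B \<partial>\<mu>)"
    by (rule integral_mono) (use assms integrable_bounded[OF assms(1-3)] in \<open>auto intro!: integrable_bounded\<close>)
  finally show ?thesis by (simp add: prob_space)
qed

lemma integral_marginal:
  assumes K: "feller K" and \<nu>: "\<nu> \<in> space (prob_algebra configs)" and t: "t \<ge> 0"
    and f: "f \<in> borel_measurable configs" "\<And>\<xi>. \<bar>f \<xi>\<bar> \<le> B"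
  shows "(\<integral>\<xi>. f \<xi> \<partial>marginal \<nu> K t) = (\<integral>\<xi>. semigroup_of K t f \<xi> \<partial>\<nu>)"
proof -
  have s: "sets \<nu> = sets configs" and pr: "prob_space \<nu>" using \<nu> by (auto simp: space_prob_algebra)
  interpret prob_space \<nu> by fact
  have m: "K t \<in> measurable \<nu> (subprob_algebra configs)"
    using kernel_subprob[OF K t] s by (simp cong: measurable_cong_sets)
  have "emeasure (K t x) (space (K t x)) \<le> ennreal 1" for x
    using prob_space.emeasure_space_1[OF kernel_space(1)[OF K t]] by simp
  then show ?thesis unfolding marginal_def semigroup_of_def
    by (intro integral_bind[OF f(1) _ m finite_measure_axioms, of B 1]) (use f(2) in auto)
qed

lemma semigroup_abs_le:
  assumes "feller K" "t \<ge> 0" "f \<in> borel_measurable configs" "\<And>\<xi>. \<bar>f \<xi>\<bar> \<le> B"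
  shows "\<bar>semigroup_of K t f \<eta>\<bar> \<le> B"
  unfolding semigroup_of_def
  by (rule integral_abs_bound_prob) (use assms kernel_space in auto)

text \<open>A bound uniform in the starting configuration survives integration against the law at
  time \<open>t\<close>. The scalar \<open>c\<close> lets one estimate serve twice:
  \<open>c = h\<close> for difference quotients, and \<open>c = 0\<close> for continuity in
  time.\<close>

lemma marginal_increment:
  assumes K: "feller K" and \<nu>: "\<nu> \<in> space (prob_algebra configs)" and t: "t \<ge> 0" "h \<ge> 0"
    and f: "f \<in> borel_measurable configs" "\<And>\<xi>. \<bar>f \<xi>\<bar> \<le> B"
    and g: "g \<in> borel_measurable configs" "\<And>\<xi>. \<bar>g \<xi>\<bar> \<le> B"
    and e: "\<And>\<xi>. \<bar>semigroup_of K h f \<xi> - f \<xi> - c * g \<xi>\<bar> \<le> e"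
  shows "\<bar>(\<integral>\<xi>. f \<xi> \<partial>marginal \<nu> K (t + h)) - (\<integral>\<xi>. f \<xi> \<partial>marginal \<nu> K t)
           - c * (\<integral>\<xi>. g \<xi> \<partial>marginal \<nu> K t)\<bar> \<le> e"
proof -
  let ?\<mu> = "marginal \<nu> K t"
  note \<mu> = marginal_space[OF K \<nu> t(1)]
  have \<mu>': "?\<mu> \<in> space (prob_algebra configs)" using \<mu> by (simp add: space_prob_algebra)
  have i: "integrable ?\<mu> f" "integrable ?\<mu> g" "integrable ?\<mu> (semigroup_of K h f)"
    by (rule integrable_bounded[OF \<mu> f] integrable_bounded[OF \<mu> g]
        integrable_bounded[OF \<mu> semigroup_measurable[OF K t(2) f(1)] semigroup_abs_le[OF K t(2) f]])+
  have "(\<integral>\<xi>. f \<xi> \<partial>marginal \<nu> K (t + h)) = (\<integral>\<xi>. semigroup_of K h f \<xi> \<partial>?\<mu>)"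
    using marginal_add[OF K \<nu> t] integral_marginal[OF K \<mu>' t(2) f] by simp
  then have "(\<integral>\<xi>. f \<xi> \<partial>marginal \<nu> K (t + h)) - (\<integral>\<xi>. f \<xi> \<partial>?\<mu>) - c * (\<integral>\<xi>. g \<xi> \<partial>?\<mu>)
      = (\<integral>\<xi>. semigroup_of K h f \<xi> - f \<xi> - c * g \<xi> \<partial>?\<mu>)"
    using i by simp
  also have "\<bar>\<dots>\<bar> \<le> e"
    by (rule integral_abs_bound_prob[OF \<mu>])
       (use f g semigroup_measurable[OF K t(2) f(1)] e in auto)
  finally show ?thesis .
qed

text \<open>The generator controls right difference quotients. Its error is uniform in the
  configuration and hence in the base time, so a quotient over an interval to the left of
  \<open>t\<close> is a right quotient at the earlier time \<open>s\<close>; continuity in time of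
  the expectation of \<open>g\<close> then replaces \<open>s\<close> by \<open>t\<close>.\<close>

lemma marginal_derivative:
  assumes K: "feller K" and \<nu>: "\<nu> \<in> space (prob_algebra configs)" and t: "t \<ge> 0"
    and f: "f \<in> borel_measurable configs" "\<And>\<xi>. \<bar>f \<xi>\<bar> \<le> B"
    and g: "g \<in> borel_measurable configs" "\<And>\<xi>. \<bar>g \<xi>\<bar> \<le> B"
    and gen: "generator_maps K f g"
  shows "((\<lambda>s. \<integral>\<xi>. f \<xi> \<partial>marginal \<nu> K s) has_real_derivative (\<integral>\<xi>. g \<xi> \<partial>marginal \<nu> K t))
           (at t within {0..})"
  unfolding has_field_derivative_iff
proof (rule tendstoI)
  fix e :: real assume e: "e > 0"
  define E where "E f s = (\<integral>\<xi>. f \<xi> \<partial>marginal \<nu> K s)" for f :: "config \<Rightarrow> real" and s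
  have "continuous_on UNIV g" using gen by (simp add: generator_maps_def)
  then have "uniform_limit UNIV (\<lambda>t. semigroup_of K t g) g (at_right 0)"
    using K by (simp add: feller_def)
  from uniform_limitD[OF this, of "e / 3"] have "\<forall>\<^sub>F h in at_right 0. \<forall>\<xi>. \<bar>semigroup_of K h g \<xi> - g \<xi>\<bar> < e / 3"
    using e by (simp add: dist_real_def)
  moreover have "\<forall>\<^sub>F h in at_right 0. \<forall>\<xi>. \<bar>(semigroup_of K h f \<xi> - f \<xi>) / h - g \<xi>\<bar> < e / 3"
    using gen e uniform_limitD[where e = "e / 3" and l = g] unfolding generator_maps_def
    by (fastforce simp: dist_real_def)
  ultimately have "\<forall>\<^sub>F h in at_right 0. (\<forall>\<xi>. \<bar>semigroup_of K h g \<xi> - g \<xi>\<bar> < e / 3) \<and>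
      (\<forall>\<xi>. \<bar>(semigroup_of K h f \<xi> - f \<xi>) / h - g \<xi>\<bar> < e / 3)"
    by eventually_elim auto
  then obtain d where d: "d > 0" "\<And>h. 0 < h \<Longrightarrow> h < d \<Longrightarrow> (\<forall>\<xi>. \<bar>semigroup_of K h g \<xi> - g \<xi>\<bar> < e / 3) \<and>
      (\<forall>\<xi>. \<bar>(semigroup_of K h f \<xi> - f \<xi>) / h - g \<xi>\<bar> < e / 3)"
    unfolding eventually_at_right_field by auto
  have df: "\<bar>semigroup_of K h f \<xi> - f \<xi> - h * g \<xi>\<bar> \<le> h * (e / 3)" if "0 < h" "h < d" for h \<xi>
  proof -
    have "semigroup_of K h f \<xi> - f \<xi> - h * g \<xi> = h * ((semigroup_of K h f \<xi> - f \<xi>) / h - g \<xi>)"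
      using that by (simp add: field_simps)
    then show ?thesis using d(2)[OF that] that by (simp add: abs_mult less_imp_le)
  qed
  have close: "\<bar>(E f (s + h) - E f s) / h - E g s\<bar> \<le> e / 3" if "s \<ge> 0" "0 < h" "h < d" for s h
  proof -
    have "\<bar>E f (s + h) - E f s - h * E g s\<bar> \<le> h * (e / 3)"
      unfolding E_def by (rule marginal_increment[OF K \<nu> that(1) _ f g]) (use that df in auto)
    moreover have "(E f (s + h) - E f s) / h - E g s = (E f (s + h) - E f s - h * E g s) / h"
      using that by (simp add: field_simps)
    ultimately show ?thesis using that by (simp add: abs_divide divide_le_eq mult.commute)
  qed
  have cont: "\<bar>E g (s + h) - E g s\<bar> \<le> e / 3" if "s \<ge> 0" "0 < h" "h < d" for s h
    using marginal_increment[OF K \<nu> that(1) _ g g, of h 0 "e / 3"] that d(2)[of h]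
    unfolding E_def by (force simp: less_imp_le)
  have "\<bar>(E f s - E f t) / (s - t) - E g t\<bar> < e" if "s \<ge> 0" "s \<noteq> t" "\<bar>s - t\<bar> < d" for s
  proof (cases "s > t")
    case True
    then show ?thesis using close[of t "s - t"] that t e by simp
  next
    case False
    have "(E f s - E f t) / (s - t) = (E f t - E f s) / (t - s)"
      by (metis minus_diff_eq minus_divide_divide)
    moreover have "\<bar>(E f t - E f s) / (t - s) - E g s\<bar> \<le> e / 3" "\<bar>E g t - E g s\<bar> \<le> e / 3"
      using close[of s "t - s"] cont[of s "t - s"] that t False by simp_all
    ultimately show ?thesis using e by linarith
  qed
  then have "\<forall>\<^sub>F s in at t within {0..}. \<bar>(E f s - E f t) / (s - t) - E g t\<bar> < e"
    unfolding eventually_at using d(1) by (auto simp: dist_real_def)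
  then show "\<forall>\<^sub>F y in at t within {0..}. dist (((\<integral>\<xi>. f \<xi> \<partial>marginal \<nu> K y) - (\<integral>\<xi>. f \<xi> \<partial>marginal \<nu> K t)) / (y - t))
            (\<integral>\<xi>. g \<xi> \<partial>marginal \<nu> K t) < e"
    by (simp add: E_def dist_real_def)
qed

text \<open>Taking expectations in the Markov property at time \<open>0\<close> removes the
  conditional expectation and leaves the kernel integrated against the initial law.\<close>

lemma distr_markov:
  assumes M: "markov_process M \<eta> K" and K: "feller K" and \<nu>: "distr M configs (\<eta> 0) = \<nu>"
    "\<nu> \<in> space (prob_algebra configs)" and t: "t \<ge> 0"
  shows "distr M configs (\<eta> t) = marginal \<nu> K t"
proof -
  interpret prob_space M using M by (simp add: markov_process_def)
  have m [measurable]: "\<eta> t \<in> measurable M configs" "\<eta> 0 \<in> measurable M configs"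
    using M t by (auto simp: markov_process_def)
  let ?F = "natural_filtration M \<eta> 0"
  have sub: "(\<Union>u\<in>{0..0}. {\<eta> u -` A \<inter> space M | A. A \<in> sets configs}) \<subseteq> sets M"
    using m(2) by (auto intro: measurable_sets)
  have "subalgebra M ?F"
    unfolding subalgebra_def natural_filtration_def
    using sub sets.sigma_sets_subset[OF sub] by (subst space_measure_of_conv, subst sets_measure_of) (auto intro: sets.sets_into_space[THEN subsetD])
  then interpret finite_measure_subalgebra M ?F by unfold_locales
  note sp = marginal_space[OF K \<nu>(2) t]
  interpret mg: prob_space "marginal \<nu> K t" by (rule sp)
  interpret d: prob_space "distr M configs (\<eta> t)" by (rule prob_space_distr) simp
  interpret n: prob_space \<nu> using \<nu>(2) by (simp add: space_prob_algebra)
  show ?thesis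
  proof (rule measure_eqI)
    show "sets (distr M configs (\<eta> t)) = sets (marginal \<nu> K t)" using sp by simp
    fix A assume "A \<in> sets (distr M configs (\<eta> t))"
    then have A [measurable]: "A \<in> sets configs" by simp
    have mk: "(\<lambda>\<xi>. measure (K t \<xi>) A) \<in> borel_measurable configs"
      using measurable_compose[OF kernel_subprob[OF K t] measurable_measure_subprob_algebra[OF A]] .
    have i: "integrable M (\<lambda>\<omega>. indicator A (\<eta> t \<omega>) :: real)"
      by (rule integrable_const_bound[of _ 1]) (auto simp: indicator_def)
    have "measure (distr M configs (\<eta> t)) A = (\<integral>\<omega>. indicator A (\<eta> t \<omega>) \<partial>M)"
    proof -
      have "(\<integral>\<omega>. (indicator A (\<eta> t \<omega>) :: real) \<partial>M) = (\<integral>\<xi>. indicator A \<xi> \<partial>distr M configs (\<eta> t))"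
        by (rule integral_distr[symmetric, OF m(1)]) auto
      then show ?thesis by simp
    qed
    also have "\<dots> = (\<integral>\<omega>. real_cond_exp M ?F (\<lambda>\<omega>. indicator A (\<eta> t \<omega>)) \<omega> \<partial>M)"
      using real_cond_exp_int(2)[OF i] by simp
    also have "\<dots> = (\<integral>\<omega>. measure (K t (\<eta> 0 \<omega>)) A \<partial>M)"
    proof (rule integral_cong_AE)
      show "AE \<omega> in M. real_cond_exp M ?F (\<lambda>\<omega>. indicator A (\<eta> t \<omega>)) \<omega> = measure (K t (\<eta> 0 \<omega>)) A"
        using M[unfolded markov_process_def, THEN conjunct2, THEN conjunct2, rule_format, of 0 t A] t A
        by simp
    qed (use mk in measurable)
    also have "\<dots> = (\<integral>\<xi>. measure (K t \<xi>) A \<partial>\<nu>)"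
      unfolding \<nu>(1)[symmetric] by (rule integral_distr[symmetric, OF m(2) mk])
    also have "\<dots> = measure (marginal \<nu> K t) A"
    proof -
      have "sets \<nu> = sets configs" using \<nu>(2) by (auto simp: space_prob_algebra)
      then have "K t \<in> measurable \<nu> (subprob_algebra configs)"
        using kernel_subprob[OF K t] by (simp cong: measurable_cong_sets)
      from n.measure_bind[OF this A] show ?thesis by (simp add: marginal_def)
    qed
    finally show "emeasure (distr M configs (\<eta> t)) A = emeasure (marginal \<nu> K t) A"
      by (simp add: d.emeasure_eq_measure mg.emeasure_eq_measure)
  qed
qed

section \<open>Duality between exclusion and the stirring of finite sets\<close>

lemma vacancy_bounded [simp]: "\<bar>vacancy A \<eta>\<bar> \<le> 1" "0 \<le> vacancy A \<eta>" "vacancy A \<eta> \<le> 1"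
  by (auto simp: vacancy_def)

lemma occupied_measurable [measurable]: "(\<lambda>\<eta>. \<eta> x) \<in> measurable configs (count_space UNIV)"
  unfolding configs_def by (rule measurable_component_singleton) simp

lemma vacancy_measurable [measurable]: "vacancy A \<in> borel_measurable configs"
proof -
  have "{\<eta>\<in>space configs. \<forall>x\<in>A. \<not> \<eta> x} \<in> sets configs" by measurable
  moreover have "vacancy A = indicator {\<eta>\<in>space configs. \<forall>x\<in>A. \<not> \<eta> x}" by (auto simp: vacancy_def indicator_def)
  ultimately show ?thesis by simp
qed

lemma cylinder_vacancy: "finite A \<Longrightarrow> cylinder (vacancy A)"
  unfolding cylinder_def vacancy_def by (intro exI[of _ A]) auto

lemma vacancy_exchange: "vacancy A (exchange x y \<eta>) = vacancy (site_swap x y ` A) \<eta>"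
proof -
  have "exchange x y \<eta> z = \<eta> (site_swap x y z)" for z by (auto simp: exchange_def Transposition.transpose_def)
  then show ?thesis by (simp add: vacancy_def)
qed

text \<open>By symmetry the jumps from \<open>x\<close> to \<open>y\<close> and from
  \<open>y\<close> to \<open>x\<close> have the same rate. If exactly one of the sites is occupied,
  exactly one of the two exclusion factors is \<open>1\<close>; otherwise the exchange changes
  nothing. Adding both orders removes the exclusion constraint, so the generator acts linearly on
  vacancy indicators.\<close>

lemma exclusion_generator_vacancy:
  assumes sym: "\<And>i. pmf p i = pmf p (- i)" and A: "finite A"
  shows "exclusion_generator p (vacancy A) \<eta> = stirring p (\<lambda>B. vacancy B \<eta>) A"
proof -
  define D where "D x y = vacancy (site_swap x y ` A) \<eta> - vacancy A \<eta>" for x y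
  have Dsym: "D x y = D y x" for x y by (simp add: D_def Transposition.transpose_commute)
  have Db: "\<bar>D x y\<bar> \<le> 1" for x y by (auto simp: D_def vacancy_def)
  have D0: "D x y = 0" if "x \<in> A \<longleftrightarrow> y \<in> A" for x y
    using Transposition.transpose_image_eq[OF that] by (simp add: D_def)
  have Deta: "D x y = 0" if "\<eta> x = \<eta> y" for x y
  proof -
    have "vacancy (site_swap x y ` A) \<eta> = vacancy A (exchange x y \<eta>)" by (simp add: vacancy_exchange)
    also have "exchange x y \<eta> = \<eta>" using that by (auto simp: exchange_def fun_eq_iff)
    finally show ?thesis by (simp add: D_def)
  qed
  \<comment> \<open>Exchange rates without the exclusion constraint. Only pairs with exactly one
    site in \<open>A\<close> contribute, and there \<open>F\<close> is absolutely summable and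
    dominates both orders of \<open>T\<close>, which justifies summing them separately.\<close>
  define F where "F = (\<lambda>(x,y). pmf p (y - x) * D x y)"
  define T where "T = (\<lambda>(x,y). pmf p (y - x) * of_bool (\<eta> x) * (1 - of_bool (\<eta> y)) * D x y)"
  define e where "e x = measure_pmf.expectation p (\<lambda>i. D x (x + i))" for x
  have F1: "(F has_sum e x) ({x} \<times> (- A))" if "x \<in> A" for x
  proof -
    have "((\<lambda>i. pmf p i * D x (x + i)) has_sum e x) UNIV"
      unfolding e_def by (rule pmf_has_sum[OF pmf_integrable_bounded[of _ 1]]) (use Db in auto)
    also have "?this \<longleftrightarrow> (F has_sum e x) ({x} \<times> UNIV)"
      by (rule has_sum_reindex_bij_witness[of _ "\<lambda>(_,y). y - x" "\<lambda>i. (x, x + i)"]) (auto simp: F_def)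
    also have "\<dots> \<longleftrightarrow> (F has_sum e x) ({x} \<times> (- A))"
      by (rule has_sum_cong_neutral) (use that D0 in \<open>auto simp: F_def\<close>)
    finally show ?thesis .
  qed
  have "(F has_sum (\<Sum>x\<in>A. e x)) (\<Union>x\<in>A. {x} \<times> (- A))"
    by (rule sum_has_sum[OF A]) (use F1 in auto)
  moreover have "(\<Union>x\<in>A. {x} \<times> (- A)) = A \<times> (- A)" by auto
  ultimately have F: "(F has_sum (\<Sum>x\<in>A. e x)) (A \<times> (- A))" by simp
  then have "F summable_on (A \<times> (- A))" by (rule has_sum_imp_summable)
  then have Fa: "(\<lambda>z. norm (F z)) summable_on (A \<times> (- A))"
    by (rule summable_on_iff_abs_summable_on_real[THEN iffD1])
  have psym: "pmf p (x - y) = pmf p (y - x)" for x y using sym[of "x - y"] by simp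
  have T1: "\<bar>T (x, y)\<bar> \<le> \<bar>F (x, y)\<bar>" for x y
    by (cases "\<eta> x"; cases "\<eta> y") (auto simp: T_def F_def)
  have T2: "\<bar>(T \<circ> prod.swap) (x, y)\<bar> \<le> \<bar>F (x, y)\<bar>" for x y
    using T1[of y x] by (simp add: F_def Dsym[of y x] psym[of x y])
  have S1: "T summable_on (A \<times> (- A))"
    by (subst summable_on_iff_abs_summable_on_real, rule Infinite_Sum.abs_summable_on_comparison_test[OF Fa])
       (metis T1 real_norm_def surj_pair)
  have S2: "(T \<circ> prod.swap) summable_on (A \<times> (- A))"
    by (subst summable_on_iff_abs_summable_on_real, rule Infinite_Sum.abs_summable_on_comparison_test[OF Fa])
       (metis T2 real_norm_def surj_pair)
  have "((\<lambda>z. T z + (T \<circ> prod.swap) z) has_sum (infsum T (A \<times> (- A)) + infsum (T \<circ> prod.swap) (A \<times> (- A)))) (A \<times> (- A))"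
    by (intro has_sum_add has_sum_infsum S1 S2)
  moreover
  have "T (x,y) + (T \<circ> prod.swap) (x,y) = F (x,y)" for x y
  proof -
    show ?thesis using Deta[of x y] Dsym[of x y] psym[of x y] by (cases "\<eta> x"; cases "\<eta> y") (auto simp: T_def F_def)
  qed
  then have "(\<lambda>z. T z + (T \<circ> prod.swap) z) = F" by (intro ext) (metis surj_pair)
  ultimately have "(F has_sum (infsum T (A \<times> (- A)) + infsum (T \<circ> prod.swap) (A \<times> (- A)))) (A \<times> (- A))"
    by simp
  then have eq: "infsum T (A \<times> (- A)) + infsum (T \<circ> prod.swap) (A \<times> (- A)) = (\<Sum>x\<in>A. e x)"
    using F by (rule has_sum_unique)
  have "((T \<circ> prod.swap) has_sum infsum (T \<circ> prod.swap) (A \<times> (- A))) (A \<times> (- A))"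
    using S2 by simp
  then have "(T has_sum infsum (T \<circ> prod.swap) (A \<times> (- A))) (prod.swap ` (A \<times> (- A)))"
    by (subst has_sum_reindex) auto
  then have "(T has_sum infsum (T \<circ> prod.swap) (A \<times> (- A))) ((- A) \<times> A)"
    by (simp only: product_swap)
  with S1 have "(T has_sum (infsum T (A \<times> (- A)) + infsum (T \<circ> prod.swap) (A \<times> (- A)))) (A \<times> (- A) \<union> (- A) \<times> A)"
    by (intro has_sum_Un_disjoint) auto
  then have "(T has_sum (\<Sum>x\<in>A. e x)) (A \<times> (- A) \<union> (- A) \<times> A)" by (simp only: eq)
  also have "?this \<longleftrightarrow> (T has_sum (\<Sum>x\<in>A. e x)) UNIV"
  proof (rule has_sum_cong_neutral)
    fix z assume z: "z \<in> UNIV - (A \<times> (- A) \<union> (- A) \<times> A)"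
    obtain x y where xy: "z = (x, y)" by (rule prod.exhaust)
    with z have "x \<in> A \<longleftrightarrow> y \<in> A" by auto
    then show "T z = 0" by (simp add: xy T_def D0)
  qed auto
  finally have "infsum T UNIV = (\<Sum>x\<in>A. e x)" by (rule infsumI)
  then show ?thesis
    unfolding exclusion_generator_def stirring_def T_def e_def D_def by (simp add: vacancy_exchange)
qed

lemma pmf_pair_measurable:
  fixes F :: "int \<Rightarrow> config \<Rightarrow> real"
  assumes "sets \<mu> = sets configs" "\<And>i. F i \<in> borel_measurable configs"
  shows "(\<lambda>(i, \<xi>). F i \<xi>) \<in> borel_measurable (measure_pmf p \<Otimes>\<^sub>M \<mu>)"
proof -
  have "(\<lambda>z. F (fst z) (snd z)) \<in> borel_measurable (count_space UNIV \<Otimes>\<^sub>M configs)"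
    by (rule measurable_pair_measure_countable1) (use assms in auto)
  moreover have "sets (measure_pmf p \<Otimes>\<^sub>M \<mu>) = sets (count_space UNIV \<Otimes>\<^sub>M configs)"
    by (intro sets_pair_measure_cong) (use assms in auto)
  ultimately show ?thesis by (simp add: case_prod_unfold cong: measurable_cong_sets)
qed

lemma pmf_Fubini:
  fixes F :: "int \<Rightarrow> config \<Rightarrow> real"
  assumes \<mu>: "prob_space \<mu>" "sets \<mu> = sets configs" and F: "\<And>i. F i \<in> borel_measurable configs"
    and b: "\<And>i \<xi>. \<bar>F i \<xi>\<bar> \<le> B"
  shows "(\<lambda>\<xi>. \<integral>i. F i \<xi> \<partial>measure_pmf p) \<in> borel_measurable configs"
    and "(\<integral>\<xi>. (\<integral>i. F i \<xi> \<partial>measure_pmf p) \<partial>\<mu>) = (\<integral>i. (\<integral>\<xi>. F i \<xi> \<partial>\<mu>) \<partial>measure_pmf p)"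
proof -
  interpret \<mu>: prob_space \<mu> by fact
  interpret pair_prob_space "measure_pmf p" \<mu> ..
  have m: "(\<lambda>(i, \<xi>). F i \<xi>) \<in> borel_measurable (measure_pmf p \<Otimes>\<^sub>M \<mu>)"
    by (rule pmf_pair_measurable[OF \<mu>(2) F])
  have m2: "(\<lambda>(\<xi>, i). F i \<xi>) \<in> borel_measurable (\<mu> \<Otimes>\<^sub>M measure_pmf p)"
    using measurable_pair_swap[OF m] by (simp add: case_prod_unfold)
  show "(\<lambda>\<xi>. \<integral>i. F i \<xi> \<partial>measure_pmf p) \<in> borel_measurable configs"
    using measure_pmf.borel_measurable_lebesgue_integral[OF m2] \<mu>(2) by (simp cong: measurable_cong_sets)
  have "integrable (measure_pmf p \<Otimes>\<^sub>M \<mu>) (\<lambda>(i, \<xi>). F i \<xi>)"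
    by (rule integrable_const_bound[of _ B]) (use b m in auto)
  from Fubini_integral[OF this]
  show "(\<integral>\<xi>. (\<integral>i. F i \<xi> \<partial>measure_pmf p) \<partial>\<mu>) = (\<integral>i. (\<integral>\<xi>. F i \<xi> \<partial>\<mu>) \<partial>measure_pmf p)" by simp
qed

text \<open>This is the pointwise duality integrated against the law at time \<open>t\<close>, with
  Fubini exchanging the jump and the configuration. Exchanges preserve cardinality, so the sets of
  each size satisfy a closed linear system.\<close>

lemma vacancy_derivative:
  assumes sym: "\<And>i. pmf p i = pmf p (- i)" and A: "finite A"
    and K: "feller K" and \<nu>: "\<nu> \<in> space (prob_algebra configs)" and t: "t \<ge> 0"
    and gen: "\<And>f. cylinder f \<Longrightarrow> generator_maps K f (exclusion_generator p f)"
  shows "((\<lambda>s. \<integral>\<xi>. vacancy A \<xi> \<partial>marginal \<nu> K s) has_real_derivative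
           stirring p (\<lambda>B. \<integral>\<xi>. vacancy B \<xi> \<partial>marginal \<nu> K t) A) (at t within {0..})"
proof -
  let ?\<mu> = "marginal \<nu> K t"
  note \<mu> = marginal_space[OF K \<nu> t]
  have b: "\<bar>vacancy B \<xi> - vacancy A \<xi>\<bar> \<le> 1" for B \<xi> by (auto simp: vacancy_def)
  have g: "exclusion_generator p (vacancy A) = (\<lambda>\<xi>. stirring p (\<lambda>B. vacancy B \<xi>) A)"
    using exclusion_generator_vacancy[OF sym A] by auto
  note Fub = pmf_Fubini[OF \<mu>, of "\<lambda>i \<xi>. vacancy (site_swap x (x + i) ` A) \<xi> - vacancy A \<xi>" 1 p for x]
  have gm: "exclusion_generator p (vacancy A) \<in> borel_measurable configs"
    unfolding g stirring_def by (intro borel_measurable_sum Fub) (use b in auto)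
  have gx: "\<bar>measure_pmf.expectation p (\<lambda>i. vacancy (site_swap x (x + i) ` A) \<xi> - vacancy A \<xi>)\<bar> \<le> 1" for x \<xi>
    by (rule pmf_abs_le) (rule b)
  have gb: "\<bar>exclusion_generator p (vacancy A) \<xi>\<bar> \<le> max 1 (real (card A))" for \<xi>
  proof -
    have "\<bar>exclusion_generator p (vacancy A) \<xi>\<bar> \<le> (\<Sum>x\<in>A. 1)"
      unfolding g stirring_def by (rule order.trans[OF sum_abs]) (intro sum_mono gx)
    then show ?thesis by simp
  qed
  have "((\<lambda>s. \<integral>\<xi>. vacancy A \<xi> \<partial>marginal \<nu> K s) has_real_derivative
          (\<integral>\<xi>. exclusion_generator p (vacancy A) \<xi> \<partial>?\<mu>)) (at t within {0..})"
    by (rule marginal_derivative[OF K \<nu> t, where B = "max 1 (real (card A))"])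
       (use gm gb gen[OF cylinder_vacancy[OF A]] in \<open>auto simp: le_max_iff_disj\<close>)
  also have "(\<integral>\<xi>. exclusion_generator p (vacancy A) \<xi> \<partial>?\<mu>) = (\<Sum>x\<in>A. \<integral>\<xi>. measure_pmf.expectation p (\<lambda>i. vacancy (site_swap x (x + i) ` A) \<xi> - vacancy A \<xi>) \<partial>?\<mu>)"
    unfolding g stirring_def
    by (rule Bochner_Integration.integral_sum, rule integrable_bounded[OF \<mu>, of _ 1])
       (intro Fub, use b gx in auto)
  also have "\<dots> = stirring p (\<lambda>B. \<integral>\<xi>. vacancy B \<xi> \<partial>?\<mu>) A"
    unfolding stirring_def
  proof (rule sum.cong[OF refl])
    fix x assume "x \<in> A"
    have i: "integrable ?\<mu> (vacancy B)" for B by (rule integrable_bounded[OF \<mu>, of _ 1]) auto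
    show "(\<integral>\<xi>. measure_pmf.expectation p (\<lambda>i. vacancy (site_swap x (x + i) ` A) \<xi> - vacancy A \<xi>) \<partial>?\<mu>)
        = measure_pmf.expectation p (\<lambda>i. (\<integral>\<xi>. vacancy (site_swap x (x + i) ` A) \<xi> \<partial>?\<mu>) - (\<integral>\<xi>. vacancy A \<xi> \<partial>?\<mu>))"
      by (subst Fub(2)) (use b i in auto)
  qed
  finally show ?thesis .
qed

section \<open>Comparison with product measures\<close>

text \<open>Derivatives within \<open>{0..}\<close> include time \<open>0\<close>. In the interior
  they are ordinary derivatives, and at the end points continuity is enough.\<close>

lemma within_deriv_mono:
  fixes f :: "real \<Rightarrow> real"
  assumes d: "\<And>s. 0 \<le> s \<Longrightarrow> s \<le> t \<Longrightarrow> (f has_real_derivative f' s) (at s within {0..})"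
    and n: "\<And>s. 0 \<le> s \<Longrightarrow> s \<le> t \<Longrightarrow> f' s \<ge> 0" and t: "t \<ge> 0"
  shows "f 0 \<le> f t"
proof (rule DERIV_nonneg_imp_increasing_open[OF t])
  fix x :: real assume x: "0 < x" "x < t"
  have "at x within {0..} = at x" using x by (intro at_within_interior) auto
  with d[of x] n[of x] x show "\<exists>y. (f has_real_derivative y) (at x) \<and> 0 \<le> y" by auto
next
  show "continuous_on {0..t} f"
    unfolding continuous_on_eq_continuous_within
  proof
    fix x assume "x \<in> {0..t}"
    then have "continuous (at x within {0..}) f" using d[of x] by (intro DERIV_continuous) auto
    then show "continuous (at x within {0..t}) f" by (rule continuous_within_subset) auto
  qed
qed

text \<open>There are infinitely many sets of a given size and a minimising one need not exist, so
  the usual argument at a minimum is replaced by this bound against an a priori lower bound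
  \<open>- n\<close>.\<close>

lemma stirring_lower:
  assumes M: "\<And>B. finite B \<Longrightarrow> card B = card A \<Longrightarrow> \<bar>Q B\<bar> \<le> M"
    and n: "\<And>B. finite B \<Longrightarrow> card B = card A \<Longrightarrow> - n \<le> Q B" and A: "finite A"
  shows "real (card A) * (- n - Q A) \<le> stirring p Q A"
proof -
  have "- n - Q A \<le> measure_pmf.expectation p (\<lambda>i. Q (site_swap x (x + i) ` A) - Q A)" for x
  proof -
    have "\<bar>Q (site_swap x (x + i) ` A) - Q A\<bar> \<le> 2 * M" for i
      using M[of "site_swap x (x + i) ` A"] M[of A] A by simp
    then have "integrable (measure_pmf p) (\<lambda>i. Q (site_swap x (x + i) ` A) - Q A)"
      by (rule pmf_integrable_bounded)
    then have "measure_pmf.expectation p (\<lambda>i. - n - Q A) \<le> measure_pmf.expectation p (\<lambda>i. Q (site_swap x (x + i) ` A) - Q A)"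
      by (intro integral_mono) (use n A in auto)
    then show ?thesis by simp
  qed
  then have "(\<Sum>x\<in>A. - n - Q A) \<le> stirring p Q A" unfolding stirring_def by (intro sum_mono) auto
  then show ?thesis by simp
qed

text \<open>Iterating the differential inequality improves the lower bound \<open>- M\<close> to
  \<open>- M (k s)\<^sup>j / j!\<close> for every \<open>j\<close>.\<close>

lemma minimum_principle:
  assumes der: "\<And>A s. finite A \<Longrightarrow> card A = k \<Longrightarrow> 0 \<le> s \<Longrightarrow> ((\<lambda>s. Q s A) has_real_derivative D s A) (at s within {0..})"
    and super: "\<And>A s. finite A \<Longrightarrow> card A = k \<Longrightarrow> 0 \<le> s \<Longrightarrow> stirring p (Q s) A \<le> D s A"
    and bound: "\<And>A s. finite A \<Longrightarrow> card A = k \<Longrightarrow> 0 \<le> s \<Longrightarrow> \<bar>Q s A\<bar> \<le> M"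
    and init: "\<And>A. finite A \<Longrightarrow> card A = k \<Longrightarrow> 0 \<le> Q 0 A"
    and A: "finite A" "card A = k" and s: "0 \<le> s"
  shows "0 \<le> Q s A"
proof -
  define m where "m j s = M * (real k * s) ^ j / fact j" for j and s :: real
  have iter: "- m j s \<le> Q s A" if "finite A" "card A = k" "0 \<le> s" for j s A
    using that
  proof (induction j arbitrary: s A)
    case 0
    then show ?case using bound[of A s] by (simp add: m_def)
  next
    case (Suc j)
    have dm: "((\<lambda>s. m (Suc j) s) has_real_derivative real k * m j s) (at s within {0..})" for s
    proof -
      define c where "c = M * real k ^ Suc j / fact (Suc j)"
      have "m (Suc j) = (\<lambda>s. c * s ^ Suc j)" by (simp add: m_def c_def power_mult_distrib fun_eq_iff)
      moreover have "((\<lambda>s. c * s ^ Suc j) has_real_derivative c * (real (Suc j) * s ^ j)) (at s within {0..})"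
        by (auto intro!: derivative_eq_intros simp del: power_Suc)
      moreover have "c * (real (Suc j) * s ^ j) = real k * m j s"
        unfolding c_def m_def fact_Suc by (simp add: power_mult_distrib del: of_nat_Suc)
      ultimately show ?thesis by simp
    qed
    \<comment> \<open>The integrating factor absorbs the loss term \<open>- k * Q\<close> that
      \<open>stirring_lower\<close> leaves.\<close>
    define R where "R s = exp (real k * s) * (Q s A + m (Suc j) s)" for s
    have dR: "(R has_real_derivative exp (real k * s) * (real k * (Q s A + m (Suc j) s) + (D s A + real k * m j s))) (at s within {0..})"
      if "0 \<le> s" for s
      unfolding R_def using der[OF Suc.prems(1,2) that] dm[of s]
      by (auto intro!: derivative_eq_intros simp: algebra_simps)
    have "R 0 \<le> R s"
    proof (rule within_deriv_mono[OF dR _ Suc.prems(3)])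
      fix u assume u: "0 \<le> u" "u \<le> s"
      have "real (card A) * (- m j u - Q u A) \<le> stirring p (Q u) A"
        by (rule stirring_lower) (use bound Suc u in auto)
      also have "\<dots> \<le> D u A" using super Suc.prems u by auto
      finally have "0 \<le> D u A + real k * m j u + real k * Q u A"
        using Suc.prems by (simp add: algebra_simps)
      moreover have "0 \<le> m (Suc j) u"
        using u bound[OF Suc.prems(1,2), of 0] by (simp add: m_def)
      ultimately
      have "0 \<le> real k * (Q u A + m (Suc j) u) + (D u A + real k * m j u)"
        using mult_nonneg_nonneg[OF of_nat_0_le_iff \<open>0 \<le> m (Suc j) u\<close>, of k]
        by (simp only: distrib_left)
      then show "0 \<le> exp (real k * u) * (real k * (Q u A + m (Suc j) u) + (D u A + real k * m j u))"
        by simp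
    qed auto
    moreover have "0 \<le> R 0" using init[OF Suc.prems(1,2)] by (simp add: R_def m_def)
    ultimately have "0 \<le> Q s A + m (Suc j) s" unfolding R_def
      by (metis exp_gt_zero order_trans zero_le_mult_iff not_less)
    then show ?case by simp
  qed
  have "(\<lambda>j. (real k * s) ^ j / fact j) \<longlonglongrightarrow> 0"
    using summable_LIMSEQ_zero[OF summable_exp[of "real k * s"]] by (simp add: field_simps)
  then have "(\<lambda>j. - m j s) \<longlonglongrightarrow> - (M * 0)" unfolding m_def times_divide_eq_right[symmetric]
    by (intro tendsto_intros)
  then have "(\<lambda>j. - m j s) \<longlonglongrightarrow> 0" by simp
  then show ?thesis
    by (rule LIMSEQ_le_const2) (use iter[OF A s] in auto)
qed

lemma pmf_restrict_finite:
  fixes x :: int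
  assumes "finite A"
  shows "measure_pmf.expectation p (\<lambda>i. if x + i \<in> A then f (x + i) else 0) = (\<Sum>z\<in>A. pmf p (z - x) * (f z :: real))"
proof -
  let ?B = "(\<lambda>z. z - x) ` A"
  have "measure_pmf.expectation p (\<lambda>i. if x + i \<in> A then f (x + i) else 0)
      = (\<Sum>i\<in>?B. (if x + i \<in> A then f (x + i) else 0) * pmf p i)"
    by (rule integral_measure_pmf_real) (use assms in \<open>auto split: if_splits intro!: image_eqI[of _ _ "x + i" for i]\<close>)
  also have "\<dots> = (\<Sum>z\<in>A. pmf p (z - x) * f z)"
    by (subst sum.reindex) (auto simp: inj_on_def intro!: sum.cong)
  finally show ?thesis .
qed

text \<open>In the product every factor averages freely over all targets, whereas an exchange inside
  \<open>A\<close> leaves the set unchanged. The difference of the two motions is a sum over ordered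
  pairs of \<open>A\<close>, and the symmetry of \<open>p\<close> turns it into squares, which gives
  it a sign.\<close>

lemma product_generator:
  fixes h :: "int \<Rightarrow> real"
  assumes sym: "\<And>i. pmf p i = pmf p (- i)" and A: "finite A" and h: "\<And>x. \<bar>h x\<bar> \<le> 1"
  shows "(\<Sum>x\<in>A. (avg p h x - h x) * prod h (A - {x})) = stirring p (prod h) A
     + (\<Sum>x\<in>A. \<Sum>z\<in>A. pmf p (z - x) * (h z - h x)\<^sup>2 * prod h (A - {x, z})) / 2"
proof -
  have ih: "integrable (measure_pmf p) (\<lambda>i. h (x + i))" for x
    by (rule pmf_integrable_bounded[of _ 1]) (rule h)
  have i2: "integrable (measure_pmf p) (\<lambda>i. if x + i \<in> A then h (x + i) - h x else 0)" for x
  proof (rule pmf_integrable_bounded[of _ 2])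
    show "\<bar>if x + i \<in> A then h (x + i) - h x else 0\<bar> \<le> 2" for i
      using h[of "x + i"] h[of x] by auto
  qed
  have *: "measure_pmf.expectation p (\<lambda>i. prod h (site_swap x (x + i) ` A) - prod h A)
      = prod h (A - {x}) * (avg p h x - h x) - prod h (A - {x}) * (\<Sum>z\<in>A. pmf p (z - x) * (h z - h x))"
    if x: "x \<in> A" for x
  proof -
    have "prod h (site_swap x (x + i) ` A) - prod h A
        = prod h (A - {x}) * (h (x + i) - h x) - prod h (A - {x}) * (if x + i \<in> A then h (x + i) - h x else 0)" for i
    proof (cases "x + i \<in> A")
      case True
      then show ?thesis using x by (simp add: Transposition.transpose_image_eq)
    next
      case False
      have "prod h (site_swap x (x + i) ` A) = h (x + i) * prod h (A - {x})"
        using False x A by (simp add: site_swap_image)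
      moreover have "prod h A = h x * prod h (A - {x})" using A x by (rule prod.remove)
      ultimately show ?thesis using False by (simp add: algebra_simps)
    qed
    then have "measure_pmf.expectation p (\<lambda>i. prod h (site_swap x (x + i) ` A) - prod h A)
      = measure_pmf.expectation p (\<lambda>i. prod h (A - {x}) * (h (x + i) - h x) - prod h (A - {x}) * (if x + i \<in> A then h (x + i) - h x else 0))"
      by simp
    also have "\<dots> = prod h (A - {x}) * (avg p h x - h x) - prod h (A - {x}) * measure_pmf.expectation p (\<lambda>i. if x + i \<in> A then h (x + i) - h x else 0)"
      using ih[of x] i2[of x] by (simp add: avg_def)
    also have "measure_pmf.expectation p (\<lambda>i. if x + i \<in> A then h (x + i) - h x else 0) = (\<Sum>z\<in>A. pmf p (z - x) * (h z - h x))"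
      by (rule pmf_restrict_finite[OF A])
    finally show ?thesis .
  qed
  have "(\<Sum>x\<in>A. (avg p h x - h x) * prod h (A - {x})) - stirring p (prod h) A
      = (\<Sum>x\<in>A. prod h (A - {x}) * (\<Sum>z\<in>A. pmf p (z - x) * (h z - h x)))"
    unfolding stirring_def sum_subtractf[symmetric] by (intro sum.cong) (auto simp: * mult.commute)
  also have "\<dots> = (\<Sum>x\<in>A. \<Sum>z\<in>A. pmf p (z - x) * ((h z - h x) * h z * prod h (A - {x, z})))" (is "_ = ?S")
  proof -
    have "prod h (A - {x}) * (pmf p (z - x) * (h z - h x)) = pmf p (z - x) * ((h z - h x) * h z * prod h (A - {x, z}))"
      if "x \<in> A" "z \<in> A" for x z
    proof (cases "x = z")
      case False
      then have "prod h (A - {x}) = h z * prod h (A - {x} - {z})" using A that by (intro prod.remove) auto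
      also have "A - {x} - {z} = A - {x, z}" by auto
      finally show ?thesis by simp
    qed simp
    then show ?thesis unfolding sum_distrib_left by (intro sum.cong refl)
  qed
  \<comment> \<open>Averaging with the sum in which \<open>x\<close> and \<open>z\<close> are
    interchanged turns \<open>(h z - h x) * h z\<close> into half of a square.\<close>
  also have "?S = (?S + ?S) / 2" by simp
  also have "?S + ?S = ?S + (\<Sum>x\<in>A. \<Sum>z\<in>A. pmf p (x - z) * ((h x - h z) * h x * prod h (A - {z, x})))"
    by (subst (2) sum.swap) simp
  also have "\<dots> = (\<Sum>x\<in>A. \<Sum>z\<in>A. pmf p (z - x) * (h z - h x)\<^sup>2 * prod h (A - {x, z}))"
  proof -
    have "pmf p (x - z) = pmf p (z - x)" for x z using sym[of "x - z"] by simp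
    then show ?thesis unfolding sum.distrib[symmetric]
      by (intro sum.cong refl) (simp add: insert_commute power2_eq_square algebra_simps)
  qed
  finally show ?thesis by simp
qed


lemma has_field_derivative_prod_within:
  fixes h :: "real \<Rightarrow> 'a \<Rightarrow> real"
  assumes A: "finite A" and d: "\<And>x. x \<in> A \<Longrightarrow> ((\<lambda>s. h s x) has_real_derivative h' x) (at t within S)"
  shows "((\<lambda>s. prod (h s) A) has_real_derivative (\<Sum>x\<in>A. h' x * prod (h t) (A - {x}))) (at t within S)"
  using A d
proof (induction A rule: finite_induct)
  case (insert x A)
  have eq: "prod (h t) (insert x A - {y}) = h t x * prod (h t) (A - {y})" if "y \<in> A" for y
  proof -
    have "insert x A - {y} = insert x (A - {y})" using insert that by auto
    then show ?thesis using insert by simp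
  qed
  have "((\<lambda>s. h s x * prod (h s) A) has_real_derivative
      (h' x * prod (h t) A + (\<Sum>x\<in>A. h' x * prod (h t) (A - {x})) * h t x)) (at t within S)"
    using DERIV_mult[OF insert.prems[of x] insert.IH] insert.prems by simp
  moreover have "h' x * prod (h t) A + (\<Sum>x\<in>A. h' x * prod (h t) (A - {x})) * h t x
      = (\<Sum>y\<in>insert x A. h' y * prod (h t) (insert x A - {y}))"
    using insert by (simp add: eq sum_distrib_right sum_distrib_left mult_ac cong: sum.cong)
  ultimately show ?case using insert by simp
qed simp

lemma stirring_diff:
  assumes "\<And>B. finite B \<Longrightarrow> card B = card A \<Longrightarrow> \<bar>Q B\<bar> \<le> M"
    "\<And>B. finite B \<Longrightarrow> card B = card A \<Longrightarrow> \<bar>R B\<bar> \<le> M" and A: "finite A"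
  shows "stirring p (\<lambda>B. Q B - R B) A = stirring p Q A - stirring p R A"
proof -
  have i: "integrable (measure_pmf p) (\<lambda>i. F (site_swap x (x + i) ` A) - F A)"
    if "\<And>B. finite B \<Longrightarrow> card B = card A \<Longrightarrow> \<bar>F B\<bar> \<le> M" for F :: "int set \<Rightarrow> real" and x
  proof (rule pmf_integrable_bounded[of _ "2 * M"])
    show "\<bar>F (site_swap x (x + i) ` A) - F A\<bar> \<le> 2 * M" for i
      using that[of "site_swap x (x + i) ` A"] that[of A] A by simp
  qed
  show ?thesis unfolding stirring_def sum_subtractf[symmetric]
  proof (rule sum.cong[OF refl])
    fix x
    have "measure_pmf.expectation p (\<lambda>i. Q (site_swap x (x + i) ` A) - R (site_swap x (x + i) ` A) - (Q A - R A))
       = measure_pmf.expectation p (\<lambda>i. (Q (site_swap x (x + i) ` A) - Q A) - (R (site_swap x (x + i) ` A) - R A))"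
      by (rule Bochner_Integration.integral_cong) auto
    also have "\<dots> = measure_pmf.expectation p (\<lambda>i. Q (site_swap x (x + i) ` A) - Q A) -
           measure_pmf.expectation p (\<lambda>i. R (site_swap x (x + i) ` A) - R A)"
      by (rule Bochner_Integration.integral_diff; rule i) (use assms in auto)
    finally show "measure_pmf.expectation p (\<lambda>i. Q (site_swap x (x + i) ` A) - R (site_swap x (x + i) ` A) - (Q A - R A)) =
           measure_pmf.expectation p (\<lambda>i. Q (site_swap x (x + i) ` A) - Q A) -
           measure_pmf.expectation p (\<lambda>i. R (site_swap x (x + i) ` A) - R A)" .
  qed
qed

section \<open>Pair sums and the comparison with products\<close>

definition pairsum :: "(int set \<Rightarrow> real) \<Rightarrow> int set \<Rightarrow> real" where
  "pairsum D A = (\<Sum>x\<in>A. \<Sum>z\<in>A. if x = z then 0 else D {x, z}) / 2"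

lemma sum_antisym_zero:
  fixes f :: "'a \<Rightarrow> 'a \<Rightarrow> real"
  assumes "\<And>x y. f x y = - f y x"
  shows "(\<Sum>x\<in>A. \<Sum>y\<in>A. f x y) = 0"
proof -
  have "(\<Sum>x\<in>A. \<Sum>y\<in>A. f x y) = (\<Sum>y\<in>A. \<Sum>x\<in>A. - f y x)"
    by (subst sum.swap) (simp add: assms[symmetric])
  then show ?thesis by (simp add: sum_negf)
qed

text \<open>A site of \<open>A\<close> outside \<open>{x, z}\<close> moves this pair only by
  exchanging with \<open>x\<close> or \<open>z\<close>. Summed over \<open>A\<close>, these
  contributions cancel in pairs, so each pair effectively evolves by its own stirring.\<close>

lemma stirring_pairsum:
  assumes sym: "\<And>i. pmf p i = pmf p (- i)" and A: "finite A"
    and b: "\<And>x y. \<bar>D {x, y}\<bar> \<le> M"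
  shows "stirring p (pairsum D) A = pairsum (stirring p D) A"
proof -
  have "0 \<le> M" using b[of 0 0] by simp
  define e where "e a x z = measure_pmf.expectation p (\<lambda>i. D (site_swap a (a + i) ` {x, z}) - D {x, z})" for a x z
  have bb: "\<bar>D (site_swap a (a + i) ` {x, z}) - D {x, z}\<bar> \<le> 2 * M" for a i x z
    using b[of x z] b[of "site_swap a (a + i) x" "site_swap a (a + i) z"] by simp
  have ie: "integrable (measure_pmf p) (\<lambda>i. D (site_swap a (a + i) ` {x, z}) - D {x, z})" for a x z
    by (rule pmf_integrable_bounded) (rule bb)
  have E: "measure_pmf.expectation p (\<lambda>i. pairsum D (site_swap a (a + i) ` A) - pairsum D A)
      = (\<Sum>x\<in>A. \<Sum>z\<in>A. if x = z then 0 else e a x z) / 2" for a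
  proof -
    have "pairsum D (site_swap a (a + i) ` A) - pairsum D A
        = (\<Sum>x\<in>A. \<Sum>z\<in>A. if x = z then 0 else D (site_swap a (a + i) ` {x, z}) - D {x, z}) / 2" for i
    proof -
      have "(site_swap a (a + i) x = site_swap a (a + i) z) = (x = z)" for x z by (metis Transposition.transpose_involutory)
      then have "pairsum D (site_swap a (a + i) ` A) = (\<Sum>x\<in>A. \<Sum>z\<in>A. if x = z then 0 else D (site_swap a (a + i) ` {x, z})) / 2"
        unfolding pairsum_def by (simp add: sum.reindex cong: if_cong)
      then show ?thesis unfolding pairsum_def
        by (simp add: diff_divide_distrib[symmetric] sum_subtractf[symmetric]) (intro sum.cong refl, auto)
    qed
    then have "measure_pmf.expectation p (\<lambda>i. pairsum D (site_swap a (a + i) ` A) - pairsum D A)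
      = measure_pmf.expectation p (\<lambda>i. (\<Sum>x\<in>A. \<Sum>z\<in>A. if x = z then 0 else D (site_swap a (a + i) ` {x, z}) - D {x, z}) / 2)"
      by (simp only:)
    also have "\<dots> = (\<Sum>x\<in>A. \<Sum>z\<in>A. measure_pmf.expectation p (\<lambda>i. if x = z then 0 else D (site_swap a (a + i) ` {x, z}) - D {x, z})) / 2"
    proof -
      have i': "integrable (measure_pmf p) (\<lambda>i. if x = z then 0 else D (site_swap a (a + i) ` {x, z}) - D {x, z})" for x z
        using ie[of a x z] by (cases "x = z") auto
      show ?thesis using i'
        by (simp only: integral_divide_zero Bochner_Integration.integral_sum Bochner_Integration.integrable_sum)
    qed
    also have "\<dots> = (\<Sum>x\<in>A. \<Sum>z\<in>A. if x = z then 0 else e a x z) / 2"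
      unfolding e_def by (intro arg_cong[where f = "\<lambda>u. u / 2"] sum.cong refl) auto
    finally show ?thesis .
  qed
  \<comment> \<open>Contribution of a third site \<open>a\<close> that is exchanged with
    \<open>x\<close>. It changes sign when \<open>a\<close> and \<open>x\<close> are interchanged,
    which is why its sum over \<open>A\<close> vanishes.\<close>
  define W where "W x z a = (if x = z \<or> a = x \<or> a = z then 0 else pmf p (x - a) * (D {a, z} - D {x, z}))" for x z a
  have e1: "e a x z = W x z a + W z x a" if "x \<noteq> z" "a \<noteq> x" "a \<noteq> z" for a x z
  proof -
    have *: "D (site_swap a (a + i) ` {x, z}) - D {x, z}
        = (if a + i \<in> {x, z} then (if a + i = x then D {a, z} else D {x, a}) - D {x, z} else 0)" for i
      using that by (auto simp: Transposition.transpose_def insert_commute)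
    have "e a x z = (\<Sum>y\<in>{x, z}. pmf p (y - a) * ((if y = x then D {a, z} else D {x, a}) - D {x, z}))"
      unfolding e_def * by (rule pmf_restrict_finite) simp
    then show ?thesis using that by (simp add: W_def insert_commute)
  qed
  have Wanti: "W x z a = - W a z x" for x z a
    using sym[of "x - a"] by (auto simp: W_def algebra_simps)
  have inner: "(\<Sum>a\<in>A. e a x z) = stirring p D {x, z} + (\<Sum>a\<in>A. W x z a + W z x a)" if "x \<in> A" "z \<in> A" "x \<noteq> z" for x z
  proof -
    have "(\<Sum>a\<in>A. e a x z) = (\<Sum>a\<in>{x, z}. e a x z) + (\<Sum>a\<in>A - {x, z}. e a x z)"
      using A that by (subst sum.subset_diff[of "{x, z}"]) auto
    also have "(\<Sum>a\<in>{x, z}. e a x z) = stirring p D {x, z}" by (simp add: stirring_def e_def)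
    also have "(\<Sum>a\<in>A - {x, z}. e a x z) = (\<Sum>a\<in>A - {x, z}. W x z a + W z x a)"
      using that by (intro sum.cong refl e1) auto
    also have "\<dots> = (\<Sum>a\<in>A. W x z a + W z x a)"
      by (rule sum.mono_neutral_left) (use A in \<open>auto simp: W_def\<close>)
    finally show ?thesis .
  qed
  have W1: "(\<Sum>x\<in>A. \<Sum>z\<in>A. \<Sum>a\<in>A. W x z a) = 0"
  proof -
    have "(\<Sum>x\<in>A. \<Sum>z\<in>A. \<Sum>a\<in>A. W x z a) = (\<Sum>z\<in>A. \<Sum>x\<in>A. \<Sum>a\<in>A. W x z a)" by (rule sum.swap)
    also have "\<dots> = (\<Sum>z\<in>A. 0)" by (intro sum.cong refl sum_antisym_zero Wanti)
    finally show ?thesis by simp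
  qed
  have W2: "(\<Sum>x\<in>A. \<Sum>z\<in>A. \<Sum>a\<in>A. W z x a) = 0"
    using W1 by (subst sum.swap)
  have "stirring p (pairsum D) A = (\<Sum>a\<in>A. \<Sum>x\<in>A. \<Sum>z\<in>A. if x = z then 0 else e a x z) / 2"
    unfolding stirring_def E by (simp add: sum_divide_distrib)
  also have "(\<Sum>a\<in>A. \<Sum>x\<in>A. \<Sum>z\<in>A. if x = z then 0 else e a x z) = (\<Sum>x\<in>A. \<Sum>z\<in>A. \<Sum>a\<in>A. if x = z then 0 else e a x z)"
    by (subst sum.swap) (intro sum.cong refl sum.swap)
  also have "\<dots> = (\<Sum>x\<in>A. \<Sum>z\<in>A. (if x = z then 0 else stirring p D {x, z}) + ((\<Sum>a\<in>A. W x z a) + (\<Sum>a\<in>A. W z x a)))"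
  proof (intro sum.cong refl)
    fix x z assume "x \<in> A" "z \<in> A"
    then show "(\<Sum>a\<in>A. if x = z then 0 else e a x z) = (if x = z then 0 else stirring p D {x, z}) + ((\<Sum>a\<in>A. W x z a) + (\<Sum>a\<in>A. W z x a))"
      using inner[of x z] by (cases "x = z") (auto simp: W_def sum.distrib)
  qed
  also have "\<dots> = (\<Sum>x\<in>A. \<Sum>z\<in>A. if x = z then 0 else stirring p D {x, z})"
    using W1 W2 by (simp add: sum.distrib)
  finally show ?thesis unfolding pairsum_def[of "stirring p D"] .
qed


text \<open>For the last bound, \<open>pairsum (D s)\<close> solves the same equation with source
  \<open>pairsum (src s)\<close>. This source dominates \<open>src s A\<close>: for a set of two
  sites no factor of \<open>h\<close> remains, and in larger sets the remaining factors are at most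
  \<open>1\<close>. The minimum principle then applies to the difference.\<close>

lemma product_comparison:
  fixes h q :: "real \<Rightarrow> _ \<Rightarrow> real"
  assumes sym: "\<And>i. pmf p i = pmf p (- i)"
    and h: "\<And>s x. 0 \<le> s \<Longrightarrow> ((\<lambda>s. h s x) has_real_derivative avg p (h s) x - h s x) (at s within {0..})"
    and h01: "\<And>s x. 0 \<le> s \<Longrightarrow> 0 \<le> h s x \<and> h s x \<le> 1"
    and q: "\<And>s A. 0 \<le> s \<Longrightarrow> finite A \<Longrightarrow> ((\<lambda>s. q s A) has_real_derivative stirring p (q s) A) (at s within {0..})"
    and q01: "\<And>s A. 0 \<le> s \<Longrightarrow> finite A \<Longrightarrow> 0 \<le> q s A \<and> q s A \<le> 1"
    and q0: "\<And>A. finite A \<Longrightarrow> q 0 A = prod (h 0) A"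
  defines "D \<equiv> \<lambda>s A. prod (h s) A - q s A"
    and "src \<equiv> \<lambda>s A. (\<Sum>x\<in>A. \<Sum>z\<in>A. pmf p (z - x) * (h s z - h s x)\<^sup>2 * prod (h s) (A - {x, z})) / 2"
  shows "\<And>s A. 0 \<le> s \<Longrightarrow> finite A \<Longrightarrow> \<bar>D s A\<bar> \<le> 1"
    and "\<And>s A. 0 \<le> s \<Longrightarrow> finite A \<Longrightarrow> ((\<lambda>s. D s A) has_real_derivative stirring p (D s) A + src s A) (at s within {0..})"
    and "\<And>s A. 0 \<le> s \<Longrightarrow> finite A \<Longrightarrow> 0 \<le> D s A"
    and "\<And>s A. 0 \<le> s \<Longrightarrow> finite A \<Longrightarrow> D s A \<le> pairsum (D s) A"
proof -
  have v01: "0 \<le> prod (h s) A \<and> prod (h s) A \<le> 1" if "0 \<le> s" for s A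
    using h01[OF that] by (auto intro: prod_nonneg prod_le_1)
  show Db: "\<bar>D s A\<bar> \<le> 1" if "0 \<le> s" "finite A" for s A
    using v01[OF that(1), of A] q01[OF that] by (auto simp: D_def)
  show D': "((\<lambda>s. D s A) has_real_derivative stirring p (D s) A + src s A) (at s within {0..})"
    if s: "0 \<le> s" and A: "finite A" for s A
  proof -
    have hb: "\<bar>h s x\<bar> \<le> 1" for x using h01[OF s, of x] by auto
    have "((\<lambda>s. prod (h s) A) has_real_derivative stirring p (prod (h s)) A + src s A) (at s within {0..})"
      using has_field_derivative_prod_within[where h = h, OF A h[OF s]] product_generator[where h = "h s", OF sym A hb]
      unfolding src_def by simp
    then have der: "((\<lambda>s. D s A) has_real_derivative stirring p (prod (h s)) A + src s A - stirring p (q s) A) (at s within {0..})"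
      unfolding D_def by (rule DERIV_diff) (rule q[OF s A])
    moreover have "stirring p (D s) A = stirring p (prod (h s)) A - stirring p (q s) A"
      unfolding D_def by (rule stirring_diff[of A _ 1]) (use v01[OF s] q01[OF s] A in \<open>auto simp: abs_le_iff intro: order.trans[of _ 0]\<close>)
    ultimately have "stirring p (prod (h s)) A + src s A - stirring p (q s) A = stirring p (D s) A + src s A" by simp
    with der show ?thesis by simp
  qed
  have src0: "0 \<le> src s A" if "0 \<le> s" for s A
    unfolding src_def using v01[OF that] by (auto intro!: sum_nonneg)
  show D0: "0 \<le> D s A" if s: "0 \<le> s" and A: "finite A" for s A
  proof (rule minimum_principle[where k = "card A" and p = p and Q = D and M = 1])
    show "((\<lambda>s. D s B) has_real_derivative stirring p (D s) B + src s B) (at s within {0..})"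
      if "finite B" "0 \<le> s" for B s by (rule D'[OF that(2,1)])
  qed (use s A Db src0 q0 in \<open>auto simp: D_def\<close>)
  show "D s A \<le> pairsum (D s) A" if s: "0 \<le> s" and A: "finite A" for s A
  proof -
    define k where "k = card A"
    define Q where "Q s B = pairsum (D s) B - D s B" for s B
    have pb: "\<bar>pairsum (D s) B\<bar> \<le> real k * real k" if "0 \<le> s" "finite B" "card B = k" for s B
    proof -
      have "\<bar>\<Sum>x\<in>B. \<Sum>z\<in>B. if x = z then 0 else D s {x, z}\<bar> \<le> (\<Sum>x\<in>B. \<Sum>z\<in>B. 1)"
        using Db[OF that(1)] by (intro sum_abs[THEN order.trans] sum_mono) auto
      also have "\<dots> = real k * real k" using that by simp
      finally show ?thesis unfolding pairsum_def by simp
    qed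
    have Qd: "((\<lambda>s. Q s B) has_real_derivative
        pairsum (\<lambda>C. stirring p (D s) C + src s C) B - (stirring p (D s) B + src s B)) (at s within {0..})"
      if s: "0 \<le> s" and B: "finite B" for s B
    proof -
      have "((\<lambda>s. if x = z then 0 else D s {x, z}) has_real_derivative
          (if x = z then 0 else stirring p (D s) {x, z} + src s {x, z})) (at s within {0..})" for x z
        using D'[OF s, of "{x, z}"] by (cases "x = z") auto
      then have "((\<lambda>s. pairsum (D s) B) has_real_derivative
          pairsum (\<lambda>C. stirring p (D s) C + src s C) B) (at s within {0..})"
        unfolding pairsum_def by (intro DERIV_cdivide DERIV_sum)
      then show ?thesis unfolding Q_def by (rule DERIV_diff) (rule D'[OF s B])
    qed
    have Qs: "stirring p (Q s) B \<le> pairsum (\<lambda>C. stirring p (D s) C + src s C) B - (stirring p (D s) B + src s B)"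
      if s: "0 \<le> s" and B: "finite B" "card B = k" for s B
    proof -
      have "stirring p (Q s) B = stirring p (pairsum (D s)) B - stirring p (D s) B"
        unfolding Q_def
        by (rule stirring_diff[where M = "max 1 (real k * real k)"])
           (use B s pb Db in \<open>auto simp: le_max_iff_disj\<close>)
      also have "stirring p (pairsum (D s)) B = pairsum (stirring p (D s)) B"
        by (rule stirring_pairsum[OF sym B(1), where M = 1]) (use Db[OF s] in auto)
      finally have 1: "stirring p (Q s) B = pairsum (stirring p (D s)) B - stirring p (D s) B" .
      have "pairsum (\<lambda>C. stirring p (D s) C + src s C) B = pairsum (stirring p (D s)) B + pairsum (src s) B"
        unfolding pairsum_def add_divide_distrib[symmetric] sum.distrib[symmetric]
        by (intro arg_cong[where f = "\<lambda>u. u / 2"] sum.cong refl) auto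
      moreover have "src s B \<le> pairsum (src s) B"
      proof -
        have "pmf p (x - z) = pmf p (z - x)" for x z using sym[of "x - z"] by simp
        then have e: "src s {x, z} = pmf p (z - x) * (h s z - h s x)\<^sup>2" if "x \<noteq> z" for x z
          using that unfolding src_def by (simp add: power2_commute insert_commute)
        have sB: "src s B = (\<Sum>x\<in>B. \<Sum>z\<in>B. pmf p (z - x) * (h s z - h s x)\<^sup>2 * prod (h s) (B - {x, z})) / 2"
          by (simp only: src_def)
        show ?thesis unfolding sB pairsum_def
        proof (intro divide_right_mono sum_mono)
          fix x z
          have "pmf p (z - x) * (h s z - h s x)\<^sup>2 * prod (h s) (B - {x, z}) \<le> pmf p (z - x) * (h s z - h s x)\<^sup>2 * 1"
            using v01[OF s] by (intro mult_left_mono) auto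
          then show "pmf p (z - x) * (h s z - h s x)\<^sup>2 * prod (h s) (B - {x, z}) \<le> (if x = z then 0 else src s {x, z})"
            using e[of x z] by auto
        qed simp
      qed
      ultimately show ?thesis using 1 by simp
    qed
    have "0 \<le> Q s A"
    proof (rule minimum_principle[where k = k and p = p and Q = Q and M = "real k * real k + 1"])
      show "\<bar>Q s B\<bar> \<le> real k * real k + 1" if "finite B" "card B = k" "0 \<le> s" for B s
        using pb[OF that(3,1,2)] Db[OF that(3,1)] unfolding Q_def by linarith
      show "0 \<le> Q 0 B" if "finite B" for B
      proof -
        have z: "D 0 C = 0" if "finite C" for C using q0[OF that] by (simp add: D_def)
        have "pairsum (D 0) B = 0" using z unfolding pairsum_def by (simp cong: if_cong)
        then show ?thesis using z[OF that] by (simp add: Q_def)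
      qed
    qed (use s A Qd Qs in \<open>auto simp: k_def\<close>)
    then show ?thesis by (simp add: Q_def)
  qed
qed

text \<open>Compared with two independent walks: a jump onto the partner leaves the pair in place
  under stirring, but in the average it meets \<open>d\<close> on the diagonal, where
  \<open>d\<close> is set to \<open>0\<close>. The term with factor \<open>2\<close> restores this
  value, once for each of the two sites.\<close>

lemma pair_derivative:
  fixes D :: "int set \<Rightarrow> real"
  assumes sym: "\<And>i. pmf p i = pmf p (- i)" and b: "\<And>x z. \<bar>D {x, z}\<bar> \<le> 1" and xz: "x \<noteq> z"
  defines "d \<equiv> \<lambda>x z. if x = z then 0 else D {x, z}"
  shows "stirring p D {x, z} = avg p (\<lambda>u. d u z) x + avg p (d x) z - 2 * d x z + 2 * pmf p (z - x) * d x z"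
proof -
  have *: "measure_pmf.expectation p (\<lambda>i. D (site_swap u (u + i) ` {u, v}) - D {u, v})
     = avg p (\<lambda>u. d u v) u - d u v + pmf p (v - u) * d u v" if "u \<noteq> v" for u v
  proof -
    have "D (site_swap u (u + i) ` {u, v}) - D {u, v} = d (u + i) v - d u v + (if u + i \<in> {v} then d u v else 0)" for i
      using that by (auto simp: d_def Transposition.transpose_def insert_commute)
    moreover have "integrable (measure_pmf p) (\<lambda>i. d (u + i) v)"
      by (rule pmf_integrable_bounded[of _ 1]) (use b in \<open>auto simp: d_def\<close>)
    moreover have "integrable (measure_pmf p) (\<lambda>i. if u + i \<in> {v} then d u v else 0)"
      by (rule pmf_integrable_bounded[of _ 1]) (use b in \<open>auto simp: d_def\<close>)
    ultimately have "measure_pmf.expectation p (\<lambda>i. D (site_swap u (u + i) ` {u, v}) - D {u, v})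
      = avg p (\<lambda>u. d u v) u - d u v + measure_pmf.expectation p (\<lambda>i. if u + i \<in> {v} then d u v else 0)"
      by (simp add: avg_def del: insert_iff)
    also have "measure_pmf.expectation p (\<lambda>i. if u + i \<in> {v} then d u v else 0) = pmf p (v - u) * d u v"
      by (subst pmf_restrict_finite[of "{v}" p u "\<lambda>_. d u v"]) auto
    finally show ?thesis .
  qed
  have dsym: "d u v = d v u" for u v by (auto simp: d_def insert_commute)
  have ds: "(\<lambda>u. d u x) = d x" by (intro ext dsym)
  have "pmf p (x - z) = pmf p (z - x)" using sym[of "x - z"] by simp
  then show ?thesis
    using *[OF xz] *[OF xz[symmetric]] xz dsym[of z x] ds
    by (simp add: stirring_def insert_commute[of z x])
qed

section \<open>The heat kernel\<close>

text \<open>Transition probability from \<open>0\<close> to \<open>j\<close> of the walk that jumps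
  at rate 1, expanded over the Poisson number of jumps.\<close>

definition heat :: "int pmf \<Rightarrow> real \<Rightarrow> int \<Rightarrow> real" where
  "heat p t j = (\<Sum>n. exp (- t) * t ^ n / fact n * pmf (walk p n 0) j)"

definition symm :: "int pmf \<Rightarrow> bool" where
  "symm p \<longleftrightarrow> (\<forall>i. pmf p i = pmf p (- i))"

lemma symm_map: "symm p \<Longrightarrow> map_pmf uminus p = p"
proof (rule pmf_eqI)
  fix i assume "symm p"
  have "pmf (map_pmf uminus p) (- (- i)) = pmf p (- i)" by (rule pmf_map_inj') (simp add: inj_def)
  then show "pmf (map_pmf uminus p) i = pmf p i" using \<open>symm p\<close> by (simp add: symm_def)
qed

lemma symm_expectation:
  fixes f :: "int \<Rightarrow> real"
  assumes "symm p"
  shows "measure_pmf.expectation p (\<lambda>i. f (- i)) = measure_pmf.expectation p f"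
  using integral_map_pmf[of uminus p f] symm_map[OF assms] by simp

lemma walk_Suc': "walk p (Suc n) x = bind_pmf p (\<lambda>i. map_pmf (\<lambda>y. y + i) (walk p n x))"
  by (simp add: map_pmf_def bind_commute_pmf[of p])

lemma pmf_walk_Suc': "pmf (walk p (Suc n) x) j = measure_pmf.expectation p (\<lambda>i. pmf (walk p n x) (j - i))"
proof -
  have "pmf (map_pmf (\<lambda>y. y + i) (walk p n x)) (j - i + i) = pmf (walk p n x) (j - i)" for i
    by (rule pmf_map_inj') (simp add: inj_def)
  then show ?thesis by (simp only: walk_Suc' pmf_bind) simp
qed

lemma pmf_walk_Suc:
  assumes "symm p"
  shows "pmf (walk p (Suc n) x) j = avg p (pmf (walk p n x)) j"
  using symm_expectation[OF assms, of "\<lambda>i. pmf (walk p n x) (j + i)"]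
  by (simp add: pmf_walk_Suc' avg_def del: walk.simps)

lemma pmf_walk_uminus:
  assumes "symm p"
  shows "pmf (walk p n 0) (- j) = pmf (walk p n 0) j"
proof (induction n arbitrary: j)
  case 0
  then show ?case by (simp add: pmf_return indicator_def)
next
  case (Suc n)
  have "pmf (walk p (Suc n) 0) (- j) = measure_pmf.expectation p (\<lambda>i. pmf (walk p n 0) (- j + i))"
    by (simp add: pmf_walk_Suc[OF assms] avg_def del: walk.simps)
  also have "\<dots> = measure_pmf.expectation p (\<lambda>i. pmf (walk p n 0) (j - i))"
    using Suc.IH[of "j - _"] by simp
  finally show ?case by (simp only: pmf_walk_Suc')
qed

lemma summable_exp_weights:
  fixes a :: "nat \<Rightarrow> real"
  assumes "\<And>n. \<bar>a n\<bar> \<le> B"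
  shows "summable (\<lambda>n. a n / fact n * t ^ n)"
proof (rule summable_comparison_test')
  show "summable (\<lambda>n. B * (\<bar>t\<bar> ^ n /\<^sub>R fact n))"
    by (intro summable_mult summable_exp_generic)
  have B: "0 \<le> B" using assms[of 0] by auto
  show "norm (a n / fact n * t ^ n) \<le> B * (\<bar>t\<bar> ^ n /\<^sub>R fact n)" if "0 \<le> n" for n
  proof -
    have "\<bar>a n\<bar> * (\<bar>t\<bar> ^ n / fact n) \<le> B * (\<bar>t\<bar> ^ n / fact n)"
      by (rule mult_right_mono[OF assms]) auto
    then show ?thesis by (simp add: abs_mult power_abs divide_inverse mult_ac)
  qed
qed

lemma heat_altdef: "heat p t j = exp (- t) * (\<Sum>n. pmf (walk p n 0) j / fact n * t ^ n)"
proof -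
  have "summable (\<lambda>n. pmf (walk p n 0) j / fact n * t ^ n)"
    by (rule summable_exp_weights[of _ 1]) (simp add: pmf_le_1)
  from suminf_mult[OF this, of "exp (- t)"] show ?thesis
    unfolding heat_def by (simp add: mult_ac)
qed

lemma avg_heat:
  assumes p: "symm p" and t: "0 \<le> t"
  shows "avg p (heat p t) j = exp (- t) * (\<Sum>n. pmf (walk p (Suc n) 0) j / fact n * t ^ n)"
proof -
  let ?f = "\<lambda>n i. pmf (walk p n 0) (j + i) / fact n * t ^ n"
  have fb: "\<bar>?f n i\<bar> \<le> t ^ n /\<^sub>R fact n" "0 \<le> ?f n i" for n i
  proof -
    have "pmf (walk p n 0) (j + i) * (t ^ n / fact n) \<le> 1 * (t ^ n / fact n)"
      by (rule mult_right_mono) (use t in \<open>auto simp: pmf_le_1\<close>)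
    then show "\<bar>?f n i\<bar> \<le> t ^ n /\<^sub>R fact n" using t by (simp add: divide_inverse mult_ac abs_mult)
    show "0 \<le> ?f n i" using t by simp
  qed
  have s: "summable (\<lambda>n. t ^ n /\<^sub>R fact n)" by (rule summable_exp_generic)
  have i: "integrable (measure_pmf p) (?f n)" for n
    by (rule pmf_integrable_bounded[of _ "t ^ n /\<^sub>R fact n"]) (rule fb)
  have "avg p (heat p t) j = measure_pmf.expectation p (\<lambda>i. exp (- t) * (\<Sum>n. ?f n i))"
    by (simp add: avg_def heat_altdef)
  also have "\<dots> = exp (- t) * measure_pmf.expectation p (\<lambda>i. \<Sum>n. ?f n i)" by simp
  also have "measure_pmf.expectation p (\<lambda>i. \<Sum>n. ?f n i) = (\<Sum>n. measure_pmf.expectation p (?f n))"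
  proof (rule integral_suminf[OF i])
    show "AE i in measure_pmf p. summable (\<lambda>n. norm (?f n i))"
    proof (rule AE_I2)
      fix i show "summable (\<lambda>n. norm (?f n i))"
        by (rule summable_comparison_test'[OF s, of 0]) (use fb(1) in auto)
    qed
    show "summable (\<lambda>n. \<integral>i. norm (?f n i) \<partial>measure_pmf p)"
    proof (rule summable_comparison_test'[OF s, of 0])
      fix n
      have "\<bar>\<integral>i. norm (?f n i) \<partial>measure_pmf p\<bar> \<le> t ^ n /\<^sub>R fact n"
        by (rule pmf_abs_le) (use fb(1) in auto)
      then show "norm (\<integral>i. norm (?f n i) \<partial>measure_pmf p) \<le> t ^ n /\<^sub>R fact n" by simp
    qed
  qed
  also have "(\<lambda>n. measure_pmf.expectation p (?f n)) = (\<lambda>n. pmf (walk p (Suc n) 0) j / fact n * t ^ n)"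
  proof
    fix n
    have "integrable (measure_pmf p) (\<lambda>i. pmf (walk p n 0) (j + i))"
      by (rule pmf_integrable_bounded[of _ 1]) (simp add: pmf_le_1)
    then show "measure_pmf.expectation p (?f n) = pmf (walk p (Suc n) 0) j / fact n * t ^ n"
      by (simp add: pmf_walk_Suc[OF p] avg_def del: walk.simps)
  qed
  finally show ?thesis .
qed

text \<open>Up to \<open>exp (- t)\<close> the kernel is an exponential power series in
  \<open>t\<close>. Differentiation shifts the coefficients by one index, and one more step of the
  walk is one more average.\<close>

lemma heat_derivative:
  assumes p: "symm p" and t: "0 \<le> t"
  shows "((\<lambda>t. heat p t j) has_real_derivative avg p (heat p t) j - heat p t j) (at t within S)"
proof -
  define c where "c n = pmf (walk p n 0) j / fact n" for n
  have "((\<lambda>t. \<Sum>n. c n * t ^ n) has_real_derivative (\<Sum>n. diffs c n * t ^ n)) (at t)"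
    by (rule termdiffs_strong_converges_everywhere, unfold c_def, rule summable_exp_weights[of _ 1])
       (simp add: pmf_le_1)
  moreover have "diffs c = (\<lambda>n. pmf (walk p (Suc n) 0) j / fact n)"
    by (auto simp: diffs_def c_def fun_eq_iff field_simps simp del: walk.simps of_nat_Suc)
  ultimately have *: "((\<lambda>t. \<Sum>n. c n * t ^ n) has_real_derivative (\<Sum>n. pmf (walk p (Suc n) 0) j / fact n * t ^ n)) (at t)"
    by simp
  have "((\<lambda>t. exp (- t) * (\<Sum>n. c n * t ^ n)) has_real_derivative
      exp (- t) * (\<Sum>n. pmf (walk p (Suc n) 0) j / fact n * t ^ n) - exp (- t) * (\<Sum>n. c n * t ^ n)) (at t)"
    by (rule derivative_eq_intros * refl)+ simp
  then have "((\<lambda>t. heat p t j) has_real_derivative avg p (heat p t) j - heat p t j) (at t)"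
    unfolding heat_altdef avg_heat[OF p t] c_def .
  then show ?thesis by (rule has_field_derivative_at_within)
qed

lemma heat_nonneg: "0 \<le> t \<Longrightarrow> 0 \<le> heat p t j"
  unfolding heat_altdef
  by (intro mult_nonneg_nonneg suminf_nonneg summable_exp_weights[of _ 1]) (auto simp: pmf_le_1)

lemma heat_uminus: "symm p \<Longrightarrow> heat p t (- j) = heat p t j"
  by (simp add: heat_def pmf_walk_uminus)

text \<open>Up to the exponential factor the series has nonnegative coefficients. This crude
  comparison later gives majorants that hold at all times up to \<open>t\<close>.\<close>

lemma heat_mono:
  assumes "0 \<le> s" "s \<le> t"
  shows "heat p s j \<le> exp (t - s) * heat p t j"
proof -
  have "(\<Sum>n. pmf (walk p n 0) j / fact n * s ^ n) \<le> (\<Sum>n. pmf (walk p n 0) j / fact n * t ^ n)"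
    by (intro suminf_le summable_exp_weights[of _ 1] mult_left_mono power_mono) (use assms in \<open>auto simp: pmf_le_1\<close>)
  then have "exp (- s) * (\<Sum>n. pmf (walk p n 0) j / fact n * s ^ n) \<le> exp (- s) * (\<Sum>n. pmf (walk p n 0) j / fact n * t ^ n)"
    by simp
  also have "\<dots> = exp (t - s) * (exp (- t) * (\<Sum>n. pmf (walk p n 0) j / fact n * t ^ n))"
    by (simp only: mult.assoc[symmetric] exp_add[symmetric]) simp
  finally show ?thesis by (simp only: heat_altdef)
qed

lemma heat_0: "heat p 0 j = of_bool (j = 0)"
proof -
  have "(\<lambda>n. pmf (walk p n 0) j / fact n * 0 ^ n) sums (pmf (walk p 0 0) j / fact 0 * 0 ^ 0)"
    using sums_single[of 0 "\<lambda>n. pmf (walk p n 0) j / fact n * 0 ^ n"]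
    by (rule sums_cong[THEN iffD1, rotated]) auto
  then have "(\<Sum>n. pmf (walk p n 0) j / fact n * 0 ^ n) = pmf (return_pmf 0) j"
    by (simp add: sums_iff)
  then show ?thesis by (simp add: heat_altdef pmf_return indicator_def)
qed

text \<open>The argument is complex so that one computation covers both uses: exponential moments
  for real \<open>z\<close>, and characteristic functions of tilted walks along a vertical
  line.\<close>

definition mgf :: "int pmf \<Rightarrow> complex \<Rightarrow> complex" where
  "mgf p z = (\<Sum>\<^sub>\<infinity>i. of_real (pmf p i) * exp (z * of_int i))"

text \<open>Symmetry is part of the notion because it turns the one-sided moment into a two-sided
  one.\<close>

definition exp_moment :: "int pmf \<Rightarrow> real \<Rightarrow> bool" where
  "exp_moment p \<theta> \<longleftrightarrow> \<theta> > 0 \<and> symm p \<and> (\<lambda>i. exp (\<theta> * real_of_int i) * pmf p i) summable_on UNIV"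

lemma exp_moment_abs:
  assumes "exp_moment p \<theta>"
  shows "(\<lambda>i. pmf p i * exp (\<theta> * \<bar>real_of_int i\<bar>)) summable_on UNIV"
proof -
  have s: "(\<lambda>i. exp (\<theta> * real_of_int i) * pmf p i) summable_on UNIV" using assms by (simp add: exp_moment_def)
  then have "(\<lambda>i. exp (\<theta> * real_of_int (- i)) * pmf p (- i)) summable_on UNIV"
    by (subst summable_on_reindex_bij_witness[of _ uminus uminus UNIV "\<lambda>i. exp (\<theta> * real_of_int i) * pmf p i"]) auto
  moreover have "pmf p (- i) = pmf p i" for i using assms by (simp add: exp_moment_def symm_def)
  ultimately have "(\<lambda>i. exp (\<theta> * real_of_int i) * pmf p i + exp (\<theta> * real_of_int (- i)) * pmf p i) summable_on UNIV"
    using s by (intro summable_on_add) auto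
  then show ?thesis
    by (rule summable_on_comparison_test) (auto simp: abs_if algebra_simps)
qed

lemma mgf_has_sum:
  assumes "exp_moment p \<theta>" "\<bar>Re z\<bar> \<le> \<theta>"
  shows "(\<lambda>i. norm (of_real (pmf p i) * exp (z * of_int i))) summable_on UNIV"
    and "((\<lambda>i. of_real (pmf p i) * exp (z * of_int i)) has_sum mgf p z) UNIV"
proof -
  show s: "(\<lambda>i. norm (of_real (pmf p i) * exp (z * of_int i))) summable_on UNIV"
  proof (rule summable_on_comparison_test[OF exp_moment_abs[OF assms(1)]])
    fix i :: int
    have "Re z * real_of_int i \<le> \<bar>Re z\<bar> * \<bar>real_of_int i\<bar>" by (metis abs_ge_self abs_mult)
    also have "\<dots> \<le> \<theta> * \<bar>real_of_int i\<bar>" using assms(2) by (intro mult_right_mono) auto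
    finally show "norm (of_real (pmf p i) * exp (z * of_int i)) \<le> pmf p i * exp (\<theta> * \<bar>real_of_int i\<bar>)"
      by (simp add: norm_mult mult_left_mono)
  qed auto
  show "((\<lambda>i. of_real (pmf p i) * exp (z * of_int i)) has_sum mgf p z) UNIV"
    unfolding mgf_def by (rule has_sum_infsum, rule abs_summable_summable[OF s])
qed

lemma has_sum_product_complex:
  fixes f :: "'a \<Rightarrow> complex" and g :: "'b \<Rightarrow> complex"
  assumes f: "(\<lambda>x. norm (f x)) summable_on UNIV" "(f has_sum a) UNIV"
    and g: "(\<lambda>x. norm (g x)) summable_on UNIV" "(g has_sum b) UNIV"
  shows "(\<lambda>(x, y). norm (f x * g y)) summable_on UNIV"
    and "((\<lambda>(x, y). f x * g y) has_sum a * b) UNIV"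
proof -
  have "((\<lambda>y. norm (f x * g y)) has_sum norm (f x) * infsum (\<lambda>y. norm (g y)) UNIV) UNIV" for x
    unfolding norm_mult by (intro has_sum_cmult_right has_sum_infsum g)
  moreover have "(\<lambda>x. norm (f x) * infsum (\<lambda>y. norm (g y)) UNIV) summable_on UNIV"
    by (intro summable_on_cmult_left f)
  ultimately have "(\<lambda>(x, y). norm (f x * g y)) summable_on (UNIV \<times> UNIV)"
    by (intro summable_on_SigmaI[where g = "\<lambda>x. norm (f x) * infsum (\<lambda>y. norm (g y)) UNIV"]) auto
  then show n: "(\<lambda>(x, y). norm (f x * g y)) summable_on UNIV" by simp
  then have "(\<lambda>z. norm (case z of (x, y) \<Rightarrow> f x * g y)) summable_on UNIV" by (simp add: case_prod_unfold)
  then have "(\<lambda>(x, y). f x * g y) summable_on (UNIV \<times> UNIV)" by (simp add: abs_summable_summable)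
  then have "((\<lambda>(x, y). f x * g y) has_sum a * b) (UNIV \<times> UNIV)"
    by (intro has_sum_SigmaI[where g = "\<lambda>x. f x * b"]) (auto intro!: has_sum_cmult_right has_sum_cmult_left f g)
  then show "((\<lambda>(x, y). f x * g y) has_sum a * b) UNIV" by simp
qed

text \<open>The law after one more step is a convolution, so the transforms multiply. Absolute
  summability is carried through the induction because the product of the two series is rearranged
  along \<open>j = i + k\<close>.\<close>

lemma walk_mgf:
  assumes p: "exp_moment p \<theta>" and z: "\<bar>Re z\<bar> \<le> \<theta>"
  shows "(\<lambda>i. norm (of_real (pmf (walk p n 0) i) * exp (z * of_int i))) summable_on UNIV \<and>
     ((\<lambda>i. of_real (pmf (walk p n 0) i) * exp (z * of_int i)) has_sum mgf p z ^ n) UNIV"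
proof (induction n)
  case 0
  have fin: "((\<lambda>i. of_real (pmf (walk p 0 0) i) * exp (z * of_int i)) has_sum 1) {0}"
    by (rule has_sum_finiteI) auto
  have *: "((\<lambda>i. of_real (pmf (walk p 0 0) i) * exp (z * of_int i)) has_sum 1) UNIV"
    by (rule has_sum_cong_neutral[THEN iffD1, OF _ _ _ fin]) (auto simp: pmf_return)
  have "(\<lambda>i. norm (of_real (pmf (walk p 0 0) i) * exp (z * of_int i))) summable_on {0}" by simp
  then have "(\<lambda>i. norm (of_real (pmf (walk p 0 0) i) * exp (z * of_int i))) summable_on UNIV"
    by (rule summable_on_cong_neutral[THEN iffD1, rotated 3]) (auto simp: pmf_return)
  with * show ?case by simp
next
  case (Suc n)
  let ?f = "\<lambda>i. of_real (pmf p i) * exp (z * of_int i)"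
  let ?g = "\<lambda>i. of_real (pmf (walk p n 0) i) * exp (z * of_int i)"
  let ?h = "\<lambda>j. of_real (pmf (walk p (Suc n) 0) j) * exp (z * of_int j)"
  let ?F = "\<lambda>(j, i). of_real (pmf p i * pmf (walk p n 0) (j - i)) * exp (z * of_int j)"
  note pr = has_sum_product_complex[OF mgf_has_sum[OF p z] Suc.IH[THEN conjunct1] Suc.IH[THEN conjunct2]]
  have F: "(?F has_sum mgf p z * mgf p z ^ n) UNIV"
    by (rule has_sum_reindex_bij_witness[where i = "\<lambda>(j, i). (i, j - i)" and j = "\<lambda>(i, k). (i + k, i)", THEN iffD1, OF _ _ _ _ _ _ pr(2)])
       (auto simp: exp_add[symmetric] algebra_simps)
  have Fn: "(\<lambda>z. norm (?F z)) summable_on UNIV"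
    by (rule summable_on_reindex_bij_witness[where i = "\<lambda>(j, i). (i, j - i)" and j = "\<lambda>(i, k). (i + k, i)", THEN iffD1, OF _ _ _ _ _ pr(1)])
       (auto simp: norm_mult algebra_simps exp_add[symmetric])
  have w: "((\<lambda>i. pmf p i * pmf (walk p n 0) (j - i)) has_sum pmf (walk p (Suc n) 0) j) UNIV" for j
    unfolding pmf_walk_Suc' by (rule pmf_has_sum[OF pmf_integrable_bounded[of _ 1]]) (simp add: pmf_le_1)
  have h: "((\<lambda>i. ?F (j, i)) has_sum ?h j) UNIV" for j
    using has_sum_cmult_left[OF has_sum_of_real[OF w[of j], where ?'a = complex], of "exp (z * of_int j)"] by simp
  have h1: "(?h has_sum mgf p z * mgf p z ^ n) UNIV"
    by (rule has_sum_SigmaD[where f = ?F and A = UNIV and B = "\<lambda>_. UNIV"]) (use F h in auto)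
  have hn: "((\<lambda>i. norm (?F (j, i))) has_sum norm (?h j)) UNIV" for j
    using has_sum_cmult_left[OF w[of j], of "norm (exp (z * of_int j))"] by (simp add: norm_mult abs_mult)
  have "(\<lambda>j. infsum (\<lambda>i. norm (?F (j, i))) UNIV) summable_on UNIV"
    by (rule summable_on_Sigma_banach) (use Fn in \<open>simp add: case_prod_unfold\<close>)
  then have "(\<lambda>j. norm (?h j)) summable_on UNIV" using infsumI[OF hn] by simp
  then show ?case using h1 by simp
qed

lemma heat_has_sum:
  assumes "0 \<le> t"
  shows "((\<lambda>n. exp (- t) * t ^ n / fact n * pmf (walk p n 0) j) has_sum heat p t j) UNIV"
proof -
  have "summable (\<lambda>n. pmf (walk p n 0) j / fact n * t ^ n)"
    by (rule summable_exp_weights[of _ 1]) (simp add: pmf_le_1)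
  from summable_mult[OF this, of "exp (- t)"]
  have "summable (\<lambda>n. exp (- t) * t ^ n / fact n * pmf (walk p n 0) j)" by (simp add: mult_ac)
  then have "(\<lambda>n. exp (- t) * t ^ n / fact n * pmf (walk p n 0) j) sums heat p t j"
    unfolding heat_def by (rule summable_sums)
  then show ?thesis by (rule sums_nonneg_imp_has_sum) (use assms in auto)
qed

text \<open>Poisson mixture of the powers \<open>mgf p z ^ n\<close>; the work lies in exchanging
  the sum over jumps with the sum over sites.\<close>

lemma heat_mgf:
  assumes p: "exp_moment p \<theta>" and z: "\<bar>Re z\<bar> \<le> \<theta>" and t: "0 \<le> t"
  shows "(\<lambda>j. norm (of_real (heat p t j) * exp (z * of_int j))) summable_on UNIV"
    and "((\<lambda>j. of_real (heat p t j) * exp (z * of_int j)) has_sum exp (of_real t * (mgf p z - 1))) UNIV"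
proof -
  define c where "c n = exp (- t) * t ^ n / fact n" for n :: nat
  have c0: "0 \<le> c n" for n using t by (simp add: c_def)
  let ?w = "\<lambda>n j. of_real (pmf (walk p n 0) j) * exp (z * of_int j)"
  let ?F = "\<lambda>(j, n). of_real (c n) * ?w n j"
  \<comment> \<open>The series of absolute values depends on \<open>Re z\<close> alone and equals
    the power of \<open>mgf\<close> at that real point, so the Poisson weights sum it.\<close>
  define N where "N n = infsum (\<lambda>j. norm (?w n j)) UNIV" for n
  have Re: "\<bar>Re (of_real (Re z))\<bar> \<le> \<theta>" using z by simp
  have Nr: "N n = Re (mgf p (of_real (Re z)) ^ n)" for n
  proof -
    have "((\<lambda>j. Re (of_real (pmf (walk p n 0) j) * exp (of_real (Re z) * of_int j))) has_sum Re (mgf p (of_real (Re z)) ^ n)) UNIV"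
      using walk_mgf[OF p Re, of n] by (intro has_sum_Re) simp
    moreover have "Re (of_real (pmf (walk p n 0) j) * exp (of_real (Re z) * of_int j)) = norm (?w n j)" for j
      by (simp add: norm_mult Re_exp)
    ultimately show ?thesis unfolding N_def by (simp add: infsumI)
  qed
  have exps: "(\<lambda>n. of_real (c n) * x ^ n) sums exp (of_real t * (x - 1))" for x :: complex
  proof -
    have "(\<lambda>n. of_real (exp (- t)) * ((of_real t * x) ^ n /\<^sub>R fact n)) sums (of_real (exp (- t)) * exp (of_real t * x))"
      by (intro sums_mult exp_converges)
    moreover have "of_real (exp (- t)) * ((of_real t * x) ^ n /\<^sub>R fact n) = of_real (c n) * x ^ n" for n
      by (simp add: c_def scaleR_conv_of_real power_mult_distrib divide_inverse mult_ac)
    moreover have "of_real (exp (- t)) * exp (of_real t * x) = exp (of_real t * (x - 1))"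
      by (simp add: exp_of_real[symmetric] exp_add[symmetric] algebra_simps)
    ultimately show ?thesis by simp
  qed
  have "summable (\<lambda>n. Re (of_real (c n) * mgf p (of_real (Re z)) ^ n))"
    using sums_Re[OF exps[of "mgf p (of_real (Re z))"]] by (simp add: sums_iff)
  then have cN: "summable (\<lambda>n. c n * N n)" by (simp add: Nr)
  have N0: "0 \<le> N n" for n unfolding N_def by (rule infsum_nonneg) auto
  have cN': "(\<lambda>n. c n * N n) summable_on UNIV"
    by (rule summable_nonneg_imp_summable_on[OF cN]) (simp add: c0 N0)
  have "(\<lambda>(n, j). norm (?F (j, n))) summable_on (UNIV \<times> UNIV)"
  proof (rule summable_on_SigmaI[OF _ cN'])
    fix n
    have "((\<lambda>j. norm (?w n j)) has_sum N n) UNIV" unfolding N_def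
      by (rule has_sum_infsum) (use walk_mgf[OF p z, of n] in simp)
    from has_sum_cmult_right[OF this, of "c n"]
    show "((\<lambda>j. case (n, j) of (n, j) \<Rightarrow> norm (?F (j, n))) has_sum c n * N n) UNIV"
      using c0[of n] by (simp add: norm_mult)
  qed auto
  then have nj: "(\<lambda>(n, j). norm (?F (j, n))) summable_on UNIV" by simp
  have jn: "(\<lambda>u. norm (?F u)) summable_on UNIV"
    by (rule summable_on_reindex_bij_witness[where i = prod.swap and j = prod.swap, THEN iffD1, OF _ _ _ _ _ nj]) auto
  have njs: "(\<lambda>(n, j). ?F (j, n)) summable_on (UNIV \<times> UNIV)"
    by (rule abs_summable_summable) (use nj in \<open>simp only: case_prod_unfold fst_conv snd_conv UNIV_Times_UNIV\<close>)
  define S where "S = infsum (\<lambda>(n, j). ?F (j, n)) (UNIV \<times> UNIV)"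
  have nS: "((\<lambda>(n, j). ?F (j, n)) has_sum S) (UNIV \<times> UNIV)" unfolding S_def using njs by simp
  have "((\<lambda>n. of_real (c n) * mgf p z ^ n) has_sum S) UNIV"
    by (rule has_sum_SigmaD[OF nS]) (use walk_mgf[OF p z] in \<open>auto intro!: has_sum_cmult_right\<close>)
  then have "(\<lambda>n. of_real (c n) * mgf p z ^ n) sums S" by (rule has_sum_imp_sums)
  then have S: "S = exp (of_real t * (mgf p z - 1))" using exps sums_unique2 by blast
  have "(?F has_sum S) UNIV"
    using nS by (subst has_sum_reindex_bij_witness[of UNIV prod.swap prod.swap UNIV "\<lambda>(n, j). ?F (j, n)" _ _ S]) auto
  then have FS: "(?F has_sum S) (UNIV \<times> UNIV)" by simp
  have row: "((\<lambda>n. ?F (j, n)) has_sum of_real (heat p t j) * exp (z * of_int j)) UNIV" for j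
    using has_sum_cmult_left[OF has_sum_of_real[OF heat_has_sum[OF t, of p j], where ?'a = complex], of "exp (z * of_int j)"]
    by (simp add: c_def mult_ac)
  show "((\<lambda>j. of_real (heat p t j) * exp (z * of_int j)) has_sum exp (of_real t * (mgf p z - 1))) UNIV"
    using has_sum_SigmaD[OF FS row] by (simp add: S)
  have rown: "((\<lambda>n. norm (?F (j, n))) has_sum norm (of_real (heat p t j) * exp (z * of_int j))) UNIV" for j
  proof -
    have "((\<lambda>n. c n * pmf (walk p n 0) j * norm (exp (z * of_int j))) has_sum heat p t j * norm (exp (z * of_int j))) UNIV"
      unfolding c_def by (rule has_sum_cmult_left[OF heat_has_sum[OF t]])
    moreover have "norm (?F (j, n)) = c n * pmf (walk p n 0) j * norm (exp (z * of_int j))" for n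
      using c0[of n] by (simp only: prod.case norm_mult norm_of_real abs_of_nonneg pmf_nonneg)
    moreover have "norm (of_real (heat p t j) * exp (z * of_int j)) = heat p t j * norm (exp (z * of_int j))"
      using heat_nonneg[OF t, of p j] by (simp only: norm_mult norm_of_real abs_of_nonneg)
    ultimately show ?thesis by presburger
  qed
  have "(\<lambda>j. infsum (\<lambda>n. norm (?F (j, n))) UNIV) summable_on UNIV"
    by (rule summable_on_Sigma_banach) (use jn in \<open>simp only: case_prod_unfold fst_conv snd_conv UNIV_Times_UNIV\<close>)
  then show "(\<lambda>j. norm (of_real (heat p t j) * exp (z * of_int j))) summable_on UNIV"
    using infsumI[OF rown] by simp
qed

text \<open>Cumulant exponent per unit time: at time \<open>t\<close> the exponential moment of the
  continuous-time walk is \<open>exp (t * psi p a)\<close>.\<close>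

definition psi :: "int pmf \<Rightarrow> real \<Rightarrow> real" where
  "psi p a = (\<Sum>\<^sub>\<infinity>i. pmf p i * exp (a * real_of_int i)) - 1"

lemma psi_has_sum:
  assumes "exp_moment p \<theta>" "\<bar>a\<bar> \<le> \<theta>"
  shows "((\<lambda>i. pmf p i * exp (a * real_of_int i)) has_sum 1 + psi p a) UNIV"
proof -
  have "((\<lambda>i. Re (of_real (pmf p i) * exp (of_real a * of_int i))) has_sum Re (mgf p (of_real a))) UNIV"
    by (rule has_sum_Re, rule mgf_has_sum[OF assms(1)]) (use assms in simp)
  then have "((\<lambda>i. pmf p i * exp (a * real_of_int i)) has_sum Re (mgf p (of_real a))) UNIV"
    by (simp add: Re_exp)
  from has_sum_infsum[OF has_sum_imp_summable[OF this]] show ?thesis by (simp add: psi_def)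
qed

lemma mgf_real:
  assumes "exp_moment p \<theta>" "\<bar>a\<bar> \<le> \<theta>"
  shows "mgf p (of_real a) = of_real (1 + psi p a)"
proof -
  have "((\<lambda>i. of_real (pmf p i * exp (a * real_of_int i)) :: complex) has_sum of_real (1 + psi p a)) UNIV"
    using psi_has_sum[OF assms] by (rule has_sum_of_real)
  then have "((\<lambda>i. of_real (pmf p i) * exp (of_real a * of_int i) :: complex) has_sum of_real (1 + psi p a)) UNIV"
    by (simp add: exp_of_real[symmetric])
  then show ?thesis unfolding mgf_def by (rule infsumI)
qed

lemma psi_uminus_has_sum:
  assumes "exp_moment p \<theta>" "\<bar>a\<bar> \<le> \<theta>"
  shows "((\<lambda>i. pmf p i * exp (- (a * real_of_int i))) has_sum 1 + psi p a) UNIV"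
proof -
  have p: "pmf p (- i) = pmf p i" for i using assms by (simp add: exp_moment_def symm_def)
  show ?thesis
    by (rule has_sum_reindex_bij_witness[where i = uminus and j = uminus, THEN iffD1, OF _ _ _ _ _ _ psi_has_sum[OF assms]])
       (auto simp: p)
qed

lemma pmf_has_sum_1: "(pmf p has_sum 1) UNIV"
  using pmf_has_sum[of p "\<lambda>_. 1"] by simp

text \<open>By symmetry \<open>psi\<close> is the mean of \<open>cosh - 1\<close>.\<close>

lemma psi_nonneg:
  assumes "exp_moment p \<theta>" "\<bar>a\<bar> \<le> \<theta>"
  shows "0 \<le> psi p a"
proof -
  have "((\<lambda>i. pmf p i * exp (a * real_of_int i) + pmf p i * exp (- (a * real_of_int i))) has_sum (1 + psi p a) + (1 + psi p a)) UNIV"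
    by (intro has_sum_add psi_has_sum[OF assms] psi_uminus_has_sum[OF assms])
  moreover have "((\<lambda>i. pmf p i * 2) has_sum 1 * 2) UNIV" by (rule has_sum_cmult_left[OF pmf_has_sum_1])
  moreover have "pmf p i * 2 \<le> pmf p i * exp (a * real_of_int i) + pmf p i * exp (- (a * real_of_int i))" for i
  proof -
    have "2 \<le> exp (a * real_of_int i) + exp (- (a * real_of_int i))"
      using cosh_real_ge_1[of "a * real_of_int i"] by (simp add: cosh_def)
    then show ?thesis by (metis distrib_left mult_left_mono pmf_nonneg)
  qed
  ultimately have "1 * 2 \<le> (1 + psi p a) + (1 + psi p a)" using has_sum_mono by blast
  then show ?thesis by simp
qed

lemma heat_exp_has_sum:
  assumes p: "exp_moment p \<theta>" and a: "\<bar>a\<bar> \<le> \<theta>" and t: "0 \<le> t"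
  shows "((\<lambda>j. heat p t j * exp (a * real_of_int j)) has_sum exp (t * psi p a)) UNIV"
proof -
  have "((\<lambda>j. Re (of_real (heat p t j) * exp (of_real a * of_int j))) has_sum Re (exp (of_real t * (mgf p (of_real a) - 1)))) UNIV"
    by (rule has_sum_Re, rule heat_mgf[OF p _ t]) (use a in simp)
  moreover have "exp (of_real t * (mgf p (of_real a) - 1)) = complex_of_real (exp (t * psi p a))"
    using mgf_real[OF p a] by (simp add: exp_of_real[symmetric])
  ultimately show ?thesis by (simp add: Re_exp)
qed

lemma exp_moment_0: "exp_moment p \<theta> \<Longrightarrow> \<bar>0\<bar> \<le> \<theta>"
  by (simp add: exp_moment_def)

lemma psi_0 [simp]: "psi p 0 = 0"
  using infsumI[OF pmf_has_sum_1] by (simp add: psi_def)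

lemma heat_has_sum_1:
  assumes "exp_moment p \<theta>" "0 \<le> t"
  shows "(heat p t has_sum 1) UNIV"
  using heat_exp_has_sum[OF assms(1) exp_moment_0[OF assms(1)] assms(2)] by simp

lemma exp_momentD: "exp_moment p \<theta> \<Longrightarrow> symm p" "exp_moment p \<theta> \<Longrightarrow> 0 < \<theta>"
  by (auto simp: exp_moment_def)

lemma summable_on_finite_sum:
  fixes f :: "'k \<Rightarrow> 'i \<Rightarrow> real"
  assumes "finite B" "\<And>k. k \<in> B \<Longrightarrow> f k summable_on S"
  shows "(\<lambda>x. \<Sum>k\<in>B. f k x) summable_on S"
  using assms by (induction B rule: finite_induct) (auto intro: summable_on_add)

text \<open>Solution of the heat equation started from \<open>c\<close> on \<open>B\<close>. It
  serves both as the particle density \<rho> and, with \<open>c = 1\<close> on the target set, as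
  the function \<open>g\<close> running backwards in time.\<close>

definition occupation :: "int pmf \<Rightarrow> int set \<Rightarrow> (int \<Rightarrow> real) \<Rightarrow> real \<Rightarrow> int \<Rightarrow> real" where
  "occupation p B c s x = (\<Sum>k\<in>B. c k * heat p s (x - k))"

context
  fixes p :: "int pmf" and \<theta> :: real and B :: "int set" and c :: "int \<Rightarrow> real"
  assumes p: "exp_moment p \<theta>" and B: "finite B" and c: "\<And>k. 0 \<le> c k \<and> c k \<le> 1"
begin

lemma heat_le_1: "0 \<le> s \<Longrightarrow> heat p s j \<le> 1"
  using finite_sum_le_has_sum[OF heat_has_sum_1[OF p], of s "{j}"] heat_nonneg[of s] by auto

lemma occupation_nonneg: "0 \<le> s \<Longrightarrow> 0 \<le> occupation p B c s x"
  unfolding occupation_def using c heat_nonneg by (intro sum_nonneg) auto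

text \<open>Exponential Chebyshev bound. The sign of \<open>a\<close> says on which side of
  \<open>m\<close> the set \<open>B\<close> lies: positive for the target set to the right of
  \<open>Y\<close>, negative for the initial block to the left of \<open>0\<close>, and
  \<open>a = 0\<close> gives the bound by \<open>1\<close>.\<close>

lemma occupation_le_exp:
  assumes s: "0 \<le> s" and a: "\<bar>a\<bar> \<le> \<theta>" and Bm: "\<And>k. k \<in> B \<Longrightarrow> a * m \<le> a * real_of_int k"
  shows "occupation p B c s x \<le> exp (a * (real_of_int x - m) + s * psi p a)"
proof -
  have "occupation p B c s x \<le> (\<Sum>k\<in>B. exp (a * (real_of_int x - m)) * (heat p s (k - x) * exp (a * real_of_int (k - x))))"
    unfolding occupation_def
  proof (rule sum_mono)
    fix k assume k: "k \<in> B"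
    have "heat p s (x - k) = heat p s (k - x)" using heat_uminus[OF exp_momentD(1)[OF p], of s "k - x"] by simp
    moreover have "1 \<le> exp (a * (real_of_int x - m)) * exp (a * real_of_int (k - x))"
      using Bm[OF k] by (simp add: exp_add[symmetric] algebra_simps)
    then have "c k * heat p s (k - x) \<le> (exp (a * (real_of_int x - m)) * exp (a * real_of_int (k - x))) * heat p s (k - x)"
      using c[of k] heat_nonneg[OF s] by (intro mult_right_mono) auto
    ultimately show "c k * heat p s (x - k) \<le> exp (a * (real_of_int x - m)) * (heat p s (k - x) * exp (a * real_of_int (k - x)))"
      by (simp add: mult_ac)
  qed
  also have "\<dots> = exp (a * (real_of_int x - m)) * (\<Sum>j\<in>(\<lambda>k. k - x) ` B. heat p s j * exp (a * real_of_int j))"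
    by (subst sum.reindex) (auto simp: inj_on_def sum_distrib_left)
  also have "\<dots> \<le> exp (a * (real_of_int x - m)) * exp (s * psi p a)"
    by (intro mult_left_mono finite_sum_le_has_sum[OF heat_exp_has_sum[OF p a s]])
       (use B heat_nonneg[OF s] in auto)
  finally show ?thesis by (simp add: exp_add)
qed

lemma occupation_le_1: "0 \<le> s \<Longrightarrow> occupation p B c s x \<le> 1"
  using occupation_le_exp[of s 0 0 x] exp_moment_0[OF p] by simp

lemma occupation_derivative:
  assumes "0 \<le> s"
  shows "((\<lambda>s. occupation p B c s x) has_real_derivative avg p (occupation p B c s) x - occupation p B c s x) (at s within S)"
proof -
  have "((\<lambda>s. occupation p B c s x) has_real_derivative (\<Sum>k\<in>B. c k * (avg p (heat p s) (x - k) - heat p s (x - k)))) (at s within S)"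
    unfolding occupation_def by (intro DERIV_sum DERIV_cmult heat_derivative exp_momentD[OF p] assms)
  moreover have "avg p (occupation p B c s) x = (\<Sum>k\<in>B. c k * avg p (heat p s) (x - k))"
  proof -
    have i: "integrable (measure_pmf p) (\<lambda>i. heat p s (x - k + i))" for k
      by (rule pmf_integrable_bounded[of _ 1]) (use heat_nonneg[OF assms] heat_le_1[OF assms] in \<open>simp add: abs_le_iff order.trans[of _ 0]\<close>)
    have e: "x + i - k = x - k + i" for i k :: int by simp
    show ?thesis unfolding avg_def occupation_def e using i by (subst Bochner_Integration.integral_sum) auto
  qed
  ultimately show ?thesis by (simp add: occupation_def right_diff_distrib sum_subtractf)
qed

lemma occupation_mono:
  assumes "0 \<le> s" "s \<le> t"
  shows "occupation p B c s x \<le> exp t * occupation p B c t x"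
proof -
  have "occupation p B c s x \<le> (\<Sum>k\<in>B. c k * (exp t * heat p t (x - k)))"
    unfolding occupation_def
  proof (rule sum_mono, rule mult_left_mono)
    fix k
    have "heat p s (x - k) \<le> exp (t - s) * heat p t (x - k)" by (rule heat_mono[OF assms])
    also have "\<dots> \<le> exp t * heat p t (x - k)" using assms heat_nonneg[of t] by (intro mult_right_mono) auto
    finally show "heat p s (x - k) \<le> exp t * heat p t (x - k)" .
  qed (use c in auto)
  then show ?thesis by (simp add: occupation_def sum_distrib_left mult_ac)
qed

lemma occupation_exp_summable:
  assumes "0 \<le> s" "\<bar>a\<bar> \<le> \<theta>"
  shows "(\<lambda>x. occupation p B c s x * exp (a * real_of_int x)) summable_on UNIV"
proof -
  have "((\<lambda>x. \<Sum>k\<in>B. c k * exp (a * real_of_int k) * (heat p s (x - k) * exp (a * real_of_int (x - k)))) summable_on UNIV)"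
  proof (intro summable_on_finite_sum[OF B] summable_on_cmult_right)
    fix k
    show "(\<lambda>x. heat p s (x - k) * exp (a * real_of_int (x - k))) summable_on UNIV"
      by (rule summable_on_reindex_bij_witness[where i = "\<lambda>x. x - k" and j = "\<lambda>x. x + k", THEN iffD1, OF _ _ _ _ _ has_sum_imp_summable[OF heat_exp_has_sum[OF p assms(2,1)]]])
         auto
  qed
  moreover have "(\<Sum>k\<in>B. c k * exp (a * real_of_int k) * (heat p s (x - k) * exp (a * real_of_int (x - k)))) = occupation p B c s x * exp (a * real_of_int x)" for x
    unfolding occupation_def sum_distrib_right
  proof (rule sum.cong[OF refl])
    fix k
    have "exp (a * real_of_int k) * exp (a * real_of_int (x - k)) = exp (a * real_of_int x)"
      by (simp add: exp_add[symmetric] algebra_simps)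
    then show "c k * exp (a * real_of_int k) * (heat p s (x - k) * exp (a * real_of_int (x - k))) = c k * heat p s (x - k) * exp (a * real_of_int x)"
      by (metis (no_types, opaque_lifting) mult.assoc mult.left_commute)
  qed
  ultimately show ?thesis by simp
qed

lemma occupation_0: "occupation p B c 0 x = (if x \<in> B then c x else 0)"
proof -
  have "occupation p B c 0 x = (\<Sum>k\<in>B. if k = x then c k else 0)"
    unfolding occupation_def by (intro sum.cong) (auto simp: heat_0)
  then show ?thesis using B by simp
qed

end

lemma avg_has_sum:
  assumes "\<And>x. \<bar>f x\<bar> \<le> M"
  shows "((\<lambda>z. pmf p (z - x) * f z) has_sum avg p f x) UNIV"
proof -
  have "((\<lambda>i. pmf p i * f (x + i)) has_sum avg p f x) UNIV"
    unfolding avg_def by (rule pmf_has_sum[OF pmf_integrable_bounded[of _ M]]) (rule assms)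
  then show ?thesis
    by (rule has_sum_reindex_bij_witness[where i = "\<lambda>z. z - x" and j = "\<lambda>i. x + i", THEN iffD1, rotated -1]) auto
qed

text \<open>The infinite sum itself is never differentiated. By the M-test the series of derivatives
  converges uniformly on \<open>{0..t}\<close>, so every large finite sum has derivative at most
  \<epsilon> throughout; integrating costs at most \<open>e\<close>, and then the finite set
  exhausts the index set.\<close>

lemma sum_nonincreasing:
  fixes \<phi> :: "'i \<Rightarrow> real \<Rightarrow> real"
  assumes t: "0 \<le> t"
    and d: "\<And>i s. 0 \<le> s \<Longrightarrow> s \<le> t \<Longrightarrow> (\<phi> i has_real_derivative \<phi>' i s) (at s within {0..})"
    and M: "\<And>i s. 0 \<le> s \<Longrightarrow> s \<le> t \<Longrightarrow> \<bar>\<phi>' i s\<bar> \<le> M i" "M summable_on UNIV"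
    and neg: "\<And>s. 0 \<le> s \<Longrightarrow> s \<le> t \<Longrightarrow> infsum (\<lambda>i. \<phi>' i s) UNIV \<le> 0"
    and s: "(\<lambda>i. \<phi> i 0) summable_on UNIV" "(\<lambda>i. \<phi> i t) summable_on UNIV"
  shows "infsum (\<lambda>i. \<phi> i t) UNIV \<le> infsum (\<lambda>i. \<phi> i 0) UNIV"
proof (rule field_le_epsilon)
  fix e :: real assume e: "0 < e"
  define \<epsilon> where "\<epsilon> = e / (t + 1)"
  have \<epsilon>: "0 < \<epsilon>" "\<epsilon> * t \<le> e" using e t by (auto simp: \<epsilon>_def field_simps)
  have lim: "uniform_limit {0..t} (\<lambda>F s. \<Sum>i\<in>F. \<phi>' i s) (\<lambda>s. infsum (\<lambda>i. \<phi>' i s) UNIV) (finite_subsets_at_top UNIV)"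
    by (rule Weierstrass_m_test_general[where M = M]) (use M in auto)
  have "\<forall>\<^sub>F F in finite_subsets_at_top UNIV. \<forall>s\<in>{0..t}. (\<Sum>i\<in>F. \<phi>' i s) \<le> \<epsilon>"
    using uniform_limitD[OF lim \<epsilon>(1)]
  proof eventually_elim
    case (elim F)
    show ?case
    proof
      fix s assume "s \<in> {0..t}"
      then show "(\<Sum>i\<in>F. \<phi>' i s) \<le> \<epsilon>" using elim neg[of s] by (force simp: dist_real_def)
    qed
  qed
  then have ev: "\<forall>\<^sub>F F in finite_subsets_at_top UNIV. (\<Sum>i\<in>F. \<phi> i t) \<le> (\<Sum>i\<in>F. \<phi> i 0) + e"
  proof eventually_elim
    case (elim F)
    have "\<epsilon> * 0 - (\<Sum>i\<in>F. \<phi> i 0) \<le> \<epsilon> * t - (\<Sum>i\<in>F. \<phi> i t)"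
    proof (rule within_deriv_mono[OF _ _ t])
      fix s assume "0 \<le> s" "s \<le> t"
      then show "((\<lambda>s. \<epsilon> * s - (\<Sum>i\<in>F. \<phi> i s)) has_real_derivative \<epsilon> * 1 - (\<Sum>i\<in>F. \<phi>' i s)) (at s within {0..})"
        by (intro DERIV_diff DERIV_cmult DERIV_sum d DERIV_ident)
    qed (use elim in auto)
    then show ?case using \<epsilon>(2) by simp
  qed
  show "infsum (\<lambda>i. \<phi> i t) UNIV \<le> infsum (\<lambda>i. \<phi> i 0) UNIV + e"
    by (rule tendsto_le[OF _ _ _ ev])
       (use has_sum_infsum[OF s(1)] has_sum_infsum[OF s(2)] in \<open>auto simp: has_sum_def intro!: tendsto_intros\<close>)
qed

section \<open>The sum of the pair gaps\<close>

lemma summable_dominated: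
  fixes F :: "'i \<Rightarrow> real"
  assumes "G summable_on S" "\<And>u. u \<in> S \<Longrightarrow> \<bar>F u\<bar> \<le> G u"
  shows "F summable_on S"
proof -
  have "(\<lambda>u. \<bar>F u\<bar>) summable_on S"
    by (rule summable_on_comparison_test[OF assms(1)]) (use assms(2) in auto)
  then show ?thesis using abs_summable_summable[of F S] by (simp only: real_norm_def)
qed

lemma rows_has_sum:
  fixes F :: "int \<times> int \<Rightarrow> real"
  assumes "F summable_on UNIV" "\<And>x. ((\<lambda>z. F (x, z)) has_sum r x) UNIV"
  shows "(r has_sum infsum F UNIV) UNIV"
  by (rule has_sum_SigmaD[where f = F and A = UNIV and B = "\<lambda>_. UNIV"]) (use assms in auto)

lemma summable_rows:
  fixes F :: "int \<times> int \<Rightarrow> real"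
  assumes "\<And>x. ((\<lambda>z. F (x, z)) has_sum r x) UNIV" "r summable_on UNIV" "\<And>u. 0 \<le> F u"
  shows "F summable_on UNIV"
  using summable_on_SigmaI[where f = F and A = UNIV and B = "\<lambda>_. UNIV" and g = r] assms by simp

lemma has_sum_swap:
  fixes F :: "int \<times> int \<Rightarrow> real"
  shows "((\<lambda>(x, z). F (z, x)) has_sum S) UNIV \<longleftrightarrow> (F has_sum S) UNIV"
  by (rule has_sum_reindex_bij_witness[where i = prod.swap and j = prod.swap]) auto

lemma summable_swap:
  fixes F :: "int \<times> int \<Rightarrow> real"
  assumes "F summable_on UNIV"
  shows "(\<lambda>(x, z). F (z, x)) summable_on UNIV"
  using assms by (simp add: summable_on_def has_sum_swap)

lemma has_sum_diagonal:
  fixes e :: "int \<Rightarrow> real"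
  assumes "(e has_sum S) UNIV"
  shows "((\<lambda>(x, z). if x = z then e x else 0) has_sum S) UNIV"
proof -
  have "((\<lambda>(x, z). if x = z then e x else 0) has_sum S) (range (\<lambda>x. (x, x)))"
    by (subst has_sum_reindex) (use assms in \<open>auto simp: inj_on_def o_def\<close>)
  also have "?this \<longleftrightarrow> ?thesis" by (rule has_sum_cong_neutral) auto
  finally show ?thesis .
qed

lemma summable_product:
  fixes f g :: "int \<Rightarrow> real"
  assumes "f summable_on UNIV" "g summable_on UNIV" "\<And>x. 0 \<le> f x" "\<And>x. 0 \<le> g x"
  shows "(\<lambda>(x, z). f x * g z) summable_on UNIV"
  by (rule summable_rows[where r = "\<lambda>x. f x * infsum g UNIV"])
     (use assms in \<open>auto intro: has_sum_cmult_right has_sum_infsum summable_on_cmult_left\<close>)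

text \<open>Here \<open>a\<close> and \<open>b\<close> stand for \<rho> at two sites and
  \<open>E\<close> for the ratio of the weights there; the difference of both sides is
  \<open>w\<close> times a square over \<open>2 * E\<close>. Averaged over a jump \<open>i\<close>
  with \<open>E = exp (\<alpha> * i)\<close>, the factor \<open>3 - E - 2 / E\<close> becomes
  \<open>- 3 * psi p \<alpha>\<close>, which is where the rate in the weight comes from.\<close>

lemma weighted_square_bound:
  fixes E a b w :: real
  assumes "0 < E" "0 < w"
  shows "w * a\<^sup>2 * (3 - E - 2 / E) \<le> w * E * b\<^sup>2 + w * a\<^sup>2 - 2 * w * a * b - w * E * (a - b)\<^sup>2 / 2"
proof -
  have id: "E * b\<^sup>2 + a\<^sup>2 - 2 * a * b - E * (a - b)\<^sup>2 / 2 - a\<^sup>2 * (3 - E - 2 / E)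
      = (E * (b - a) + 2 * a * (E - 1))\<^sup>2 / (2 * E)"
    using assms by (simp add: field_simps power2_eq_square)
  have "0 \<le> w * (E * b\<^sup>2 + a\<^sup>2 - 2 * a * b - E * (a - b)\<^sup>2 / 2 - a\<^sup>2 * (3 - E - 2 / E))"
    unfolding id using assms by simp
  then show ?thesis by (simp add: algebra_simps)
qed

text \<open>The off-diagonal and diagonal summands of the time derivative of
  \<open>\<Sum>\<^bsub>x \<noteq> z\<^esub> d\<^sub>s(x,z) g(x) g(z) + 2 \<Sum>\<^sub>x g(x) w(x) \<rho>\<^sub>s(x)\<^sup>2\<close>, in which \<open>g\<close> and \<open>w\<close>
  run backwards in time.\<close>

definition off_diagonal_rate :: "int pmf \<Rightarrow> (int \<Rightarrow> real) \<Rightarrow> (int \<Rightarrow> real) \<Rightarrow> (int \<Rightarrow> int \<Rightarrow> real) \<Rightarrow> int \<Rightarrow> int \<Rightarrow> real" where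
  "off_diagonal_rate p g \<rho> d x z = (avg p (\<lambda>u. d u z) x + avg p (d x) z - 2 * d x z + 2 * pmf p (z - x) * d x z
    + pmf p (z - x) * (\<rho> x - \<rho> z)\<^sup>2) * (g x * g z)
    - d x z * ((avg p g x - g x) * g z + g x * (avg p g z - g z))"

definition diagonal_rate :: "int pmf \<Rightarrow> real \<Rightarrow> (int \<Rightarrow> real) \<Rightarrow> (int \<Rightarrow> real) \<Rightarrow> (int \<Rightarrow> real) \<Rightarrow> int \<Rightarrow> real" where
  "diagonal_rate p \<alpha> g \<rho> w x = 2 * (- ((avg p g x - g x) * w x * (\<rho> x)\<^sup>2) - g x * (3 * psi p \<alpha> * w x) * (\<rho> x)\<^sup>2
    + g x * w x * (2 * \<rho> x * (avg p \<rho> x - \<rho> x)))"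

lemma unit_diff_square:
  fixes x y :: real
  assumes "0 \<le> x" "x \<le> 1" "0 \<le> y" "y \<le> 1"
  shows "(x - y)\<^sup>2 \<le> 1"
proof -
  have "\<bar>x - y\<bar> \<le> 1" using assms by linarith
  then show ?thesis by (simp add: abs_square_le_1)
qed

section \<open>The derivative of the pair functional is nonpositive\<close>

context
  fixes p :: "int pmf" and \<theta> \<alpha> C :: real and g w :: "int \<Rightarrow> real"
  assumes p: "exp_moment p \<theta>" and \<alpha>: "0 < \<alpha>" "\<alpha> \<le> \<theta>"
    and g0: "\<And>x. 0 \<le> g x" and g1: "\<And>x. g x \<le> 1" and gw: "\<And>x. g x \<le> w x"
    and gs: "g summable_on UNIV" and gws: "(\<lambda>x. g x * w x) summable_on UNIV"
    and w: "\<And>x. w x = C * exp (\<alpha> * real_of_int x)" and C: "0 < C"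
begin

lemma J_sym: "pmf p (x - z) = pmf p (z - x)"
  using exp_momentD(1)[OF p] unfolding symm_def by (metis minus_diff_eq)

lemma \<alpha>_le: "\<bar>\<alpha>\<bar> \<le> \<theta>" using \<alpha> by simp

lemma w_pos: "0 < w x" using C by (simp add: w)

lemma J_sum: "((\<lambda>z. pmf p (z - x)) has_sum 1) UNIV"
  using avg_has_sum[of "\<lambda>_. 1" 1 p x] by (simp add: avg_def)

text \<open>The exponential weight is an eigenfunction of the average over jumps.\<close>

lemma Jw_sum: "((\<lambda>z. pmf p (z - x) * w z) has_sum w x * (1 + psi p \<alpha>)) UNIV"
proof -
  have "((\<lambda>i. w x * (pmf p i * exp (\<alpha> * real_of_int i))) has_sum w x * (1 + psi p \<alpha>)) UNIV"
    by (intro has_sum_cmult_right psi_has_sum[OF p \<alpha>_le])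
  then show ?thesis
    by (rule has_sum_reindex_bij_witness[where i = "\<lambda>z. z - x" and j = "\<lambda>i. x + i", THEN iffD1, rotated -1])
       (auto simp: w exp_add algebra_simps)
qed

lemma Jgw_summable: "(\<lambda>(x, z). pmf p (z - x) * g x * w z) summable_on UNIV"
proof (rule summable_rows)
  fix x
  show "((\<lambda>z. case (x, z) of (x, z) \<Rightarrow> pmf p (z - x) * g x * w z) has_sum g x * w x * (1 + psi p \<alpha>)) UNIV"
    using has_sum_cmult_right[OF Jw_sum[of x], of "g x"] by (simp add: mult_ac)
next
  show "(\<lambda>x. g x * w x * (1 + psi p \<alpha>)) summable_on UNIV" by (intro summable_on_cmult_left gws)
next
  fix u show "0 \<le> (case u of (x, z) \<Rightarrow> pmf p (z - x) * g x * w z)"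
    using g0 w_pos by (auto split: prod.splits simp: less_imp_le)
qed

lemma Jg_summable: "h summable_on UNIV \<Longrightarrow> (\<And>x. 0 \<le> h x) \<Longrightarrow> (\<lambda>(x, z). pmf p (z - x) * h x) summable_on UNIV"
  by (rule summable_rows[where r = h]) (use has_sum_cmult_left[OF J_sum] in auto)

text \<open>Symmetry of \<open>p\<close> makes the average self-adjoint for counting measure.
  Absolute summability of the double series allows the rows and columns to be exchanged.\<close>

lemma avg_adjoint:
  assumes f: "\<And>x. \<bar>f x\<bar> \<le> 1"
  shows "\<exists>S. ((\<lambda>x. avg p f x * g x) has_sum S) UNIV \<and> ((\<lambda>x. f x * avg p g x) has_sum S) UNIV"
proof -
  let ?F = "\<lambda>(x, z). pmf p (z - x) * (f z * g x)"
  have s: "?F summable_on UNIV"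
  proof (rule summable_dominated[OF Jg_summable[OF gs g0]])
    fix u show "\<bar>?F u\<bar> \<le> (case u of (x, z) \<Rightarrow> pmf p (z - x) * g x)"
    proof (cases u)
      case (Pair x z)
      have "\<bar>f z\<bar> * g x \<le> 1 * g x" by (rule mult_right_mono[OF f g0])
      then show ?thesis using g0[of x] by (simp add: Pair abs_mult mult_left_mono)
    qed
  qed
  have g1': "\<bar>g x\<bar> \<le> 1" for x using g0[of x] g1[of x] by simp
  have "((\<lambda>x. avg p f x * g x) has_sum infsum ?F UNIV) UNIV"
    by (rule rows_has_sum[OF s]) (use has_sum_cmult_left[OF avg_has_sum[OF f]] in \<open>simp add: mult.assoc\<close>)
  moreover have "((\<lambda>x. f x * avg p g x) has_sum infsum (\<lambda>(x, z). ?F (z, x)) UNIV) UNIV"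
  proof (rule rows_has_sum[OF summable_swap[OF s]])
    fix x
    show "((\<lambda>z. case (x, z) of (x, z) \<Rightarrow> ?F (z, x)) has_sum f x * avg p g x) UNIV"
      using has_sum_cmult_right[OF avg_has_sum[where f = g and x = x and p = p, OF g1'], of "f x"] by (simp add: J_sym mult_ac)
  qed
  moreover have "infsum (\<lambda>(x, z). ?F (z, x)) UNIV = infsum ?F UNIV"
    by (rule infsumI) (use s has_sum_swap[of ?F] in simp)
  ultimately show ?thesis by auto
qed

lemma avg_g_bounds: "0 \<le> avg p g x" "avg p g x \<le> 1"
proof -
  have gb: "\<bar>g x\<bar> \<le> 1" for x using g0[of x] g1[of x] by simp
  from avg_has_sum[where f = g and x = x and p = p, OF gb] show "0 \<le> avg p g x"
    by (rule has_sum_nonneg) (use g0 in auto)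
  show "avg p g x \<le> 1"
    by (rule has_sum_mono[OF avg_has_sum[where f = g and x = x and p = p, OF gb] J_sum[of x]])
       (simp add: mult_left_le g1)
qed

lemma avg_g_summable: "avg p g summable_on UNIV" "(\<lambda>x. avg p g x * w x) summable_on UNIV"
proof -
  have g1': "\<bar>g x\<bar> \<le> 1" for x using g0[of x] g1[of x] by simp
  show "avg p g summable_on UNIV"
    using avg_adjoint[of "\<lambda>_. 1"] by (auto intro: has_sum_imp_summable)
  let ?F = "\<lambda>(x, z). pmf p (z - x) * g x * w z"
  have "((\<lambda>x. avg p g x * w x) has_sum infsum (\<lambda>(x, z). ?F (z, x)) UNIV) UNIV"
  proof (rule rows_has_sum[OF summable_swap[OF Jgw_summable]])
    fix x
    show "((\<lambda>z. case (x, z) of (x, z) \<Rightarrow> ?F (z, x)) has_sum avg p g x * w x) UNIV"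
      using has_sum_cmult_left[OF avg_has_sum[where f = g and x = x and p = p, OF g1'], of "w x"] by (simp add: J_sym)
  qed
  then show "(\<lambda>x. avg p g x * w x) summable_on UNIV" by (auto intro: has_sum_imp_summable)
qed

context
  fixes \<rho> :: "int \<Rightarrow> real" and d :: "int \<Rightarrow> int \<Rightarrow> real"
  assumes \<rho>0: "\<And>x. 0 \<le> \<rho> x" and \<rho>1: "\<And>x. \<rho> x \<le> 1"
    and d0: "\<And>x z. 0 \<le> d x z" and d1: "\<And>x z. d x z \<le> 1" and dd: "\<And>x. d x x = 0"
    and dsym: "\<And>x z. d x z = d z x"
begin

lemma \<rho>_diff: "(\<rho> x - \<rho> z)\<^sup>2 \<le> 1"
  by (rule unit_diff_square[OF \<rho>0 \<rho>1 \<rho>0 \<rho>1])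

text \<open>Energy of \<rho> with the weight \<open>w\<close> at one of the two sites. It links both
  parts of the functional: the diagonal part loses at least \<open>QJ\<close>, and the source of the
  pair gaps is at most \<open>QJ\<close>.\<close>

definition "QJ = infsum (\<lambda>(x, z). pmf p (z - x) * (\<rho> x - \<rho> z)\<^sup>2 * (g x * w z)) UNIV"

lemma QJ_summable: "(\<lambda>(x, z). pmf p (z - x) * (\<rho> x - \<rho> z)\<^sup>2 * (g x * w z)) summable_on UNIV"
proof (rule summable_dominated[OF Jgw_summable])
  fix u :: "int \<times> int"
  obtain x z where u: "u = (x, z)" by (rule prod.exhaust)
  have "(\<rho> x - \<rho> z)\<^sup>2 * (pmf p (z - x) * (g x * w z)) \<le> 1 * (pmf p (z - x) * (g x * w z))"
    using g0[of x] w_pos[of z] by (intro mult_right_mono \<rho>_diff) (auto simp: less_imp_le)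
  then show "\<bar>case u of (x, z) \<Rightarrow> pmf p (z - x) * (\<rho> x - \<rho> z)\<^sup>2 * (g x * w z)\<bar> \<le> (case u of (x, z) \<Rightarrow> pmf p (z - x) * g x * w z)"
    using g0[of x] w_pos[of z] by (simp add: u abs_mult less_imp_le mult_ac)
qed

text \<open>Moving the average from \<open>g\<close> to the other factors gives the row-wise form
  \<open>?U + ?B\<close>. By \<open>weighted_square_bound\<close> each row is at least half the
  energy minus \<open>3 * psi p \<alpha>\<close> times \<open>c\<close>, and the time derivative of
  \<open>w\<close> contributes precisely the term that cancels this loss.\<close>

lemma diagonal_rate_sum: "diagonal_rate p \<alpha> g \<rho> w summable_on UNIV" "infsum (diagonal_rate p \<alpha> g \<rho> w) UNIV \<le> - QJ"
proof -
  have \<rho>b: "\<bar>\<rho> x\<bar> \<le> 1" for x using \<rho>0[of x] \<rho>1[of x] by simp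
  have \<rho>2: "(\<rho> x)\<^sup>2 \<le> 1" "0 \<le> (\<rho> x)\<^sup>2" for x using \<rho>0[of x] \<rho>1[of x] by (auto simp: power_le_one)
  have g1': "\<bar>g x\<bar> \<le> 1" for x using g0[of x] g1[of x] by simp
  have a\<rho>: "\<bar>avg p \<rho> x\<bar> \<le> 1" for x unfolding avg_def by (rule pmf_abs_le) (rule \<rho>b)
  let ?U = "\<lambda>(x, z). pmf p (z - x) * g x * w z * (\<rho> z)\<^sup>2"
  let ?B = "\<lambda>(x, z). pmf p (z - x) * (g x * w x * ((\<rho> x)\<^sup>2 - 2 * \<rho> x * \<rho> z))"
  have Us: "?U summable_on UNIV"
  proof (rule summable_dominated[OF Jgw_summable])
    fix u :: "int \<times> int"
    obtain x z where u: "u = (x, z)" by (rule prod.exhaust)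
    have "pmf p (z - x) * g x * w z * (\<rho> z)\<^sup>2 \<le> pmf p (z - x) * g x * w z * 1"
      using g0[of x] w_pos[of z] by (intro mult_left_mono \<rho>2) (auto simp: less_imp_le)
    then show "\<bar>?U u\<bar> \<le> (case u of (x, z) \<Rightarrow> pmf p (z - x) * g x * w z)"
      using g0[of x] w_pos[of z] by (simp add: u abs_mult less_imp_le)
  qed
  have gws0: "0 \<le> g x * w x" for x using g0[of x] w_pos[of x] by simp
  have br: "\<bar>(\<rho> x)\<^sup>2 - 2 * \<rho> x * y\<bar> \<le> 3" if "\<bar>y\<bar> \<le> 1" for x y
  proof -
    have "\<bar>\<rho> x * y\<bar> \<le> 1" using mult_mono[of "\<bar>\<rho> x\<bar>" 1 "\<bar>y\<bar>" 1] \<rho>b[of x] that by (simp add: abs_mult)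
    then show ?thesis using \<rho>2[of x] unfolding mult.assoc by linarith
  qed
  have Bs: "?B summable_on UNIV"
  proof (rule summable_dominated[OF summable_on_cmult_left[OF Jg_summable[OF gws gws0], of 3]])
    fix u :: "int \<times> int"
    obtain x z where u: "u = (x, z)" by (rule prod.exhaust)
    have "pmf p (z - x) * (g x * w x) * \<bar>(\<rho> x)\<^sup>2 - 2 * \<rho> x * \<rho> z\<bar> \<le> pmf p (z - x) * (g x * w x) * 3"
      using gws0[of x] by (intro mult_left_mono br \<rho>b) auto
    then show "\<bar>?B u\<bar> \<le> (case u of (x, z) \<Rightarrow> pmf p (z - x) * (g x * w x)) * 3"
      using gws0[of x] g0[of x] w_pos[of x] by (simp add: u abs_mult less_imp_le mult_ac)
  qed
  define a where "a x = avg p g x * w x * (\<rho> x)\<^sup>2" for x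
  define b where "b x = g x * w x * ((\<rho> x)\<^sup>2 - 2 * \<rho> x * avg p \<rho> x)" for x
  define c where "c x = g x * w x * (\<rho> x)\<^sup>2" for x
  have aU: "(a has_sum infsum ?U UNIV) UNIV"
  proof -
    have "(a has_sum infsum (\<lambda>(x, z). ?U (z, x)) UNIV) UNIV"
    proof (rule rows_has_sum[OF summable_swap[OF Us]])
      fix x
      show "((\<lambda>z. case (x, z) of (x, z) \<Rightarrow> ?U (z, x)) has_sum a x) UNIV"
        using has_sum_cmult_left[OF avg_has_sum[where f = g and x = x and p = p, OF g1'], of "w x * (\<rho> x)\<^sup>2"] by (simp add: a_def J_sym mult_ac)
    qed
    moreover have "infsum (\<lambda>(x, z). ?U (z, x)) UNIV = infsum ?U UNIV"
      by (rule infsumI) (use Us has_sum_swap[of ?U] in simp)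
    ultimately show ?thesis by simp
  qed
  have bB: "(b has_sum infsum ?B UNIV) UNIV"
  proof (rule rows_has_sum[OF Bs])
    fix x
    have "((\<lambda>z. g x * w x * (\<rho> x)\<^sup>2 * pmf p (z - x) + (- 2 * g x * w x * \<rho> x) * (pmf p (z - x) * \<rho> z)) has_sum
        g x * w x * (\<rho> x)\<^sup>2 * 1 + (- 2 * g x * w x * \<rho> x) * avg p \<rho> x) UNIV"
      by (intro has_sum_add has_sum_cmult_right J_sum avg_has_sum[OF \<rho>b])
    then show "((\<lambda>z. ?B (x, z)) has_sum b x) UNIV" by (simp add: b_def algebra_simps)
  qed
  have cs: "c summable_on UNIV"
  proof (rule summable_dominated[OF gws])
    fix x show "\<bar>c x\<bar> \<le> g x * w x"
      using mult_left_mono[OF \<rho>2(1)[of x] gws0[of x]] g0[of x] w_pos[of x] by (simp add: c_def abs_mult less_imp_le)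
  qed
  have dia: "diagonal_rate p \<alpha> g \<rho> w = (\<lambda>x. - 2 * a x + - 2 * b x + (- 6 * psi p \<alpha>) * c x)"
    by (auto simp: diagonal_rate_def a_def b_def c_def algebra_simps power2_eq_square)
  have dsum: "(diagonal_rate p \<alpha> g \<rho> w has_sum - 2 * infsum ?U UNIV + - 2 * infsum ?B UNIV + (- 6 * psi p \<alpha>) * infsum c UNIV) UNIV"
    unfolding dia by (intro has_sum_add has_sum_cmult_right aU bB has_sum_infsum cs)
  then show "diagonal_rate p \<alpha> g \<rho> w summable_on UNIV" by (rule has_sum_imp_summable)
  let ?Q = "\<lambda>(x, z). pmf p (z - x) * (\<rho> x - \<rho> z)\<^sup>2 * (g x * w z)"
  let ?H = "\<lambda>(x, z). ?U (x, z) + ?B (x, z) + (- 1 / 2) * ?Q (x, z)"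
  have QQ: "(?Q has_sum QJ) UNIV" unfolding QJ_def using QJ_summable by simp
  have "((\<lambda>u. ?U u + ?B u + (- 1 / 2) * ?Q u) has_sum infsum ?U UNIV + infsum ?B UNIV + (- 1 / 2) * QJ) UNIV"
    by (intro has_sum_add has_sum_cmult_right has_sum_infsum Us Bs QQ)
  moreover have "(\<lambda>u. ?U u + ?B u + (- 1 / 2) * ?Q u) = ?H" by auto
  ultimately have H: "(?H has_sum infsum ?U UNIV + infsum ?B UNIV + (- 1 / 2) * QJ) UNIV" by simp
  have Hs: "?H summable_on UNIV" by (rule has_sum_imp_summable[OF H])
  have Hrow: "(\<lambda>z. ?H (x, z)) summable_on UNIV" for x
    by (rule summable_on_SigmaD1[where f = "\<lambda>x z. ?H (x, z)" and A = UNIV and B = "\<lambda>_. UNIV"])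
       (use Hs in \<open>simp_all add: case_prod_unfold\<close>)
  define r where "r x = infsum (\<lambda>z. ?H (x, z)) UNIV" for x
  have rr: "((\<lambda>z. ?H (x, z)) has_sum r x) UNIV" for x unfolding r_def by (rule has_sum_infsum[OF Hrow])
  have rH: "(r has_sum infsum ?H UNIV) UNIV" by (rule rows_has_sum[OF Hs rr])
  \<comment> \<open>Row \<open>x\<close> is compared termwise with \<open>c x\<close> times
    \<open>3 - E - 2 / E\<close>; the means of \<open>E\<close> and \<open>1 / E\<close> are both
    \<open>1 + psi p \<alpha>\<close>.\<close>
  have rge: "(- 3 * psi p \<alpha>) * c x \<le> r x" for x
  proof -
    have e1: "((\<lambda>z. pmf p (z - x) * exp (\<alpha> * real_of_int (z - x))) has_sum (1 + psi p \<alpha>)) UNIV"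
      by (rule has_sum_reindex_bij_witness[where i = "\<lambda>z. z - x" and j = "\<lambda>i. x + i", THEN iffD1, OF _ _ _ _ _ _ psi_has_sum[OF p \<alpha>_le]]) auto
    have e2: "((\<lambda>z. pmf p (z - x) * exp (- (\<alpha> * real_of_int (z - x)))) has_sum (1 + psi p \<alpha>)) UNIV"
      by (rule has_sum_reindex_bij_witness[where i = "\<lambda>z. z - x" and j = "\<lambda>i. x + i", THEN iffD1, OF _ _ _ _ _ _ psi_uminus_has_sum[OF p \<alpha>_le]]) auto
    have "((\<lambda>z. c x * (3 * pmf p (z - x) + (- 1) * (pmf p (z - x) * exp (\<alpha> * real_of_int (z - x)))
         + (- 2) * (pmf p (z - x) * exp (- (\<alpha> * real_of_int (z - x)))))) has_sum
         c x * (3 * 1 + (- 1) * (1 + psi p \<alpha>) + (- 2) * (1 + psi p \<alpha>))) UNIV"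
      by (intro has_sum_add has_sum_cmult_right J_sum e1 e2)
    then have "c x * (3 * 1 + (- 1) * (1 + psi p \<alpha>) + (- 2) * (1 + psi p \<alpha>)) \<le> r x"
    proof (rule has_sum_mono[OF _ rr])
      fix z
      define E where "E = exp (\<alpha> * real_of_int (z - x))"
      have wz: "w z = w x * E" by (simp add: w E_def exp_add[symmetric] algebra_simps)
      have "w x * (\<rho> x)\<^sup>2 * (3 - E - 2 / E) \<le> w x * E * (\<rho> z)\<^sup>2 + w x * (\<rho> x)\<^sup>2 - 2 * w x * \<rho> x * \<rho> z - w x * E * (\<rho> x - \<rho> z)\<^sup>2 / 2"
        by (rule weighted_square_bound) (use w_pos in \<open>auto simp: E_def\<close>)
      from mult_left_mono[OF this, of "pmf p (z - x) * g x"] g0[of x]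
      have "pmf p (z - x) * g x * (w x * (\<rho> x)\<^sup>2 * (3 - E - 2 / E)) \<le> ?H (x, z)"
        unfolding prod.case wz by (simp add: algebra_simps)
      moreover have "exp (- (\<alpha> * real_of_int (z - x))) = 1 / E" by (simp add: E_def exp_minus inverse_eq_divide)
      ultimately show "c x * (3 * pmf p (z - x) + (- 1) * (pmf p (z - x) * exp (\<alpha> * real_of_int (z - x)))
         + (- 2) * (pmf p (z - x) * exp (- (\<alpha> * real_of_int (z - x))))) \<le> ?H (x, z)"
        unfolding c_def E_def[symmetric] by (simp add: algebra_simps)
    qed
    then show ?thesis by (simp add: algebra_simps)
  qed
  have "(- 3 * psi p \<alpha>) * infsum c UNIV \<le> infsum ?H UNIV"
    by (rule has_sum_mono[OF has_sum_cmult_right[OF has_sum_infsum[OF cs]] rH]) (rule rge)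
  then have "(- 3 * psi p \<alpha>) * infsum c UNIV \<le> infsum ?U UNIV + infsum ?B UNIV - QJ / 2"
    using infsumI[OF H] by simp
  then show "infsum (diagonal_rate p \<alpha> g \<rho> w) UNIV \<le> - QJ"
    using infsumI[OF dsum] by simp
qed

lemma avg_d_bounds: "0 \<le> avg p (d x) z" "avg p (d x) z \<le> 1"
proof -
  have b: "\<bar>d x z\<bar> \<le> 1" for z using d0[of x z] d1[of x z] by simp
  show "0 \<le> avg p (d x) z" by (rule has_sum_nonneg[OF avg_has_sum[OF b]]) (use d0 in auto)
  show "avg p (d x) z \<le> 1"
    by (rule has_sum_mono[OF avg_has_sum[OF b] J_sum[of z]]) (simp add: mult_left_le d1)
qed

lemma avg_d_sym: "avg p (\<lambda>u. d u z) x = avg p (d z) x"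
  by (rule arg_cong[where f = "\<lambda>f. avg p f x"]) (auto simp: dsym)

text \<open>The transport terms \<open>?T\<close> and their transpose cancel by self-adjointness.
  The interaction term \<open>2 * p * d * g * g\<close> is absorbed by the diagonal of
  \<open>?T\<close> through the inequality between the product and the squares of \<open>g\<close>.
  The source is at most \<open>QJ\<close> because \<open>g \<le> w\<close>, and the diagonal part
  supplies \<open>- QJ\<close>.\<close>

lemma functional_derivative_nonpos:
  "infsum (\<lambda>(x, z). if x = z then diagonal_rate p \<alpha> g \<rho> w x else off_diagonal_rate p g \<rho> d x z) UNIV \<le> 0"
proof -
  let ?T = "\<lambda>(x, z). avg p (d z) x * (g x * g z) - d x z * (avg p g x * g z)"
  let ?V = "\<lambda>(x, z). pmf p (z - x) * (2 * d x z + (\<rho> x - \<rho> z)\<^sup>2) * (g x * g z)"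
  let ?W = "\<lambda>(x, z). pmf p (z - x) * d x z * (g x)\<^sup>2"
  have db: "\<bar>d x z\<bar> \<le> 1" for x z using d0[of x z] d1[of x z] by simp
  have Ts: "?T summable_on UNIV"
  proof (rule summable_dominated)
    show "(\<lambda>u. (case u of (x, z) \<Rightarrow> g x * g z) + (case u of (x, z) \<Rightarrow> avg p g x * g z)) summable_on UNIV"
      by (intro summable_on_add summable_product gs avg_g_summable g0 avg_g_bounds)
    fix u :: "int \<times> int"
    obtain x z where u: "u = (x, z)" by (rule prod.exhaust)
    have "avg p (d z) x * (g x * g z) \<le> 1 * (g x * g z)" "d x z * (avg p g x * g z) \<le> 1 * (avg p g x * g z)"
      by (intro mult_right_mono avg_d_bounds d1 mult_nonneg_nonneg g0 avg_g_bounds)+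
    moreover have "0 \<le> avg p (d z) x * (g x * g z)" "0 \<le> d x z * (avg p g x * g z)"
      by (intro mult_nonneg_nonneg avg_d_bounds d0 g0 avg_g_bounds)+
    ultimately show "\<bar>?T u\<bar> \<le> (case u of (x, z) \<Rightarrow> g x * g z) + (case u of (x, z) \<Rightarrow> avg p g x * g z)"
      by (simp add: u)
  qed
  have T0: "(?T has_sum 0) UNIV"
  proof -
    have "((\<lambda>x. ?T (x, z)) has_sum 0) UNIV" for z
    proof -
      obtain S where "((\<lambda>x. avg p (d z) x * g x) has_sum S) UNIV" "((\<lambda>x. d z x * avg p g x) has_sum S) UNIV"
        using avg_adjoint[of "d z"] db by auto
      then have "((\<lambda>x. avg p (d z) x * g x * g z + (- g z) * (d z x * avg p g x)) has_sum S * g z + (- g z) * S) UNIV"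
        by (intro has_sum_add has_sum_cmult_left has_sum_cmult_right)
      then show ?thesis by (simp add: mult_ac dsym[of z])
    qed
    then have "((\<lambda>_. 0) has_sum infsum (\<lambda>(x, z). ?T (z, x)) UNIV) (UNIV :: int set)"
      by (intro rows_has_sum[OF summable_swap[OF Ts]]) simp
    then have "infsum (\<lambda>(x, z). ?T (z, x)) UNIV = 0" using has_sum_unique[OF _ has_sum_0_simp] by blast
    moreover have "infsum (\<lambda>(x, z). ?T (z, x)) UNIV = infsum ?T UNIV"
      by (rule infsumI) (use Ts has_sum_swap[of ?T] in simp)
    ultimately show ?thesis using has_sum_infsum[OF Ts] by simp
  qed
  have gg: "g x * g z \<le> g x" "0 \<le> g x * g z" for x z using g0 g1 by (auto simp: mult_left_le)
  have Vs: "?V summable_on UNIV"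
  proof (rule summable_dominated[OF summable_on_cmult_left[OF Jg_summable[OF gs g0], of 3]])
    fix u :: "int \<times> int"
    obtain x z where u: "u = (x, z)" by (rule prod.exhaust)
    have "(2 * d x z + (\<rho> x - \<rho> z)\<^sup>2) * (g x * g z) \<le> 3 * g x"
      by (rule mult_mono) (use gg[of x z] d1[of x z] d0[of x z] \<rho>_diff[of x z] in auto)
    then have "pmf p (z - x) * ((2 * d x z + (\<rho> x - \<rho> z)\<^sup>2) * (g x * g z)) \<le> pmf p (z - x) * (3 * g x)"
      by (rule mult_left_mono) simp
    moreover have "0 \<le> pmf p (z - x) * ((2 * d x z + (\<rho> x - \<rho> z)\<^sup>2) * (g x * g z))"
      using gg[of x z] d0[of x z] by simp
    ultimately show "\<bar>?V u\<bar> \<le> (case u of (x, z) \<Rightarrow> pmf p (z - x) * g x) * 3"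
      by (simp add: u mult_ac)
  qed
  have Ws: "?W summable_on UNIV"
  proof (rule summable_dominated[OF Jg_summable[OF gs g0]])
    fix u :: "int \<times> int"
    obtain x z where u: "u = (x, z)" by (rule prod.exhaust)
    have "d x z * (g x)\<^sup>2 \<le> 1 * g x"
      by (rule mult_mono) (use gg[of x x] d1 g0 in \<open>auto simp: power2_eq_square\<close>)
    then have "pmf p (z - x) * (d x z * (g x)\<^sup>2) \<le> pmf p (z - x) * (1 * g x)" by (rule mult_left_mono) simp
    then show "\<bar>?W u\<bar> \<le> (case u of (x, z) \<Rightarrow> pmf p (z - x) * g x)"
      using d0[of x z] by (simp add: u mult_ac)
  qed
  have Wrow: "((\<lambda>x. avg p (d x) x * (g x)\<^sup>2) has_sum infsum ?W UNIV) UNIV"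
    by (rule rows_has_sum[OF Ws]) (use has_sum_cmult_left[OF avg_has_sum[OF db]] in simp)
  have W2: "((\<lambda>(x, z). ?W (z, x)) has_sum infsum ?W UNIV) UNIV"
    using has_sum_swap[of ?W] has_sum_infsum[OF Ws] by simp
  have T2: "((\<lambda>(x, z). ?T (z, x)) has_sum 0) UNIV" using T0 has_sum_swap[of ?T] by simp
  \<comment> \<open>The cancelling sum runs over all pairs, but the functional has no gap term on
    the diagonal. Removing the diagonal values of \<open>?T\<close> and its transpose subtracts
    \<open>?W\<close> twice, and this is what absorbs the interaction.\<close>
  let ?e = "\<lambda>x. diagonal_rate p \<alpha> g \<rho> w x + (- 2) * (avg p (d x) x * (g x)\<^sup>2)"
  have e: "(?e has_sum infsum (diagonal_rate p \<alpha> g \<rho> w) UNIV + (- 2) * infsum ?W UNIV) UNIV"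
    by (intro has_sum_add has_sum_cmult_right Wrow has_sum_infsum diagonal_rate_sum)
  have tot: "((\<lambda>u. ?T u + (\<lambda>(x, z). ?T (z, x)) u + ?V u + (\<lambda>(x, z). if x = z then ?e x else 0) u) has_sum
      0 + 0 + infsum ?V UNIV + (infsum (diagonal_rate p \<alpha> g \<rho> w) UNIV + (- 2) * infsum ?W UNIV)) UNIV"
    by (intro has_sum_add T0 T2 has_sum_infsum[OF Vs] has_sum_diagonal[OF e])
  have "(\<lambda>u. ?T u + (\<lambda>(x, z). ?T (z, x)) u + ?V u + (\<lambda>(x, z). if x = z then ?e x else 0) u)
      = (\<lambda>(x, z). if x = z then diagonal_rate p \<alpha> g \<rho> w x else off_diagonal_rate p g \<rho> d x z)"
  proof
    fix u :: "int \<times> int"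
    obtain x z where u: "u = (x, z)" by (rule prod.exhaust)
    show "?T u + (\<lambda>(x, z). ?T (z, x)) u + ?V u + (\<lambda>(x, z). if x = z then ?e x else 0) u
      = (\<lambda>(x, z). if x = z then diagonal_rate p \<alpha> g \<rho> w x else off_diagonal_rate p g \<rho> d x z) u"
    proof (cases "x = z")
      case True
      then show ?thesis by (simp add: u dd power2_eq_square)
    next
      case False
      then show ?thesis using dsym[of z x] by (simp add: u off_diagonal_rate_def avg_d_sym algebra_simps)
    qed
  qed
  with tot have total: "((\<lambda>(x, z). if x = z then diagonal_rate p \<alpha> g \<rho> w x else off_diagonal_rate p g \<rho> d x z) has_sum
      infsum ?V UNIV + infsum (diagonal_rate p \<alpha> g \<rho> w) UNIV - 2 * infsum ?W UNIV) UNIV" by (simp add: add_diff_eq)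
  let ?Q = "\<lambda>(x, z). pmf p (z - x) * (\<rho> x - \<rho> z)\<^sup>2 * (g x * w z)"
  have "infsum ?V UNIV + (- 1) * infsum ?W UNIV + (- 1) * infsum ?W UNIV \<le> QJ"
  proof (rule has_sum_mono)
    show "((\<lambda>u. ?V u + (- 1) * ?W u + (- 1) * (\<lambda>(x, z). ?W (z, x)) u) has_sum
       infsum ?V UNIV + (- 1) * infsum ?W UNIV + (- 1) * infsum ?W UNIV) UNIV"
      by (intro has_sum_add has_sum_cmult_right has_sum_infsum[OF Vs] has_sum_infsum[OF Ws] W2)
    show "(?Q has_sum QJ) UNIV" unfolding QJ_def using QJ_summable by simp
    fix u :: "int \<times> int"
    obtain x z where u: "u = (x, z)" by (rule prod.exhaust)
    have "2 * d x z * (g x * g z) \<le> d x z * (g x)\<^sup>2 + d x z * (g z)\<^sup>2"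
      using mult_left_mono[OF sum_squares_bound[of "g x" "g z"] d0[of x z]] by (simp add: algebra_simps)
    moreover have "(\<rho> x - \<rho> z)\<^sup>2 * (g x * g z) \<le> (\<rho> x - \<rho> z)\<^sup>2 * (g x * w z)"
      by (intro mult_left_mono gw g0) auto
    ultimately have "pmf p (z - x) * ((2 * d x z + (\<rho> x - \<rho> z)\<^sup>2) * (g x * g z)) \<le>
        pmf p (z - x) * (d x z * (g x)\<^sup>2 + d x z * (g z)\<^sup>2 + (\<rho> x - \<rho> z)\<^sup>2 * (g x * w z))"
      by (intro mult_left_mono) (auto simp: algebra_simps)
    then show "?V u + (- 1) * ?W u + (- 1) * (\<lambda>(x, z). ?W (z, x)) u \<le> ?Q u"
      by (simp add: u J_sym[of x z] dsym[of z x] algebra_simps)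
  qed
  then show ?thesis using infsumI[OF total] diagonal_rate_sum(2) by simp
qed

end

end

text \<open>The constants are explicit and \<open>A\<close> enters through its left edge and its
  mean number of particles, so the bound does not deteriorate as \<open>A\<close> grows.\<close>

lemma pair_sum_bound:
  fixes d :: "real \<Rightarrow> int \<Rightarrow> int \<Rightarrow> real" and Y :: real
  assumes p: "exp_moment p \<theta>" and \<alpha>: "0 < \<alpha>" "\<alpha> \<le> \<theta>" and t: "0 \<le> t"
    and A: "finite A" "\<And>a. a \<in> A \<Longrightarrow> Y \<le> real_of_int a"
    and B: "finite B" "\<And>k. k \<in> B \<Longrightarrow> k \<le> 0" and c: "\<And>k. 0 \<le> c k \<and> c k \<le> 1"
    and d01: "\<And>s x z. 0 \<le> s \<Longrightarrow> 0 \<le> d s x z \<and> d s x z \<le> 1"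
    and dd: "\<And>s x. d s x x = 0" and dsym: "\<And>s x z. d s x z = d s z x" and di: "\<And>x z. d 0 x z = 0"
    and dder: "\<And>s x z. 0 \<le> s \<Longrightarrow> x \<noteq> z \<Longrightarrow> ((\<lambda>s. d s x z) has_real_derivative
        avg p (\<lambda>u. d s u z) x + avg p (d s x) z - 2 * d s x z + 2 * pmf p (z - x) * d s x z
        + pmf p (z - x) * (occupation p B c s x - occupation p B c s z)\<^sup>2) (at s within {0..})"
  shows "(\<Sum>x\<in>A. \<Sum>z\<in>A. d t x z) \<le> 2 * exp (3 * psi p \<alpha> * t - \<alpha> * Y) * (\<Sum>x\<in>A. occupation p B c t x)"
proof -
  define \<rho> where "\<rho> = occupation p B c"
  define g where "g = occupation p A (\<lambda>_. 1)"
  define C where "C s = exp (3 * psi p \<alpha> * s - \<alpha> * Y)" for s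
  define w where "w s x = C s * exp (\<alpha> * real_of_int x)" for s and x :: int
  \<comment> \<open>Time runs backwards in \<open>g\<close> and \<open>w\<close>. At
    \<open>s = t\<close> the factor \<open>g 0\<close> is \<open>1\<close> on \<open>A\<close> and
    the off-diagonal part contains the desired sum; at \<open>s = 0\<close> the pair gaps vanish and
    the diagonal remains. The factor \<open>2\<close> makes the dissipation match the source, which
    occurs for both orders of a pair.\<close>
  define \<phi> where "\<phi> = (\<lambda>(x, z) s. if x = z then 2 * (g (t - s) x * w (t - s) x * (\<rho> s x)\<^sup>2)
      else d s x z * (g (t - s) x * g (t - s) z))"
  define \<phi>' where "\<phi>' = (\<lambda>(x, z) s. if x = z then diagonal_rate p \<alpha> (g (t - s)) (\<rho> s) (w (t - s)) x
      else off_diagonal_rate p (g (t - s)) (\<rho> s) (d s) x z)"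
  have c1: "0 \<le> (1::real) \<and> (1::real) \<le> 1" by simp
  have \<alpha>': "\<bar>\<alpha>\<bar> \<le> \<theta>" using \<alpha> by simp
  have \<psi>: "0 \<le> psi p \<alpha>" by (rule psi_nonneg[OF p \<alpha>'])
  have \<rho>b: "0 \<le> \<rho> s x" "\<rho> s x \<le> 1" if "0 \<le> s" for s x
    using occupation_nonneg[OF p B(1) c that] occupation_le_1[OF p B(1) c that] by (auto simp: \<rho>_def)
  have gb: "0 \<le> g s x" "g s x \<le> 1" if "0 \<le> s" for s x
    using occupation_nonneg[OF p A(1) c1 that] occupation_le_1[OF p A(1) c1 that] by (auto simp: g_def)
  have Cpos: "0 < C s" for s by (simp add: C_def)
  have wpos: "0 < w s x" for s x using Cpos by (simp add: w_def)
  \<comment> \<open>Chebyshev's bound gives the exponent with a single \<open>psi\<close>; as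
    \<open>psi\<close> is nonnegative, the rate \<open>3 * psi p \<alpha>\<close> demanded by
    \<open>diagonal_rate_sum\<close> keeps \<open>w\<close> above \<open>g\<close>.\<close>
  have gw: "g s x \<le> w s x" if s: "0 \<le> s" for s x
  proof -
    have "g s x \<le> exp (\<alpha> * (real_of_int x - Y) + s * psi p \<alpha>)"
      unfolding g_def by (rule occupation_le_exp[OF p A(1) c1 s \<alpha>']) (use A \<alpha> in auto)
    also have "\<dots> \<le> exp (\<alpha> * (real_of_int x - Y) + 3 * psi p \<alpha> * s)" using s \<psi> by simp
    also have "\<dots> = w s x" by (simp add: w_def C_def exp_add[symmetric] algebra_simps)
    finally show ?thesis .
  qed
  have gs: "g s summable_on UNIV" if "0 \<le> s" for s
    using occupation_exp_summable[OF p A(1) c1 that exp_moment_0[OF p]] by (simp add: g_def)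
  have gws: "(\<lambda>x. g s x * w r x) summable_on UNIV" if "0 \<le> s" for s r
    using summable_on_cmult_right[OF occupation_exp_summable[OF p A(1) c1 that \<alpha>'], of "C r"]
    by (simp add: g_def w_def mult_ac)
  have neg: "infsum (\<lambda>i. \<phi>' i s) UNIV \<le> 0" if s: "0 \<le> s" "s \<le> t" for s
  proof -
    have r: "0 \<le> t - s" using s by simp
    have "(\<lambda>i. \<phi>' i s) = (\<lambda>(x, z). if x = z then diagonal_rate p \<alpha> (g (t - s)) (\<rho> s) (w (t - s)) x
      else off_diagonal_rate p (g (t - s)) (\<rho> s) (d s) x z)" by (auto simp: \<phi>'_def)
    then show ?thesis
      using functional_derivative_nonpos[OF p \<alpha> gb[OF r] gw[OF r] gs[OF r] gws[OF r] w_def Cpos \<rho>b[OF s(1)], of "d s"]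
        d01[OF s(1)] dd dsym by simp
  qed
  have gder: "((\<lambda>s. g (t - s) x) has_real_derivative - (avg p (g (t - s)) x - g (t - s) x)) (at s within {0..})"
    if "s \<le> t" for s x
  proof -
    have "((\<lambda>r. g r x) has_real_derivative avg p (g (t - s)) x - g (t - s) x) (at (t - s))"
      unfolding g_def by (rule occupation_derivative[OF p A(1) c1]) (use that in simp)
    moreover have "((\<lambda>s. t - s) has_real_derivative - 1) (at s within {0..})"
      by (auto intro!: derivative_eq_intros)
    ultimately show ?thesis
      using DERIV_chain'[where f = "\<lambda>s. t - s" and g = "\<lambda>r. g r x" and x = s] by fastforce
  qed
  have \<rho>der: "((\<lambda>s. \<rho> s x) has_real_derivative avg p (\<rho> s) x - \<rho> s x) (at s within {0..})" if "0 \<le> s" for s x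
    unfolding \<rho>_def by (rule occupation_derivative[OF p B(1) c that])
  have \<rho>2der: "((\<lambda>s. (\<rho> s x)\<^sup>2) has_real_derivative 2 * (avg p (\<rho> s) x - \<rho> s x) * \<rho> s x) (at s within {0..})"
    if "0 \<le> s" for s x
    using DERIV_power[OF \<rho>der[OF that, of x], of 2] by (simp add: algebra_simps)
  have wder: "((\<lambda>s. w (t - s) x) has_real_derivative - (3 * psi p \<alpha> * w (t - s) x)) (at s within {0..})" for s x
    unfolding w_def C_def by (auto intro!: derivative_eq_intros simp: algebra_simps)
  have \<phi>der: "(\<phi> i has_real_derivative \<phi>' i s) (at s within {0..})" if s: "0 \<le> s" "s \<le> t" for i s
  proof -
    obtain x z where i: "i = (x, z)" by (rule prod.exhaust)
    show ?thesis
    proof (cases "x = z")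
      case True
      have "((\<lambda>s. 2 * (g (t - s) x * w (t - s) x * (\<rho> s x)\<^sup>2)) has_real_derivative
         2 * ((- (avg p (g (t - s)) x - g (t - s) x) * w (t - s) x + - (3 * psi p \<alpha> * w (t - s) x) * g (t - s) x) * (\<rho> s x)\<^sup>2
           + (2 * (avg p (\<rho> s) x - \<rho> s x) * \<rho> s x) * (g (t - s) x * w (t - s) x))) (at s within {0..})"
        by (intro DERIV_cmult DERIV_mult gder wder s \<rho>2der)
      then show ?thesis using True
        by (simp add: i \<phi>_def \<phi>'_def diagonal_rate_def algebra_simps)
    next
      case False
      have "((\<lambda>s. d s x z * (g (t - s) x * g (t - s) z)) has_real_derivative
         (avg p (\<lambda>u. d s u z) x + avg p (d s x) z - 2 * d s x z + 2 * pmf p (z - x) * d s x z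
        + pmf p (z - x) * (\<rho> s x - \<rho> s z)\<^sup>2) * (g (t - s) x * g (t - s) z) +
         (- (avg p (g (t - s)) x - g (t - s) x) * g (t - s) z + - (avg p (g (t - s)) z - g (t - s) z) * g (t - s) x) * d s x z) (at s within {0..})"
        unfolding \<rho>_def by (intro DERIV_mult gder s dder False)
      then show ?thesis using False by (simp add: i \<phi>_def \<phi>'_def off_diagonal_rate_def algebra_simps)
    qed
  qed
  \<comment> \<open>By \<open>heat_mono\<close> the value at time \<open>t\<close>, multiplied by
    \<open>exp t\<close>, bounds \<open>g\<close> and its average at all earlier times. This yields
    the time-independent summable bounds for the M-test.\<close>
  define G where "G x = exp t * g t x" for x
  define H where "H x = exp t * avg p (g t) x" for x
  have gG: "g r x \<le> G x" if "0 \<le> r" "r \<le> t" for r x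
    using occupation_mono[OF p A(1) c1 that] by (simp add: g_def G_def)
  have ga: "\<bar>g r x\<bar> \<le> 1" if "0 \<le> r" for r x using gb[OF that] by (simp add: abs_le_iff order.trans[of _ 0])
  have gH: "avg p (g r) x \<le> H x" "0 \<le> avg p (g r) x" if r: "0 \<le> r" "r \<le> t" for r x
  proof -
    show "avg p (g r) x \<le> H x"
      unfolding H_def
      by (rule has_sum_mono[OF avg_has_sum[where f = "g r", OF ga[OF r(1)]] has_sum_cmult_right[OF avg_has_sum[where f = "g t", OF ga[OF t]]]])
         (use mult_left_mono[OF gG[OF r] pmf_nonneg] in \<open>simp add: G_def mult.left_commute\<close>)
    show "0 \<le> avg p (g r) x"
      by (rule has_sum_nonneg[OF avg_has_sum[where f = "g r", OF ga[OF r(1)]]]) (use gb[OF r(1)] in auto)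
  qed
  have G0: "0 \<le> G x" for x using gb[OF t] by (simp add: G_def)
  have H0: "0 \<le> H x" for x using gH[OF t] by (rule order.trans[rotated]) auto
  have Gs: "G summable_on UNIV" unfolding G_def by (intro summable_on_cmult_right gs t)
  have GWs: "(\<lambda>x. G x * w t x) summable_on UNIV"
    using summable_on_cmult_right[OF gws[OF t, of t], of "exp t"] by (simp add: G_def mult_ac)
  note avs = avg_g_summable[OF p \<alpha> gb[OF t] gw[OF t] gs[OF t] gws[OF t] w_def Cpos]
  have Hs: "H summable_on UNIV" unfolding H_def by (intro summable_on_cmult_right avs(1))
  have HWs: "(\<lambda>x. H x * w t x) summable_on UNIV"
    using summable_on_cmult_right[OF avs(2), of "exp t"] by (simp add: H_def mult_ac)
  have wle: "w r x \<le> w t x" if "r \<le> t" for r x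
    using that \<psi> by (simp add: w_def C_def mult_left_mono)
  \<comment> \<open>The numbers are crude: 7 bounds the bracket in \<open>off_diagonal_rate\<close>,
    and 2 comes from the loss terms in the derivative of \<open>g\<close>.\<close>
  define Mo where "Mo = (\<lambda>(x, z). 9 * (G x * G z) + (H x * G z + G x * H z))"
  define Md where "Md x = 2 * (H x * w t x) + (10 + 6 * psi p \<alpha>) * (G x * w t x)" for x
  have Mos: "Mo summable_on UNIV"
  proof -
    have "(\<lambda>u. 9 * (\<lambda>(x, z). G x * G z) u + ((\<lambda>(x, z). H x * G z) u + (\<lambda>(x, z). G x * H z) u)) summable_on UNIV"
      by (intro summable_on_add summable_on_cmult_right summable_product Gs Hs G0 H0)
    also have "(\<lambda>u. 9 * (\<lambda>(x, z). G x * G z) u + ((\<lambda>(x, z). H x * G z) u + (\<lambda>(x, z). G x * H z) u)) = Mo"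
      by (auto simp: Mo_def)
    finally show ?thesis .
  qed
  have Mds: "Md summable_on UNIV" unfolding Md_def
    by (intro summable_on_add summable_on_cmult_right GWs HWs)
  define M where "M = (\<lambda>u. Mo u + (\<lambda>(x, z). if x = z then Md x else 0) u)"
  have Ms: "M summable_on UNIV" unfolding M_def
    by (intro summable_on_add Mos has_sum_imp_summable[OF has_sum_diagonal[OF has_sum_infsum[OF Mds]]])
  have Mo0: "0 \<le> Mo u" for u using G0 H0 by (auto simp: Mo_def split: prod.splits)
  have Md0: "0 \<le> Md x" for x using G0[of x] H0[of x] wpos[of t x] \<psi> by (simp add: Md_def)
  have offb: "\<bar>off_diagonal_rate p (g r) (\<rho> s) (d s) x z\<bar> \<le> Mo (x, z)" if s: "0 \<le> s" and r: "0 \<le> r" "r \<le> t" for r s x z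
  proof -
    have db: "\<bar>d s x z\<bar> \<le> 1" for x z using d01[OF s, of x z] by simp
    have a1: "\<bar>avg p (\<lambda>u. d s u z) x\<bar> \<le> 1" "\<bar>avg p (d s x) z\<bar> \<le> 1"
      unfolding avg_def by (rule pmf_abs_le, rule db)+
    have "pmf p (z - x) * d s x z \<le> 1 * 1" "0 \<le> pmf p (z - x) * d s x z"
      by (intro mult_mono) (use d01[OF s, of x z] pmf_le_1 in auto)
    moreover have "pmf p (z - x) * (\<rho> s x - \<rho> s z)\<^sup>2 \<le> 1 * 1"
      by (intro mult_mono unit_diff_square \<rho>b[OF s]) (auto simp: pmf_le_1)
    moreover have "0 \<le> pmf p (z - x) * (\<rho> s x - \<rho> s z)\<^sup>2" by simp
    ultimately have "\<bar>avg p (\<lambda>u. d s u z) x + avg p (d s x) z - 2 * d s x z + 2 * pmf p (z - x) * d s x z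
        + pmf p (z - x) * (\<rho> s x - \<rho> s z)\<^sup>2\<bar> \<le> 7"
      using a1 d01[OF s, of x z] unfolding abs_le_iff mult.assoc by linarith
    moreover have gg: "g r x * g r z \<le> G x * G z" "0 \<le> g r x * g r z"
      by (intro mult_mono gG r G0 gb mult_nonneg_nonneg)+
    ultimately have 1: "\<bar>(avg p (\<lambda>u. d s u z) x + avg p (d s x) z - 2 * d s x z + 2 * pmf p (z - x) * d s x z
        + pmf p (z - x) * (\<rho> s x - \<rho> s z)\<^sup>2) * (g r x * g r z)\<bar> \<le> 7 * (G x * G z)"
      unfolding abs_mult[of _ "g r x * g r z"] by (intro mult_mono) auto
    have x1: "avg p (g r) x * g r z \<le> H x * G z" "0 \<le> avg p (g r) x * g r z"
      "g r x * avg p (g r) z \<le> G x * H z" "0 \<le> g r x * avg p (g r) z"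
      by (intro mult_mono gG gH r G0 H0 gb mult_nonneg_nonneg)+
    have "\<bar>(avg p (g r) x - g r x) * g r z + g r x * (avg p (g r) z - g r z)\<bar> \<le> 2 * (G x * G z) + (H x * G z + G x * H z)"
      using x1 gg by (simp add: algebra_simps abs_le_iff)
    then have 2: "\<bar>d s x z * ((avg p (g r) x - g r x) * g r z + g r x * (avg p (g r) z - g r z))\<bar> \<le> 1 * (2 * (G x * G z) + (H x * G z + G x * H z))"
      unfolding abs_mult[of "d s x z"] using db by (intro mult_mono) auto
    show ?thesis unfolding off_diagonal_rate_def Mo_def prod.case
      by (rule order.trans[OF abs_triangle_ineq4 order.trans[OF add_mono[OF 1 2]]]) simp
  qed
  have diab: "\<bar>diagonal_rate p \<alpha> (g r) (\<rho> s) (w r) x\<bar> \<le> Md x" if s: "0 \<le> s" and r: "0 \<le> r" "r \<le> t" for r s x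
  proof -
    have r2: "(\<rho> s x)\<^sup>2 \<le> 1" "0 \<le> (\<rho> s x)\<^sup>2" using \<rho>b[OF s] by (auto simp: power_le_one)
    have HW: "avg p (g r) x * w r x \<le> H x * w t x" "0 \<le> avg p (g r) x * w r x"
      by (intro mult_mono gH r wle H0 mult_nonneg_nonneg less_imp_le[OF wpos])+
    have GW: "g r x * w r x \<le> G x * w t x" "0 \<le> g r x * w r x"
      by (intro mult_mono gG gb r wle G0 mult_nonneg_nonneg less_imp_le[OF wpos])+
    have e1: "avg p (g r) x * w r x * (\<rho> s x)\<^sup>2 \<le> H x * w t x * 1" "0 \<le> avg p (g r) x * w r x * (\<rho> s x)\<^sup>2"
      by (intro mult_mono mult_nonneg_nonneg HW r2 less_imp_le[OF wpos] H0 gH r zero_le_one)+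
    have e2: "g r x * w r x * (\<rho> s x)\<^sup>2 \<le> G x * w t x * 1" "0 \<le> g r x * w r x * (\<rho> s x)\<^sup>2"
      by (intro mult_mono mult_nonneg_nonneg GW r2 less_imp_le[OF wpos] G0 gb r zero_le_one)+
    have "\<bar>avg p (\<rho> s) x\<bar> \<le> 1" unfolding avg_def
      by (rule pmf_abs_le) (use \<rho>b[OF s] in \<open>simp add: abs_le_iff order.trans[of _ 0]\<close>)
    then have "\<bar>\<rho> s x * (avg p (\<rho> s) x - \<rho> s x)\<bar> \<le> 1 * 2"
      unfolding abs_mult using \<rho>b[OF s, of x] by (intro mult_mono) (auto simp: abs_le_iff)
    then have e3: "\<bar>g r x * w r x * (\<rho> s x * (avg p (\<rho> s) x - \<rho> s x))\<bar> \<le> G x * w t x * 2"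
      unfolding abs_mult[of "g r x * w r x"] using GW G0 wpos[of t x] by (intro mult_mono) (auto simp: less_imp_le)
    have e4: "psi p \<alpha> * (g r x * w r x * (\<rho> s x)\<^sup>2) \<le> psi p \<alpha> * (G x * w t x)" "0 \<le> psi p \<alpha> * (g r x * w r x * (\<rho> s x)\<^sup>2)"
      using e2 \<psi> by (auto intro: mult_left_mono)
    have "diagonal_rate p \<alpha> (g r) (\<rho> s) (w r) x = - 2 * (avg p (g r) x * w r x * (\<rho> s x)\<^sup>2) + 2 * (g r x * w r x * (\<rho> s x)\<^sup>2)
       - 6 * (psi p \<alpha> * (g r x * w r x * (\<rho> s x)\<^sup>2)) + 4 * (g r x * w r x * (\<rho> s x * (avg p (\<rho> s) x - \<rho> s x)))"
      by (simp add: diagonal_rate_def algebra_simps)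
    moreover have "Md x = 2 * (H x * w t x) + 10 * (G x * w t x) + 6 * (psi p \<alpha> * (G x * w t x))"
      by (simp add: Md_def algebra_simps)
    ultimately show ?thesis using e1 e2 e3 e4 unfolding abs_le_iff by linarith
  qed
  have \<phi>'M: "\<bar>\<phi>' i s\<bar> \<le> M i" if s: "0 \<le> s" "s \<le> t" for i s
  proof -
    obtain x z where i: "i = (x, z)" by (rule prod.exhaust)
    have r: "0 \<le> t - s" "t - s \<le> t" using s by auto
    show ?thesis using offb[OF s(1) r, of x z] diab[OF s(1) r, of x] Mo0[of "(x, z)"]
      by (auto simp: i \<phi>'_def M_def)
  qed
  have \<phi>s: "(\<lambda>i. \<phi> i s) summable_on UNIV" if s: "0 \<le> s" "s \<le> t" for s
  proof (rule summable_dominated[OF summable_on_add[OF summable_product[OF Gs Gs G0 G0] has_sum_imp_summable[OF has_sum_diagonal[OF has_sum_infsum[OF summable_on_cmult_right[OF GWs, of 2]]]]]])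
    fix i :: "int \<times> int"
    obtain x z where i: "i = (x, z)" by (rule prod.exhaust)
    have r: "0 \<le> t - s" "t - s \<le> t" using s by auto
    have "d s x z * (g (t - s) x * g (t - s) z) \<le> 1 * (G x * G z)" "0 \<le> d s x z * (g (t - s) x * g (t - s) z)"
      using d01[OF s(1), of x z] by (intro mult_mono mult_nonneg_nonneg gG r gb G0; simp)+
    moreover have "g (t - s) x * w (t - s) x * (\<rho> s x)\<^sup>2 \<le> G x * w t x * 1" "0 \<le> g (t - s) x * w (t - s) x * (\<rho> s x)\<^sup>2"
      by (intro mult_mono mult_nonneg_nonneg gG r gb G0 wle less_imp_le[OF wpos] power_le_one \<rho>b s zero_le_one zero_le_power2)+
    moreover have "0 \<le> G x * G z" using G0 by simp
    ultimately show "\<bar>\<phi> i s\<bar> \<le> (\<lambda>(x, z). G x * G z) i + (\<lambda>(x, z). if x = z then 2 * (G x * w t x) else 0) i"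
      by (auto simp: i \<phi>_def)
  qed
  have main: "infsum (\<lambda>i. \<phi> i t) UNIV \<le> infsum (\<lambda>i. \<phi> i 0) UNIV"
    by (rule sum_nonincreasing[OF t \<phi>der \<phi>'M Ms neg \<phi>s \<phi>s]) (use t in auto)
  have \<phi>0: "0 \<le> \<phi> i t" for i
    using d01[OF t] gb[of 0] wpos by (auto simp: \<phi>_def less_imp_le split: prod.splits)
  have "(\<Sum>x\<in>A. \<Sum>z\<in>A. d t x z) = (\<Sum>(x, z)\<in>A \<times> A. d t x z)"
    by (rule sum.cartesian_product)
  also have "\<dots> \<le> (\<Sum>i\<in>A \<times> A. \<phi> i t)"
  proof (rule sum_mono)
    fix i assume "i \<in> A \<times> A"
    then obtain x z where i: "i = (x, z)" "x \<in> A" "z \<in> A" by auto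
    have "g 0 x = 1" "g 0 z = 1" using occupation_0[OF p A(1) c1] i by (auto simp: g_def)
    then show "(case i of (x, z) \<Rightarrow> d t x z) \<le> \<phi> i t"
      using \<phi>0[of i] dd by (auto simp: i \<phi>_def)
  qed
  also have "\<dots> \<le> infsum (\<lambda>i. \<phi> i t) UNIV"
    by (rule finite_sum_le_infsum) (use A \<phi>s[of t] t \<phi>0 in auto)
  also note main
  \<comment> \<open>At time \<open>0\<close> only the diagonal over \<open>B\<close> is left. These
    sites are \<le> 0, so \<open>w t\<close> is at most \<open>C t\<close> there;
    \<open>c\<^sup>2 \<le> c\<close> and the symmetry of the heat kernel turn the sum into the mean
    number of particles in \<open>A\<close>.\<close>
  also have "infsum (\<lambda>i. \<phi> i 0) UNIV \<le> 2 * C t * (\<Sum>x\<in>A. occupation p B c t x)"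
  proof -
    let ?e = "\<lambda>x. 2 * (g t x * w t x * (\<rho> 0 x)\<^sup>2)"
    have \<rho>0: "\<rho> 0 x = (if x \<in> B then c x else 0)" for x using occupation_0[OF p B(1) c] by (simp add: \<rho>_def)
    have "(?e has_sum (\<Sum>x\<in>B. ?e x)) UNIV"
      by (rule has_sum_cong_neutral[THEN iffD1, OF _ _ _ has_sum_finite[OF B(1)]]) (auto simp: \<rho>0)
    from has_sum_diagonal[OF this]
    have "((\<lambda>i. \<phi> i 0) has_sum (\<Sum>x\<in>B. ?e x)) UNIV"
      by (rule has_sum_cong[THEN iffD1, rotated]) (auto simp: \<phi>_def di)
    then have "infsum (\<lambda>i. \<phi> i 0) UNIV = (\<Sum>x\<in>B. ?e x)" by (rule infsumI)
    also have "\<dots> \<le> (\<Sum>x\<in>B. 2 * C t * (c x * g t x))"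
    proof (rule sum_mono)
      fix x assume x: "x \<in> B"
      have "exp (\<alpha> * real_of_int x) \<le> 1" using B(2)[OF x] \<alpha> by (simp add: mult_nonneg_nonpos)
      then have "w t x \<le> C t" using Cpos[of t] by (simp add: w_def)
      moreover have "(c x)\<^sup>2 \<le> c x" using c[of x] by (simp add: power2_eq_square mult_left_le)
      ultimately have "w t x * (c x)\<^sup>2 \<le> C t * c x"
        using wpos[of t x] c[of x] by (intro mult_mono) (auto simp: less_imp_le)
      from mult_left_mono[OF this gb(1)[OF t, of x]]
      show "?e x \<le> 2 * C t * (c x * g t x)" using x by (simp add: \<rho>0 mult_ac)
    qed
    also have "\<dots> = 2 * C t * (\<Sum>x\<in>B. c x * (\<Sum>a\<in>A. heat p t (x - a)))"
      by (simp add: sum_distrib_left g_def occupation_def)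
    also have "(\<Sum>x\<in>B. c x * (\<Sum>a\<in>A. heat p t (x - a))) = (\<Sum>a\<in>A. occupation p B c t a)"
    proof -
      have "heat p t (x - a) = heat p t (a - x)" for x a
        using heat_uminus[OF exp_momentD(1)[OF p], of t "a - x"] by simp
      then show ?thesis unfolding occupation_def sum_distrib_left by (subst sum.swap) simp
    qed
    finally show ?thesis .
  qed
  finally show ?thesis by (simp add: C_def)
qed

section \<open>Vacancy bounds for Bernoulli initial laws\<close>

lemma bernoulli_product_space: "bernoulli_product f \<in> space (prob_algebra configs)"
proof -
  interpret product_prob_space "\<lambda>k. measure_pmf (bernoulli_pmf (f k))" "UNIV :: int set"
    by (intro product_prob_spaceI) unfold_locales
  have "prob_space (bernoulli_product f)" unfolding bernoulli_product_def by (rule P.prob_space_axioms)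
  moreover have "sets (bernoulli_product f) = sets configs"
    unfolding bernoulli_product_def configs_def by (intro sets_PiM_cong) auto
  ultimately show ?thesis by (simp add: space_prob_algebra)
qed

lemma bernoulli_product_vacancy:
  assumes A: "finite A" and f: "\<And>k. 0 \<le> f k \<and> f k \<le> 1"
  shows "(\<integral>\<xi>. vacancy A \<xi> \<partial>bernoulli_product f) = (\<Prod>x\<in>A. 1 - f x)"
proof -
  interpret product_prob_space "\<lambda>k. measure_pmf (bernoulli_pmf (f k))" "UNIV :: int set"
    by (intro product_prob_spaceI) unfold_locales
  let ?S = "{\<xi>\<in>space (bernoulli_product f). \<forall>x\<in>A. \<xi> x \<in> {False}}"
  have "(\<integral>\<xi>. vacancy A \<xi> \<partial>bernoulli_product f) = (\<integral>\<xi>. indicator ?S \<xi> \<partial>bernoulli_product f)"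
    by (rule Bochner_Integration.integral_cong) (auto simp: vacancy_def indicator_def)
  also have "\<dots> = measure (bernoulli_product f) ?S" by (simp add: Int_def conj_commute)
  also have "\<dots> = (\<Prod>x\<in>A. measure (measure_pmf (bernoulli_pmf (f x))) {False})"
    unfolding bernoulli_product_def measure_def
    by (subst emeasure_PiM_Collect) (use A in \<open>auto simp: measure_pmf.emeasure_eq_measure prod_ennreal prod_nonneg\<close>)
  also have "\<dots> = (\<Prod>x\<in>A. 1 - f x)" using f by (simp add: measure_pmf_single)
  finally show ?thesis .
qed

text \<open>\<open>pairsum\<close> counts unordered pairs, which absorbs the factor \<open>2\<close>
  of \<open>pair_sum_bound\<close>. The parameter \<alpha> stays free: it is chosen only when the
  scales of time and threshold are known.\<close>

lemma vacancy_bounds: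
  fixes \<eta> :: "real \<Rightarrow> 'w \<Rightarrow> config" and Y :: real
  assumes p: "exp_moment p \<theta>" and t: "0 \<le> t" and A: "finite A"
    and B: "finite B" "\<And>k. k \<in> B \<Longrightarrow> k \<le> 0" and c: "\<And>k. 0 \<le> c k \<and> c k \<le> 1"
    and ex: "exclusion_process p M \<eta>"
    and init: "distr M configs (\<eta> 0) = bernoulli_product (\<lambda>k. if k \<in> B then c k else 0)"
  shows "measure M {\<omega>\<in>space M. \<forall>x\<in>A. \<not> \<eta> t \<omega> x} \<le> (\<Prod>x\<in>A. 1 - occupation p B c t x)"
    and "\<And>\<alpha> Y. 0 < \<alpha> \<Longrightarrow> \<alpha> \<le> \<theta> \<Longrightarrow> (\<And>a. a \<in> A \<Longrightarrow> Y \<le> real_of_int a) \<Longrightarrow>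
      (\<Prod>x\<in>A. 1 - occupation p B c t x) - exp (3 * psi p \<alpha> * t - \<alpha> * Y) * (\<Sum>x\<in>A. occupation p B c t x)
      \<le> measure M {\<omega>\<in>space M. \<forall>x\<in>A. \<not> \<eta> t \<omega> x}"
proof -
  define f where "f = (\<lambda>k. if k \<in> B then c k else 0)"
  define \<nu> where "\<nu> = bernoulli_product f"
  obtain K where K: "feller K" and gen: "\<And>f. cylinder f \<Longrightarrow> generator_maps K f (exclusion_generator p f)"
    and mk: "markov_process M \<eta> K"
    using ex unfolding exclusion_process_def by blast
  have \<nu>: "\<nu> \<in> space (prob_algebra configs)" unfolding \<nu>_def by (rule bernoulli_product_space)
  have sym: "pmf p i = pmf p (- i)" for i using exp_momentD(1)[OF p] unfolding symm_def by blast
  define q where "q s A = (\<integral>\<xi>. vacancy A \<xi> \<partial>marginal \<nu> K s)" for s A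
  have qd: "((\<lambda>s. q s A) has_real_derivative stirring p (q s) A) (at s within {0..})" if "0 \<le> s" "finite A" for s A
    unfolding q_def using vacancy_derivative[OF sym that(2) K \<nu> that(1) gen] .
  have q01: "0 \<le> q s A \<and> q s A \<le> 1" if "0 \<le> s" for s A
  proof -
    note \<mu> = marginal_space[OF K \<nu> that]
    have "\<bar>q s A\<bar> \<le> 1" unfolding q_def by (rule integral_abs_bound_prob[OF \<mu>]) auto
    moreover have "0 \<le> q s A" unfolding q_def by (rule Bochner_Integration.integral_nonneg) simp
    ultimately show ?thesis by simp
  qed
  define h where "h s x = 1 - occupation p B c s x" for s x
  have hd: "((\<lambda>s. h s x) has_real_derivative avg p (h s) x - h s x) (at s within {0..})" if s: "0 \<le> s" for s x
  proof -
    have b: "\<bar>occupation p B c s x\<bar> \<le> 1" for x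
      using occupation_nonneg[OF p B(1) c s] occupation_le_1[OF p B(1) c s] by (simp add: abs_le_iff order.trans[of _ 0])
    have "avg p (h s) x = 1 - avg p (occupation p B c s) x"
      unfolding avg_def h_def
      by (subst Bochner_Integration.integral_diff) (auto intro: pmf_integrable_bounded[of _ 1] b)
    then have "avg p (h s) x - h s x = 0 - (avg p (occupation p B c s) x - occupation p B c s x)" by (simp add: h_def)
    moreover have "((\<lambda>s. h s x) has_real_derivative 0 - (avg p (occupation p B c s) x - occupation p B c s x)) (at s within {0..})"
      unfolding h_def by (intro DERIV_diff DERIV_const occupation_derivative[OF p B(1) c s])
    ultimately show ?thesis by simp
  qed
  have h01: "0 \<le> h s x \<and> h s x \<le> 1" if s: "0 \<le> s" for s x
    using occupation_nonneg[OF p B(1) c s] occupation_le_1[OF p B(1) c s] by (simp add: h_def)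
  have h0: "h 0 x = 1 - f x" for x using occupation_0[OF p B(1) c] by (simp add: h_def f_def)
  have q0: "q 0 A = prod (h 0) A" if "finite A" for A
    unfolding q_def marginal_0[OF K \<nu>] unfolding \<nu>_def h0
    by (rule bernoulli_product_vacancy[OF that]) (use c in \<open>auto simp: f_def\<close>)
  define D where "D s A = prod (h s) A - q s A" for s A
  have cmp1: "\<bar>D s A\<bar> \<le> 1" if "0 \<le> s" "finite A" for s A
    unfolding D_def using that by (intro product_comparison(1)[where p = p]) (rule sym hd h01 qd q01 q0 | assumption)+
  have cmp2: "((\<lambda>s. D s A) has_real_derivative stirring p (D s) A +
      (\<Sum>x\<in>A. \<Sum>z\<in>A. pmf p (z - x) * (h s z - h s x)\<^sup>2 * prod (h s) (A - {x, z})) / 2) (at s within {0..})"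
    if "0 \<le> s" "finite A" for s A
    unfolding D_def using that by (intro product_comparison(2)) (rule sym hd h01 qd q01 q0 | assumption)+
  have cmp3: "0 \<le> D s A" if "0 \<le> s" "finite A" for s A
    unfolding D_def using that by (intro product_comparison(3)[where p = p]) (rule sym hd h01 qd q01 q0 | assumption)+
  have cmp4: "D s A \<le> pairsum (D s) A" if "0 \<le> s" "finite A" for s A
    unfolding D_def using that by (intro product_comparison(4)[where p = p]) (rule sym hd h01 qd q01 q0 | assumption)+
  have "q t A = measure M {\<omega>\<in>space M. \<forall>x\<in>A. \<not> \<eta> t \<omega> x}"
  proof -
    have m: "\<eta> t \<in> measurable M configs" using mk t by (auto simp: markov_process_def)
    have "distr M configs (\<eta> t) = marginal \<nu> K t"
      by (rule distr_markov[OF mk K _ \<nu> t]) (simp add: init \<nu>_def f_def)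
    then have "q t A = (\<integral>\<omega>. vacancy A (\<eta> t \<omega>) \<partial>M)"
      unfolding q_def by (metis integral_distr m vacancy_measurable)
    also have "\<dots> = (\<integral>\<omega>. indicator {\<omega>\<in>space M. \<forall>x\<in>A. \<not> \<eta> t \<omega> x} \<omega> \<partial>M)"
      by (rule Bochner_Integration.integral_cong) (auto simp: vacancy_def indicator_def)
    also have "\<dots> = measure M {\<omega>\<in>space M. \<forall>x\<in>A. \<not> \<eta> t \<omega> x}" by (simp add: Int_def conj_commute)
    finally show ?thesis .
  qed
  note qt = this
  show "measure M {\<omega>\<in>space M. \<forall>x\<in>A. \<not> \<eta> t \<omega> x} \<le> (\<Prod>x\<in>A. 1 - occupation p B c t x)"
    using cmp3[OF t A] qt by (simp add: D_def h_def)
  show "(\<Prod>x\<in>A. 1 - occupation p B c t x) - exp (3 * psi p \<alpha> * t - \<alpha> * Y) * (\<Sum>x\<in>A. occupation p B c t x)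
      \<le> measure M {\<omega>\<in>space M. \<forall>x\<in>A. \<not> \<eta> t \<omega> x}"
    if \<alpha>: "0 < \<alpha>" "\<alpha> \<le> \<theta>" and Y: "\<And>a. a \<in> A \<Longrightarrow> Y \<le> real_of_int a" for \<alpha> Y
  proof -
    define d where "d s x z = (if x = z then 0 else D s {x, z})" for s x z
    have D01: "0 \<le> D s {x, z} \<and> D s {x, z} \<le> 1" if "0 \<le> s" for s x z
      using cmp1[OF that, of "{x, z}"] cmp3[OF that, of "{x, z}"] by auto
    have "(\<Sum>x\<in>A. \<Sum>z\<in>A. d t x z) \<le> 2 * exp (3 * psi p \<alpha> * t - \<alpha> * Y) * (\<Sum>x\<in>A. occupation p B c t x)"
    proof (rule pair_sum_bound[OF p \<alpha> t A Y B c])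
      show "0 \<le> d s x z \<and> d s x z \<le> 1" if "0 \<le> s" for s x z
        using D01[OF that] by (simp add: d_def)
      show "d 0 x z = 0" for x z using q0[of "{x, z}"] by (simp add: d_def D_def)
      show "d s x z = d s z x" for s x z by (simp add: d_def insert_commute)
      fix s x z assume s: "0 \<le> (s::real)" and xz: "(x::int) \<noteq> z"
      have "\<bar>D s {x, z}\<bar> \<le> 1" for x z using D01[OF s, of x z] by simp
      from pair_derivative[where D = "D s", OF sym this xz]
      have g: "stirring p (D s) {x, z} = avg p (\<lambda>u. d s u z) x + avg p (d s x) z - 2 * d s x z + 2 * pmf p (z - x) * d s x z"
        unfolding d_def by simp
      have src: "(\<Sum>u\<in>{x, z}. \<Sum>v\<in>{x, z}. pmf p (v - u) * (h s v - h s u)\<^sup>2 * prod (h s) ({x, z} - {u, v})) / 2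
          = pmf p (z - x) * (occupation p B c s x - occupation p B c s z)\<^sup>2"
        using xz sym[of "x - z"] by (simp add: h_def insert_commute power2_commute)
      show "((\<lambda>s. d s x z) has_real_derivative
        avg p (\<lambda>u. d s u z) x + avg p (d s x) z - 2 * d s x z + 2 * pmf p (z - x) * d s x z
        + pmf p (z - x) * (occupation p B c s x - occupation p B c s z)\<^sup>2) (at s within {0..})"
        using cmp2[OF s, of "{x, z}"] xz unfolding src g by (simp add: d_def)
    qed (auto simp: d_def)
    then have "pairsum (D t) A \<le> exp (3 * psi p \<alpha> * t - \<alpha> * Y) * (\<Sum>x\<in>A. occupation p B c t x)"
      unfolding pairsum_def d_def by simp
    then show ?thesis using cmp4[OF t A] qt by (simp add: D_def h_def)
  qed
qed

section \<open>The tilted walk\<close>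

text \<open>One minus the real part of the characteristic function of \<open>p\<close>.\<close>

definition cgap :: "int pmf \<Rightarrow> real \<Rightarrow> real" where
  "cgap p \<xi> = measure_pmf.expectation p (\<lambda>i. 1 - cos (\<xi> * real_of_int i))"

text \<open>A quasi-triangle inequality: \<open>1 - cos\<close> is twice the squared sine of the
  half angle, and the absolute value of the sine is subadditive.\<close>

lemma one_minus_cos_add: "1 - cos (a + b) \<le> 2 * (1 - cos a) + 2 * (1 - cos (b :: real))"
proof -
  have c: "1 - cos u = 2 * (sin (u / 2))\<^sup>2" for u :: real
    using cos_double_sin[of "u / 2"] by simp
  have "\<bar>sin (a / 2 + b / 2)\<bar> \<le> \<bar>sin (a / 2)\<bar> + \<bar>sin (b / 2)\<bar>"
  proof -
    have "\<bar>sin (a / 2 + b / 2)\<bar> \<le> \<bar>sin (a / 2)\<bar> * \<bar>cos (b / 2)\<bar> + \<bar>cos (a / 2)\<bar> * \<bar>sin (b / 2)\<bar>"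
      unfolding sin_add by (rule order.trans[OF abs_triangle_ineq]) (simp add: abs_mult)
    also have "\<dots> \<le> \<bar>sin (a / 2)\<bar> * 1 + 1 * \<bar>sin (b / 2)\<bar>"
      by (intro add_mono mult_mono) auto
    finally show ?thesis by simp
  qed
  then have "(sin (a / 2 + b / 2))\<^sup>2 \<le> (\<bar>sin (a / 2)\<bar> + \<bar>sin (b / 2)\<bar>)\<^sup>2"
    by (metis abs_ge_zero power2_abs power_mono)
  also have "\<dots> \<le> 2 * (sin (a / 2))\<^sup>2 + 2 * (sin (b / 2))\<^sup>2"
    using sum_squares_bound[of "\<bar>sin (a / 2)\<bar>" "\<bar>sin (b / 2)\<bar>"] by (simp add: power2_sum)
  finally show ?thesis by (simp add: c add_divide_distrib)
qed

lemma cgap_nonneg: "0 \<le> cgap p \<xi>"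
  unfolding cgap_def by (rule Bochner_Integration.integral_nonneg) simp

lemma cgap_has_sum: "((\<lambda>i. pmf p i * (1 - cos (\<xi> * real_of_int i))) has_sum cgap p \<xi>) UNIV"
  unfolding cgap_def
proof (rule pmf_has_sum, rule pmf_integrable_bounded)
  fix i
  show "\<bar>1 - cos (\<xi> * real_of_int i)\<bar> \<le> 2"
    using cos_ge_minus_one[of "\<xi> * real_of_int i"] cos_le_one[of "\<xi> * real_of_int i"] by linarith
qed

lemma one_minus_cos_le_cgap:
  assumes "0 < pmf p i"
  shows "1 - cos (\<xi> * real_of_int i) \<le> cgap p \<xi> / pmf p i"
proof -
  have "(\<Sum>i\<in>{i}. pmf p i * (1 - cos (\<xi> * real_of_int i))) \<le> cgap p \<xi>"
    by (rule finite_sum_le_has_sum[OF cgap_has_sum]) auto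
  then show ?thesis using assms by (simp add: field_simps)
qed

text \<open>A path to \<open>y\<close> is split into single steps. By irreducibility this applies to \<open>y = 1\<close>, which gives the
  quadratic lower bound for the gap below.\<close>

lemma walk_cgap:
  assumes "0 < pmf (walk p n 0) y"
  shows "\<exists>C\<ge>0. \<forall>\<xi>. 1 - cos (\<xi> * real_of_int y) \<le> C * cgap p \<xi>"
  using assms
proof (induction n arbitrary: y)
  case 0
  then have "y = 0" by (simp add: pmf_return indicator_def split: if_splits)
  then show ?case by (auto simp: intro!: exI[of _ 0])
next
  case (Suc n)
  have "y \<in> set_pmf (walk p (Suc n) 0)" using Suc.prems by (simp add: set_pmf_iff del: walk.simps)
  then obtain k i where ki: "y = k + i" "k \<in> set_pmf (walk p n 0)" "i \<in> set_pmf p"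
    by auto
  then have pos: "0 < pmf (walk p n 0) k" "0 < pmf p i" by (auto simp: pmf_positive)
  then obtain C where C: "0 \<le> C" "\<And>\<xi>. 1 - cos (\<xi> * real_of_int k) \<le> C * cgap p \<xi>"
    using Suc.IH by blast
  show ?case
  proof (intro exI[of _ "2 * C + 2 / pmf p i"] conjI allI)
    show "0 \<le> 2 * C + 2 / pmf p i" using C pos by simp
    fix \<xi>
    have "1 - cos (\<xi> * real_of_int y) \<le> 2 * (1 - cos (\<xi> * real_of_int k)) + 2 * (1 - cos (\<xi> * real_of_int i))"
      using one_minus_cos_add[of "\<xi> * real_of_int k" "\<xi> * real_of_int i"] by (simp add: ki ring_distribs)
    also have "\<dots> \<le> 2 * (C * cgap p \<xi>) + 2 * (cgap p \<xi> / pmf p i)"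
      using C(2)[of \<xi>] one_minus_cos_le_cgap[OF pos(2), of \<xi>] by (intro add_mono mult_left_mono) auto
    finally show "1 - cos (\<xi> * real_of_int y) \<le> (2 * C + 2 / pmf p i) * cgap p \<xi>"
      by (simp add: algebra_simps)
  qed
qed

lemma one_minus_cos_lower:
  fixes x :: real
  assumes "\<bar>x\<bar> \<le> pi"
  shows "x\<^sup>2 / 18 \<le> 1 - cos x"
proof -
  \<comment> \<open>On \<open>0 \<le> y \<le> 2\<close> the cubic Taylor remainder is at most
    \<open>2 / 3 * y\<close>, hence \<open>sin y \<ge> y / 3\<close>. Halving the angle and squaring
    produces the constant 18; \<open>pi < 4\<close> keeps \<open>y\<close> in this range.\<close>
  define y where "y = \<bar>x\<bar> / 2"
  have y: "0 \<le> y" "y \<le> 2" using assms pi_less_4 by (auto simp: y_def)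
  have "\<bar>sin y - (\<Sum>m<3. sin_coeff m * y ^ m)\<bar> \<le> inverse (fact 3) * \<bar>y\<bar> ^ 3" by (rule Maclaurin_sin_bound)
  moreover have "(\<Sum>m<3. sin_coeff m * y ^ m) = y" by (simp add: numeral_3_eq_3 sin_coeff_def)
  moreover have "inverse (fact 3) * \<bar>y\<bar> ^ 3 \<le> 2 / 3 * y"
  proof -
    have "y * y \<le> 2 * 2" by (rule mult_mono) (use y in auto)
    then have "y * y * y \<le> 4 * y" using y by (intro mult_right_mono) auto
    then show ?thesis using y by (simp add: fact_numeral power3_eq_cube)
  qed
  ultimately have "y / 3 \<le> sin y" by linarith
  then have "(y / 3)\<^sup>2 \<le> (sin y)\<^sup>2" using y by (intro power_mono) auto
  moreover have "1 - cos x = 2 * (sin y)\<^sup>2"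
    using cos_double_sin[of y] by (simp add: y_def)
  ultimately show ?thesis by (simp add: y_def power_divide)
qed

lemma cgap_lower:
  assumes "irreducible_walk p"
  obtains \<kappa> where "0 < \<kappa>" "\<And>\<xi>. \<bar>\<xi>\<bar> \<le> pi \<Longrightarrow> \<kappa> * \<xi>\<^sup>2 \<le> cgap p \<xi>"
proof -
  obtain n where "0 < pmf (walk p n 0) 1" using assms unfolding irreducible_walk_def by blast
  from walk_cgap[OF this] obtain C where C: "0 \<le> C" "\<And>\<xi>. 1 - cos \<xi> \<le> C * cgap p \<xi>" by auto
  show ?thesis
  \<comment> \<open>\<open>C\<close> may be \<open>0\<close>, so \<open>C + 1\<close> is used as
    denominator.\<close>
  proof (rule that[of "1 / (18 * (C + 1))"])
    show "0 < 1 / (18 * (C + 1))" using C by simp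
    fix \<xi> :: real assume "\<bar>\<xi>\<bar> \<le> pi"
    then have "\<xi>\<^sup>2 / 18 \<le> 1 - cos \<xi>" by (rule one_minus_cos_lower)
    also have "\<dots> \<le> (C + 1) * cgap p \<xi>" using C(2)[of \<xi>] cgap_nonneg[of p \<xi>] by (simp add: algebra_simps)
    finally show "1 / (18 * (C + 1)) * \<xi>\<^sup>2 \<le> cgap p \<xi>" using C(1) by (simp add: field_simps)
  qed
qed

text \<open>By symmetry the tilting factor can be replaced by \<open>cosh (\<alpha> * i)\<close>,
  which is at least \<open>1\<close>. Tilting thus never shrinks the gap, and the decay of the
  characteristic function is uniform in the tilt, which will vary with time.\<close>

lemma mgf_decay:
  assumes p: "exp_moment p \<theta>" and a: "\<bar>\<alpha>\<bar> \<le> \<theta>"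
  shows "Re (mgf p (Complex \<alpha> \<xi>)) - (1 + psi p \<alpha>) \<le> - cgap p \<xi>"
proof -
  have "((\<lambda>i. Re (of_real (pmf p i) * exp (Complex \<alpha> \<xi> * of_int i))) has_sum Re (mgf p (Complex \<alpha> \<xi>))) UNIV"
    by (rule has_sum_Re, rule mgf_has_sum[OF p]) (use a in simp)
  moreover have "Re (of_real (pmf p i) * exp (Complex \<alpha> \<xi> * of_int i)) = pmf p i * (exp (\<alpha> * real_of_int i) * cos (\<xi> * real_of_int i))" for i
    by (simp add: Re_exp)
  ultimately have "((\<lambda>i. pmf p i * (exp (\<alpha> * real_of_int i) * cos (\<xi> * real_of_int i))) has_sum Re (mgf p (Complex \<alpha> \<xi>))) UNIV"
    by (simp only:)
  then have "((\<lambda>i. pmf p i * exp (\<alpha> * real_of_int i) + (- 1) * (pmf p i * (exp (\<alpha> * real_of_int i) * cos (\<xi> * real_of_int i)))) has_sum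
      (1 + psi p \<alpha>) + (- 1) * Re (mgf p (Complex \<alpha> \<xi>))) UNIV"
    by (intro has_sum_add has_sum_cmult_right psi_has_sum[OF p a])
  then have d: "((\<lambda>i. pmf p i * (exp (\<alpha> * real_of_int i) * (1 - cos (\<xi> * real_of_int i)))) has_sum
      (1 + psi p \<alpha>) - Re (mgf p (Complex \<alpha> \<xi>))) UNIV" (is "(?f has_sum ?S) UNIV")
    by (simp add: algebra_simps)
  have ps: "pmf p (- i) = pmf p i" for i using exp_momentD(1)[OF p] by (simp add: symm_def)
  have d': "((\<lambda>i. pmf p i * (exp (- (\<alpha> * real_of_int i)) * (1 - cos (\<xi> * real_of_int i)))) has_sum ?S) UNIV"
    by (rule has_sum_reindex_bij_witness[where i = uminus and j = uminus, THEN iffD1, OF _ _ _ _ _ _ d]) (auto simp: ps)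
  have "2 * cgap p \<xi> \<le> ?S + ?S"
  proof (rule has_sum_mono[OF has_sum_cmult_right[OF cgap_has_sum] has_sum_add[OF d d']])
    fix i
    have "2 \<le> exp (\<alpha> * real_of_int i) + exp (- (\<alpha> * real_of_int i))"
      using cosh_real_ge_1[of "\<alpha> * real_of_int i"] by (simp add: cosh_def)
    then have "2 * (pmf p i * (1 - cos (\<xi> * real_of_int i))) \<le>
       (exp (\<alpha> * real_of_int i) + exp (- (\<alpha> * real_of_int i))) * (pmf p i * (1 - cos (\<xi> * real_of_int i)))"
      by (intro mult_right_mono) auto
    then show "2 * (pmf p i * (1 - cos (\<xi> * real_of_int i))) \<le>
       pmf p i * (exp (\<alpha> * real_of_int i) * (1 - cos (\<xi> * real_of_int i))) +
       pmf p i * (exp (- (\<alpha> * real_of_int i)) * (1 - cos (\<xi> * real_of_int i)))"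
      by (simp add: algebra_simps)
  qed
  then show ?thesis by simp
qed

lemma cube_le_exp: "0 \<le> u \<Longrightarrow> u ^ 3 \<le> 27 * exp (u::real)"
proof -
  assume u: "0 \<le> u"
  have "u / 3 \<le> exp (u / 3)" using exp_ge_add_one_self[of "u / 3"] by linarith
  then have "(u / 3) ^ 3 \<le> exp (u / 3) ^ 3" using u by (intro power_mono) auto
  also have "\<dots> = exp u" by (simp add: exp_of_nat_mult[symmetric])
  finally show ?thesis by (simp add: power_divide)
qed

text \<open>Second-order Taylor formula under the sum; the linear term vanishes by symmetry. The
  radius is half of \<theta>, so that the other half can pay for the cube in the remainder.\<close>

lemma mgf_expansion:
  assumes p: "exp_moment p \<theta>" and \<sigma>: "\<sigma>\<^sup>2 = (\<Sum>\<^sub>\<infinity>i. (real_of_int i)\<^sup>2 * pmf p i)"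
  obtains K where "0 \<le> K" "\<And>z. norm z \<le> \<theta> / 2 \<Longrightarrow> norm (mgf p z - 1 - of_real (\<sigma>\<^sup>2 / 2) * z\<^sup>2) \<le> K * norm z ^ 3"
proof -
  have \<theta>: "0 < \<theta>" using p by (rule exp_momentD)
  \<comment> \<open>The cube is absorbed by \<open>cube_le_exp\<close> at \<theta> / 2 times the
    absolute value of \<open>i\<close>, so that 216 is 27 times 8.\<close>
  have s3: "(\<lambda>i. pmf p i * (\<bar>real_of_int i\<bar> ^ 3 * exp (\<theta> / 2 * \<bar>real_of_int i\<bar>))) summable_on UNIV"
  proof (rule summable_on_comparison_test[OF summable_on_cmult_right[OF exp_moment_abs[OF p], of "216 / \<theta> ^ 3"]])
    fix i :: int
    let ?u = "\<theta> / 2 * \<bar>real_of_int i\<bar>"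
    have "?u ^ 3 \<le> 27 * exp ?u" by (rule cube_le_exp) (use \<theta> in simp)
    then have "\<bar>real_of_int i\<bar> ^ 3 \<le> 216 / \<theta> ^ 3 * exp ?u"
      using \<theta> by (simp add: power_mult_distrib power_divide field_simps)
    then have "\<bar>real_of_int i\<bar> ^ 3 * exp ?u \<le> 216 / \<theta> ^ 3 * exp ?u * exp ?u" by (intro mult_right_mono) auto
    also have "\<dots> = 216 / \<theta> ^ 3 * exp (\<theta> * \<bar>real_of_int i\<bar>)" by (simp add: mult.assoc exp_add[symmetric])
    finally have "pmf p i * (\<bar>real_of_int i\<bar> ^ 3 * exp ?u) \<le> pmf p i * (216 / \<theta> ^ 3 * exp (\<theta> * \<bar>real_of_int i\<bar>))"
      by (rule mult_left_mono) simp
    then show "pmf p i * (\<bar>real_of_int i\<bar> ^ 3 * exp ?u) \<le> 216 / \<theta> ^ 3 * (pmf p i * exp (\<theta> * \<bar>real_of_int i\<bar>))"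
      by (simp add: mult_ac)
  qed auto
  have dom: "(\<lambda>i. pmf p i * f (real_of_int i)) summable_on UNIV"
    if "\<And>i::int. \<bar>f (real_of_int i)\<bar> \<le> \<bar>real_of_int i\<bar> ^ 3" for f
  proof -
    have "(\<lambda>i. \<bar>pmf p i * f (real_of_int i)\<bar>) summable_on UNIV"
    proof (rule summable_on_comparison_test[OF s3])
      fix i :: int
      have "\<bar>f (real_of_int i)\<bar> * 1 \<le> \<bar>real_of_int i\<bar> ^ 3 * exp (\<theta> / 2 * \<bar>real_of_int i\<bar>)"
        using that[of i] \<theta> by (intro mult_mono) auto
      then show "\<bar>pmf p i * f (real_of_int i)\<bar> \<le> pmf p i * (\<bar>real_of_int i\<bar> ^ 3 * exp (\<theta> / 2 * \<bar>real_of_int i\<bar>))"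
        by (simp add: abs_mult mult_left_mono)
    qed auto
    then show ?thesis
      using abs_summable_summable[of "\<lambda>i. pmf p i * f (real_of_int i)" UNIV] by (simp only: real_norm_def)
  qed
  have ipow: "\<bar>real_of_int i\<bar> ^ k \<le> \<bar>real_of_int i\<bar> ^ 3" if "0 < k" "k \<le> 3" for i :: int and k
  proof (cases "i = 0")
    case False
    then have "1 \<le> \<bar>real_of_int i\<bar>" by linarith
    then show ?thesis using that by (intro power_increasing) auto
  qed (use that in \<open>auto simp: zero_power\<close>)
  have s1: "(\<lambda>i. pmf p i * real_of_int i) summable_on UNIV"
    by (rule dom[of "\<lambda>x. x"]) (use ipow[of 1] in simp)
  have s2: "(\<lambda>i. pmf p i * (real_of_int i)\<^sup>2) summable_on UNIV"
    by (rule dom[of "\<lambda>x. x\<^sup>2"]) (use ipow[of 2] in simp)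
  have ps: "pmf p (- i) = pmf p i" for i using exp_momentD(1)[OF p] by (simp add: symm_def)
  define m1 where "m1 = infsum (\<lambda>i. pmf p i * real_of_int i) UNIV"
  have h1: "((\<lambda>i. pmf p i * real_of_int i) has_sum m1) UNIV" unfolding m1_def by (rule has_sum_infsum[OF s1])
  have "((\<lambda>i. - (pmf p i * real_of_int i)) has_sum m1) UNIV"
    by (rule has_sum_reindex_bij_witness[where i = uminus and j = uminus, THEN iffD1, OF _ _ _ _ _ _ h1]) (auto simp: ps)
  moreover have "((\<lambda>i. - (pmf p i * real_of_int i)) has_sum - m1) UNIV" using h1 by (simp add: has_sum_uminus)
  ultimately have "m1 = - m1" by (rule has_sum_unique)
  then have h1: "((\<lambda>i. pmf p i * real_of_int i) has_sum 0) UNIV" using h1 by simp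
  have h2: "((\<lambda>i. pmf p i * (real_of_int i)\<^sup>2) has_sum \<sigma>\<^sup>2) UNIV"
    using has_sum_infsum[OF s2] unfolding \<sigma> by (simp add: mult.commute)
  define K where "K = infsum (\<lambda>i. pmf p i * (\<bar>real_of_int i\<bar> ^ 3 * exp (\<theta> / 2 * \<bar>real_of_int i\<bar>))) UNIV"
  show ?thesis
  proof (rule that[of K])
    show "0 \<le> K" unfolding K_def by (rule infsum_nonneg) auto
    fix z :: complex assume z: "norm z \<le> \<theta> / 2"
    have Rz: "\<bar>Re z\<bar> \<le> \<theta>" using abs_Re_le_cmod[of z] z \<theta> by linarith
    let ?f = "\<lambda>i. of_real (pmf p i) * (exp (z * of_int i) - (1 + z * of_int i + (z * of_int i)\<^sup>2 / 2))"
    have "((\<lambda>i. of_real (pmf p i) * exp (z * of_int i) + (- 1) * of_real (pmf p i) + (- z) * of_real (pmf p i * real_of_int i)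
        + (- (z\<^sup>2 / 2)) * of_real (pmf p i * (real_of_int i)\<^sup>2)) has_sum
        mgf p z + (- 1) * of_real 1 + (- z) * of_real 0 + (- (z\<^sup>2 / 2)) * of_real (\<sigma>\<^sup>2)) UNIV"
      by (intro has_sum_add has_sum_cmult_right has_sum_of_real h1 h2 pmf_has_sum_1 mgf_has_sum[OF p Rz])
    then have F: "(?f has_sum mgf p z - 1 - of_real (\<sigma>\<^sup>2 / 2) * z\<^sup>2) UNIV"
      by (simp add: algebra_simps power_mult_distrib)
    have "norm (mgf p z - 1 - of_real (\<sigma>\<^sup>2 / 2) * z\<^sup>2) \<le> norm z ^ 3 * K"
    proof (rule norm_infsum_le[OF F])
      show "((\<lambda>i. norm z ^ 3 * (pmf p i * (\<bar>real_of_int i\<bar> ^ 3 * exp (\<theta> / 2 * \<bar>real_of_int i\<bar>)))) has_sum norm z ^ 3 * K) UNIV"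
        unfolding K_def by (intro has_sum_cmult_right has_sum_infsum s3)
      fix i :: int
      have "norm (exp (z * of_int i) - (\<Sum>k\<le>2. (z * of_int i) ^ k / fact k)) \<le> exp \<bar>Re (z * of_int i)\<bar> * norm (z * of_int i) ^ Suc 2 / fact 2"
        by (rule Taylor_exp)
      also have "(\<Sum>k\<le>2. (z * of_int i) ^ k / fact k) = 1 + z * of_int i + (z * of_int i)\<^sup>2 / 2"
        by (simp add: numeral_2_eq_2)
      also have "exp \<bar>Re (z * of_int i)\<bar> * norm (z * of_int i) ^ Suc 2 / fact 2 \<le> exp (\<theta> / 2 * \<bar>real_of_int i\<bar>) * norm (z * of_int i) ^ 3"
      proof -
        have "\<bar>Re (z * of_int i)\<bar> = \<bar>Re z\<bar> * \<bar>real_of_int i\<bar>" by (simp add: abs_mult)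
        also have "\<dots> \<le> \<theta> / 2 * \<bar>real_of_int i\<bar>" using abs_Re_le_cmod[of z] z by (intro mult_right_mono) auto
        finally have "exp \<bar>Re (z * of_int i)\<bar> * norm (z * of_int i) ^ 3 \<le> exp (\<theta> / 2 * \<bar>real_of_int i\<bar>) * norm (z * of_int i) ^ 3"
          by (intro mult_right_mono) auto
        moreover have "exp \<bar>Re (z * of_int i)\<bar> * norm (z * of_int i) ^ Suc 2 / fact 2 \<le> exp \<bar>Re (z * of_int i)\<bar> * norm (z * of_int i) ^ 3"
          by (simp add: fact_numeral numeral_3_eq_3 numeral_2_eq_2)
        ultimately show ?thesis by linarith
      qed
      finally have "norm (exp (z * of_int i) - (1 + z * of_int i + (z * of_int i)\<^sup>2 / 2)) \<le> norm z ^ 3 * (\<bar>real_of_int i\<bar> ^ 3 * exp (\<theta> / 2 * \<bar>real_of_int i\<bar>))"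
        by (simp add: norm_mult power_mult_distrib mult_ac)
      then have "pmf p i * norm (exp (z * of_int i) - (1 + z * of_int i + (z * of_int i)\<^sup>2 / 2)) \<le> pmf p i * (norm z ^ 3 * (\<bar>real_of_int i\<bar> ^ 3 * exp (\<theta> / 2 * \<bar>real_of_int i\<bar>)))"
        by (rule mult_left_mono) simp
      then show "norm (?f i) \<le> norm z ^ 3 * (pmf p i * (\<bar>real_of_int i\<bar> ^ 3 * exp (\<theta> / 2 * \<bar>real_of_int i\<bar>)))"
        by (simp add: norm_mult mult_ac)
    qed
    then show "norm (mgf p z - 1 - of_real (\<sigma>\<^sup>2 / 2) * z\<^sup>2) \<le> K * norm z ^ 3" by (simp add: mult.commute)
  qed
qed

text \<open>Law at time \<open>t\<close> after the exponential change of measure with parameter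
  \<alpha>; near \<alpha> = 0 its mean is close to
  \<open>\<sigma>\<^sup>2 * t * \<alpha>\<close>.\<close>

definition tilt :: "int pmf \<Rightarrow> real \<Rightarrow> real \<Rightarrow> int \<Rightarrow> real" where
  "tilt p t \<alpha> j = exp (\<alpha> * real_of_int j - t * psi p \<alpha>) * heat p t j"

text \<open>Characteristic function of the tilted law, recentred at \<open>j\<close> so that it is
  the integrand of Fourier inversion at \<open>j\<close>.\<close>

definition tilt_char :: "int pmf \<Rightarrow> real \<Rightarrow> real \<Rightarrow> int \<Rightarrow> real \<Rightarrow> complex" where
  "tilt_char p t \<alpha> j \<xi> = exp (of_real t * (mgf p (Complex \<alpha> \<xi>) - of_real (1 + psi p \<alpha>))) * cis (- \<xi> * real_of_int j)"

section \<open>Fourier inversion for the tilted law\<close>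

lemma cis_has_integral:
  "((\<lambda>\<xi>. cis (\<xi> * real_of_int n)) has_integral (if n = 0 then 2 * of_real pi else 0)) {- pi..pi}"
proof (cases "n = 0")
  case True
  have "((\<lambda>\<xi>. 1 :: complex) has_integral (pi - - pi) *\<^sub>R 1) {- pi..pi}"
    using has_integral_const_real[of "1::complex" "- pi" pi] by simp
  then show ?thesis using True by (simp add: scaleR_conv_of_real)
next
  case False
  let ?F = "\<lambda>\<xi>. cis (\<xi> * real_of_int n) / (\<i> * of_int n)"
  have "((\<lambda>\<xi>. cis (\<xi> * real_of_int n)) has_integral ?F pi - ?F (- pi)) {- pi..pi}"
  proof (rule fundamental_theorem_of_calculus)
    fix x :: real
    have "((\<lambda>z. exp (\<i> * of_int n * z) / (\<i> * of_int n)) has_field_derivative exp (\<i> * of_int n * of_real x)) (at (of_real x))"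
      using False by (auto intro!: derivative_eq_intros)
    from has_vector_derivative_real_field[OF this]
    show "(?F has_vector_derivative cis (x * real_of_int n)) (at x within {- pi..pi})"
      by (simp add: cis_conv_exp mult_ac)
  qed simp
  moreover have "cis (pi * real_of_int n) = cis (- pi * real_of_int n)"
    by (simp add: complex_eq_iff)
  ultimately show ?thesis using False by simp
qed

context
  fixes p :: "int pmf" and \<theta> \<alpha> t :: real
  assumes p: "exp_moment p \<theta>" and a: "\<bar>\<alpha>\<bar> \<le> \<theta>" and t: "0 \<le> t"
begin

lemma tilt_sum: "(tilt p t \<alpha> has_sum 1) UNIV"
proof -
  have "((\<lambda>j. exp (- (t * psi p \<alpha>)) * (heat p t j * exp (\<alpha> * real_of_int j))) has_sum exp (- (t * psi p \<alpha>)) * exp (t * psi p \<alpha>)) UNIV"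
    by (intro has_sum_cmult_right heat_exp_has_sum[OF p a t])
  then show ?thesis unfolding tilt_def by (simp add: exp_minus exp_diff field_simps)
qed

lemma tilt_nonneg: "0 \<le> tilt p t \<alpha> j"
  using heat_nonneg[OF t] by (simp add: tilt_def)

lemma tilt_char_has_sum: "((\<lambda>m. of_real (tilt p t \<alpha> m) * cis (\<xi> * real_of_int (m - j))) has_sum tilt_char p t \<alpha> j \<xi>) UNIV"
proof -
  let ?c = "of_real (exp (- (t * psi p \<alpha>))) * cis (- \<xi> * real_of_int j)"
  have "((\<lambda>m. ?c * (of_real (heat p t m) * exp (Complex \<alpha> \<xi> * of_int m))) has_sum ?c * exp (of_real t * (mgf p (Complex \<alpha> \<xi>) - 1))) UNIV"
    by (intro has_sum_cmult_right heat_mgf[OF p _ t]) (use a in simp)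
  moreover have "?c * (of_real (heat p t m) * exp (Complex \<alpha> \<xi> * of_int m)) = of_real (tilt p t \<alpha> m) * cis (\<xi> * real_of_int (m - j))" for m
  proof -
    have "Complex \<alpha> \<xi> * of_int m = of_real (\<alpha> * real_of_int m) + \<i> * of_real (\<xi> * real_of_int m)"
      by (simp add: complex_eq_iff)
    then have "exp (Complex \<alpha> \<xi> * of_int m) = of_real (exp (\<alpha> * real_of_int m)) * cis (\<xi> * real_of_int m)"
      by (simp only: exp_add exp_of_real cis_conv_exp)
    moreover have "cis (\<xi> * real_of_int m) * cis (- \<xi> * real_of_int j) = cis (\<xi> * real_of_int (m - j))"
      by (simp add: cis_mult algebra_simps)
    ultimately show ?thesis
      by (simp add: tilt_def exp_diff exp_minus field_simps)
  qed
  moreover have "?c * exp (of_real t * (mgf p (Complex \<alpha> \<xi>) - 1)) = tilt_char p t \<alpha> j \<xi>"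
    unfolding tilt_char_def exp_of_real[symmetric] by (simp add: exp_add[symmetric] mult_ac) (simp add: algebra_simps)
  ultimately show ?thesis by simp
qed

text \<open>The Fourier series is dominated by the tilted probabilities, which sum to
  \<open>1\<close>. Convergence is therefore uniform in the frequency and the series may be
  integrated termwise.\<close>

lemma tilt_char_integral:
  "continuous_on {- pi..pi} (tilt_char p t \<alpha> j)"
  "(tilt_char p t \<alpha> j has_integral 2 * of_real pi * of_real (tilt p t \<alpha> j)) {- pi..pi}"
proof -
  let ?f = "\<lambda>F \<xi>. \<Sum>m\<in>F. of_real (tilt p t \<alpha> m) * cis (\<xi> * real_of_int (m - j))"
  have u: "uniform_limit {- pi..pi} ?f (tilt_char p t \<alpha> j) (finite_subsets_at_top UNIV)"
    by (rule Weierstrass_m_test_general'[where M = "tilt p t \<alpha>"])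
       (use tilt_char_has_sum tilt_nonneg has_sum_imp_summable[OF tilt_sum] in \<open>auto simp: norm_mult\<close>)
  have c: "continuous_on {- pi..pi} (?f F)" for F by (intro continuous_intros)
  show "continuous_on {- pi..pi} (tilt_char p t \<alpha> j)"
    by (rule uniform_limit_theorem[OF _ u]) (use c in auto)
  obtain I J where I: "\<And>F. (?f F has_integral I F) {- pi..pi}" and J: "(tilt_char p t \<alpha> j has_integral J) {- pi..pi}"
    and lim: "(I \<longlongrightarrow> J) (finite_subsets_at_top UNIV)"
    using uniform_limit_integral[OF u c] by auto
  \<comment> \<open>By orthogonality the integral no longer changes once the finite index set
    contains \<open>j\<close>.\<close>
  have "\<forall>\<^sub>F F in finite_subsets_at_top UNIV. I F = 2 * of_real pi * of_real (tilt p t \<alpha> j)"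
  proof (rule eventually_finite_subsets_at_top[THEN iffD2], intro exI[of _ "{j}"] conjI allI impI)
    fix F :: "int set" assume F: "finite F \<and> {j} \<subseteq> F \<and> F \<subseteq> UNIV"
    have "(?f F has_integral (\<Sum>m\<in>F. of_real (tilt p t \<alpha> m) * (if m - j = 0 then 2 * of_real pi else 0))) {- pi..pi}"
      by (intro has_integral_sum has_integral_mult_right cis_has_integral) (use F in auto)
    then have "I F = (\<Sum>m\<in>F. of_real (tilt p t \<alpha> m) * (if m - j = 0 then 2 * of_real pi else 0))"
      using I has_integral_unique by blast
    also have "\<dots> = (\<Sum>m\<in>F. if m = j then 2 * of_real pi * of_real (tilt p t \<alpha> j) else 0)"
      by (intro sum.cong) auto
    finally show "I F = 2 * of_real pi * of_real (tilt p t \<alpha> j)" using F by simp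
  qed auto
  then have "(I \<longlongrightarrow> 2 * of_real pi * of_real (tilt p t \<alpha> j)) (finite_subsets_at_top UNIV)"
    by (rule tendsto_eventually)
  then have "J = 2 * of_real pi * of_real (tilt p t \<alpha> j)"
    by (rule tendsto_unique[OF finite_subsets_at_top_neq_bot lim])
  then show "(tilt_char p t \<alpha> j has_integral 2 * of_real pi * of_real (tilt p t \<alpha> j)) {- pi..pi}" using J by simp
qed

lemma tilt_char_set_integrable: "set_integrable lborel {- pi..pi} (tilt_char p t \<alpha> j)"
  by (rule borel_integrable_atLeastAtMost'[OF tilt_char_integral(1)])

lemma tilt_Lebesgue: "2 * of_real pi * of_real (tilt p t \<alpha> j) = (LINT \<xi>:{- pi..pi}|lborel. tilt_char p t \<alpha> j \<xi>)"
  using set_borel_integral_eq_integral(2)[OF tilt_char_set_integrable] integral_unique[OF tilt_char_integral(2)] by simp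

lemma norm_tilt_char_le:
  assumes "\<And>\<xi>. \<bar>\<xi>\<bar> \<le> pi \<Longrightarrow> \<kappa> * \<xi>\<^sup>2 \<le> cgap p \<xi>" "\<bar>\<xi>\<bar> \<le> pi"
  shows "norm (tilt_char p t \<alpha> j \<xi>) \<le> exp (- (t * (\<kappa> * \<xi>\<^sup>2)))"
proof -
  have "t * (Re (mgf p (Complex \<alpha> \<xi>)) - (1 + psi p \<alpha>)) \<le> t * - (\<kappa> * \<xi>\<^sup>2)"
    using mgf_decay[OF p a, of \<xi>] assms(1)[OF assms(2)] t by (intro mult_left_mono) auto
  then show ?thesis by (simp add: tilt_char_def norm_mult algebra_simps)
qed

end

lemma cis_diff_le: "norm (cis a - cis b) \<le> \<bar>a - b\<bar>"
proof -
  have "norm (cis (a - b) - 1) \<le> \<bar>a - b\<bar>"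
    using iexp_approx1[of "a - b" 0] by (simp add: cis_conv_exp)
  moreover have "cis a - cis b = cis b * (cis (a - b) - 1)" by (simp add: algebra_simps cis_mult)
  ultimately show ?thesis by (simp add: norm_mult)
qed

lemma gaussian_integral:
  assumes "0 < s"
  shows "integrable lborel (\<lambda>u. exp (- (s * u\<^sup>2 / 2)))" "(\<integral>u. exp (- (s * u\<^sup>2 / 2)) \<partial>lborel) = sqrt (2 * pi / s)"
proof -
  define \<tau> where "\<tau> = 1 / sqrt s"
  have \<tau>: "0 < \<tau>" "\<tau>\<^sup>2 = 1 / s" using assms by (auto simp: \<tau>_def power_divide)
  have e: "exp (- (s * u\<^sup>2 / 2)) = sqrt (2 * pi / s) * normal_density 0 \<tau> u" for u
    using assms by (simp add: normal_density_def \<tau>(2))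
  have "integrable lborel (normal_density 0 \<tau>)" using \<tau> by simp
  then show "integrable lborel (\<lambda>u. exp (- (s * u\<^sup>2 / 2)))" unfolding e by simp
  show "(\<integral>u. exp (- (s * u\<^sup>2 / 2)) \<partial>lborel) = sqrt (2 * pi / s)" unfolding e using \<tau> by simp
qed

lemma abs_gaussian_integrable:
  assumes "0 < \<kappa>"
  shows "integrable lborel (\<lambda>u::real. \<bar>u\<bar> * exp (- (\<kappa> * u\<^sup>2)))"
proof (rule Bochner_Integration.integrable_bound)
  show "integrable lborel (\<lambda>u::real. (1 + 2 / \<kappa>) * exp (- (\<kappa> * u\<^sup>2 / 2)))"
    using gaussian_integral(1)[OF assms] by simp
  show "AE u in lborel. norm (\<bar>u\<bar> * exp (- (\<kappa> * u\<^sup>2))) \<le> norm ((1 + 2 / \<kappa>) * exp (- (\<kappa> * u\<^sup>2 / 2)))"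
  proof (rule AE_I2)
    fix u :: real
    have "\<bar>u\<bar> \<le> 1 + u\<^sup>2" using sum_squares_bound[of "\<bar>u\<bar>" 1] by simp
    also have "\<dots> \<le> (1 + 2 / \<kappa>) * exp (\<kappa> * u\<^sup>2 / 2)"
    proof -
      have "\<kappa> * u\<^sup>2 / 2 \<le> exp (\<kappa> * u\<^sup>2 / 2)" using exp_ge_add_one_self[of "\<kappa> * u\<^sup>2 / 2"] by linarith
      then have "u\<^sup>2 \<le> 2 / \<kappa> * exp (\<kappa> * u\<^sup>2 / 2)" using assms by (simp add: field_simps)
      moreover have "1 \<le> exp (\<kappa> * u\<^sup>2 / 2)" using assms by simp
      moreover have "(1 + 2 / \<kappa>) * exp (\<kappa> * u\<^sup>2 / 2) = exp (\<kappa> * u\<^sup>2 / 2) + 2 / \<kappa> * exp (\<kappa> * u\<^sup>2 / 2)"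
        by (simp add: distrib_right)
      ultimately show ?thesis by linarith
    qed
    finally have "\<bar>u\<bar> * exp (- (\<kappa> * u\<^sup>2)) \<le> (1 + 2 / \<kappa>) * exp (\<kappa> * u\<^sup>2 / 2) * exp (- (\<kappa> * u\<^sup>2))"
      by (rule mult_right_mono) simp
    also have "\<dots> = (1 + 2 / \<kappa>) * exp (- (\<kappa> * u\<^sup>2 / 2))"
      by (simp add: mult.assoc exp_add[symmetric] field_simps)
    finally show "norm (\<bar>u\<bar> * exp (- (\<kappa> * u\<^sup>2))) \<le> norm ((1 + 2 / \<kappa>) * exp (- (\<kappa> * u\<^sup>2 / 2)))"
      using assms by simp
  qed
qed measurable

text \<open>Shifting by \<open>l\<close> sites inserts a factor of size \<open>l\<close> times the
  frequency, and the integrand lives on frequencies of order \<open>1 / sqrt t\<close>; the tilted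
  law hence changes by order \<open>l / t\<close>, uniformly in \<alpha>. This carries the local
  limit from one site to all sites at distance of smaller order than \<open>sqrt t\<close>.\<close>

lemma tilt_Lipschitz:
  assumes irr: "irreducible_walk p" and p: "exp_moment p \<theta>"
  obtains C where "0 \<le> C" "\<And>\<alpha> t j l. \<bar>\<alpha>\<bar> \<le> \<theta> \<Longrightarrow> 0 < t \<Longrightarrow>
    \<bar>sqrt t * tilt p t \<alpha> (j + int l) - sqrt t * tilt p t \<alpha> j\<bar> \<le> C * real l / sqrt t"
proof -
  obtain \<kappa> where \<kappa>: "0 < \<kappa>" "\<And>\<xi>. \<bar>\<xi>\<bar> \<le> pi \<Longrightarrow> \<kappa> * \<xi>\<^sup>2 \<le> cgap p \<xi>" using cgap_lower[OF irr] by metis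
  define C0 where "C0 = (\<integral>u. \<bar>u\<bar> * exp (- (\<kappa> * u\<^sup>2)) \<partial>lborel)"
  have C0: "0 \<le> C0" unfolding C0_def by (rule Bochner_Integration.integral_nonneg) simp
  show ?thesis
  proof (rule that[of "C0 / (2 * pi)"])
    show "0 \<le> C0 / (2 * pi)" using C0 by simp
    fix \<alpha> t :: real and j :: int and l :: nat
    assume a: "\<bar>\<alpha>\<bar> \<le> \<theta>" and t: "0 < t"
    then have t0: "0 \<le> t" by simp
    let ?h = "\<lambda>\<xi>. \<bar>\<xi>\<bar> * exp (- (t * \<kappa> * \<xi>\<^sup>2))"
    have hi: "integrable lborel ?h" by (rule abs_gaussian_integrable) (use t \<kappa> in simp)
    have scal: "(\<integral>\<xi>. ?h \<xi> \<partial>lborel) = C0 / t"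
    proof -
      have "(\<integral>\<xi>. ?h \<xi> \<partial>lborel) = \<bar>1 / sqrt t\<bar> *\<^sub>R (\<integral>u. ?h (0 + 1 / sqrt t * u) \<partial>lborel)"
        by (rule lborel_integral_real_affine) (use t in simp)
      also have "(\<lambda>u. ?h (0 + 1 / sqrt t * u)) = (\<lambda>u. 1 / sqrt t * (\<bar>u\<bar> * exp (- (\<kappa> * u\<^sup>2))))"
        using t by (auto simp: abs_mult power_divide)
      finally show ?thesis using t by (simp add: C0_def)
    qed
    have "2 * of_real pi * of_real (tilt p t \<alpha> (j + int l)) - 2 * of_real pi * of_real (tilt p t \<alpha> j)
      = (LINT \<xi>:{- pi..pi}|lborel. tilt_char p t \<alpha> (j + int l) \<xi> - tilt_char p t \<alpha> j \<xi>)"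
      unfolding tilt_Lebesgue[OF p a t0]
      by (rule set_integral_diff(2)[symmetric]) (rule tilt_char_set_integrable[OF p a t0])+
    also have "norm \<dots> \<le> (\<integral>\<xi>. real l * ?h \<xi> \<partial>lborel)"
      unfolding set_lebesgue_integral_def
    proof (rule Bochner_Integration.integral_norm_bound_integral)
      show "integrable lborel (\<lambda>\<xi>. indicat_real {- pi..pi} \<xi> *\<^sub>R (tilt_char p t \<alpha> (j + int l) \<xi> - tilt_char p t \<alpha> j \<xi>))"
        using set_integral_diff(1)[OF tilt_char_set_integrable[OF p a t0] tilt_char_set_integrable[OF p a t0]]
        unfolding set_integrable_def .
      show "integrable lborel (\<lambda>\<xi>. real l * ?h \<xi>)" using hi by simp
      fix \<xi> :: real
      show "norm (indicat_real {- pi..pi} \<xi> *\<^sub>R (tilt_char p t \<alpha> (j + int l) \<xi> - tilt_char p t \<alpha> j \<xi>)) \<le> real l * ?h \<xi>"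
      proof (cases "\<xi> \<in> {- pi..pi}")
        case True
        then have x: "\<bar>\<xi>\<bar> \<le> pi" by auto
        have "norm (tilt_char p t \<alpha> 0 \<xi>) \<le> exp (- (t * (\<kappa> * \<xi>\<^sup>2)))" by (rule norm_tilt_char_le[OF p a t0 \<kappa>(2) x])
        moreover have "tilt_char p t \<alpha> (j + int l) \<xi> - tilt_char p t \<alpha> j \<xi> = tilt_char p t \<alpha> 0 \<xi> * (cis (- \<xi> * real_of_int (j + int l)) - cis (- \<xi> * real_of_int j))"
          by (simp add: tilt_char_def algebra_simps)
        moreover have "norm (cis (- \<xi> * real_of_int (j + int l)) - cis (- \<xi> * real_of_int j)) \<le> \<bar>\<xi>\<bar> * real l"
          by (rule order.trans[OF cis_diff_le]) (simp add: algebra_simps abs_mult)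
        ultimately have "norm (tilt_char p t \<alpha> (j + int l) \<xi> - tilt_char p t \<alpha> j \<xi>) \<le> exp (- (t * (\<kappa> * \<xi>\<^sup>2))) * (\<bar>\<xi>\<bar> * real l)"
          by (simp add: norm_mult mult_mono)
        then show ?thesis using True by (simp add: mult_ac)
      qed simp
    qed
    also have "\<dots> = real l * (C0 / t)" using scal by simp
    finally have "norm (complex_of_real (2 * pi * (tilt p t \<alpha> (j + int l) - tilt p t \<alpha> j))) \<le> real l * (C0 / t)"
      by (simp add: algebra_simps)
    then have "2 * pi * \<bar>tilt p t \<alpha> (j + int l) - tilt p t \<alpha> j\<bar> \<le> real l * (C0 / t)"
      unfolding norm_of_real by (simp add: abs_mult)
    then have "\<bar>tilt p t \<alpha> (j + int l) - tilt p t \<alpha> j\<bar> \<le> real l * (C0 / t) / (2 * pi)"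
      by (subst pos_le_divide_eq) (simp_all only: pi_gt_zero mult.commute zero_less_mult_iff zero_less_numeral simp_thms)
    then have "\<bar>tilt p t \<alpha> (j + int l) - tilt p t \<alpha> j\<bar> \<le> C0 / (2 * pi) * real l / t"
      by (simp add: mult_ac)
    then have "sqrt t * \<bar>tilt p t \<alpha> (j + int l) - tilt p t \<alpha> j\<bar> \<le> sqrt t * (C0 / (2 * pi) * real l / t)"
      using t by (intro mult_left_mono) auto
    also have "\<dots> = C0 / (2 * pi) * real l / sqrt t"
      using t real_sqrt_mult_self[of t] by (simp add: field_simps)
    finally show "\<bar>sqrt t * tilt p t \<alpha> (j + int l) - sqrt t * tilt p t \<alpha> j\<bar> \<le> C0 / (2 * pi) * real l / sqrt t"
      using t by (simp add: right_diff_distrib[symmetric] abs_mult)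
  qed
qed


section \<open>Local limit theorem at the tilted mean\<close>

lemma cube_sum_le:
  fixes x y :: real
  assumes "0 \<le> x" "0 \<le> y"
  shows "(x + y) ^ 3 \<le> 4 * x ^ 3 + 4 * y ^ 3"
proof -
  have "0 \<le> (x + y) * (x - y)\<^sup>2" using assms by simp
  then show ?thesis by (simp add: power2_eq_square power3_eq_cube algebra_simps)
qed

text \<open>At frequency \<open>u / sqrt t\<close> the quadratic term of the exponent gives the
  Gaussian plus an imaginary drift of slope \<open>\<sigma>\<^sup>2 * t * \<alpha> t\<close>.
  Recentring at \<open>Y t\<close> cancels the drift up to rounding, and the cubic errors vanish by
  the two assumptions on \<alpha>.\<close>

lemma tilt_char_limit:
  fixes \<alpha> :: "real \<Rightarrow> real" and Y :: "real \<Rightarrow> int"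
  assumes p: "exp_moment p \<theta>" and \<sigma>: "\<sigma>\<^sup>2 = (\<Sum>\<^sub>\<infinity>i. (real_of_int i)\<^sup>2 * pmf p i)"
    and \<alpha>0: "(\<alpha> \<longlongrightarrow> 0) at_top" and \<alpha>3: "((\<lambda>t. t * \<bar>\<alpha> t\<bar> ^ 3) \<longlongrightarrow> 0) at_top"
    and Y: "\<forall>\<^sub>F t in at_top. \<bar>real_of_int (Y t) - \<sigma>\<^sup>2 * t * \<alpha> t\<bar> \<le> 1"
  shows "((\<lambda>t. tilt_char p t (\<alpha> t) (Y t) (u / sqrt t)) \<longlongrightarrow> of_real (exp (- (\<sigma>\<^sup>2 * u\<^sup>2 / 2)))) at_top"
proof -
  have \<theta>: "0 < \<theta>" using p by (rule exp_momentD)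
  obtain K where K: "0 \<le> K" "\<And>z. norm z \<le> \<theta> / 2 \<Longrightarrow> norm (mgf p z - 1 - of_real (\<sigma>\<^sup>2 / 2) * z\<^sup>2) \<le> K * norm z ^ 3"
    using mgf_expansion[OF p \<sigma>] by blast
  define E where "E t = of_real t * (mgf p (Complex (\<alpha> t) (u / sqrt t)) - of_real (1 + psi p (\<alpha> t)))
     - \<i> * of_real (u / sqrt t * real_of_int (Y t))" for t
  have tc: "tilt_char p t (\<alpha> t) (Y t) (u / sqrt t) = exp (E t)" for t
    unfolding tilt_char_def E_def cis_conv_exp exp_add[symmetric] by (simp add: algebra_simps)
  have u0: "((\<lambda>t. \<bar>u\<bar> / sqrt t) \<longlongrightarrow> 0) at_top"
    by (intro tendsto_divide_0[OF tendsto_const] filterlim_at_top_imp_at_infinity sqrt_at_top)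
  have ev1: "\<forall>\<^sub>F t in at_top. \<bar>\<alpha> t\<bar> + \<bar>u\<bar> / sqrt t < \<theta> / 2"
    using order_tendstoD(2)[OF tendsto_add[OF tendsto_rabs_zero[OF \<alpha>0] u0], of "\<theta> / 2"] \<theta> by simp
  \<comment> \<open>The summands bound the Taylor error at the complex argument, the Taylor error of
    the normalising exponent, and the rounding of \<open>Y\<close>.\<close>
  define R where "R t = K * (4 * (t * \<bar>\<alpha> t\<bar> ^ 3) + 4 * (\<bar>u\<bar> ^ 3 / sqrt t)) + K * (t * \<bar>\<alpha> t\<bar> ^ 3) + \<bar>u\<bar> / sqrt t" for t
  have "((\<lambda>t. \<bar>u\<bar> ^ 3 / sqrt t) \<longlongrightarrow> 0) at_top"
    by (intro tendsto_divide_0[OF tendsto_const] filterlim_at_top_imp_at_infinity sqrt_at_top)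
  then have "(R \<longlongrightarrow> K * (4 * 0 + 4 * 0) + K * 0 + 0) at_top"
    unfolding R_def by (intro tendsto_intros \<alpha>3 u0)
  then have R0: "(R \<longlongrightarrow> 0) at_top" by simp
  have "\<forall>\<^sub>F t in at_top. norm (E t - of_real (- (\<sigma>\<^sup>2 * u\<^sup>2 / 2))) \<le> R t"
    using ev1 Y eventually_gt_at_top[of 0]
  proof eventually_elim
    case (elim t)
    define z where "z = Complex (\<alpha> t) (u / sqrt t)"
    have t: "0 < t" by fact
    have zle: "norm z \<le> \<bar>\<alpha> t\<bar> + \<bar>u\<bar> / sqrt t" unfolding z_def
      using cmod_le[of "Complex (\<alpha> t) (u / sqrt t)"] t by (simp add: abs_divide)
    have zs: "norm z \<le> \<theta> / 2" using zle elim by linarith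
    have as: "\<bar>\<alpha> t\<bar> \<le> \<theta> / 2" using elim t by (smt (verit) divide_nonneg_nonneg real_sqrt_ge_zero abs_ge_zero)
    have "norm z ^ 3 \<le> (\<bar>\<alpha> t\<bar> + \<bar>u\<bar> / sqrt t) ^ 3" by (rule power_mono[OF zle]) simp
    also have "\<dots> \<le> 4 * \<bar>\<alpha> t\<bar> ^ 3 + 4 * (\<bar>u\<bar> / sqrt t) ^ 3" by (rule cube_sum_le) (use t in auto)
    finally have "t * norm z ^ 3 \<le> t * (4 * \<bar>\<alpha> t\<bar> ^ 3 + 4 * (\<bar>u\<bar> / sqrt t) ^ 3)" using t by simp
    also have "\<dots> = 4 * (t * \<bar>\<alpha> t\<bar> ^ 3) + 4 * (\<bar>u\<bar> ^ 3 / sqrt t)"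
    proof -
      have "sqrt t ^ 3 = t * sqrt t" using t by (simp add: power3_eq_cube)
      then show ?thesis using t by (simp add: power_divide algebra_simps)
    qed
    finally have tz: "t * norm z ^ 3 \<le> 4 * (t * \<bar>\<alpha> t\<bar> ^ 3) + 4 * (\<bar>u\<bar> ^ 3 / sqrt t)" .
    let ?A = "mgf p z - 1 - of_real (\<sigma>\<^sup>2 / 2) * z\<^sup>2"
    let ?B = "mgf p (of_real (\<alpha> t)) - 1 - of_real (\<sigma>\<^sup>2 / 2) * (of_real (\<alpha> t))\<^sup>2"
    have mr: "mgf p (of_real (\<alpha> t)) = of_real (1 + psi p (\<alpha> t))" by (rule mgf_real[OF p]) (use as \<theta> in linarith)
    have z2: "of_real t * z\<^sup>2 = of_real (t * (\<alpha> t)\<^sup>2 - u\<^sup>2) + \<i> * of_real (2 * \<alpha> t * u * sqrt t)"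
    proof -
      define v where "v = u / sqrt t"
      have v2: "t * (v * v) = u\<^sup>2" using t by (simp add: v_def power2_eq_square)
      have v1: "t * v = u * sqrt t" using t real_sqrt_mult_self[of t] by (simp add: v_def field_simps)
      have "t * (\<alpha> t * \<alpha> t - v * v) = t * (\<alpha> t)\<^sup>2 - u\<^sup>2"
        using v2 by (simp add: right_diff_distrib power2_eq_square)
      moreover have "t * (\<alpha> t * v + v * \<alpha> t) = 2 * \<alpha> t * (t * v)" by (simp add: algebra_simps)
      ultimately show ?thesis unfolding z_def v_def[symmetric] complex_eq_iff
        by (simp add: power2_eq_square v1)
    qed
    have st: "sqrt t = t * (1 / sqrt t)" using t real_sqrt_mult_self[of t] by (simp add: field_simps)
    have "E t - of_real (- (\<sigma>\<^sup>2 * u\<^sup>2 / 2)) = of_real t * ?A - of_real t * ?B + of_real (\<sigma>\<^sup>2 / 2) * (of_real t * z\<^sup>2)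
       - of_real (\<sigma>\<^sup>2 / 2) * of_real (t * (\<alpha> t)\<^sup>2) + of_real (\<sigma>\<^sup>2 * u\<^sup>2 / 2) - \<i> * of_real (u / sqrt t * real_of_int (Y t))"
      unfolding E_def z_def[symmetric] mr[symmetric] by (simp add: algebra_simps)
    also have "\<dots> = of_real t * ?A - of_real t * ?B + \<i> * of_real (u / sqrt t * (\<sigma>\<^sup>2 * t * \<alpha> t - real_of_int (Y t)))"
    proof -
      have "u / sqrt t * (\<sigma>\<^sup>2 * t * \<alpha> t) = \<sigma>\<^sup>2 / 2 * (2 * \<alpha> t * u * sqrt t)" by (subst (2) st) simp
      then show ?thesis unfolding z2 by (simp add: complex_eq_iff algebra_simps)
    qed
    finally have E: "E t - of_real (- (\<sigma>\<^sup>2 * u\<^sup>2 / 2)) = of_real t * ?A - of_real t * ?B + \<i> * of_real (u / sqrt t * (\<sigma>\<^sup>2 * t * \<alpha> t - real_of_int (Y t)))" .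
    have "norm (of_real t * ?A) \<le> K * (4 * (t * \<bar>\<alpha> t\<bar> ^ 3) + 4 * (\<bar>u\<bar> ^ 3 / sqrt t))"
    proof -
      have "norm (of_real t * ?A) \<le> t * (K * norm z ^ 3)"
        using K(2)[OF zs] t by (simp add: norm_mult)
      also have "\<dots> = K * (t * norm z ^ 3)" by simp
      finally show ?thesis using mult_left_mono[OF tz K(1)] by linarith
    qed
    moreover have "norm (of_real t * ?B) \<le> K * (t * \<bar>\<alpha> t\<bar> ^ 3)"
      using K(2)[of "of_real (\<alpha> t)"] as t by (simp add: norm_mult mult.left_commute)
    moreover have "norm (\<i> * of_real (u / sqrt t * (\<sigma>\<^sup>2 * t * \<alpha> t - real_of_int (Y t))) :: complex) \<le> \<bar>u\<bar> / sqrt t"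
    proof -
      have "\<bar>u\<bar> / sqrt t * \<bar>\<sigma>\<^sup>2 * t * \<alpha> t - real_of_int (Y t)\<bar> \<le> \<bar>u\<bar> / sqrt t * 1"
        using elim t by (intro mult_left_mono) (auto simp: abs_minus_commute)
      then show ?thesis using t unfolding norm_mult norm_of_real by (simp add: abs_mult)
    qed
    ultimately show ?case unfolding E R_def
      by (intro order.trans[OF norm_triangle_ineq] order.trans[OF add_right_mono[OF norm_triangle_ineq4]]) linarith
  qed
  then have "((\<lambda>t. E t - of_real (- (\<sigma>\<^sup>2 * u\<^sup>2 / 2))) \<longlongrightarrow> 0) at_top"
    by (rule Lim_null_comparison[OF _ R0])
  then have "(E \<longlongrightarrow> of_real (- (\<sigma>\<^sup>2 * u\<^sup>2 / 2))) at_top" by (rule LIM_zero_cancel)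
  then have "((\<lambda>t. exp (E t)) \<longlongrightarrow> exp (of_real (- (\<sigma>\<^sup>2 * u\<^sup>2 / 2)))) at_top" by (rule tendsto_exp)
  then show ?thesis unfolding tc exp_of_real .
qed

text \<open>Rescale the inversion integral by \<open>sqrt t\<close> and use dominated convergence.
  The Gaussian majorant comes from \<open>mgf_decay\<close> and \<open>cgap_lower\<close>, whose
  constant does not depend on the moving tilt.\<close>

lemma tilt_limit:
  fixes \<alpha> :: "real \<Rightarrow> real" and Y :: "real \<Rightarrow> int"
  assumes irr: "irreducible_walk p" and p: "exp_moment p \<theta>"
    and \<sigma>: "\<sigma>\<^sup>2 = (\<Sum>\<^sub>\<infinity>i. (real_of_int i)\<^sup>2 * pmf p i)" "0 < \<sigma>"
    and \<alpha>0: "(\<alpha> \<longlongrightarrow> 0) at_top" and \<alpha>3: "((\<lambda>t. t * \<bar>\<alpha> t\<bar> ^ 3) \<longlongrightarrow> 0) at_top"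
    and Y: "\<forall>\<^sub>F t in at_top. \<bar>real_of_int (Y t) - \<sigma>\<^sup>2 * t * \<alpha> t\<bar> \<le> 1"
  shows "((\<lambda>t. sqrt t * tilt p t (\<alpha> t) (Y t)) \<longlongrightarrow> 1 / (\<sigma> * sqrt (2 * pi))) at_top"
proof -
  have \<theta>: "0 < \<theta>" using p by (rule exp_momentD)
  obtain \<kappa> where \<kappa>: "0 < \<kappa>" "\<And>\<xi>. \<bar>\<xi>\<bar> \<le> pi \<Longrightarrow> \<kappa> * \<xi>\<^sup>2 \<le> cgap p \<xi>" using cgap_lower[OF irr] by metis
  \<comment> \<open>Measurability of the integrand is demanded for every \<open>t\<close>, but the
    tilt is admissible only eventually; elsewhere \<open>s\<close> is set to
    \<open>0\<close>.\<close>
  define good where "good t \<longleftrightarrow> 0 < t \<and> \<bar>\<alpha> t\<bar> \<le> \<theta>" for t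
  have evg: "\<forall>\<^sub>F t in at_top. good t"
    using order_tendstoD(2)[OF tendsto_rabs_zero[OF \<alpha>0] \<theta>] eventually_gt_at_top[of 0]
    by eventually_elim (auto simp: good_def)
  define f where "f t \<xi> = indicat_real {- pi..pi} \<xi> *\<^sub>R tilt_char p t (\<alpha> t) (Y t) \<xi>" for t \<xi>
  define s where "s t u = (if good t then f t (u / sqrt t) else 0)" for t u
  have fm: "f t \<in> borel_measurable lborel" if "good t" for t
    using tilt_char_set_integrable[OF p, of "\<alpha> t" t "Y t"] that unfolding f_def set_integrable_def good_def by auto
  have "((\<lambda>t. \<integral>u. s t u \<partial>lborel) \<longlongrightarrow> (\<integral>u. of_real (exp (- (\<sigma>\<^sup>2 * u\<^sup>2 / 2))) \<partial>lborel)) at_top"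
  proof (rule integral_dominated_convergence_at_top[where w = "\<lambda>u. exp (- (2 * \<kappa> * u\<^sup>2 / 2))"])
    show "(\<lambda>u. complex_of_real (exp (- (\<sigma>\<^sup>2 * u\<^sup>2 / 2)))) \<in> borel_measurable lborel" by measurable
    show "s t \<in> borel_measurable lborel" for t
    proof (cases "good t")
      case True
      have "(\<lambda>u. f t (u / sqrt t)) \<in> borel_measurable lborel"
        by (rule measurable_compose[OF _ fm[OF True]]) simp
      moreover have "s t = (\<lambda>u. f t (u / sqrt t))" using True by (simp add: s_def fun_eq_iff)
      ultimately show ?thesis by simp
    next
      case False
      then have "s t = (\<lambda>u. 0)" by (simp add: s_def fun_eq_iff)
      then show ?thesis by simp
    qed
    show "integrable lborel (\<lambda>u. exp (- (2 * \<kappa> * u\<^sup>2 / 2)))"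
      by (rule gaussian_integral(1)) (use \<kappa> in simp)
    show "\<forall>\<^sub>F t in at_top. AE u in lborel. norm (s t u) \<le> exp (- (2 * \<kappa> * u\<^sup>2 / 2))"
      using evg
    proof eventually_elim
      case (elim t)
      then have t: "0 < t" "\<bar>\<alpha> t\<bar> \<le> \<theta>" by (auto simp: good_def)
      show ?case
      proof (rule AE_I2)
        fix u :: real
        show "norm (s t u) \<le> exp (- (2 * \<kappa> * u\<^sup>2 / 2))"
        proof (cases "u / sqrt t \<in> {- pi..pi}")
          case True
          then have "\<bar>u / sqrt t\<bar> \<le> pi" by auto
          from norm_tilt_char_le[OF p t(2) less_imp_le[OF t(1)] \<kappa>(2) this, of "Y t"]
          have "norm (tilt_char p t (\<alpha> t) (Y t) (u / sqrt t)) \<le> exp (- (t * (\<kappa> * (u / sqrt t)\<^sup>2)))" by simp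
          also have "t * (\<kappa> * (u / sqrt t)\<^sup>2) = \<kappa> * u\<^sup>2" using t by (simp add: power_divide)
          finally show ?thesis using True elim by (simp add: s_def f_def)
        qed (use elim in \<open>simp add: s_def f_def\<close>)
      qed
    qed
    show "AE u in lborel. ((\<lambda>t. s t u) \<longlongrightarrow> of_real (exp (- (\<sigma>\<^sup>2 * u\<^sup>2 / 2)))) at_top"
    proof (rule AE_I2)
      fix u :: real
      have "((\<lambda>t. \<bar>u\<bar> / sqrt t) \<longlongrightarrow> 0) at_top"
        by (intro tendsto_divide_0[OF tendsto_const] filterlim_at_top_imp_at_infinity sqrt_at_top)
      from order_tendstoD(2)[OF this pi_gt_zero]
      have "\<forall>\<^sub>F t in at_top. s t u = tilt_char p t (\<alpha> t) (Y t) (u / sqrt t)"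
        using evg
      proof eventually_elim
        case (elim t)
        then have "\<bar>u / sqrt t\<bar> \<le> pi" by (simp add: good_def)
        then have "u / sqrt t \<in> {- pi..pi}" unfolding abs_le_iff atLeastAtMost_iff by linarith
        then show ?case using elim by (simp add: s_def f_def)
      qed
      then show "((\<lambda>t. s t u) \<longlongrightarrow> of_real (exp (- (\<sigma>\<^sup>2 * u\<^sup>2 / 2)))) at_top"
        using tilt_char_limit[OF p \<sigma>(1) \<alpha>0 \<alpha>3 Y, of u] by (simp add: tendsto_cong)
    qed
  qed
  also have "(\<integral>u. complex_of_real (exp (- (\<sigma>\<^sup>2 * u\<^sup>2 / 2))) \<partial>lborel) = of_real (sqrt (2 * pi / \<sigma>\<^sup>2))"
  proof -
    have "0 < \<sigma>\<^sup>2" using \<sigma>(2) by simp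
    from gaussian_integral(2)[OF this] show ?thesis by (subst integral_complex_of_real) (simp only:)
  qed
  finally have lim: "((\<lambda>t. \<integral>u. s t u \<partial>lborel) \<longlongrightarrow> of_real (sqrt (2 * pi / \<sigma>\<^sup>2))) at_top" .
  have "\<forall>\<^sub>F t in at_top. (\<integral>u. s t u \<partial>lborel) = of_real (2 * pi * (sqrt t * tilt p t (\<alpha> t) (Y t)))"
    using evg
  proof eventually_elim
    case (elim t)
    then have t: "0 < t" "\<bar>\<alpha> t\<bar> \<le> \<theta>" by (auto simp: good_def)
    have "2 * of_real pi * of_real (tilt p t (\<alpha> t) (Y t)) = (\<integral>\<xi>. f t \<xi> \<partial>lborel)"
      using tilt_Lebesgue[OF p t(2) less_imp_le[OF t(1)], of "Y t"] by (simp add: f_def set_lebesgue_integral_def)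
    also have "\<dots> = \<bar>1 / sqrt t\<bar> *\<^sub>R (\<integral>u. f t (0 + 1 / sqrt t * u) \<partial>lborel)"
      by (rule lborel_integral_real_affine) (use t in simp)
    also have "(\<lambda>u. f t (0 + 1 / sqrt t * u)) = s t" using elim by (auto simp: s_def)
    finally have "(\<integral>u. s t u \<partial>lborel) = sqrt t *\<^sub>R (2 * of_real pi * of_real (tilt p t (\<alpha> t) (Y t)))"
      using t by simp
    then show ?case by (simp add: scaleR_conv_of_real mult_ac)
  qed
  with lim have "((\<lambda>t. complex_of_real (2 * pi * (sqrt t * tilt p t (\<alpha> t) (Y t)))) \<longlongrightarrow> of_real (sqrt (2 * pi / \<sigma>\<^sup>2))) at_top"
    by (rule Lim_transform_eventually)
  then have "((\<lambda>t. 2 * pi * (sqrt t * tilt p t (\<alpha> t) (Y t))) \<longlongrightarrow> sqrt (2 * pi / \<sigma>\<^sup>2)) at_top"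
    by (simp only: tendsto_of_real_iff)
  from tendsto_mult[OF tendsto_const[of "1 / (2 * pi)"] this]
  have "((\<lambda>t. sqrt t * tilt p t (\<alpha> t) (Y t)) \<longlongrightarrow> 1 / (2 * pi) * sqrt (2 * pi / \<sigma>\<^sup>2)) at_top" by simp
  moreover have "1 / (2 * pi) * sqrt (2 * pi / \<sigma>\<^sup>2) = 1 / (\<sigma> * sqrt (2 * pi))"
    using \<sigma>(2) real_sqrt_mult_self[of "2 * pi"] by (simp add: real_sqrt_divide field_simps del: real_sqrt_mult_self real_sqrt_mult)
  ultimately show ?thesis by simp
qed

lemma psi_expansion:
  assumes p: "exp_moment p \<theta>" and \<sigma>: "\<sigma>\<^sup>2 = (\<Sum>\<^sub>\<infinity>i. (real_of_int i)\<^sup>2 * pmf p i)"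
  obtains K where "0 \<le> K" "\<And>a. \<bar>a\<bar> \<le> \<theta> / 2 \<Longrightarrow> \<bar>psi p a - \<sigma>\<^sup>2 / 2 * a\<^sup>2\<bar> \<le> K * \<bar>a\<bar> ^ 3"
proof -
  obtain K where K: "0 \<le> K" "\<And>z. norm z \<le> \<theta> / 2 \<Longrightarrow> norm (mgf p z - 1 - of_real (\<sigma>\<^sup>2 / 2) * z\<^sup>2) \<le> K * norm z ^ 3"
    using mgf_expansion[OF p \<sigma>] by blast
  have "\<bar>psi p a - \<sigma>\<^sup>2 / 2 * a\<^sup>2\<bar> \<le> K * \<bar>a\<bar> ^ 3" if a: "\<bar>a\<bar> \<le> \<theta> / 2" for a
  proof -
    have "\<bar>a\<bar> \<le> \<theta>" using a exp_momentD(2)[OF p] by linarith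
    from mgf_real[OF p this] have "mgf p (of_real a) - 1 - of_real (\<sigma>\<^sup>2 / 2) * (of_real a)\<^sup>2 = of_real (psi p a - \<sigma>\<^sup>2 / 2 * a\<^sup>2)"
      by simp
    then show ?thesis using K(2)[of "of_real a"] a by (simp only: norm_of_real)
  qed
  with K(1) show ?thesis using that by blast
qed

section \<open>Sums of the heat kernel over a half-line\<close>

lemma geometric_sums':
  fixes x :: real
  assumes "0 < x" "x < 1"
  shows "(\<lambda>n. x ^ Suc n) sums (x / (1 - x))" "(\<lambda>n. real (Suc n) * x ^ Suc n) sums (x / (1 - x)\<^sup>2)"
proof -
  have n: "norm x < 1" using assms by simp
  show "(\<lambda>n. x ^ Suc n) sums (x / (1 - x))"
    using sums_mult[OF geometric_sums[OF n], of x] by simp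
  show "(\<lambda>n. real (Suc n) * x ^ Suc n) sums (x / (1 - x)\<^sup>2)"
    using sums_mult[OF geometric_deriv_sums[OF n], of x] by (simp add: mult_ac)
qed

lemma tilt_le_1: "exp_moment p \<theta> \<Longrightarrow> \<bar>\<alpha>\<bar> \<le> \<theta> \<Longrightarrow> 0 \<le> t \<Longrightarrow> tilt p t \<alpha> j \<le> 1"
  using finite_sum_le_has_sum[OF tilt_sum, of p \<theta> \<alpha> t "{j}"] tilt_nonneg[of p \<theta> \<alpha> t] by auto

text \<open>Undoing the tilt turns the tail sum into a geometric series in \<open>x\<close>.
  Replacing each tilted probability by the one at \<open>Y\<close> costs the Lipschitz error, which
  adds up to two mean distances: \<open>1 / (1 - x)\<close> for the target sites and
  \<open>W1 / W\<close> for the initial sites.\<close>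

lemma tail_expansion:
  fixes r :: "nat \<Rightarrow> real" and N :: nat
  assumes p: "exp_moment p \<theta>" and a: "0 < \<alpha>" "\<alpha> \<le> \<theta>" and t: "0 < t" and r: "\<And>k. 0 \<le> r k"
    and C: "0 \<le> C" "\<And>j l. \<bar>sqrt t * tilt p t \<alpha> (j + int l) - sqrt t * tilt p t \<alpha> j\<bar> \<le> C * real l / sqrt t"
  defines "x \<equiv> exp (- \<alpha>)"
  defines "W \<equiv> \<Sum>k\<le>N. r k * x ^ k" and "W1 \<equiv> \<Sum>k\<le>N. r k * (real k * x ^ k)"
  assumes W: "0 < W"
  shows "\<And>k. summable (\<lambda>n. heat p t (Y + 1 + int n + int k))"
    and "\<bar>sqrt t * (\<Sum>k\<le>N. r k * (\<Sum>n. heat p t (Y + 1 + int n + int k))) * exp (\<alpha> * real_of_int Y - t * psi p \<alpha>) / (W * (x / (1 - x)))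
       - sqrt t * tilt p t \<alpha> Y\<bar> \<le> C * (1 / (1 - x)) / sqrt t + C * (W1 / W) / sqrt t"
proof -
  have a': "\<bar>\<alpha>\<bar> \<le> \<theta>" and t0: "0 \<le> t" using a t by auto
  have x: "0 < x" "x < 1" using a by (auto simp: x_def)
  define E where "E = exp (\<alpha> * real_of_int Y - t * psi p \<alpha>)"
  define S0 where "S0 = sqrt t * tilt p t \<alpha> Y"
  define M where "M = x / (1 - x)"
  define M1 where "M1 = x / (1 - x)\<^sup>2"
  have M: "0 < M" using x by (simp add: M_def)
  have E: "0 < E" by (simp add: E_def)
  \<comment> \<open>The target \<open>Y + 1 + n\<close> and the initial site \<open>- k\<close> are
    \<open>n + 1 + k\<close> steps away from the reference displacement \<open>Y\<close>, hence the
    exponents \<open>Suc n\<close> and \<open>k\<close>.\<close>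
  have heq: "E * heat p t (Y + 1 + int n + int k) = x ^ k * (x ^ Suc n * tilt p t \<alpha> (Y + int (Suc n + k)))" for n k
  proof -
    have "x ^ k * x ^ Suc n = exp (- (\<alpha> * real (Suc n + k)))"
      unfolding x_def exp_of_nat_mult[symmetric] exp_add[symmetric] by (simp add: algebra_simps)
    then have "x ^ k * (x ^ Suc n * tilt p t \<alpha> (Y + int (Suc n + k)))
       = exp (- (\<alpha> * real (Suc n + k))) * exp (\<alpha> * real_of_int (Y + int (Suc n + k)) - t * psi p \<alpha>) * heat p t (Y + int (Suc n + k))"
      by (simp only: tilt_def mult.assoc[symmetric])
    also have "exp (- (\<alpha> * real (Suc n + k))) * exp (\<alpha> * real_of_int (Y + int (Suc n + k)) - t * psi p \<alpha>) = E"
      unfolding E_def exp_add[symmetric] by (simp add: algebra_simps)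
    finally have "x ^ k * (x ^ Suc n * tilt p t \<alpha> (Y + int (Suc n + k))) = E * heat p t (Y + int (Suc n + k))" .
    moreover have "Y + int (Suc n + k) = Y + 1 + int n + int k" by simp
    ultimately show ?thesis by (simp only:)
  qed
  have sm: "summable (\<lambda>n. x ^ Suc n * tilt p t \<alpha> (Y + int (Suc n + k)))" for k
  proof (rule summable_comparison_test'[of "\<lambda>n. x ^ Suc n" 0])
    show "summable (\<lambda>n. x ^ Suc n)" using geometric_sums'(1)[OF x] by (rule sums_summable)
    show "norm (x ^ Suc n * tilt p t \<alpha> (Y + int (Suc n + k))) \<le> x ^ Suc n" for n
      using tilt_le_1[OF p a' t0, of "Y + int (Suc n + k)"] tilt_nonneg[OF p a' t0, of "Y + int (Suc n + k)"] x
      by (simp add: abs_mult mult_left_le del: power_Suc)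
  qed
  show hs: "summable (\<lambda>n. heat p t (Y + 1 + int n + int k))" for k
  proof -
    have "summable (\<lambda>n. x ^ k * (x ^ Suc n * tilt p t \<alpha> (Y + int (Suc n + k))))" by (intro summable_mult sm)
    then have "summable (\<lambda>n. E * heat p t (Y + 1 + int n + int k))" by (simp only: heq)
    then show ?thesis using E by (simp add: summable_cmult_iff)
  qed
  have inner: "\<bar>sqrt t * (E * (\<Sum>n. heat p t (Y + 1 + int n + int k))) - x ^ k * (M * S0)\<bar> \<le> x ^ k * ((C / sqrt t) * (M1 + real k * M))" for k
  proof -
    let ?f = "\<lambda>n. x ^ Suc n * (sqrt t * tilt p t \<alpha> (Y + int (Suc n + k)))"
    have e1: "sqrt t * (E * (\<Sum>n. heat p t (Y + 1 + int n + int k))) = x ^ k * (\<Sum>n. ?f n)"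
    proof -
      have "E * (\<Sum>n. heat p t (Y + 1 + int n + int k)) = (\<Sum>n. E * heat p t (Y + 1 + int n + int k))"
        by (rule suminf_mult[OF hs, symmetric])
      also have "\<dots> = x ^ k * (\<Sum>n. x ^ Suc n * tilt p t \<alpha> (Y + int (Suc n + k)))"
        unfolding heq by (rule suminf_mult[OF sm])
      finally have "sqrt t * (E * (\<Sum>n. heat p t (Y + 1 + int n + int k))) = x ^ k * (sqrt t * (\<Sum>n. x ^ Suc n * tilt p t \<alpha> (Y + int (Suc n + k))))"
        by (simp only: mult.left_commute)
      also have "sqrt t * (\<Sum>n. x ^ Suc n * tilt p t \<alpha> (Y + int (Suc n + k))) = (\<Sum>n. ?f n)"
        unfolding suminf_mult[OF sm, symmetric] by (simp only: mult.left_commute)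
      finally show ?thesis .
    qed
    have sf: "summable ?f" using summable_mult[OF sm, of "sqrt t" k] by (simp only: mult.left_commute)
    have "(\<lambda>n. ?f n - x ^ Suc n * S0) sums ((\<Sum>n. ?f n) - M * S0)"
      unfolding M_def by (intro sums_diff summable_sums[OF sf] sums_mult2 geometric_sums'(1)[OF x])
    moreover have "(\<lambda>n. (C / sqrt t) * (real (Suc n) * x ^ Suc n + real k * x ^ Suc n)) sums ((C / sqrt t) * (M1 + real k * M))"
      unfolding M_def M1_def by (intro sums_mult sums_add geometric_sums'[OF x])
    moreover have "\<bar>?f n - x ^ Suc n * S0\<bar> \<le> (C / sqrt t) * (real (Suc n) * x ^ Suc n + real k * x ^ Suc n)" for n
    proof -
      have "\<bar>?f n - x ^ Suc n * S0\<bar> = x ^ Suc n * \<bar>sqrt t * tilt p t \<alpha> (Y + int (Suc n + k)) - S0\<bar>"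
        using x unfolding right_diff_distrib[symmetric] by (simp add: abs_mult)
      also have "\<dots> \<le> x ^ Suc n * (C * real (Suc n + k) / sqrt t)"
        unfolding S0_def by (intro mult_left_mono C(2)) (use x in auto)
      finally show ?thesis by (simp add: algebra_simps add_divide_distrib)
    qed
    ultimately have "\<bar>(\<Sum>n. ?f n) - M * S0\<bar> \<le> (C / sqrt t) * (M1 + real k * M)"
    proof -
      assume 1: "(\<lambda>n. ?f n - x ^ Suc n * S0) sums ((\<Sum>n. ?f n) - M * S0)"
        and 2: "(\<lambda>n. (C / sqrt t) * (real (Suc n) * x ^ Suc n + real k * x ^ Suc n)) sums ((C / sqrt t) * (M1 + real k * M))"
        and 3: "\<And>n. \<bar>?f n - x ^ Suc n * S0\<bar> \<le> (C / sqrt t) * (real (Suc n) * x ^ Suc n + real k * x ^ Suc n)"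
      have "(\<Sum>n. ?f n) - M * S0 \<le> (C / sqrt t) * (M1 + real k * M)"
        by (rule sums_le[OF _ 1 2]) (use 3 in \<open>meson abs_le_D1\<close>)
      moreover have "- ((\<Sum>n. ?f n) - M * S0) \<le> (C / sqrt t) * (M1 + real k * M)"
        by (rule sums_le[OF _ sums_minus[OF 1] 2]) (use 3 in \<open>meson abs_le_D2\<close>)
      ultimately show ?thesis by (rule abs_leI)
    qed
    then have "x ^ k * \<bar>(\<Sum>n. ?f n) - M * S0\<bar> \<le> x ^ k * ((C / sqrt t) * (M1 + real k * M))"
      using x by (intro mult_left_mono) auto
    moreover have "\<bar>x ^ k * (\<Sum>n. ?f n) - x ^ k * (M * S0)\<bar> = x ^ k * \<bar>(\<Sum>n. ?f n) - M * S0\<bar>"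
      unfolding right_diff_distrib[symmetric] using x by (simp add: abs_mult)
    ultimately show ?thesis unfolding e1 by linarith
  qed
  define T where "T = sqrt t * (\<Sum>k\<le>N. r k * (\<Sum>n. heat p t (Y + 1 + int n + int k))) * E"
  have "T - W * (M * S0) = (\<Sum>k\<le>N. r k * (sqrt t * (E * (\<Sum>n. heat p t (Y + 1 + int n + int k))) - x ^ k * (M * S0)))"
    unfolding T_def W_def by (simp add: sum_distrib_left sum_distrib_right sum_subtractf right_diff_distrib mult_ac)
  also have "\<bar>\<dots>\<bar> \<le> (\<Sum>k\<le>N. r k * (x ^ k * ((C / sqrt t) * (M1 + real k * M))))"
    by (rule order.trans[OF sum_abs], rule sum_mono) (simp only: abs_mult abs_of_nonneg[OF r] mult_left_mono[OF inner r])
  also have "\<dots> = (C / sqrt t) * (W * M1 + W1 * M)"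
    unfolding W_def W1_def by (simp add: sum_distrib_left sum_distrib_right sum.distrib algebra_simps)
  finally have b: "\<bar>T - W * (M * S0)\<bar> \<le> (C / sqrt t) * (W * M1 + W1 * M)" .
  have WM: "0 < W * M" using W M by simp
  have "T / (W * M) - S0 = (T - W * (M * S0)) / (W * M)" using W M by (simp add: diff_divide_distrib)
  also have "\<bar>\<dots>\<bar> \<le> (C / sqrt t) * (W * M1 + W1 * M) / (W * M)"
    unfolding abs_divide abs_of_pos[OF WM] by (rule divide_right_mono[OF b less_imp_le[OF WM]])
  also have "\<dots> = C * (M1 / M) / sqrt t + C * (W1 / W) / sqrt t"
    using W M t by (simp add: field_simps)
  also have "M1 / M = 1 / (1 - x)" using x by (simp add: M1_def M_def power2_eq_square)
  finally show "\<bar>sqrt t * (\<Sum>k\<le>N. r k * (\<Sum>n. heat p t (Y + 1 + int n + int k))) * exp (\<alpha> * real_of_int Y - t * psi p \<alpha>) / (W * (x / (1 - x)))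
       - sqrt t * tilt p t \<alpha> Y\<bar> \<le> C * (1 / (1 - x)) / sqrt t + C * (W1 / W) / sqrt t"
    unfolding T_def E_def M_def S0_def .
qed

text \<open>The relevant target sites lie within order \<open>1 / \<alpha> t\<close> of
  \<open>Y t\<close>. The assumptions make this distance and \<open>W1 t / W t\<close> of smaller
  order than \<open>sqrt t\<close>, so the local limit at the single site \<open>Y t\<close>
  determines the whole sum.\<close>

lemma tail_limit:
  fixes \<alpha> :: "real \<Rightarrow> real" and Y :: "real \<Rightarrow> int" and N :: "real \<Rightarrow> nat" and r :: "nat \<Rightarrow> real"
  assumes irr: "irreducible_walk p" and p: "exp_moment p \<theta>"
    and \<sigma>: "\<sigma>\<^sup>2 = (\<Sum>\<^sub>\<infinity>i. (real_of_int i)\<^sup>2 * pmf p i)" "0 < \<sigma>"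
    and \<alpha>0: "filterlim \<alpha> (at_right 0) at_top" and \<alpha>1: "filterlim (\<lambda>t. \<alpha> t * sqrt t) at_top at_top"
    and \<alpha>3: "((\<lambda>t. t * \<alpha> t ^ 3) \<longlongrightarrow> 0) at_top"
    and Y: "\<forall>\<^sub>F t in at_top. \<bar>real_of_int (Y t) - \<sigma>\<^sup>2 * t * \<alpha> t\<bar> \<le> 1"
    and r: "\<And>k. 0 \<le> r k" "r 0 = 1"
  defines "W \<equiv> \<lambda>t. \<Sum>k\<le>N t. r k * exp (- \<alpha> t) ^ k" and "W1 \<equiv> \<lambda>t. \<Sum>k\<le>N t. r k * (real k * exp (- \<alpha> t) ^ k)"
  assumes W1: "((\<lambda>t. W1 t / W t / sqrt t) \<longlongrightarrow> 0) at_top"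
  defines "lam \<equiv> \<lambda>t. \<Sum>k\<le>N t. r k * (\<Sum>n. heat p t (Y t + 1 + int n + int k))"
  shows "((\<lambda>t. lam t * (\<sigma> * sqrt (2 * pi) * sqrt t * \<alpha> t * exp (\<sigma>\<^sup>2 * t * (\<alpha> t)\<^sup>2 / 2)) / W t) \<longlongrightarrow> 1) at_top"
proof -
  have \<theta>: "0 < \<theta>" using p by (rule exp_momentD)
  have a0: "(\<alpha> \<longlongrightarrow> 0) at_top" and apos: "\<forall>\<^sub>F t in at_top. 0 < \<alpha> t"
    using \<alpha>0 by (auto simp: filterlim_at elim: eventually_mono)
  have asm: "\<forall>\<^sub>F t in at_top. \<alpha> t < \<theta> / 2" by (rule order_tendstoD(2)[OF a0]) (use \<theta> in simp)
  have \<alpha>3': "((\<lambda>t. t * \<bar>\<alpha> t\<bar> ^ 3) \<longlongrightarrow> 0) at_top"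
    by (rule Lim_transform_eventually[OF \<alpha>3]) (use apos in \<open>auto elim!: eventually_mono\<close>)
  have tl: "((\<lambda>t. sqrt t * tilt p t (\<alpha> t) (Y t)) \<longlongrightarrow> 1 / (\<sigma> * sqrt (2 * pi))) at_top"
    by (rule tilt_limit[OF irr p \<sigma> a0 \<alpha>3' Y])
  obtain C where C: "0 \<le> C" "\<And>\<alpha> t j l. \<bar>\<alpha>\<bar> \<le> \<theta> \<Longrightarrow> 0 < t \<Longrightarrow>
    \<bar>sqrt t * tilt p t \<alpha> (j + int l) - sqrt t * tilt p t \<alpha> j\<bar> \<le> C * real l / sqrt t"
    using tilt_Lipschitz[OF irr p] by blast
  obtain K where K: "0 \<le> K" "\<And>a. \<bar>a\<bar> \<le> \<theta> / 2 \<Longrightarrow> \<bar>psi p a - \<sigma>\<^sup>2 / 2 * a\<^sup>2\<bar> \<le> K * \<bar>a\<bar> ^ 3"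
    using psi_expansion[OF p \<sigma>(1)] by blast
  have Wpos: "1 \<le> W t" for t
  proof -
    have "(\<Sum>k\<in>{0}. r k * exp (- \<alpha> t) ^ k) \<le> W t" unfolding W_def by (rule sum_mono2) (use r in auto)
    then show ?thesis using r by simp
  qed
  define x where "x t = exp (- \<alpha> t)" for t
  define Q where "Q t = sqrt t * lam t * exp (\<alpha> t * real_of_int (Y t) - t * psi p (\<alpha> t)) / (W t * (x t / (1 - x t)))" for t
  define R where "R t = C * (\<alpha> t * (1 / (1 - x t))) / (\<alpha> t * sqrt t) + C * (W1 t / W t / sqrt t)" for t
  have xl: "((\<lambda>t. \<alpha> t * (1 / (1 - x t))) \<longlongrightarrow> 1) at_top" unfolding x_def
    by (rule filterlim_compose[OF _ \<alpha>0, where g = "\<lambda>a. a * (1 / (1 - exp (- a)))"]) real_asymp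
  have "((\<lambda>t. C * (\<alpha> t * (1 / (1 - x t))) / (\<alpha> t * sqrt t)) \<longlongrightarrow> 0) at_top"
    by (rule tendsto_divide_0[OF tendsto_mult[OF tendsto_const xl]]) (rule filterlim_at_top_imp_at_infinity[OF \<alpha>1])
  from tendsto_add[OF this tendsto_mult[OF tendsto_const[of C] W1]]
  have R0: "(R \<longlongrightarrow> 0) at_top" unfolding R_def by simp
  have "\<forall>\<^sub>F t in at_top. norm (Q t - sqrt t * tilt p t (\<alpha> t) (Y t)) \<le> R t"
    using apos asm eventually_gt_at_top[of 0]
  proof eventually_elim
    case (elim t)
    have "\<bar>\<alpha> t\<bar> \<le> \<theta>" using elim \<theta> by linarith
    then have "\<bar>Q t - sqrt t * tilt p t (\<alpha> t) (Y t)\<bar> \<le> C * (1 / (1 - x t)) / sqrt t + C * (W1 t / W t) / sqrt t"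
      unfolding Q_def lam_def W_def W1_def x_def
      by (intro tail_expansion(2)[OF p elim(1) _ elim(3) r(1) C(1) C(2)])
         (use elim Wpos[of t] \<theta> in \<open>auto simp: W_def\<close>)
    also have "\<dots> = R t" using elim by (simp add: R_def)
    finally show ?case by simp
  qed
  from Lim_null_comparison[OF this R0] tl
  have Ql: "(Q \<longlongrightarrow> 1 / (\<sigma> * sqrt (2 * pi))) at_top"
    using tendsto_add[of "\<lambda>t. Q t - sqrt t * tilt p t (\<alpha> t) (Y t)" 0 at_top "\<lambda>t. sqrt t * tilt p t (\<alpha> t) (Y t)"] by simp
  \<comment> \<open>Discrepancy between the exponent of the tilt and its Gaussian value: the
    rounding of \<open>Y\<close> contributes at most \<alpha>, and the cubic error of
    \<open>psi\<close> at most \<open>K * (t * \<alpha> t ^ 3)\<close>.\<close>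
  define e where "e t = \<sigma>\<^sup>2 * t * (\<alpha> t)\<^sup>2 / 2 - \<alpha> t * real_of_int (Y t) + t * psi p (\<alpha> t)" for t
  have e0: "(e \<longlongrightarrow> 0) at_top"
  proof (rule Lim_null_comparison)
    show "\<forall>\<^sub>F t in at_top. norm (e t) \<le> \<alpha> t + K * (t * \<alpha> t ^ 3)"
      using apos asm eventually_gt_at_top[of 0] Y
    proof eventually_elim
      case (elim t)
      have "e t = \<alpha> t * (\<sigma>\<^sup>2 * t * \<alpha> t - real_of_int (Y t)) + t * (psi p (\<alpha> t) - \<sigma>\<^sup>2 / 2 * (\<alpha> t)\<^sup>2)"
        by (simp add: e_def algebra_simps power2_eq_square)
      moreover have "\<bar>\<alpha> t * (\<sigma>\<^sup>2 * t * \<alpha> t - real_of_int (Y t))\<bar> \<le> \<alpha> t * 1"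
        unfolding abs_mult using elim by (intro mult_mono) (auto simp: abs_minus_commute)
      moreover have "\<bar>t * (psi p (\<alpha> t) - \<sigma>\<^sup>2 / 2 * (\<alpha> t)\<^sup>2)\<bar> \<le> t * (K * \<alpha> t ^ 3)"
        unfolding abs_mult using elim K(2)[of "\<alpha> t"] by (intro mult_mono) auto
      ultimately show ?case by (simp add: mult.left_commute)
    qed
    have "((\<lambda>t. \<alpha> t + K * (t * \<alpha> t ^ 3)) \<longlongrightarrow> 0 + K * 0) at_top" by (intro tendsto_intros a0 \<alpha>3)
    then show "((\<lambda>t. \<alpha> t + K * (t * \<alpha> t ^ 3)) \<longlongrightarrow> 0) at_top" by simp
  qed
  have xx: "((\<lambda>t. \<alpha> t * (1 / (1 - x t)) * x t) \<longlongrightarrow> 1 * exp (- 0)) at_top"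
    unfolding x_def by (intro tendsto_mult[OF xl[unfolded x_def]] tendsto_exp tendsto_minus a0)
  have "((\<lambda>t. Q t * (\<sigma> * sqrt (2 * pi)) * (\<alpha> t * (1 / (1 - x t)) * x t) * exp (e t)) \<longlongrightarrow>
      1 / (\<sigma> * sqrt (2 * pi)) * (\<sigma> * sqrt (2 * pi)) * (1 * exp (- 0)) * exp 0) at_top"
    by (rule tendsto_mult[OF tendsto_mult[OF tendsto_mult[OF Ql tendsto_const] xx] tendsto_exp[OF e0]])
  then have "((\<lambda>t. Q t * (\<sigma> * sqrt (2 * pi)) * (\<alpha> t * (1 / (1 - x t)) * x t) * exp (e t)) \<longlongrightarrow> 1) at_top"
    using \<sigma>(2) by simp
  moreover have "\<forall>\<^sub>F t in at_top. Q t * (\<sigma> * sqrt (2 * pi)) * (\<alpha> t * (1 / (1 - x t)) * x t) * exp (e t)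
      = lam t * (\<sigma> * sqrt (2 * pi) * sqrt t * \<alpha> t * exp (\<sigma>\<^sup>2 * t * (\<alpha> t)\<^sup>2 / 2)) / W t"
    using apos
  proof eventually_elim
    case (elim t)
    then have x: "0 < x t" "x t < 1" by (auto simp: x_def)
    define E1 where "E1 = exp (\<alpha> t * real_of_int (Y t) - t * psi p (\<alpha> t))"
    have ee: "E1 * exp (e t) = exp (\<sigma>\<^sup>2 * t * (\<alpha> t)\<^sup>2 / 2)"
      unfolding e_def E1_def exp_add[symmetric] by simp
    have "Q t * (\<sigma> * sqrt (2 * pi)) * (\<alpha> t * (1 / (1 - x t)) * x t) * exp (e t)
       = lam t * (\<sigma> * sqrt (2 * pi) * sqrt t * \<alpha> t * (E1 * exp (e t))) / W t"
      using x Wpos[of t] unfolding Q_def E1_def[symmetric] by (simp add: field_simps)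
    then show ?case unfolding ee .
  qed
  ultimately show ?thesis by (rule Lim_transform_eventually)
qed

section \<open>Weighted sums of a periodic profile\<close>

lemma weight_algebra:
  fixes a b u v n W :: real
  shows "a * (W - b * (u / v)) + b * (a / v * u) = a * W"
    and "0 < a \<Longrightarrow> 0 < n \<Longrightarrow> (W - b * (u / v)) / n + b * (u / (a * n) * (a / v)) = W / n"
  by (simp_all add: right_diff_distrib diff_divide_distrib)

text \<open>Summation by parts: the powers of \<open>x\<close> decrease from \<open>1\<close>, so
  their increments have one sign and telescope.\<close>

lemma power_sum_abel:
  fixes b :: "nat \<Rightarrow> real"
  assumes b: "\<And>j. \<bar>\<Sum>k\<le>j. b k\<bar> \<le> C" and x: "0 \<le> x" "x \<le> 1"
  shows "\<bar>\<Sum>k\<le>N. b k * x ^ k\<bar> \<le> C"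
proof -
  define S where "S j = (\<Sum>k\<le>j. b k)" for j
  have "(\<Sum>k\<le>N. b k * x ^ k) = S N * x ^ N + (\<Sum>k<N. S k * (x ^ k - x ^ Suc k))"
    by (induction N) (simp_all add: S_def algebra_simps)
  also have "\<bar>\<dots>\<bar> \<le> C * x ^ N + (\<Sum>k<N. C * (x ^ k - x ^ Suc k))"
  proof (rule order.trans[OF abs_triangle_ineq] add_mono)+
    show "\<bar>S N * x ^ N\<bar> \<le> C * x ^ N"
      using b[of N] x by (simp add: S_def abs_mult mult_right_mono)
    have "\<bar>S k * (x ^ k - x ^ Suc k)\<bar> \<le> C * (x ^ k - x ^ Suc k)" for k
    proof -
      have "0 \<le> x ^ k - x ^ Suc k" using x by (simp add: mult_left_le_one_le)
      then show ?thesis using b[of k] unfolding abs_mult by (simp add: S_def mult_right_mono del: power_Suc)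
    qed
    then show "\<bar>\<Sum>k<N. S k * (x ^ k - x ^ Suc k)\<bar> \<le> (\<Sum>k<N. C * (x ^ k - x ^ Suc k))"
      by (intro order.trans[OF sum_abs] sum_mono)
  qed
  also have "(\<Sum>k<N. C * (x ^ k - x ^ Suc k)) = C * (1 - x ^ N)"
    by (induction N) (simp_all add: algebra_simps)
  finally show ?thesis by (simp add: algebra_simps)
qed

text \<open>The deviations from the mean add up to zero over each full period, so only an incomplete
  period is left.\<close>

lemma periodic_partial_sums:
  fixes r :: "nat \<Rightarrow> real"
  assumes m: "1 \<le> m" and per: "\<And>k. 1 \<le> k \<Longrightarrow> r (k + m) = r k" and r: "\<And>k. 0 \<le> r k" "\<And>k. r k \<le> 1"
    and rbar: "rbar = (\<Sum>j=1..m. r j) / real m"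
  shows "\<bar>\<Sum>k\<le>j. r k - rbar\<bar> \<le> real m"
proof -
  have rb: "0 \<le> rbar" "rbar \<le> 1"
  proof -
    have "(\<Sum>j=1..m. r j) \<le> (\<Sum>j=1..m. 1)" by (intro sum_mono r)
    then show "rbar \<le> 1" unfolding rbar using m by (simp add: field_simps)
    show "0 \<le> rbar" unfolding rbar by (intro divide_nonneg_nonneg sum_nonneg r) auto
  qed
  have block: "(\<Sum>k\<in>{j<..j + m}. r k - rbar) = 0" for j
  proof (induction j)
    case 0
    have "{0<..m} = {1..m}" by auto
    then show ?case using m by (simp add: sum_subtractf rbar)
  next
    case (Suc j)
    have "(\<Sum>k\<in>{Suc j<..Suc j + m}. r k - rbar) = (\<Sum>k\<in>{Suc j<..j + m}. r k - rbar) + (r (Suc j + m) - rbar)"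
    proof -
      have "{Suc j<..Suc j + m} = insert (Suc j + m) {Suc j<..j + m}" using m by auto
      then show ?thesis by simp
    qed
    also have "r (Suc j + m) = r (Suc j)" by (rule per) simp
    also have "(\<Sum>k\<in>{Suc j<..j + m}. r k - rbar) + (r (Suc j) - rbar) = (\<Sum>k\<in>{j<..j + m}. r k - rbar)"
    proof -
      have "{j<..j + m} = insert (Suc j) {Suc j<..j + m}" using m by auto
      then show ?thesis by simp
    qed
    finally show ?case using Suc.IH by simp
  qed
  show ?thesis
  proof (induction j rule: less_induct)
    case (less j)
    show ?case
    proof (cases "j < m")
      case True
      \<comment> \<open>The index \<open>0\<close> lies outside the period, but for
        \<open>j < m\<close> there are at most \<open>m\<close> terms even when it is
        counted.\<close>
      have "\<bar>\<Sum>k\<le>j. r k - rbar\<bar> \<le> (\<Sum>k\<le>j. 1)"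
        using r rb by (intro order.trans[OF sum_abs] sum_mono) (simp add: abs_le_iff, smt (verit))
      then show ?thesis using True by simp
    next
      case False
      then obtain i where i: "j = i + m" using le_Suc_ex not_less by (metis add.commute)
      have "{..j} = {..i} \<union> {i<..i + m}" "{..i} \<inter> {i<..i + m} = {}" using i by auto
      then have "(\<Sum>k\<le>j. r k - rbar) = (\<Sum>k\<le>i. r k - rbar)"
        using block[of i] by (simp add: sum.union_disjoint)
      then show ?thesis using less[of i] i m by simp
    qed
  qed
qed

text \<open>The error is independent of \<open>x\<close> and \<open>N\<close>, whereas the geometric
  main term grows without bound in the limits taken below.\<close>

lemma periodic_power_sum:
  fixes r :: "nat \<Rightarrow> real"
  assumes "1 \<le> m" "\<And>k. 1 \<le> k \<Longrightarrow> r (k + m) = r k" "\<And>k. 0 \<le> r k" "\<And>k. r k \<le> 1"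
    "rbar = (\<Sum>j=1..m. r j) / real m" and x: "0 \<le> x" "x < 1"
  shows "\<bar>(\<Sum>k\<le>N. r k * x ^ k) - rbar * ((1 - x ^ Suc N) / (1 - x))\<bar> \<le> real m"
proof -
  have "\<bar>\<Sum>k\<le>N. (r k - rbar) * x ^ k\<bar> \<le> real m"
    by (rule power_sum_abel[OF periodic_partial_sums[OF assms(1-5)]]) (use x in auto)
  moreover have "(\<Sum>k\<le>N. x ^ k) = (1 - x ^ Suc N) / (1 - x)"
    using x sum_gp0[of x N] by (simp add: field_simps)
  then have "(\<Sum>k\<le>N. (r k - rbar) * x ^ k) = (\<Sum>k\<le>N. r k * x ^ k) - rbar * ((1 - x ^ Suc N) / (1 - x))"
    by (simp add: left_diff_distrib sum_subtractf sum_distrib_left[symmetric])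
  ultimately show ?thesis by simp
qed

context
  fixes r :: "nat \<Rightarrow> real" and m :: nat and rbar :: real and \<alpha> :: "real \<Rightarrow> real" and N :: "real \<Rightarrow> nat"
  assumes m: "1 \<le> m" and per: "\<And>k. 1 \<le> k \<Longrightarrow> r (k + m) = r k" and r0: "\<And>k. 0 \<le> r k" and r1: "\<And>k. r k \<le> 1"
    and rbar: "rbar = (\<Sum>j=1..m. r j) / real m" and rpos: "0 < rbar"
    and \<alpha>0: "filterlim \<alpha> (at_right 0) at_top" and \<alpha>1: "filterlim (\<lambda>t. \<alpha> t * sqrt t) at_top at_top"
begin

lemma apos: "\<forall>\<^sub>F t in at_top. 0 < \<alpha> t" and a0: "(\<alpha> \<longlongrightarrow> 0) at_top"
  using \<alpha>0 by (auto simp: filterlim_at elim: eventually_mono)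

lemma weight_error:
  "\<forall>\<^sub>F t in at_top. \<bar>(\<Sum>k\<le>N t. r k * exp (- \<alpha> t) ^ k)
      - rbar * ((1 - exp (- (\<alpha> t * real (Suc (N t))))) / (1 - exp (- \<alpha> t)))\<bar> \<le> real m"
  using apos
proof eventually_elim
  case (elim t)
  have "exp (- \<alpha> t) ^ Suc (N t) = exp (- (\<alpha> t * real (Suc (N t))))"
    by (simp add: exp_of_nat_mult[symmetric] algebra_simps del: power_Suc)
  with periodic_power_sum[OF m per r0 r1 rbar, of "exp (- \<alpha> t)" "N t"] elim
  show ?case by simp
qed

text \<open>Multiplication by \<alpha> removes the bounded error of \<open>weight_error\<close> and
  balances the geometric denominator, which is asymptotic to \<alpha>. The limit \<open>e\<close>
  records how much of the geometric series the finite block cuts off.\<close>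

lemma weight_limit_long:
  assumes e: "((\<lambda>t. exp (- (\<alpha> t * real (Suc (N t))))) \<longlongrightarrow> e) at_top"
  shows "((\<lambda>t. \<alpha> t * (\<Sum>k\<le>N t. r k * exp (- \<alpha> t) ^ k)) \<longlongrightarrow> rbar * (1 - e)) at_top"
proof -
  have "((\<lambda>t. \<alpha> t * ((\<Sum>k\<le>N t. r k * exp (- \<alpha> t) ^ k)
      - rbar * ((1 - exp (- (\<alpha> t * real (Suc (N t))))) / (1 - exp (- \<alpha> t))))) \<longlongrightarrow> 0) at_top"
  proof (rule Lim_null_comparison)
    show "\<forall>\<^sub>F t in at_top. norm (\<alpha> t * ((\<Sum>k\<le>N t. r k * exp (- \<alpha> t) ^ k)
      - rbar * ((1 - exp (- (\<alpha> t * real (Suc (N t))))) / (1 - exp (- \<alpha> t))))) \<le> \<alpha> t * real m"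
      using weight_error apos by eventually_elim (simp add: abs_mult mult_left_mono del: of_nat_Suc)
    show "((\<lambda>t. \<alpha> t * real m) \<longlongrightarrow> 0) at_top" using tendsto_mult_right[OF a0, of "real m"] by simp
  qed
  moreover have "((\<lambda>t. rbar * (\<alpha> t / (1 - exp (- \<alpha> t)) * (1 - exp (- (\<alpha> t * real (Suc (N t))))))) \<longlongrightarrow> rbar * (1 * (1 - e))) at_top"
    by (intro tendsto_intros e, rule filterlim_compose[OF _ \<alpha>0, where g = "\<lambda>a. a / (1 - exp (- a))"]) real_asymp
  ultimately have "((\<lambda>t. \<alpha> t * ((\<Sum>k\<le>N t. r k * exp (- \<alpha> t) ^ k)
      - rbar * ((1 - exp (- (\<alpha> t * real (Suc (N t))))) / (1 - exp (- \<alpha> t))))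
      + rbar * (\<alpha> t / (1 - exp (- \<alpha> t)) * (1 - exp (- (\<alpha> t * real (Suc (N t))))))) \<longlongrightarrow> 0 + rbar * (1 * (1 - e))) at_top"
    by (rule tendsto_add)
  then show ?thesis by (simp only: weight_algebra(1) add_0 mult_1)
qed

text \<open>The first moment is at most that of the full geometric series, of order
  \<open>1 / (\<alpha> t)\<^sup>2\<close>, and the weight is of order \<open>1 / \<alpha> t\<close>.
  The quotient is therefore of order \<open>1 / (\<alpha> t * sqrt t)\<close>.\<close>

lemma first_moment_long:
  assumes e: "((\<lambda>t. exp (- (\<alpha> t * real (Suc (N t))))) \<longlongrightarrow> e) at_top" "e < 1"
  shows "((\<lambda>t. (\<Sum>k\<le>N t. r k * (real k * exp (- \<alpha> t) ^ k)) / (\<Sum>k\<le>N t. r k * exp (- \<alpha> t) ^ k) / sqrt t) \<longlongrightarrow> 0) at_top"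
proof (rule Lim_null_comparison)
  let ?W = "\<lambda>t. \<Sum>k\<le>N t. r k * exp (- \<alpha> t) ^ k"
  let ?W1 = "\<lambda>t. \<Sum>k\<le>N t. r k * (real k * exp (- \<alpha> t) ^ k)"
  define g where "g a = a * a * (exp (- a) / (1 - exp (- a))\<^sup>2)" for a :: real
  have gl: "((\<lambda>t. g (\<alpha> t)) \<longlongrightarrow> 1) at_top"
    unfolding g_def by (rule filterlim_compose[OF _ \<alpha>0, where g = "\<lambda>a. a * a * (exp (- a) / (1 - exp (- a))\<^sup>2)"]) real_asymp
  have pos: "0 < rbar * (1 - e)" using rpos e by simp
  have Wl: "((\<lambda>t. \<alpha> t * ?W t) \<longlongrightarrow> rbar * (1 - e)) at_top" by (rule weight_limit_long[OF e(1)])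
  show "\<forall>\<^sub>F t in at_top. norm (?W1 t / ?W t / sqrt t) \<le> g (\<alpha> t) / (\<alpha> t * ?W t) / (\<alpha> t * sqrt t)"
    using apos eventually_gt_at_top[of 0] order_tendstoD(1)[OF Wl pos]
  proof eventually_elim
    case (elim t)
    let ?x = "exp (- \<alpha> t)"
    have x: "norm ?x < 1" using elim by simp
    have s: "(\<lambda>n. real (Suc n) * ?x ^ Suc n) sums (?x / (1 - ?x)\<^sup>2)"
      using sums_mult[OF geometric_deriv_sums[OF x], of ?x] by (simp add: mult_ac)
    have "?W1 t \<le> (\<Sum>k\<le>N t. real k * ?x ^ k)"
      by (intro sum_mono) (use r1 in \<open>simp add: mult_left_le_one_le r0\<close>)
    also have "\<dots> = (\<Sum>n<N t. real (Suc n) * ?x ^ Suc n)"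
      by (subst sum.atMost_shift) simp
    also have "\<dots> \<le> (\<Sum>n. real (Suc n) * ?x ^ Suc n)"
      by (rule sum_le_suminf[OF sums_summable[OF s]]) auto
    also have "\<dots> = ?x / (1 - ?x)\<^sup>2" using s by (simp add: sums_iff)
    finally have W1: "?W1 t \<le> ?x / (1 - ?x)\<^sup>2" .
    have W: "0 < ?W t" using elim by (simp add: zero_less_mult_iff)
    have "0 \<le> ?W1 t" by (intro sum_nonneg mult_nonneg_nonneg r0) auto
    then have "norm (?W1 t / ?W t / sqrt t) = ?W1 t / ?W t / sqrt t" using W elim by simp
    also have "\<dots> \<le> ?x / (1 - ?x)\<^sup>2 / ?W t / sqrt t" using W1 W elim by (intro divide_right_mono) auto
    also have "\<dots> = g (\<alpha> t) / (\<alpha> t * ?W t) / (\<alpha> t * sqrt t)" using elim by (simp add: g_def)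
    finally show ?case .
  qed
  have "((\<lambda>t. g (\<alpha> t) / (\<alpha> t * ?W t)) \<longlongrightarrow> 1 / (rbar * (1 - e))) at_top"
    by (intro tendsto_divide gl Wl) (use pos in auto)
  then show "((\<lambda>t. g (\<alpha> t) / (\<alpha> t * ?W t) / (\<alpha> t * sqrt t)) \<longlongrightarrow> 0) at_top"
    by (rule tendsto_divide_0) (rule filterlim_at_top_imp_at_infinity[OF \<alpha>1])
qed

text \<open>The exponential factors are close to \<open>1\<close> on the entire block, so the weight
  is asymptotically \<open>rbar\<close> per site.\<close>

lemma weight_limit_short:
  assumes N: "filterlim (\<lambda>t. real (N t)) at_top at_top" and s: "((\<lambda>t. \<alpha> t * real (Suc (N t))) \<longlongrightarrow> 0) at_top"
  shows "((\<lambda>t. (\<Sum>k\<le>N t. r k * exp (- \<alpha> t) ^ k) / real (Suc (N t))) \<longlongrightarrow> rbar) at_top"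
proof -
  let ?n = "\<lambda>t. real (Suc (N t))"
  let ?W = "\<lambda>t. \<Sum>k\<le>N t. r k * exp (- \<alpha> t) ^ k"
  have nlim: "filterlim ?n at_top at_top"
    by (rule filterlim_at_top_mono[OF N]) auto
  have sr: "filterlim (\<lambda>t. \<alpha> t * ?n t) (at_right 0) at_top"
    unfolding filterlim_at using s apos by (auto elim!: eventually_mono)
  have "((\<lambda>t. (?W t - rbar * ((1 - exp (- (\<alpha> t * ?n t))) / (1 - exp (- \<alpha> t)))) / ?n t) \<longlongrightarrow> 0) at_top"
  proof (rule Lim_null_comparison)
    show "\<forall>\<^sub>F t in at_top. norm ((?W t - rbar * ((1 - exp (- (\<alpha> t * ?n t))) / (1 - exp (- \<alpha> t)))) / ?n t) \<le> real m / ?n t"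
      using weight_error by eventually_elim (simp add: divide_right_mono del: of_nat_Suc)
    show "((\<lambda>t. real m / ?n t) \<longlongrightarrow> 0) at_top"
      by (rule tendsto_divide_0[OF tendsto_const]) (rule filterlim_at_top_imp_at_infinity[OF nlim])
  qed
  moreover have "((\<lambda>t. rbar * (((1 - exp (- (\<alpha> t * ?n t))) / (\<alpha> t * ?n t)) * (\<alpha> t / (1 - exp (- \<alpha> t))))) \<longlongrightarrow> rbar * (1 * 1)) at_top"
  proof (intro tendsto_intros)
    show "((\<lambda>t. (1 - exp (- (\<alpha> t * ?n t))) / (\<alpha> t * ?n t)) \<longlongrightarrow> 1) at_top"
      by (rule filterlim_compose[OF _ sr, where g = "\<lambda>a. (1 - exp (- a)) / a"]) real_asymp
    show "((\<lambda>t. \<alpha> t / (1 - exp (- \<alpha> t))) \<longlongrightarrow> 1) at_top"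
      by (rule filterlim_compose[OF _ \<alpha>0, where g = "\<lambda>a. a / (1 - exp (- a))"]) real_asymp
  qed
  ultimately have "((\<lambda>t. (?W t - rbar * ((1 - exp (- (\<alpha> t * ?n t))) / (1 - exp (- \<alpha> t)))) / ?n t
      + rbar * (((1 - exp (- (\<alpha> t * ?n t))) / (\<alpha> t * ?n t)) * (\<alpha> t / (1 - exp (- \<alpha> t))))) \<longlongrightarrow> 0 + rbar * (1 * 1)) at_top"
    by (rule tendsto_add)
  moreover have "\<forall>\<^sub>F t in at_top. (?W t - rbar * ((1 - exp (- (\<alpha> t * ?n t))) / (1 - exp (- \<alpha> t)))) / ?n t
      + rbar * (((1 - exp (- (\<alpha> t * ?n t))) / (\<alpha> t * ?n t)) * (\<alpha> t / (1 - exp (- \<alpha> t)))) = ?W t / ?n t"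
    using apos by eventually_elim (rule weight_algebra(2), simp_all)
  ultimately show ?thesis by (simp add: tendsto_cong)
qed

text \<open>The mean position cannot exceed the length of the block. Dividing by
  \<open>sqrt t\<close> and inserting \<alpha> leaves a null sequence over one that
  diverges.\<close>

lemma first_moment_short:
  assumes s: "((\<lambda>t. \<alpha> t * real (Suc (N t))) \<longlongrightarrow> 0) at_top" and r00: "r 0 = 1"
  shows "((\<lambda>t. (\<Sum>k\<le>N t. r k * (real k * exp (- \<alpha> t) ^ k)) / (\<Sum>k\<le>N t. r k * exp (- \<alpha> t) ^ k) / sqrt t) \<longlongrightarrow> 0) at_top"
proof (rule Lim_null_comparison)
  let ?W = "\<lambda>t. \<Sum>k\<le>N t. r k * exp (- \<alpha> t) ^ k"
  let ?W1 = "\<lambda>t. \<Sum>k\<le>N t. r k * (real k * exp (- \<alpha> t) ^ k)"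
  show "\<forall>\<^sub>F t in at_top. norm (?W1 t / ?W t / sqrt t) \<le> \<alpha> t * real (Suc (N t)) / (\<alpha> t * sqrt t)"
    using apos eventually_gt_at_top[of 0]
  proof eventually_elim
    case (elim t)
    have "(\<Sum>k\<in>{0}. r k * exp (- \<alpha> t) ^ k) \<le> ?W t" by (rule sum_mono2) (use r0 in auto)
    then have W: "0 < ?W t" using r00 by simp
    have "?W1 t \<le> (\<Sum>k\<le>N t. real (Suc (N t)) * (r k * exp (- \<alpha> t) ^ k))"
    proof (rule sum_mono)
      fix k assume "k \<in> {..N t}"
      then have "real k * (r k * exp (- \<alpha> t) ^ k) \<le> real (Suc (N t)) * (r k * exp (- \<alpha> t) ^ k)"
        by (intro mult_right_mono) (use r0 in auto)
      then show "r k * (real k * exp (- \<alpha> t) ^ k) \<le> real (Suc (N t)) * (r k * exp (- \<alpha> t) ^ k)"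
        by (simp only: mult.left_commute)
    qed
    then have "?W1 t \<le> real (Suc (N t)) * ?W t" by (simp only: sum_distrib_left)
    then have "?W1 t / ?W t \<le> real (Suc (N t))" using W by (simp only: pos_divide_le_eq)
    moreover have "0 \<le> ?W1 t" by (intro sum_nonneg mult_nonneg_nonneg r0) auto
    ultimately have "0 \<le> ?W1 t / ?W t" "?W1 t / ?W t \<le> real (Suc (N t))" using W by auto
    then have "\<bar>?W1 t / ?W t / sqrt t\<bar> \<le> real (Suc (N t)) / sqrt t"
      using elim by (simp add: divide_right_mono abs_divide del: of_nat_Suc divide_divide_eq_left)
    also have "\<dots> = \<alpha> t * real (Suc (N t)) / (\<alpha> t * sqrt t)" using elim by simp
    finally show ?case by simp
  qed
  show "((\<lambda>t. \<alpha> t * real (Suc (N t)) / (\<alpha> t * sqrt t)) \<longlongrightarrow> 0) at_top"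
    by (rule tendsto_divide_0[OF s]) (rule filterlim_at_top_imp_at_infinity[OF \<alpha>1])
qed

end

section \<open>The right-most particle\<close>

lemma has_sum_finite_sum:
  fixes f :: "'k \<Rightarrow> 'i \<Rightarrow> real"
  assumes "finite B" "\<And>k. k \<in> B \<Longrightarrow> (f k has_sum s k) S"
  shows "((\<lambda>x. \<Sum>k\<in>B. f k x) has_sum (\<Sum>k\<in>B. s k)) S"
  using assms by (induction B rule: finite_induct) (auto intro: has_sum_add)

definition has_max :: "config \<Rightarrow> bool" where
  "has_max \<eta> \<longleftrightarrow> (\<exists>x. \<eta> x) \<and> (\<exists>Z. \<forall>x>Z. \<not> \<eta> x)"

lemma rightmost_le_iff:
  assumes "has_max \<eta>"
  shows "rightmost \<eta> \<le> Y \<longleftrightarrow> (\<forall>x>Y. \<not> \<eta> x)"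
proof -
  obtain a Z where a: "\<eta> a" and Z: "\<And>x. x > Z \<Longrightarrow> \<not> \<eta> x" using assms by (auto simp: has_max_def)
  define S where "S = {x. \<eta> x \<and> a \<le> x}"
  have fin: "finite S" by (rule finite_subset[of _ "{a..Z}"]) (use Z in \<open>force simp: S_def\<close>)+
  have "S \<noteq> {}" using a by (auto simp: S_def)
  then have M: "\<eta> (Max S)" "\<And>x. \<eta> x \<Longrightarrow> x \<le> Max S"
    using Max_in[OF fin] Max_ge[OF fin] a by (auto simp: S_def) (metis linorder_linear order_trans)
  have "rightmost \<eta> = Max S" unfolding rightmost_def by (rule Greatest_equality) (use M in auto)
  then show ?thesis using M by (metis leD not_le order.trans)
qed

text \<open>No site satisfies the description behind \<open>GREATEST\<close>, so all these
  configurations share one default value. This is what makes the events of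
  \<open>rightmost_sets\<close> measurable.\<close>

lemma rightmost_no_max:
  assumes "\<not> has_max \<eta>"
  shows "rightmost \<eta> = (THE x. False)"
proof -
  have "(\<eta> x \<and> (\<forall>y. \<eta> y \<longrightarrow> y \<le> x)) = False" for x
    using assms unfolding has_max_def by (meson not_le)
  then show ?thesis unfolding rightmost_def Greatest_def by (simp only:)
qed

lemma vacant_above_sets [measurable]: "{\<eta>. \<forall>x>Y. \<not> \<eta> x} \<in> sets configs" for Y :: int
proof -
  have "{\<eta>\<in>space configs. \<forall>x. x > Y \<longrightarrow> \<not> \<eta> x} \<in> sets configs" by measurable
  then show ?thesis by simp
qed

lemma has_max_sets [measurable]: "{\<eta>. has_max \<eta>} \<in> sets configs"
proof -
  have "{\<eta>\<in>space configs. (\<exists>x. \<eta> x) \<and> (\<exists>Z. \<forall>x. x > Z \<longrightarrow> \<not> \<eta> x)} \<in> sets configs" by measurable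
  then show ?thesis by (simp add: has_max_def)
qed

lemma rightmost_sets: "{\<eta>. rightmost \<eta> \<le> Y} \<in> sets configs"
proof -
  have "{\<eta>. rightmost \<eta> \<le> Y} = ({\<eta>. has_max \<eta>} \<inter> {\<eta>. \<forall>x>Y. \<not> \<eta> x}) \<union>
      (if (THE x. False) \<le> Y then space configs - {\<eta>. has_max \<eta>} else {})"
  proof (intro set_eqI)
    fix \<eta> show "\<eta> \<in> {\<eta>. rightmost \<eta> \<le> Y} \<longleftrightarrow> \<eta> \<in> ({\<eta>. has_max \<eta>} \<inter> {\<eta>. \<forall>x>Y. \<not> \<eta> x}) \<union>
      (if (THE x. False) \<le> Y then space configs - {\<eta>. has_max \<eta>} else {})"
      by (cases "has_max \<eta>") (simp_all add: rightmost_le_iff rightmost_no_max)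
  qed
  also have "\<dots> \<in> sets configs"
    by (intro sets.Un sets.Int has_max_sets vacant_above_sets) (auto intro!: sets.Diff sets.top has_max_sets simp del: space_configs)
  finally show ?thesis .
qed

lemma psi_uminus:
  assumes "exp_moment p \<theta>" "\<bar>a\<bar> \<le> \<theta>"
  shows "psi p (- a) = psi p a"
  using infsumI[OF psi_uminus_has_sum[OF assms]] by (simp add: psi_def)

text \<open>The logarithm of \<open>1 - f\<close> loses at most \<open>2 * f\<^sup>2\<close>, and a
  uniform bound \<open>e\<close> on \<open>f\<close> makes this a relative error.\<close>

lemma prod_one_minus_lower:
  fixes f :: "'a \<Rightarrow> real"
  assumes "finite A" "\<And>x. x \<in> A \<Longrightarrow> 0 \<le> f x" "\<And>x. x \<in> A \<Longrightarrow> f x \<le> e" "e \<le> 1 / 2"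
  shows "exp (- ((1 + 2 * e) * sum f A)) \<le> (\<Prod>x\<in>A. 1 - f x)"
proof -
  have "exp (- ((1 + 2 * e) * sum f A)) = (\<Prod>x\<in>A. exp (- ((1 + 2 * e) * f x)))"
    using assms(1) by (simp add: exp_sum[symmetric] sum_negf sum_distrib_left)
  also have "\<dots> \<le> (\<Prod>x\<in>A. 1 - f x)"
  proof (rule prod_mono, intro conjI)
    fix x assume x: "x \<in> A"
    have f: "0 \<le> f x" "f x \<le> 1 / 2" using assms x order.trans by blast+
    have "- f x - 2 * (f x)\<^sup>2 \<le> ln (1 - f x)" by (rule ln_one_minus_pos_lower_bound[OF f])
    moreover have "(f x)\<^sup>2 \<le> e * f x"
      unfolding power2_eq_square using f assms(3)[OF x] by (intro mult_right_mono)
    ultimately have "- ((1 + 2 * e) * f x) \<le> ln (1 - f x)" by (simp add: algebra_simps)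
    then have "exp (- ((1 + 2 * e) * f x)) \<le> exp (ln (1 - f x))" by simp
    then show "exp (- ((1 + 2 * e) * f x)) \<le> 1 - f x" using f by simp
  qed simp
  finally show ?thesis .
qed

lemma prod_one_minus_upper:
  fixes f :: "'a \<Rightarrow> real"
  assumes "finite A" "\<And>x. x \<in> A \<Longrightarrow> f x \<le> 1"
  shows "(\<Prod>x\<in>A. 1 - f x) \<le> exp (- sum f A)"
proof -
  have "(\<Prod>x\<in>A. 1 - f x) \<le> (\<Prod>x\<in>A. exp (- f x))"
    by (rule prod_mono) (use assms(2) exp_ge_add_one_self[of "- f _"] in auto)
  then show ?thesis using assms(1) by (simp add: exp_sum[symmetric] sum_negf)
qed

section \<open>Bounds for the right-most particle at a fixed time\<close>

context
  fixes p :: "int pmf" and \<theta> t :: real and N :: nat and c :: "int \<Rightarrow> real"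
    and M :: "'w measure" and \<eta> :: "real \<Rightarrow> 'w \<Rightarrow> config"
  assumes p: "exp_moment p \<theta>" and t: "0 \<le> t" and c: "\<And>k. 0 \<le> c k \<and> c k \<le> 1"
    and ex: "exclusion_process p M \<eta>"
    and init: "distr M configs (\<eta> 0) = bernoulli_product (\<lambda>k. if k \<in> {- int N..0} then c k else 0)"
begin

text \<open>Mean number of particles strictly to the right of \<open>Y\<close>, summed over starting
  sites first; this is the \<lambda> of the overview.\<close>

definition tail_mass :: "int \<Rightarrow> real" where
  "tail_mass Y = (\<Sum>k\<le>N. c (- int k) * (\<Sum>n. heat p t (Y + 1 + int n + int k)))"

lemma M_prob: "prob_space M"
  using ex by (auto simp: exclusion_process_def markov_process_def)

lemma event_measurable: "S \<in> sets configs \<Longrightarrow> {\<omega>\<in>space M. \<eta> t \<omega> \<in> S} \<in> sets M"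
proof -
  assume S: "S \<in> sets configs"
  have "\<eta> t \<in> measurable M configs" using ex t by (auto simp: exclusion_process_def markov_process_def)
  from measurable_sets[OF this S] show ?thesis by (simp add: vimage_def Int_def conj_commute)
qed

lemma occupation_eq: "occupation p {- int N..0} c t x = (\<Sum>k\<le>N. c (- int k) * heat p t (x + int k))"
proof -
  have "{- int N..0} = (\<lambda>k. - int k) ` {..N}"
  proof (intro set_eqI iffI)
    fix j assume "j \<in> {- int N..0}"
    then show "j \<in> (\<lambda>k. - int k) ` {..N}" by (intro image_eqI[of _ _ "nat (- j)"]) auto
  qed auto
  then show ?thesis unfolding occupation_def by (simp add: sum.reindex inj_on_def)
qed

lemma heat_tail_summable: "summable (\<lambda>n. heat p t (j + int n))"
proof -
  have "heat p t summable_on (range (\<lambda>n. j + int n))"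
    by (rule summable_on_subset_banach[OF has_sum_imp_summable[OF heat_has_sum_1[OF p t]]]) simp
  then have "(heat p t \<circ> (\<lambda>n. j + int n)) summable_on UNIV"
    by (subst (asm) summable_on_reindex) (auto simp: inj_on_def)
  then show ?thesis by (simp add: summable_on_imp_summable o_def)
qed

lemma occupation_sums: "(\<lambda>n. occupation p {- int N..0} c t (Y + 1 + int n)) sums tail_mass Y"
  unfolding occupation_eq tail_mass_def
proof (intro sums_sum sums_mult summable_sums)
  fix k
  show "summable (\<lambda>n. heat p t (Y + 1 + int n + int k))"
    using heat_tail_summable[of "Y + 1 + int k"] by (simp add: algebra_simps)
qed

lemma initial_sites: "finite {- int N..0}" "\<And>k. k \<in> {- int N..0} \<Longrightarrow> k \<le> 0" by auto

lemma tail_mass_limit: "(\<lambda>i. tail_mass (Y + int i)) \<longlonglongrightarrow> 0"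
proof -
  let ?f = "\<lambda>n. occupation p {- int N..0} c t (Y + 1 + int n)"
  have s: "summable ?f" using occupation_sums by (rule sums_summable)
  have "tail_mass (Y + int i) = suminf ?f - sum ?f {..<i}" for i
  proof -
    have "(\<lambda>n. ?f (n + i)) sums tail_mass (Y + int i)"
      using occupation_sums[of "Y + int i"] by (simp add: algebra_simps)
    then show ?thesis using suminf_minus_initial_segment[OF s, of i] by (simp add: sums_iff)
  qed
  moreover have "(\<lambda>i. suminf ?f - sum ?f {..<i}) \<longlonglongrightarrow> suminf ?f - suminf ?f"
    by (intro tendsto_diff tendsto_const summable_LIMSEQ s)
  ultimately show ?thesis by simp
qed

lemma vacant_above_limit:
  "(\<lambda>R. measure M {\<omega>\<in>space M. \<forall>x\<in>{Y + 1..Y + int R}. \<not> \<eta> t \<omega> x})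
     \<longlonglongrightarrow> measure M {\<omega>\<in>space M. \<forall>x>Y. \<not> \<eta> t \<omega> x}"
proof -
  interpret prob_space M by (rule M_prob)
  let ?S = "\<lambda>R. {\<omega>\<in>space M. \<forall>x\<in>{Y + 1..Y + int R}. \<not> \<eta> t \<omega> x}"
  have "range ?S \<subseteq> sets M"
  proof safe
    fix R
    have "{\<xi>\<in>space configs. \<forall>x\<in>{Y + 1..Y + int R}. \<not> \<xi> x} \<in> sets configs" by measurable
    from event_measurable[OF this] show "?S R \<in> sets M" by simp
  qed
  moreover have "decseq ?S" by (auto simp: decseq_def)
  ultimately have "(\<lambda>R. measure M (?S R)) \<longlonglongrightarrow> measure M (\<Inter>R. ?S R)"
    by (rule finite_Lim_measure_decseq)
  moreover have "(\<Inter>R. ?S R) = {\<omega>\<in>space M. \<forall>x>Y. \<not> \<eta> t \<omega> x}"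
  proof (intro set_eqI iffI)
    fix \<omega> assume \<omega>: "\<omega> \<in> (\<Inter>R. ?S R)"
    have "\<not> \<eta> t \<omega> x" if "x > Y" for x
    proof -
      have "\<omega> \<in> ?S (nat (x - Y))" using \<omega> by blast
      then show ?thesis using that by auto
    qed
    then show "\<omega> \<in> {\<omega>\<in>space M. \<forall>x>Y. \<not> \<eta> t \<omega> x}" using \<omega> by auto
  qed auto
  ultimately show ?thesis by simp
qed

lemma sum_interval_lim:
  "(\<lambda>R. \<Sum>x\<in>{Y + 1..Y + int R}. occupation p {- int N..0} c t x) \<longlonglongrightarrow> tail_mass Y"
proof -
  have "(\<Sum>x\<in>{Y + 1..Y + int R}. occupation p {- int N..0} c t x) = (\<Sum>n<R. occupation p {- int N..0} c t (Y + 1 + int n))" for R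
    by (rule sum.reindex_bij_witness[of _ "\<lambda>n. Y + 1 + int n" "\<lambda>x. nat (x - Y - 1)"]) auto
  then show ?thesis using occupation_sums[of Y] by (simp add: sums_def)
qed

lemma occupation_01: "0 \<le> occupation p {- int N..0} c t x" "occupation p {- int N..0} c t x \<le> 1"
  using occupation_nonneg[OF p initial_sites(1) c t] occupation_le_1[OF p initial_sites(1) c t] by auto

lemma vacant_above_upper: "measure M {\<omega>\<in>space M. \<forall>x>Y. \<not> \<eta> t \<omega> x} \<le> exp (- tail_mass Y)"
proof (rule LIMSEQ_le[OF vacant_above_limit tendsto_exp[OF tendsto_minus[OF sum_interval_lim]]], intro exI allI impI)
  fix R :: nat
  let ?A = "{Y + 1..Y + int R}"
  have "measure M {\<omega>\<in>space M. \<forall>x\<in>?A. \<not> \<eta> t \<omega> x} \<le> (\<Prod>x\<in>?A. 1 - occupation p {- int N..0} c t x)"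
    by (rule vacancy_bounds(1)[OF p t _ initial_sites c ex init]) simp
  also have "\<dots> \<le> exp (- (\<Sum>x\<in>?A. occupation p {- int N..0} c t x))"
    by (rule prod_one_minus_upper) (use occupation_01 in auto)
  finally show "measure M {\<omega>\<in>space M. \<forall>x\<in>?A. \<not> \<eta> t \<omega> x} \<le> exp (- (\<Sum>x\<in>?A. occupation p {- int N..0} c t x))" .
qed

text \<open>One number \<open>E\<close> controls both errors: the pair gaps, and the density at each
  site beyond \<open>Y\<close>, which matters when the product is replaced by an exponential.
  \<open>E\<close> is evaluated at \<open>Y\<close> while the half-line starts at \<open>Z\<close>,
  so that \<open>Z\<close> can go to infinity with \<open>E\<close> fixed.\<close>

lemma vacant_above_lower:
  assumes a: "0 < a" "a \<le> \<theta>" and E: "exp (3 * psi p a * t - a * real_of_int Y) \<le> E" "E \<le> 1 / 2" and Z: "Y \<le> Z"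
  shows "exp (- ((1 + 2 * E) * tail_mass Z)) - E * tail_mass Z \<le> measure M {\<omega>\<in>space M. \<forall>x>Z. \<not> \<eta> t \<omega> x}"
proof (rule LIMSEQ_le[OF _ vacant_above_limit])
  show "(\<lambda>R. exp (- ((1 + 2 * E) * (\<Sum>x\<in>{Z + 1..Z + int R}. occupation p {- int N..0} c t x)))
      - E * (\<Sum>x\<in>{Z + 1..Z + int R}. occupation p {- int N..0} c t x)) \<longlonglongrightarrow> exp (- ((1 + 2 * E) * tail_mass Z)) - E * tail_mass Z"
    by (intro tendsto_intros sum_interval_lim)
  have aabs: "\<bar>- a\<bar> \<le> \<theta>" "\<bar>a\<bar> \<le> \<theta>" using a by auto
  \<comment> \<open>The negative tilt fits an initial block to the left of \<open>0\<close>;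
    evenness of \<open>psi\<close> brings the estimate back to \<open>a\<close>.\<close>
  have small: "occupation p {- int N..0} c t x \<le> E" if "Y \<le> x" for x
  proof -
    have "occupation p {- int N..0} c t x \<le> exp (- a * (real_of_int x - 0) + t * psi p (- a))"
      by (rule occupation_le_exp[OF p initial_sites(1) c t aabs(1)]) (use a in \<open>auto simp: mult_le_0_iff\<close>)
    also have "\<dots> \<le> exp (3 * psi p a * t - a * real_of_int Y)"
    proof -
      have "t * psi p a \<le> 3 * psi p a * t" using psi_nonneg[OF p aabs(2)] t by simp
      moreover have "a * real_of_int Y \<le> a * real_of_int x" using a that by simp
      ultimately show ?thesis by (simp add: psi_uminus[OF p aabs(2)])
    qed
    finally show ?thesis using E by linarith
  qed
  show "\<exists>R0. \<forall>R\<ge>R0. exp (- ((1 + 2 * E) * (\<Sum>x\<in>{Z + 1..Z + int R}. occupation p {- int N..0} c t x)))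
      - E * (\<Sum>x\<in>{Z + 1..Z + int R}. occupation p {- int N..0} c t x)
      \<le> measure M {\<omega>\<in>space M. \<forall>x\<in>{Z + 1..Z + int R}. \<not> \<eta> t \<omega> x}"
  proof (intro exI allI impI)
    fix R :: nat
    let ?A = "{Z + 1..Z + int R}"
    let ?s = "\<Sum>x\<in>?A. occupation p {- int N..0} c t x"
    have "exp (- ((1 + 2 * E) * ?s)) \<le> (\<Prod>x\<in>?A. 1 - occupation p {- int N..0} c t x)"
      by (rule prod_one_minus_lower) (use occupation_01 small E Z in auto)
    moreover have "(\<Prod>x\<in>?A. 1 - occupation p {- int N..0} c t x) - exp (3 * psi p a * t - a * real_of_int Y) * ?s
        \<le> measure M {\<omega>\<in>space M. \<forall>x\<in>?A. \<not> \<eta> t \<omega> x}"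
      by (rule vacancy_bounds(2)[OF p t _ initial_sites c ex init a]) (use Z in auto)
    moreover have "exp (3 * psi p a * t - a * real_of_int Y) * ?s \<le> E * ?s"
      by (intro mult_right_mono E sum_nonneg occupation_01)
    ultimately show "exp (- ((1 + 2 * E) * ?s)) - E * ?s \<le> measure M {\<omega>\<in>space M. \<forall>x\<in>?A. \<not> \<eta> t \<omega> x}"
      by linarith
  qed
qed

text \<open>Without a maximum \<open>rightmost\<close> is unspecified. Configurations unbounded to the right are null, and
  the empty one is unlikely because the mean number of particles is conserved.\<close>

lemma no_max_bound:
  assumes a: "0 < a" "a \<le> \<theta>" and E: "exp (3 * psi p a * t - a * real_of_int Y) \<le> E" "E \<le> 1 / 2"
  shows "measure M {\<omega>\<in>space M. \<not> has_max (\<eta> t \<omega>)} \<le> exp (1 - (\<Sum>k\<le>N. c (- int k)))"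
proof -
  interpret prob_space M by (rule M_prob)
  let ?U = "{\<omega>\<in>space M. \<exists>Z. \<forall>x>Z. \<not> \<eta> t \<omega> x}"
  let ?V = "{\<omega>\<in>space M. \<forall>x. \<not> \<eta> t \<omega> x}"
  have sU: "{\<xi>\<in>space configs. \<exists>Z. \<forall>x. x > Z \<longrightarrow> \<not> \<xi> x} \<in> sets configs"
    and sV: "{\<xi>\<in>space configs. \<forall>x. \<not> \<xi> x} \<in> sets configs" by measurable
  have mU: "?U \<in> sets M" and mV: "?V \<in> sets M"
    using event_measurable[OF sU] event_measurable[OF sV] by simp_all
  \<comment> \<open>The mean number of particles to the right of a receding threshold tends to
    \<open>0\<close>, so the lower bound for vacancy tends to \<open>1\<close>.\<close>
  have "1 \<le> measure M ?U"
  proof (rule LIMSEQ_le_const2)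
    show "(\<lambda>i. exp (- ((1 + 2 * E) * tail_mass (Y + int i))) - E * tail_mass (Y + int i)) \<longlonglongrightarrow> 1"
      using tendsto_diff[OF tendsto_exp[OF tendsto_minus[OF tendsto_mult[OF tendsto_const tail_mass_limit]]]
          tendsto_mult[OF tendsto_const[of E] tail_mass_limit], of "1 + 2 * E" Y Y] by simp
    show "\<exists>i0. \<forall>i\<ge>i0. exp (- ((1 + 2 * E) * tail_mass (Y + int i))) - E * tail_mass (Y + int i) \<le> measure M ?U"
    proof (intro exI allI impI)
      fix i :: nat
      have "exp (- ((1 + 2 * E) * tail_mass (Y + int i))) - E * tail_mass (Y + int i)
         \<le> measure M {\<omega>\<in>space M. \<forall>x>Y + int i. \<not> \<eta> t \<omega> x}"
        by (rule vacant_above_lower[OF a E]) simp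
      also have "\<dots> \<le> measure M ?U" by (rule finite_measure_mono[OF _ mU]) auto
      finally show "exp (- ((1 + 2 * E) * tail_mass (Y + int i))) - E * tail_mass (Y + int i) \<le> measure M ?U" .
    qed
  qed
  then have "measure M (space M - ?U) \<le> 0" using prob_compl[OF mU] by simp
  moreover have "measure M ?V \<le> exp (1 - (\<Sum>k\<le>N. c (- int k)))"
  proof -
    let ?h = "occupation p {- int N..0} c t"
    have tot: "(?h has_sum (\<Sum>k\<le>N. c (- int k))) UNIV"
    proof -
      have "((\<lambda>x. \<Sum>k\<le>N. c (- int k) * heat p t (x + int k)) has_sum (\<Sum>k\<le>N. c (- int k) * 1)) UNIV"
      proof (intro has_sum_finite_sum has_sum_cmult_right finite_atMost)
        fix k
        show "((\<lambda>x. heat p t (x + int k)) has_sum 1) UNIV"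
          by (rule has_sum_reindex_bij_witness[where i = "\<lambda>x. x + int k" and j = "\<lambda>x. x - int k", THEN iffD1, OF _ _ _ _ _ _ heat_has_sum_1[OF p t]]) auto
      qed
      then show ?thesis by (simp add: occupation_eq[abs_def])
    qed
    \<comment> \<open>A finite set that misses at most \<open>1\<close> of the total mean. The
      tolerance \<open>1\<close> reappears as the summand in the exponent of the bound.\<close>
    obtain A where A: "finite A" "(\<Sum>k\<le>N. c (- int k)) - 1 \<le> sum ?h A"
      using has_sum_finite_approximation[OF tot, of 1] by (force simp: dist_real_def)
    have "measure M ?V \<le> measure M {\<omega>\<in>space M. \<forall>x\<in>A. \<not> \<eta> t \<omega> x}"
    proof (rule finite_measure_mono)
      have "{\<xi>\<in>space configs. \<forall>x\<in>A. \<not> \<xi> x} \<in> sets configs" by measurable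
      from event_measurable[OF this] show "{\<omega>\<in>space M. \<forall>x\<in>A. \<not> \<eta> t \<omega> x} \<in> sets M" by simp
    qed auto
    also have "\<dots> \<le> (\<Prod>x\<in>A. 1 - ?h x)" by (rule vacancy_bounds(1)[OF p t A(1) initial_sites c ex init])
    also have "\<dots> \<le> exp (- sum ?h A)" by (rule prod_one_minus_upper) (use A occupation_01 in auto)
    also have "\<dots> \<le> exp (1 - (\<Sum>k\<le>N. c (- int k)))" using A(2) by simp
    finally show ?thesis .
  qed
  moreover have "measure M {\<omega>\<in>space M. \<not> has_max (\<eta> t \<omega>)} \<le> measure M ((space M - ?U) \<union> ?V)"
    by (rule finite_measure_mono) (use mU mV in \<open>auto simp: has_max_def\<close>)
  moreover have "\<dots> \<le> measure M (space M - ?U) + measure M ?V"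
    by (rule measure_Un_le) (use mU mV in auto)
  ultimately show ?thesis by linarith
qed

text \<open>Where a maximum exists, \<open>rightmost \<le> Y\<close> and vacancy above
  \<open>Y\<close> are the same event; \<open>e\<close> bounds the probability that none
  exists.\<close>

lemma rightmost_bounds:
  assumes a: "0 < a" "a \<le> \<theta>" and E: "exp (3 * psi p a * t - a * real_of_int Y) \<le> E" "E \<le> 1 / 2"
  defines "e \<equiv> exp (1 - (\<Sum>k\<le>N. c (- int k)))"
  shows "measure M {\<omega>\<in>space M. rightmost (\<eta> t \<omega>) \<le> Y} \<le> exp (- tail_mass Y) + e"
    and "exp (- ((1 + 2 * E) * tail_mass Y)) - E * tail_mass Y - e \<le> measure M {\<omega>\<in>space M. rightmost (\<eta> t \<omega>) \<le> Y}"
proof -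
  interpret prob_space M by (rule M_prob)
  let ?R = "{\<omega>\<in>space M. rightmost (\<eta> t \<omega>) \<le> Y}" and ?V = "{\<omega>\<in>space M. \<forall>x>Y. \<not> \<eta> t \<omega> x}"
    and ?H = "{\<omega>\<in>space M. \<not> has_max (\<eta> t \<omega>)}"
  have "space configs - {\<eta>. has_max \<eta>} \<in> sets configs" by (intro sets.Diff sets.top has_max_sets)
  from event_measurable[OF this] have mH: "?H \<in> sets M" by simp
  have mR: "?R \<in> sets M" using event_measurable[OF rightmost_sets] by simp
  have mV: "?V \<in> sets M" using event_measurable[OF vacant_above_sets] by simp
  have He: "measure M ?H \<le> e" unfolding e_def by (rule no_max_bound[OF a E])
  have "measure M ?R \<le> measure M (?V \<union> ?H)"
    by (rule finite_measure_mono) (use mV mH rightmost_le_iff in auto)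
  also have "\<dots> \<le> measure M ?V + measure M ?H" by (rule measure_Un_le[OF mV mH])
  finally show "measure M ?R \<le> exp (- tail_mass Y) + e" using He vacant_above_upper[of Y] by linarith
  have "measure M ?V \<le> measure M (?R \<union> ?H)"
    by (rule finite_measure_mono) (use mR mH rightmost_le_iff in auto)
  also have "\<dots> \<le> measure M ?R + measure M ?H" by (rule measure_Un_le[OF mR mH])
  finally show "exp (- ((1 + 2 * E) * tail_mass Y)) - E * tail_mass Y - e \<le> measure M ?R"
    using He vacant_above_lower[OF a E order.refl] by linarith
qed

end

section \<open>The two regimes\<close>

text \<open>\<open>h\<close> is \<sigma> times the tilt for the threshold of part (a), and
  \<open>K\<close> will be \<open>ln (sqrt (2 * pi))\<close>. The exponential in the fourth limit is
  of order \<open>sqrt t / ln t\<close>, and its prefactor of order \<open>ln t / sqrt t\<close>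
  cancels it: the centring in the theorem is chosen for this.\<close>

lemma scale_long:
  fixes x K :: real
  defines "h \<equiv> \<lambda>t. (x + ln t - ln (ln t) - K) / sqrt (t * ln t)"
  shows "filterlim h (at_right 0) at_top"
    and "filterlim (\<lambda>t. h t * sqrt t) at_top at_top"
    and "((\<lambda>t. t * h t ^ 3) \<longlongrightarrow> 0) at_top"
    and "((\<lambda>t. sqrt t * (h t)\<^sup>2 * exp (t * (h t)\<^sup>2 / 2)) \<longlongrightarrow> exp (x - K)) at_top"
    and "((\<lambda>t. h t * sqrt (t / ln t)) \<longlongrightarrow> 1) at_top"
  unfolding h_def by real_asymp+

text \<open>The same calibration for part (b), written in \<open>l = ln (L\<^sup>2)\<close>: here
  \<open>\<phi> l\<close> is \<sigma> times \<open>sqrt t\<close> times the tilt, and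
  \<open>exp (l / 2)\<close> is \<open>L\<close>.\<close>

lemma scale_short:
  fixes x K :: real
  defines "\<phi> \<equiv> \<lambda>l. (x + l - ln l / 2 - K) / sqrt l"
  shows "filterlim \<phi> at_top at_top"
    and "((\<lambda>l. \<phi> l * exp ((\<phi> l)\<^sup>2 / 2) / exp (l / 2)) \<longlongrightarrow> exp (x - K)) at_top"
    and "\<forall>\<^sub>F l in at_top. \<phi> l \<le> 2 * sqrt l"
proof -
  show "filterlim \<phi> at_top at_top" "\<forall>\<^sub>F l in at_top. \<phi> l \<le> 2 * sqrt l"
    unfolding \<phi>_def by real_asymp+
  show "((\<lambda>l. \<phi> l * exp ((\<phi> l)\<^sup>2 / 2) / exp (l / 2)) \<longlongrightarrow> exp (x - K)) at_top"
    unfolding \<phi>_def by real_asymp (simp add: exp_minus[symmetric] diff_divide_distrib)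
qed

lemma log_power_limits:
  "((\<lambda>t::real. 2 * sqrt (ln t) / sqrt t) \<longlongrightarrow> 0) at_top"
  "((\<lambda>t::real. 8 * ln t * sqrt (ln t) / sqrt t) \<longlongrightarrow> 0) at_top"
  by real_asymp+

lemma periodic_weight_divergence:
  fixes r :: "nat \<Rightarrow> real"
  assumes "1 \<le> m" "\<And>k. 1 \<le> k \<Longrightarrow> r (k + m) = r k" "\<And>k. 0 \<le> r k" "\<And>k. r k \<le> 1"
    "rbar = (\<Sum>j=1..m. r j) / real m"
  shows "rbar * real (Suc N) - real m \<le> (\<Sum>k\<le>N. r k)"
  using periodic_partial_sums[OF assms, of N] by (simp add: sum_subtractf abs_le_iff algebra_simps)

lemma filterlim_at_bot_mono:
  fixes f g :: "'a \<Rightarrow> real"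
  assumes "filterlim f at_bot F" "\<forall>\<^sub>F x in F. g x \<le> f x"
  shows "filterlim g at_bot F"
  unfolding filterlim_at_bot
proof
  fix Z
  from assms(1) have "\<forall>\<^sub>F x in F. f x \<le> Z" by (simp add: filterlim_at_bot)
  with assms(2) show "\<forall>\<^sub>F x in F. g x \<le> Z" by eventually_elim simp
qed

text \<open>The two regimes differ in the asymptotics of \<open>W\<close>, so these enter as
  assumptions. The choice \<open>\<alpha> t = y t / (\<sigma>\<^sup>2 * t)\<close> puts the tilted
  mean at the threshold, where the local limit has its central value.\<close>

lemma rightmost_limit:
  fixes \<eta> :: "real \<Rightarrow> 'w \<Rightarrow> config" and P :: "config measure \<Rightarrow> 'w measure"
    and \<rho> :: "int \<Rightarrow> real" and L y \<alpha> :: "real \<Rightarrow> real" and \<nu> :: "real \<Rightarrow> config measure"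
  assumes irr: "irreducible_walk p" and p: "exp_moment p \<theta>"
    and \<sigma>: "\<sigma>\<^sup>2 = (\<Sum>\<^sub>\<infinity>i. (real_of_int i)\<^sup>2 * pmf p i)" "0 < \<sigma>"
    and process: "\<And>\<mu>. \<mu> \<in> space (prob_algebra configs) \<Longrightarrow>
          exclusion_process p (P \<mu>) \<eta> \<and> distr (P \<mu>) configs (\<eta> 0) = \<mu>"
    and \<rho>: "\<And>x. 0 \<le> \<rho> x \<and> \<rho> x \<le> 1" "\<rho> 0 = 1"
    and m: "1 \<le> m" and per: "\<And>k. 1 \<le> k \<Longrightarrow> \<rho> (- int (k + m)) = \<rho> (- int k)"
    and rbar: "rbar = (\<Sum>j=1..m. \<rho> (- int j)) / real m" and rpos: "0 < rbar"
    and L: "filterlim L at_top at_top"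
    and \<nu>: "\<And>t. \<nu> t = bernoulli_product (\<lambda>k. if - L t \<le> real_of_int k \<and> k \<le> 0 then \<rho> k else 0)"
    and \<alpha>: "\<And>t. \<alpha> t = y t / (\<sigma>\<^sup>2 * t)"
    and \<alpha>0: "filterlim \<alpha> (at_right 0) at_top" and \<alpha>1: "filterlim (\<lambda>t. \<alpha> t * sqrt t) at_top at_top"
    and \<alpha>3: "((\<lambda>t. t * \<alpha> t ^ 3) \<longlongrightarrow> 0) at_top"
  defines "N \<equiv> \<lambda>t. nat \<lfloor>L t\<rfloor>"
  defines "W \<equiv> \<lambda>t. \<Sum>k\<le>N t. \<rho> (- int k) * exp (- \<alpha> t) ^ k"
    and "W1 \<equiv> \<lambda>t. \<Sum>k\<le>N t. \<rho> (- int k) * (real k * exp (- \<alpha> t) ^ k)"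
  assumes W1: "((\<lambda>t. W1 t / W t / sqrt t) \<longlongrightarrow> 0) at_top"
    and lim: "((\<lambda>t. W t / (\<sigma> * sqrt (2 * pi) * sqrt t * \<alpha> t * exp (\<sigma>\<^sup>2 * t * (\<alpha> t)\<^sup>2 / 2))) \<longlongrightarrow> \<Lambda>) at_top"
  shows "((\<lambda>t. \<P>(\<omega> in P (\<nu> t). real_of_int (rightmost (\<eta> t \<omega>)) \<le> y t)) \<longlongrightarrow> exp (- \<Lambda>)) at_top"
proof -
  define r where "r k = \<rho> (- int k)" for k
  define Y where "Y t = \<lfloor>y t\<rfloor>" for t
  define lam where "lam t = (\<Sum>k\<le>N t. r k * (\<Sum>n. heat p t (Y t + 1 + int n + int k)))" for t
  have \<theta>: "0 < \<theta>" using p by (rule exp_momentD)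
  have a0: "(\<alpha> \<longlongrightarrow> 0) at_top" and apos: "\<forall>\<^sub>F t in at_top. 0 < \<alpha> t"
    using \<alpha>0 by (auto simp: filterlim_at elim: eventually_mono)
  have yY: "\<forall>\<^sub>F t in at_top. \<bar>real_of_int (Y t) - \<sigma>\<^sup>2 * t * \<alpha> t\<bar> \<le> 1"
    using eventually_gt_at_top[of 0]
  proof eventually_elim
    case (elim t)
    then have "\<sigma>\<^sup>2 * t * \<alpha> t = y t" using \<sigma>(2) by (simp add: \<alpha>)
    then show ?case unfolding Y_def by linarith
  qed
  have r0: "0 \<le> r k" "r k \<le> 1" "r 0 = 1" for k using \<rho> by (auto simp: r_def)
  have rper: "r (k + m) = r k" if "1 \<le> k" for k using per[OF that] by (simp only: r_def)
  have rb: "rbar = (\<Sum>j=1..m. r j) / real m" by (simp add: rbar r_def)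
  have tl: "((\<lambda>t. lam t * (\<sigma> * sqrt (2 * pi) * sqrt t * \<alpha> t * exp (\<sigma>\<^sup>2 * t * (\<alpha> t)\<^sup>2 / 2)) / W t) \<longlongrightarrow> 1) at_top"
    unfolding lam_def W_def r_def[symmetric]
    by (rule tail_limit[where r = r and Y = Y, OF irr p \<sigma> \<alpha>0 \<alpha>1 \<alpha>3 yY r0(1) r0(3)]) (use W1 in \<open>simp add: W1_def W_def r_def\<close>)
  have Wpos: "0 < W t" for t
  proof -
    have "(\<Sum>k\<in>{0}. \<rho> (- int k) * exp (- \<alpha> t) ^ k) \<le> W t" unfolding W_def by (rule sum_mono2) (use \<rho> in auto)
    then show ?thesis using \<rho> by simp
  qed
  have lamL: "(lam \<longlongrightarrow> \<Lambda>) at_top"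
  proof (rule Lim_transform_eventually)
    show "((\<lambda>t. (lam t * (\<sigma> * sqrt (2 * pi) * sqrt t * \<alpha> t * exp (\<sigma>\<^sup>2 * t * (\<alpha> t)\<^sup>2 / 2)) / W t)
       * (W t / (\<sigma> * sqrt (2 * pi) * sqrt t * \<alpha> t * exp (\<sigma>\<^sup>2 * t * (\<alpha> t)\<^sup>2 / 2)))) \<longlongrightarrow> \<Lambda>) at_top"
      using tendsto_mult[OF tl lim] by simp
    show "\<forall>\<^sub>F t in at_top. (lam t * (\<sigma> * sqrt (2 * pi) * sqrt t * \<alpha> t * exp (\<sigma>\<^sup>2 * t * (\<alpha> t)\<^sup>2 / 2)) / W t)
       * (W t / (\<sigma> * sqrt (2 * pi) * sqrt t * \<alpha> t * exp (\<sigma>\<^sup>2 * t * (\<alpha> t)\<^sup>2 / 2))) = lam t"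
      using apos eventually_gt_at_top[of 0]
      by eventually_elim (use Wpos \<sigma> in \<open>simp add: less_imp_neq[symmetric]\<close>)
  qed
  obtain K where K: "0 \<le> K" "\<And>a. \<bar>a\<bar> \<le> \<theta> / 2 \<Longrightarrow> \<bar>psi p a - \<sigma>\<^sup>2 / 2 * a\<^sup>2\<bar> \<le> K * \<bar>a\<bar> ^ 3"
    using psi_expansion[OF p \<sigma>(1)] by blast
  \<comment> \<open>With a fraction \<open>f\<close> of \<alpha> the exponent of \<open>E\<close> is
    to leading order \<open>(3 / 2 * f\<^sup>2 - f) * \<sigma>\<^sup>2 * t * (\<alpha>
    t)\<^sup>2\<close>. This is negative for \<open>f\<close> between 0 and 2/3, and
    \<open>f = 1 / 6\<close> gives the coefficient -1/8.\<close>
  define a where "a t = \<alpha> t / 6" for t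
  define E where "E t = exp (3 * psi p (a t) * t - a t * real_of_int (Y t))" for t
  define e where "e t = exp (1 - (\<Sum>k\<le>N t. r k))" for t
  have E0: "(E \<longlongrightarrow> 0) at_top"
  proof -
    have up: "\<forall>\<^sub>F t in at_top. 3 * psi p (a t) * t - a t * real_of_int (Y t) \<le> (\<alpha> t / 6 + K * (t * \<alpha> t ^ 3)) + (- (\<sigma>\<^sup>2 / 8)) * (\<alpha> t * sqrt t)\<^sup>2"
      using apos order_tendstoD(2)[OF a0 \<theta>] eventually_gt_at_top[of 0] yY
    proof eventually_elim
      case (elim t)
      have at: "0 < a t" "\<bar>a t\<bar> \<le> \<theta> / 2" using elim by (auto simp: a_def)
      have "psi p (a t) \<le> \<sigma>\<^sup>2 / 2 * (a t)\<^sup>2 + K * \<bar>a t\<bar> ^ 3" using K(2)[OF at(2)] by linarith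
      then have "psi p (a t) * t \<le> (\<sigma>\<^sup>2 / 2 * (a t)\<^sup>2 + K * \<bar>a t\<bar> ^ 3) * t" using elim by (intro mult_right_mono) auto
      also have "\<dots> = \<sigma>\<^sup>2 / 72 * (t * (\<alpha> t)\<^sup>2) + K / 216 * (t * \<alpha> t ^ 3)"
        using elim by (simp add: a_def power_divide algebra_simps)
      finally have 1: "3 * psi p (a t) * t \<le> \<sigma>\<^sup>2 / 24 * (t * (\<alpha> t)\<^sup>2) + K / 72 * (t * \<alpha> t ^ 3)" by simp
      have "\<sigma>\<^sup>2 * t * \<alpha> t - 1 \<le> real_of_int (Y t)" using elim by linarith
      then have "a t * (\<sigma>\<^sup>2 * t * \<alpha> t - 1) \<le> a t * real_of_int (Y t)" using at by (intro mult_left_mono) auto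
      moreover have "a t * (\<sigma>\<^sup>2 * t * \<alpha> t - 1) = \<sigma>\<^sup>2 / 6 * (t * (\<alpha> t)\<^sup>2) - \<alpha> t / 6"
        by (simp add: a_def power2_eq_square algebra_simps)
      moreover have "K / 72 * (t * \<alpha> t ^ 3) \<le> K * (t * \<alpha> t ^ 3)"
        using K(1) elim by (intro mult_right_mono) auto
      moreover have "(- (\<sigma>\<^sup>2 / 8)) * (\<alpha> t * sqrt t)\<^sup>2 = - (\<sigma>\<^sup>2 / 8) * (t * (\<alpha> t)\<^sup>2)"
        using elim by (simp add: power_mult_distrib)
      ultimately show ?case using 1 by linarith
    qed
    have "((\<lambda>t. \<alpha> t / 6 + K * (t * \<alpha> t ^ 3)) \<longlongrightarrow> 0 / 6 + K * 0) at_top"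
      by (intro tendsto_intros a0 \<alpha>3) simp
    moreover have "filterlim (\<lambda>t. (- (\<sigma>\<^sup>2 / 8)) * (\<alpha> t * sqrt t)\<^sup>2) at_bot at_top"
      by (rule filterlim_tendsto_neg_mult_at_bot[OF tendsto_const])
         (use \<sigma>(2) filterlim_pow_at_top[OF _ \<alpha>1, of 2] in auto)
    ultimately have "filterlim (\<lambda>t. (\<alpha> t / 6 + K * (t * \<alpha> t ^ 3)) + (- (\<sigma>\<^sup>2 / 8)) * (\<alpha> t * sqrt t)\<^sup>2) at_bot at_top"
      by (rule filterlim_tendsto_add_at_bot_iff[THEN iffD2])
    then have "filterlim (\<lambda>t. 3 * psi p (a t) * t - a t * real_of_int (Y t)) at_bot at_top"
      by (rule filterlim_at_bot_mono) (rule up)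
    then show ?thesis unfolding E_def by (rule filterlim_compose[OF exp_at_bot])
  qed
  \<comment> \<open>A positive mean density on a growing block makes the mean number of particles
    diverge, so the configurations without a maximum disappear in the limit.\<close>
  have e0: "(e \<longlongrightarrow> 0) at_top"
  proof -
    have "filterlim (\<lambda>t. (real m + 1) + (- rbar) * L t) at_bot at_top"
      by (intro filterlim_tendsto_add_at_bot_iff[THEN iffD2, OF tendsto_const] filterlim_tendsto_neg_mult_at_bot[OF tendsto_const _ L]) (use rpos in simp)
    moreover have "1 - (\<Sum>k\<le>N t. r k) \<le> (real m + 1) + (- rbar) * L t" for t
    proof -
      have "L t \<le> real (Suc (N t))" unfolding N_def by linarith
      then have "rbar * L t \<le> rbar * real (Suc (N t))" using rpos by (intro mult_left_mono) auto
      then show ?thesis using periodic_weight_divergence[where r = r, OF m rper r0(1) r0(2) rb, of "N t"] by simp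
    qed
    ultimately have "filterlim (\<lambda>t. 1 - (\<Sum>k\<le>N t. r k)) at_bot at_top"
      by (rule filterlim_at_bot_mono[OF _ always_eventually[OF allI]])
    then show ?thesis unfolding e_def by (rule filterlim_compose[OF exp_at_bot])
  qed
  have ev: "\<forall>\<^sub>F t in at_top. exp (- ((1 + 2 * E t) * lam t)) - E t * lam t - e t \<le> \<P>(\<omega> in P (\<nu> t). real_of_int (rightmost (\<eta> t \<omega>)) \<le> y t)
      \<and> \<P>(\<omega> in P (\<nu> t). real_of_int (rightmost (\<eta> t \<omega>)) \<le> y t) \<le> exp (- lam t) + e t"
    using apos order_tendstoD(2)[OF a0 \<theta>] order_tendstoD(2)[OF E0, of "1 / 2", OF half_gt_zero[OF zero_less_one]] eventually_gt_at_top[of 0]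
      filterlim_at_top_dense[THEN iffD1, OF L, rule_format, of 0]
  proof eventually_elim
    case (elim t)
    have \<nu>t: "\<nu> t = bernoulli_product (\<lambda>k. if k \<in> {- int (N t)..0} then \<rho> k else 0)"
    proof -
      have "- L t \<le> real_of_int k \<and> k \<le> 0 \<longleftrightarrow> k \<in> {- int (N t)..0}" for k
      proof -
        have "- L t \<le> real_of_int k \<longleftrightarrow> - k \<le> \<lfloor>L t\<rfloor>" by (simp add: le_floor_iff) linarith
        then show ?thesis using elim by (auto simp: N_def)
      qed
      then show ?thesis by (simp only: \<nu>)
    qed
    have "\<nu> t \<in> space (prob_algebra configs)" unfolding \<nu> by (rule bernoulli_product_space)
    from process[OF this] have pr: "exclusion_process p (P (\<nu> t)) \<eta>"
      "distr (P (\<nu> t)) configs (\<eta> 0) = bernoulli_product (\<lambda>k. if k \<in> {- int (N t)..0} then \<rho> k else 0)"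
      using \<nu>t by auto
    have at: "0 < a t" "a t \<le> \<theta>" using elim by (auto simp: a_def)
    have t0: "0 \<le> t" using elim by simp
    have "tail_mass p t (N t) \<rho> (Y t) = lam t" by (simp add: tail_mass_def[OF p t0 \<rho>(1) pr] lam_def r_def)
    moreover have "{\<omega>\<in>space (P (\<nu> t)). real_of_int (rightmost (\<eta> t \<omega>)) \<le> y t} = {\<omega>\<in>space (P (\<nu> t)). rightmost (\<eta> t \<omega>) \<le> Y t}"
      by (simp add: Y_def le_floor_iff)
    ultimately show ?case
      using rightmost_bounds[OF p t0 \<rho>(1) pr at, of "Y t" "E t"] elim unfolding e_def r_def
      by (simp add: E_def)
  qed
  show ?thesis
  proof (rule tendsto_sandwich)
    show "\<forall>\<^sub>F t in at_top. exp (- ((1 + 2 * E t) * lam t)) - E t * lam t - e t \<le> \<P>(\<omega> in P (\<nu> t). real_of_int (rightmost (\<eta> t \<omega>)) \<le> y t)"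
      "\<forall>\<^sub>F t in at_top. \<P>(\<omega> in P (\<nu> t). real_of_int (rightmost (\<eta> t \<omega>)) \<le> y t) \<le> exp (- lam t) + e t"
      using ev by (auto elim: eventually_mono)
    have "((\<lambda>t. exp (- ((1 + 2 * E t) * lam t)) - E t * lam t - e t) \<longlongrightarrow> exp (- ((1 + 2 * 0) * \<Lambda>)) - 0 * \<Lambda> - 0) at_top"
      by (intro tendsto_intros E0 e0 lamL)
    then show "((\<lambda>t. exp (- ((1 + 2 * E t) * lam t)) - E t * lam t - e t) \<longlongrightarrow> exp (- \<Lambda>)) at_top" by simp
    have "((\<lambda>t. exp (- lam t) + e t) \<longlongrightarrow> exp (- \<Lambda>) + 0) at_top" by (intro tendsto_intros e0 lamL)
    then show "((\<lambda>t. exp (- lam t) + e t) \<longlongrightarrow> exp (- \<Lambda>)) at_top" by simp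
  qed
qed

text \<open>Here the tilt sees a block of rescaled length \<open>c / \<sigma>\<close>, so the weight
  is asymptotically \<open>rbar * (1 - exp (- c / \<sigma>)) / \<alpha>\<close>. As
  \<open>h = \<sigma> * \<alpha>\<close>, expressing the denominator through \<open>h\<close> leaves
  one factor \<sigma> in the limit.\<close>

lemma long_initial_condition:
  fixes r :: "nat \<Rightarrow> real" and x \<sigma> rbar :: real and L :: "real \<Rightarrow> real" and c :: ereal
  assumes m: "1 \<le> m" and per: "\<And>k. 1 \<le> k \<Longrightarrow> r (k + m) = r k" and r0: "\<And>k. 0 \<le> r k" and r1: "\<And>k. r k \<le> 1"
    and rbar: "rbar = (\<Sum>j=1..m. r j) / real m" and rpos: "0 < rbar"
    and \<sigma>: "0 < \<sigma>" and L: "filterlim L at_top at_top"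
    and c: "0 < c" "((\<lambda>t. ereal (L t * sqrt (ln t / t))) \<longlongrightarrow> c) at_top"
  defines "\<alpha> \<equiv> \<lambda>t. \<sigma> * sqrt (t / ln t) * (x + ln (t / (sqrt (2 * pi) * ln t))) / (\<sigma>\<^sup>2 * t)"
    and "N \<equiv> \<lambda>t. nat \<lfloor>L t\<rfloor>"
  defines "W \<equiv> \<lambda>t. \<Sum>k\<le>N t. r k * exp (- \<alpha> t) ^ k"
    and "W1 \<equiv> \<lambda>t. \<Sum>k\<le>N t. r k * (real k * exp (- \<alpha> t) ^ k)"
  shows "filterlim \<alpha> (at_right 0) at_top" "filterlim (\<lambda>t. \<alpha> t * sqrt t) at_top at_top"
    "((\<lambda>t. t * \<alpha> t ^ 3) \<longlongrightarrow> 0) at_top" "((\<lambda>t. W1 t / W t / sqrt t) \<longlongrightarrow> 0) at_top"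
    "((\<lambda>t. W t / (\<sigma> * sqrt (2 * pi) * sqrt t * \<alpha> t * exp (\<sigma>\<^sup>2 * t * (\<alpha> t)\<^sup>2 / 2)))
      \<longlongrightarrow> \<sigma> * rbar * (1 - (if c = \<infinity> then 0 else exp (- real_of_ereal c / \<sigma>))) * exp (- x)) at_top"
proof -
  define K where "K = ln (sqrt (2 * pi))"
  define h where "h t = (x + ln t - ln (ln t) - K) / sqrt (t * ln t)" for t
  define e where "e = (if c = \<infinity> then 0 else exp (- real_of_ereal c / \<sigma>))"
  note sc = scale_long[of x K, folded h_def]
  have h0: "(h \<longlongrightarrow> 0) at_top" and hpos: "\<forall>\<^sub>F t in at_top. 0 < h t"
    using sc(1) by (auto simp: filterlim_at elim: eventually_mono)
  have \<alpha>h: "\<forall>\<^sub>F t in at_top. \<alpha> t = h t / \<sigma>"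
    using eventually_gt_at_top[of "exp 1"]
  proof eventually_elim
    case (elim t)
    have t: "0 < t" using elim exp_gt_zero[of "1::real"] by linarith
    have "(1::real) < exp 1" by simp
    then have "1 < t" using elim by (rule less_trans)
    then have l: "0 < ln t" by simp
    have "ln (t / (sqrt (2 * pi) * ln t)) = ln t - ln (ln t) - K"
      using t l by (simp add: ln_div ln_mult K_def)
    moreover have "sqrt (t / ln t) / t = 1 / sqrt (t * ln t)"
      using t l by (simp add: real_sqrt_divide real_sqrt_mult field_simps)
    moreover have "\<alpha> t = \<sigma> / \<sigma>\<^sup>2 * ((x + ln (t / (sqrt (2 * pi) * ln t))) * (sqrt (t / ln t) / t))"
      by (simp add: \<alpha>_def)
    ultimately have "\<alpha> t = \<sigma> / \<sigma>\<^sup>2 * ((x + (ln t - ln (ln t) - K)) * (1 / sqrt (t * ln t)))"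
      by (simp only:)
    also have "\<dots> = h t / \<sigma>" using \<sigma> by (simp add: h_def power2_eq_square add_diff_eq)
    finally show ?case .
  qed
  show \<alpha>0: "filterlim \<alpha> (at_right 0) at_top"
  proof -
    have "((\<lambda>t. h t / \<sigma>) \<longlongrightarrow> 0) at_top" using tendsto_divide[OF h0 tendsto_const, of \<sigma>] \<sigma> by simp
    moreover have "\<forall>\<^sub>F t in at_top. 0 < h t / \<sigma>" using hpos by eventually_elim (use \<sigma> in simp)
    ultimately have "filterlim (\<lambda>t. h t / \<sigma>) (at_right 0) at_top"
      by (auto simp: filterlim_at elim: eventually_mono)
    then show ?thesis by (subst filterlim_cong[OF refl refl \<alpha>h])
  qed
  show \<alpha>1: "filterlim (\<lambda>t. \<alpha> t * sqrt t) at_top at_top"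
  proof -
    have "filterlim (\<lambda>t. (1 / \<sigma>) * (h t * sqrt t)) at_top at_top"
      using \<sigma> by (intro filterlim_tendsto_pos_mult_at_top[OF tendsto_const _ sc(2)]) simp
    moreover have "\<forall>\<^sub>F t in at_top. \<alpha> t * sqrt t = (1 / \<sigma>) * (h t * sqrt t)"
      using \<alpha>h by eventually_elim simp
    ultimately show ?thesis by (subst filterlim_cong[OF refl refl])
  qed
  show "((\<lambda>t. t * \<alpha> t ^ 3) \<longlongrightarrow> 0) at_top"
  proof (rule Lim_transform_eventually)
    show "((\<lambda>t. t * h t ^ 3 / \<sigma> ^ 3) \<longlongrightarrow> 0) at_top"
      using tendsto_divide[OF sc(3) tendsto_const, of "\<sigma> ^ 3"] \<sigma> by simp
    show "\<forall>\<^sub>F t in at_top. t * h t ^ 3 / \<sigma> ^ 3 = t * \<alpha> t ^ 3"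
      using \<alpha>h by eventually_elim (simp add: power_divide)
  qed
  have a0: "(\<alpha> \<longlongrightarrow> 0) at_top" and apos: "\<forall>\<^sub>F t in at_top. 0 < \<alpha> t"
    using \<alpha>0 by (auto simp: filterlim_at elim: eventually_mono)
  have Lpos: "\<forall>\<^sub>F t in at_top. 0 < L t" using L by (simp add: filterlim_at_top_dense)
  \<comment> \<open>The two square roots are reciprocal. Since \<open>h t * sqrt (t / ln t)\<close>
    tends to \<open>1\<close>, the assumption on \<open>L\<close> becomes
    \<open>\<alpha> t * L t\<close> tending to \<open>c / \<sigma>\<close>.\<close>
  have \<alpha>L: "\<forall>\<^sub>F t in at_top. (1 / \<sigma>) * (h t * sqrt (t / ln t)) * (L t * sqrt (ln t / t)) = \<alpha> t * L t"
    using \<alpha>h eventually_gt_at_top[of 1]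
  proof eventually_elim
    case (elim t)
    have "sqrt (t / ln t) * sqrt (ln t / t) = 1"
      using elim by (simp add: real_sqrt_mult[symmetric])
    then show ?case using elim by (simp add: mult.assoc mult.left_commute)
  qed
  have one: "((\<lambda>t. (1 / \<sigma>) * (h t * sqrt (t / ln t))) \<longlongrightarrow> (1 / \<sigma>) * 1) at_top"
    by (intro tendsto_intros sc(5))
  have e: "((\<lambda>t. exp (- (\<alpha> t * real (Suc (N t))))) \<longlongrightarrow> e) at_top"
  proof (cases "c = \<infinity>")
    case True
    then have "filterlim (\<lambda>t. L t * sqrt (ln t / t)) at_top at_top"
      using c(2) by (simp add: tendsto_PInfty_eq_at_top)
    then have "filterlim (\<lambda>t. (1 / \<sigma>) * (h t * sqrt (t / ln t)) * (L t * sqrt (ln t / t))) at_top at_top"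
      using \<sigma> by (intro filterlim_tendsto_pos_mult_at_top[OF one]) auto
    then have "filterlim (\<lambda>t. \<alpha> t * L t) at_top at_top"
      by (subst (asm) filterlim_cong[OF refl refl \<alpha>L])
    then have "filterlim (\<lambda>t. \<alpha> t * real (Suc (N t))) at_top at_top"
    proof (rule filterlim_at_top_mono)
      show "\<forall>\<^sub>F t in at_top. \<alpha> t * L t \<le> \<alpha> t * real (Suc (N t))"
        using apos by eventually_elim (intro mult_left_mono, auto simp: N_def, linarith)
    qed
    then have "filterlim (\<lambda>t. - (\<alpha> t * real (Suc (N t)))) at_bot at_top"
      by (simp only: filterlim_uminus_at_top)
    from filterlim_compose[OF exp_at_bot this] show ?thesis using True by (simp add: e_def)
  next
    case False
    then obtain d where d: "c = ereal d" using c(1) by (cases c) auto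
    then have "((\<lambda>t. L t * sqrt (ln t / t)) \<longlongrightarrow> d) at_top" using c(2) by simp
    then have "((\<lambda>t. (1 / \<sigma>) * (h t * sqrt (t / ln t)) * (L t * sqrt (ln t / t))) \<longlongrightarrow> (1 / \<sigma>) * 1 * d) at_top"
      by (intro tendsto_mult[OF one])
    then have l1: "((\<lambda>t. \<alpha> t * L t) \<longlongrightarrow> d / \<sigma>) at_top"
      using \<alpha>L by (auto intro: Lim_transform_eventually)
    \<comment> \<open>The block has \<open>Suc (N t)\<close> sites rather than \<open>L t\<close>;
      the difference is at most \<open>1\<close> and is multiplied by a null sequence.\<close>
    have l2: "((\<lambda>t. \<alpha> t * (real (Suc (N t)) - L t)) \<longlongrightarrow> 0) at_top"
    proof (rule Lim_null_comparison[OF _ a0])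
      show "\<forall>\<^sub>F t in at_top. norm (\<alpha> t * (real (Suc (N t)) - L t)) \<le> \<alpha> t"
        using apos Lpos
      proof eventually_elim
        case (elim t)
        have "0 \<le> real (Suc (N t)) - L t" "real (Suc (N t)) - L t \<le> 1" using elim by (auto simp: N_def) linarith+
        then show ?case using elim by (simp add: abs_mult mult_left_le del: of_nat_Suc)
      qed
    qed
    have "((\<lambda>t. exp (- (\<alpha> t * L t + \<alpha> t * (real (Suc (N t)) - L t)))) \<longlongrightarrow> exp (- (d / \<sigma> + 0))) at_top"
      by (intro tendsto_intros l1 l2)
    then show ?thesis using False d by (simp add: e_def algebra_simps del: of_nat_Suc)
  qed
  \<comment> \<open>Positivity of \<open>c\<close> keeps the limiting weight away from
    \<open>0\<close>, as the first-moment estimate requires.\<close>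
  have e1: "e < 1"
  proof (cases c)
    case (real d)
    then show ?thesis using c(1) \<sigma> by (simp add: e_def)
  qed (use c(1) in \<open>auto simp: e_def\<close>)
  show "((\<lambda>t. W1 t / W t / sqrt t) \<longlongrightarrow> 0) at_top"
    unfolding W1_def W_def by (rule first_moment_long[OF m per r0 r1 rbar rpos \<alpha>0 \<alpha>1 e e1])
  have Wl: "((\<lambda>t. \<alpha> t * W t) \<longlongrightarrow> rbar * (1 - e)) at_top"
    unfolding W_def by (rule weight_limit_long[OF m per r0 r1 rbar rpos \<alpha>0 \<alpha>1 e])
  have D: "sqrt (2 * pi) * exp (x - K) = exp x" by (simp add: exp_diff K_def)
  show "((\<lambda>t. W t / (\<sigma> * sqrt (2 * pi) * sqrt t * \<alpha> t * exp (\<sigma>\<^sup>2 * t * (\<alpha> t)\<^sup>2 / 2)))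
      \<longlongrightarrow> \<sigma> * rbar * (1 - (if c = \<infinity> then 0 else exp (- real_of_ereal c / \<sigma>))) * exp (- x)) at_top"
  proof (rule Lim_transform_eventually)
    have "((\<lambda>t. \<sigma> * (\<alpha> t * W t) / (sqrt (2 * pi) * (sqrt t * (h t)\<^sup>2 * exp (t * (h t)\<^sup>2 / 2))))
        \<longlongrightarrow> \<sigma> * (rbar * (1 - e)) / (sqrt (2 * pi) * exp (x - K))) at_top"
      by (intro tendsto_intros Wl sc(4)) simp
    also have "\<sigma> * (rbar * (1 - e)) / (sqrt (2 * pi) * exp (x - K)) = \<sigma> * rbar * (1 - e) * exp (- x)"
      by (simp only: D) (simp add: exp_minus divide_inverse)
    finally show "((\<lambda>t. \<sigma> * (\<alpha> t * W t) / (sqrt (2 * pi) * (sqrt t * (h t)\<^sup>2 * exp (t * (h t)\<^sup>2 / 2))))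
        \<longlongrightarrow> \<sigma> * rbar * (1 - (if c = \<infinity> then 0 else exp (- real_of_ereal c / \<sigma>))) * exp (- x)) at_top"
      unfolding e_def .
    show "\<forall>\<^sub>F t in at_top. \<sigma> * (\<alpha> t * W t) / (sqrt (2 * pi) * (sqrt t * (h t)\<^sup>2 * exp (t * (h t)\<^sup>2 / 2)))
        = W t / (\<sigma> * sqrt (2 * pi) * sqrt t * \<alpha> t * exp (\<sigma>\<^sup>2 * t * (\<alpha> t)\<^sup>2 / 2))"
      using \<alpha>h apos
    proof eventually_elim
      case (elim t)
      have h: "h t = \<sigma> * \<alpha> t" using elim \<sigma> by simp
      show ?case unfolding h using elim(2) \<sigma>
        by (simp add: power_mult_distrib power2_eq_square mult.assoc mult.left_commute mult.commute)
    qed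
  qed
qed

text \<open>The block is short on the scale \<open>1 / \<alpha>\<close>, so its weight is
  asymptotically \<open>rbar * L\<close> and no trace of its shape remains. In the denominator
  \<sigma> occurs only through \<open>\<sigma> * sqrt t * \<alpha> = \<phi>\<close>, hence no
  \<sigma> in the limit.\<close>

lemma short_initial_condition:
  fixes r :: "nat \<Rightarrow> real" and x \<sigma> rbar :: real and L :: "real \<Rightarrow> real"
  assumes m: "1 \<le> m" and per: "\<And>k. 1 \<le> k \<Longrightarrow> r (k + m) = r k" and r0: "\<And>k. 0 \<le> r k" and r1: "\<And>k. r k \<le> 1"
    and rbar: "rbar = (\<Sum>j=1..m. r j) / real m" and rpos: "0 < rbar" and r00: "r 0 = 1"
    and \<sigma>: "0 < \<sigma>" and L: "filterlim L at_top at_top"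
    and c: "((\<lambda>t. L t * sqrt (ln t / t)) \<longlongrightarrow> 0) at_top"
  defines "\<alpha> \<equiv> \<lambda>t. \<sigma> * sqrt (t / ln ((L t)\<^sup>2)) * (x + ln ((L t)\<^sup>2 / sqrt (2 * pi * ln ((L t)\<^sup>2)))) / (\<sigma>\<^sup>2 * t)"
    and "N \<equiv> \<lambda>t. nat \<lfloor>L t\<rfloor>"
  defines "W \<equiv> \<lambda>t. \<Sum>k\<le>N t. r k * exp (- \<alpha> t) ^ k"
    and "W1 \<equiv> \<lambda>t. \<Sum>k\<le>N t. r k * (real k * exp (- \<alpha> t) ^ k)"
  shows "filterlim \<alpha> (at_right 0) at_top" "filterlim (\<lambda>t. \<alpha> t * sqrt t) at_top at_top"
    "((\<lambda>t. t * \<alpha> t ^ 3) \<longlongrightarrow> 0) at_top" "((\<lambda>t. W1 t / W t / sqrt t) \<longlongrightarrow> 0) at_top"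
    "((\<lambda>t. W t / (\<sigma> * sqrt (2 * pi) * sqrt t * \<alpha> t * exp (\<sigma>\<^sup>2 * t * (\<alpha> t)\<^sup>2 / 2)))
      \<longlongrightarrow> rbar * exp (- x)) at_top"
proof -
  define K where "K = ln (sqrt (2 * pi))"
  define \<phi> where "\<phi> l = (x + l - ln l / 2 - K) / sqrt l" for l
  define l where "l t = ln ((L t)\<^sup>2)" for t
  note sc = scale_short[of x K, folded \<phi>_def]
  have Lge: "\<forall>\<^sub>F t in at_top. 1 < L t" using L by (simp add: filterlim_at_top_dense)
  have l: "filterlim l at_top at_top"
    unfolding l_def by (rule filterlim_compose[OF ln_at_top filterlim_pow_at_top[OF _ L]]) simp
  have \<phi>l: "filterlim (\<lambda>t. \<phi> (l t)) at_top at_top" by (rule filterlim_compose[OF sc(1) l])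
  then have \<phi>pos: "\<forall>\<^sub>F t in at_top. 0 < \<phi> (l t)" by (simp add: filterlim_at_top_dense)
  have \<alpha>\<phi>: "\<forall>\<^sub>F t in at_top. \<alpha> t = \<phi> (l t) / (\<sigma> * sqrt t)"
    using eventually_gt_at_top[of 0] Lge
  proof eventually_elim
    case (elim t)
    have t: "0 < t" by fact
    have l0: "0 < l t" using elim one_less_power[of "L t" 2] by (simp add: l_def)
    have num: "x + (l t - (K + ln (l t) / 2)) = x + l t - ln (l t) / 2 - K" by simp
    have "ln ((L t)\<^sup>2 / sqrt (2 * pi * l t)) = l t - ln (sqrt (2 * pi * l t))"
      using elim l0 by (subst ln_div) (auto simp: l_def)
    moreover have "ln (sqrt (2 * pi * l t)) = K + ln (l t) / 2"
      using l0 unfolding K_def by (subst real_sqrt_mult, subst ln_mult) (auto simp: ln_sqrt)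
    moreover have "sqrt (t / l t) / t = 1 / (sqrt (l t) * sqrt t)"
      using t l0 by (simp add: real_sqrt_divide field_simps)
    moreover have "\<alpha> t = \<sigma> / \<sigma>\<^sup>2 * ((x + ln ((L t)\<^sup>2 / sqrt (2 * pi * l t))) * (sqrt (t / l t) / t))"
      by (simp add: \<alpha>_def l_def)
    ultimately have "\<alpha> t = \<sigma> / \<sigma>\<^sup>2 * ((x + (l t - (K + ln (l t) / 2))) * (1 / (sqrt (l t) * sqrt t)))"
      by (simp only:)
    also have "\<dots> = \<phi> (l t) / (\<sigma> * sqrt t)" using \<sigma> num by (simp add: \<phi>_def power2_eq_square mult.commute mult.left_commute)
    finally show ?case .
  qed
  \<comment> \<open>The assumption on \<open>L\<close> forces \<open>L t < sqrt t\<close>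
    eventually, so \<open>l t \<le> ln t\<close>. This bounds the tilt from above in terms of
    \<open>t\<close> alone, although \<open>L\<close> is otherwise arbitrary.\<close>
  have \<phi>le: "\<forall>\<^sub>F t in at_top. \<phi> (l t) \<le> 2 * sqrt (ln t)"
    using eventually_compose_filterlim[OF sc(3) l] Lge eventually_gt_at_top[of "exp 1"] order_tendstoD(2)[OF c, of 1, OF zero_less_one]
  proof eventually_elim
    case (elim t)
    have t: "0 < t" using elim exp_gt_zero[of "1::real"] by linarith
    have ln: "1 < ln t" using elim t ln_less_cancel_iff[of "exp 1" t] by simp
    have "L t * sqrt (1 / t) \<le> L t * sqrt (ln t / t)"
      using elim ln t by (intro mult_left_mono real_sqrt_le_mono divide_right_mono) auto
    then have "L t * sqrt (1 / t) < 1" using elim by linarith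
    then have "L t < sqrt t" using t by (simp add: real_sqrt_divide)
    then have "(L t)\<^sup>2 \<le> (sqrt t)\<^sup>2" using elim by (intro power_mono) auto
    then have "l t \<le> ln t" using elim t unfolding l_def by (subst ln_le_cancel_iff) auto
    then have "sqrt (l t) \<le> sqrt (ln t)" by simp
    then show ?case using elim by linarith
  qed
  have apos: "\<forall>\<^sub>F t in at_top. 0 < \<alpha> t"
    using \<alpha>\<phi> \<phi>pos eventually_gt_at_top[of 0] by eventually_elim (use \<sigma> in simp)
  have ale: "\<forall>\<^sub>F t in at_top. \<alpha> t \<le> (1 / \<sigma>) * (2 * sqrt (ln t) / sqrt t)"
    using \<alpha>\<phi> \<phi>le eventually_gt_at_top[of 0]
  proof eventually_elim
    case (elim t)
    then have "\<phi> (l t) / (\<sigma> * sqrt t) \<le> 2 * sqrt (ln t) / (\<sigma> * sqrt t)"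
      using \<sigma> by (intro divide_right_mono) auto
    then show ?case using elim by simp
  qed
  have a0: "(\<alpha> \<longlongrightarrow> 0) at_top"
  proof (rule tendsto_sandwich[OF _ ale tendsto_const])
    show "\<forall>\<^sub>F t in at_top. 0 \<le> \<alpha> t" using apos by eventually_elim simp
    show "((\<lambda>t. (1 / \<sigma>) * (2 * sqrt (ln t) / sqrt t)) \<longlongrightarrow> 0) at_top"
      using tendsto_mult_left[OF log_power_limits(1), of "1 / \<sigma>"] by simp
  qed
  then show \<alpha>0: "filterlim \<alpha> (at_right 0) at_top"
    using apos by (auto simp: filterlim_at elim: eventually_mono)
  show \<alpha>1: "filterlim (\<lambda>t. \<alpha> t * sqrt t) at_top at_top"
  proof -
    have "filterlim (\<lambda>t. (1 / \<sigma>) * \<phi> (l t)) at_top at_top"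
      using \<sigma> by (intro filterlim_tendsto_pos_mult_at_top[OF tendsto_const _ \<phi>l]) simp
    moreover have "\<forall>\<^sub>F t in at_top. \<alpha> t * sqrt t = (1 / \<sigma>) * \<phi> (l t)"
      using \<alpha>\<phi> eventually_gt_at_top[of 0] by eventually_elim simp
    ultimately show ?thesis by (subst filterlim_cong[OF refl refl])
  qed
  have cube: "t * ((1 / \<sigma>) * (2 * s / u)) ^ 3 = (1 / \<sigma> ^ 3) * (8 * (s * s) * s * (t / (u * u)) / u)" for t s u
    by (simp add: power3_eq_cube mult.assoc mult.commute mult.left_commute)
  show "((\<lambda>t. t * \<alpha> t ^ 3) \<longlongrightarrow> 0) at_top"
  proof (rule tendsto_sandwich[OF _ _ tendsto_const])
    show "\<forall>\<^sub>F t in at_top. 0 \<le> t * \<alpha> t ^ 3" using apos eventually_gt_at_top[of 0] by eventually_elim simp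
    show "((\<lambda>t. (1 / \<sigma> ^ 3) * (8 * ln t * sqrt (ln t) / sqrt t)) \<longlongrightarrow> 0) at_top"
      using tendsto_mult_left[OF log_power_limits(2), of "1 / \<sigma> ^ 3"] by simp
    show "\<forall>\<^sub>F t in at_top. t * \<alpha> t ^ 3 \<le> (1 / \<sigma> ^ 3) * (8 * ln t * sqrt (ln t) / sqrt t)"
      using apos ale eventually_gt_at_top[of 1]
    proof eventually_elim
      case (elim t)
      have "t * \<alpha> t ^ 3 \<le> t * ((1 / \<sigma>) * (2 * sqrt (ln t) / sqrt t)) ^ 3"
        using elim by (intro mult_left_mono power_mono) auto
      also have "\<dots> = (1 / \<sigma> ^ 3) * (8 * (sqrt (ln t) * sqrt (ln t)) * sqrt (ln t) * (t / (sqrt t * sqrt t)) / sqrt t)"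
        by (rule cube)
      also have "\<dots> = (1 / \<sigma> ^ 3) * (8 * ln t * sqrt (ln t) / sqrt t)" using elim by simp
      finally show ?case .
    qed
  qed
  have NL: "L t \<le> real (Suc (N t))" for t unfolding N_def by linarith
  have NU: "\<forall>\<^sub>F t in at_top. real (Suc (N t)) \<le> L t + 1"
    using Lge by eventually_elim (simp add: N_def)
  have Nlim: "filterlim (\<lambda>t. real (N t)) at_top at_top"
  proof (rule filterlim_at_top_mono)
    show "filterlim (\<lambda>t. (- 1) + L t) at_top at_top" by (rule filterlim_tendsto_add_at_top[OF tendsto_const L])
    show "\<forall>\<^sub>F t in at_top. (- 1) + L t \<le> real (N t)" using NL by (intro always_eventually allI) (simp add: algebra_simps)
  qed
  \<comment> \<open>The tilt is at most of order \<open>sqrt (ln t / t)\<close>, so its product with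
    the length of the block is controlled by the hypothesis on \<open>L\<close>; the two factors
    \<open>2\<close> and the replacement of \<open>L t + 1\<close> by \<open>2 * L t\<close> give
    the constant 4.\<close>
  have s: "((\<lambda>t. \<alpha> t * real (Suc (N t))) \<longlongrightarrow> 0) at_top"
  proof (rule tendsto_sandwich[OF _ _ tendsto_const])
    show "\<forall>\<^sub>F t in at_top. 0 \<le> \<alpha> t * real (Suc (N t))" using apos by eventually_elim simp
    show "((\<lambda>t. (4 / \<sigma>) * (L t * sqrt (ln t / t))) \<longlongrightarrow> 0) at_top"
      using tendsto_mult_left[OF c, of "4 / \<sigma>"] by simp
    show "\<forall>\<^sub>F t in at_top. \<alpha> t * real (Suc (N t)) \<le> (4 / \<sigma>) * (L t * sqrt (ln t / t))"
      using apos ale NU Lge eventually_gt_at_top[of 1]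
    proof eventually_elim
      case (elim t)
      have "\<alpha> t * real (Suc (N t)) \<le> ((1 / \<sigma>) * (2 * sqrt (ln t) / sqrt t)) * (2 * L t)"
        using elim \<sigma> by (intro mult_mono) auto
      also have "\<dots> = (4 / \<sigma>) * (L t * sqrt (ln t / t))" by (simp add: real_sqrt_divide)
      finally show ?case .
    qed
  qed
  show "((\<lambda>t. W1 t / W t / sqrt t) \<longlongrightarrow> 0) at_top"
    unfolding W1_def W_def by (rule first_moment_short[OF m per r0 r1 rbar rpos \<alpha>0 \<alpha>1 s r00])
  have Wl: "((\<lambda>t. W t / real (Suc (N t))) \<longlongrightarrow> rbar) at_top"
    unfolding W_def by (rule weight_limit_short[OF m per r0 r1 rbar rpos \<alpha>0 \<alpha>1 Nlim s])
  have ratio: "((\<lambda>t. real (Suc (N t)) / L t) \<longlongrightarrow> 1) at_top"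
  proof (rule tendsto_sandwich[OF _ _ tendsto_const])
    show "\<forall>\<^sub>F t in at_top. 1 \<le> real (Suc (N t)) / L t"
      using Lge by eventually_elim (use NL in \<open>simp add: le_divide_eq del: of_nat_Suc\<close>)
    show "\<forall>\<^sub>F t in at_top. real (Suc (N t)) / L t \<le> 1 + inverse (L t)"
      using Lge NU by eventually_elim (simp add: field_simps)
    show "((\<lambda>t. 1 + inverse (L t)) \<longlongrightarrow> 1) at_top"
      using tendsto_add[OF tendsto_const[of 1] filterlim_compose[OF tendsto_inverse_0_at_top[OF filterlim_ident] L]] by simp
  qed
  have D: "sqrt (2 * pi) * exp (x - K) = exp x" by (simp add: exp_diff K_def)
  have den: "((\<lambda>t. \<phi> (l t) * exp ((\<phi> (l t))\<^sup>2 / 2) / exp (l t / 2)) \<longlongrightarrow> exp (x - K)) at_top"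
    by (rule filterlim_compose[OF sc(2) l])
  show "((\<lambda>t. W t / (\<sigma> * sqrt (2 * pi) * sqrt t * \<alpha> t * exp (\<sigma>\<^sup>2 * t * (\<alpha> t)\<^sup>2 / 2)))
      \<longlongrightarrow> rbar * exp (- x)) at_top"
  proof (rule Lim_transform_eventually)
    let ?D = "\<lambda>t. \<phi> (l t) * exp ((\<phi> (l t))\<^sup>2 / 2) / exp (l t / 2)"
    have "((\<lambda>t. (W t / real (Suc (N t))) * (real (Suc (N t)) / L t) / (sqrt (2 * pi) * ?D t))
        \<longlongrightarrow> rbar * 1 / (sqrt (2 * pi) * exp (x - K))) at_top"
      by (intro tendsto_mult tendsto_divide tendsto_const Wl ratio den) simp
    also have "rbar * 1 / (sqrt (2 * pi) * exp (x - K)) = rbar * exp (- x)"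
      by (simp only: D) (simp add: exp_minus divide_inverse)
    finally show "((\<lambda>t. (W t / real (Suc (N t))) * (real (Suc (N t)) / L t) / (sqrt (2 * pi) * ?D t))
        \<longlongrightarrow> rbar * exp (- x)) at_top" .
    show "\<forall>\<^sub>F t in at_top. (W t / real (Suc (N t))) * (real (Suc (N t)) / L t) / (sqrt (2 * pi) * ?D t)
        = W t / (\<sigma> * sqrt (2 * pi) * sqrt t * \<alpha> t * exp (\<sigma>\<^sup>2 * t * (\<alpha> t)\<^sup>2 / 2))"
      using \<alpha>\<phi> Lge eventually_gt_at_top[of 0]
    proof eventually_elim
      case (elim t)
      have "exp (l t / 2) = L t" using elim by (simp add: l_def ln_realpow)
      moreover have "\<phi> (l t) = \<sigma> * (sqrt t * \<alpha> t)" using elim \<sigma> by simp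
      moreover have "(\<sigma> * (sqrt t * \<alpha> t))\<^sup>2 = \<sigma>\<^sup>2 * t * (\<alpha> t)\<^sup>2" using elim(3) by (simp add: power_mult_distrib)
      ultimately show ?case using elim(2) by (simp add: mult.assoc mult.left_commute del: of_nat_Suc)
    qed
  qed
qed

theorem theorem2p2:
  fixes p :: "int pmf"
    and \<sigma> :: real
    and \<eta> :: "real \<Rightarrow> 'w \<Rightarrow> config"
    and P :: "config measure \<Rightarrow> 'w measure"
    and m :: nat
    and \<rho> :: "int \<Rightarrow> real"
    and \<rho>bar :: real
    and L :: "real \<Rightarrow> real"
    and \<nu> :: "real \<Rightarrow> config measure"
    and X :: "real \<Rightarrow> 'w \<Rightarrow> int"
  assumes p_symmetric: "\<And>i. pmf p i = pmf p (- i)"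
    and p_irreducible: "irreducible_walk p"
    and p_exp_moment: "\<exists>\<theta>>0. (\<lambda>i. exp (\<theta> * real_of_int i) * pmf p i) summable_on UNIV"
    and sigma_pos: "\<sigma> > 0"
    and sigma_sq: "\<sigma>\<^sup>2 = (\<Sum>\<^sub>\<infinity>i. (real_of_int i)\<^sup>2 * pmf p i)"
    and process: "\<And>\<mu>. \<mu> \<in> space (prob_algebra configs) \<Longrightarrow>
          exclusion_process p (P \<mu>) \<eta> \<and> distr (P \<mu>) configs (\<eta> 0) = \<mu>"
    and m_ge_1: "m \<ge> 1"
    and rho_range: "\<And>x. \<rho> x \<in> {0..1}"
    and rho_0: "\<rho> 0 = 1"
    and rho_pos: "\<And>x. x > 0 \<Longrightarrow> \<rho> x = 0"
    and rho_periodic: "\<And>i. i \<le> - 1 \<Longrightarrow> \<rho> i = \<rho> (i - int m)"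
    and rho_nontrivial: "\<exists>j\<in>{1..m}. \<rho> (- int j) \<noteq> 0"
    and rhobar: "\<rho>bar = (\<Sum>j=1..m. \<rho> (- int j)) / real m"
    and L_pos: "\<And>t. t > 0 \<Longrightarrow> L t > 0"
    and L_at_top: "filterlim L at_top at_top"
    and nu: "\<And>t. \<nu> t = bernoulli_product
               (\<lambda>k. if - L t \<le> real_of_int k \<and> k \<le> 0 then \<rho> k else 0)"
    and X: "\<And>t \<omega>. X t \<omega> = rightmost (\<eta> t \<omega>)"
  shows
    "(\<forall>c::ereal. 0 < c \<longrightarrow> ((\<lambda>t. ereal (L t * sqrt (ln t / t))) \<longlongrightarrow> c) at_top \<longrightarrow>
        (let a = (\<lambda>t. ln (t / (sqrt (2 * pi) * ln t)));
             b = (\<lambda>t. sqrt (t / ln t))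
         in \<forall>x::real.
              ((\<lambda>t. \<P>(\<omega> in P (\<nu> t). real_of_int (X t \<omega>) / (\<sigma> * b t) - a t \<le> x)) \<longlongrightarrow>
                 exp (- \<sigma> * \<rho>bar
                   * (1 - (if c = \<infinity> then 0 else exp (- real_of_ereal c / \<sigma>))) * exp (- x)))
              at_top))
     \<and> (((\<lambda>t. L t * sqrt (ln t / t)) \<longlongrightarrow> 0) at_top \<longrightarrow>
        (let a = (\<lambda>t. ln ((L t)\<^sup>2 / sqrt (2 * pi * ln ((L t)\<^sup>2))));
             b = (\<lambda>t. sqrt (t / ln ((L t)\<^sup>2)))
         in \<forall>x::real.
              ((\<lambda>t. \<P>(\<omega> in P (\<nu> t). real_of_int (X t \<omega>) / (\<sigma> * b t) - a t \<le> x)) \<longlongrightarrow>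
                 exp (- \<rho>bar * exp (- x)))
              at_top))"
proof -
  obtain \<theta> where \<theta>: "0 < \<theta>" "(\<lambda>i. exp (\<theta> * real_of_int i) * pmf p i) summable_on UNIV"
    using p_exp_moment by blast
  have p: "exp_moment p \<theta>" unfolding exp_moment_def symm_def using p_symmetric \<theta> by blast
  have \<rho>: "0 \<le> \<rho> x \<and> \<rho> x \<le> 1" for x using rho_range[of x] by simp
  have per: "\<rho> (- int (k + m)) = \<rho> (- int k)" if "1 \<le> k" for k
    using rho_periodic[of "- int k"] that by (simp add: algebra_simps)
  have rpos: "0 < \<rho>bar"
  proof -
    obtain j where j: "j \<in> {1..m}" "\<rho> (- int j) \<noteq> 0" using rho_nontrivial by blast
    have "0 < (\<Sum>j=1..m. \<rho> (- int j))"
      using j \<rho> by (intro sum_pos2[of _ j]) (auto simp: less_le)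
    then show ?thesis using m_ge_1 by (simp add: rhobar)
  qed
  define r where "r k = \<rho> (- int k)" for k
  have r: "\<And>k. 1 \<le> k \<Longrightarrow> r (k + m) = r k" "\<And>k. 0 \<le> r k" "\<And>k. r k \<le> 1" "\<rho>bar = (\<Sum>j=1..m. r j) / real m" "r 0 = 1"
    using per \<rho> rhobar rho_0 by (simp_all only: r_def) simp_all
  note limit = rightmost_limit[OF p_irreducible p sigma_sq sigma_pos process \<rho> rho_0 m_ge_1 per rhobar rpos L_at_top nu]
  \<comment> \<open>Multiplying out needs \<open>b t > 0\<close>. The logarithm inside
    \<open>b\<close> may fail to be positive at first, so the two events are identified only for
    large \<open>t\<close>.\<close>
  have event: "((\<lambda>t. \<P>(\<omega> in P (\<nu> t). real_of_int (X t \<omega>) / (\<sigma> * b t) - a t \<le> x)) \<longlongrightarrow> l) at_top"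
    if b: "\<forall>\<^sub>F t in at_top. 0 < b t"
      and l: "((\<lambda>t. \<P>(\<omega> in P (\<nu> t). real_of_int (rightmost (\<eta> t \<omega>)) \<le> \<sigma> * b t * (x + a t))) \<longlongrightarrow> l) at_top"
    for a b :: "real \<Rightarrow> real" and x l
  proof (rule Lim_transform_eventually[OF l])
    show "\<forall>\<^sub>F t in at_top. \<P>(\<omega> in P (\<nu> t). real_of_int (rightmost (\<eta> t \<omega>)) \<le> \<sigma> * b t * (x + a t))
        = \<P>(\<omega> in P (\<nu> t). real_of_int (X t \<omega>) / (\<sigma> * b t) - a t \<le> x)"
      using b
    proof eventually_elim
      case (elim t)
      have "real_of_int (X t \<omega>) / (\<sigma> * b t) - a t \<le> x \<longleftrightarrow> real_of_int (rightmost (\<eta> t \<omega>)) \<le> \<sigma> * b t * (x + a t)" for \<omega>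
        using elim sigma_pos by (simp add: X diff_le_eq pos_divide_le_eq mult.commute)
      then show ?case by simp
    qed
  qed
  have long: "((\<lambda>t. \<P>(\<omega> in P (\<nu> t). real_of_int (X t \<omega>) / (\<sigma> * sqrt (t / ln t)) - ln (t / (sqrt (2 * pi) * ln t)) \<le> x)) \<longlongrightarrow>
      exp (- \<sigma> * \<rho>bar * (1 - (if c = \<infinity> then 0 else exp (- real_of_ereal c / \<sigma>))) * exp (- x))) at_top"
    if c: "0 < c" "((\<lambda>t. ereal (L t * sqrt (ln t / t))) \<longlongrightarrow> c) at_top" for c :: ereal and x
  proof (rule event)
    show "\<forall>\<^sub>F t in at_top. 0 < sqrt (t / ln t)" by real_asymp
    note cond = long_initial_condition[where r = r and x = x, OF m_ge_1 r(1,2,3,4) rpos sigma_pos L_at_top c]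
    have "((\<lambda>t. \<P>(\<omega> in P (\<nu> t). real_of_int (rightmost (\<eta> t \<omega>)) \<le> \<sigma> * sqrt (t / ln t) * (x + ln (t / (sqrt (2 * pi) * ln t))))) \<longlongrightarrow>
      exp (- (\<sigma> * \<rho>bar * (1 - (if c = \<infinity> then 0 else exp (- real_of_ereal c / \<sigma>))) * exp (- x)))) at_top"
      by (rule limit[OF _ _ refl cond[unfolded r_def]])
    then show "((\<lambda>t. \<P>(\<omega> in P (\<nu> t). real_of_int (rightmost (\<eta> t \<omega>)) \<le> \<sigma> * sqrt (t / ln t) * (x + ln (t / (sqrt (2 * pi) * ln t))))) \<longlongrightarrow>
      exp (- \<sigma> * \<rho>bar * (1 - (if c = \<infinity> then 0 else exp (- real_of_ereal c / \<sigma>))) * exp (- x))) at_top"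
      by (simp only: mult_minus_left)
  qed
  have short: "((\<lambda>t. \<P>(\<omega> in P (\<nu> t). real_of_int (X t \<omega>) / (\<sigma> * sqrt (t / ln ((L t)\<^sup>2))) - ln ((L t)\<^sup>2 / sqrt (2 * pi * ln ((L t)\<^sup>2))) \<le> x)) \<longlongrightarrow>
      exp (- \<rho>bar * exp (- x))) at_top"
    if c: "((\<lambda>t. L t * sqrt (ln t / t)) \<longlongrightarrow> 0) at_top" for x
  proof (rule event)
    show "\<forall>\<^sub>F t in at_top. 0 < sqrt (t / ln ((L t)\<^sup>2))"
      using filterlim_at_top_dense[THEN iffD1, OF L_at_top, rule_format, of 1] eventually_gt_at_top[of 0]
    proof eventually_elim
      case (elim t)
      then show ?case using one_less_power[of "L t" 2] by simp
    qed
    note cond = short_initial_condition[where r = r and x = x, OF m_ge_1 r(1,2,3,4) rpos r(5) sigma_pos L_at_top c]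
    have "((\<lambda>t. \<P>(\<omega> in P (\<nu> t). real_of_int (rightmost (\<eta> t \<omega>)) \<le> \<sigma> * sqrt (t / ln ((L t)\<^sup>2)) * (x + ln ((L t)\<^sup>2 / sqrt (2 * pi * ln ((L t)\<^sup>2)))))) \<longlongrightarrow>
      exp (- (\<rho>bar * exp (- x)))) at_top"
      by (rule limit[OF _ _ refl cond[unfolded r_def]])
    then show "((\<lambda>t. \<P>(\<omega> in P (\<nu> t). real_of_int (rightmost (\<eta> t \<omega>)) \<le> \<sigma> * sqrt (t / ln ((L t)\<^sup>2)) * (x + ln ((L t)\<^sup>2 / sqrt (2 * pi * ln ((L t)\<^sup>2)))))) \<longlongrightarrow>
      exp (- \<rho>bar * exp (- x))) at_top"
      by (simp only: mult_minus_left)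
  qed
  show ?thesis
    unfolding Let_def using long short by blast
qed

end
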